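(* Let $P$ be the law of a random environment on $\mathbb{Z}$, i.e. a Borel probability measure on $\Omega$, which satisfies the Standing Assumption stated in the context. Assume moreover that there is $\epsilon>0$ such that $P(\min(\omega_0^-,\omega_0^+)<\epsilon)=0$. Let $\{X_n\}_{n\ge 0}$ be the associated random walk in random environment, and let $\mathbb{P}^o$ be its annealed law when started at $X_0=0$. Then, for every real $h>1$, $$\lim_{\eta\to 0}\ \lim_{n\to\infty}\ \mathbb{P}^o\left(\frac{|X_{n^h}-X_n|}{(\log n)^2}<\eta\right)=\frac{1}{h^2}\left[\frac{5}{3}-\frac{2}{3}e^{-(h-1)}\right].$$
   Context: **Environment.** For $z\in\mathbb{Z}$ let $N_z=\{(\omega_z^-,\omega_z^0,\omega_z^+):\ \omega_z^-,\omega_z^0,\omega_z^+\ge 0,\ \omega_z^-+\omega_z^0+\omega_z^+=1\}$ and $\Omega=\prod_{z\in\mathbb{Z}}N_z$, equipped with the product topology, the corresponding Borel $\sigma$-field and the shift operator. The random environment is $\omega\in\Omega$, distributed according to a Borel probability measure $P$ on $\Omega$. **Walk.** For $\omega\in\Omega$, $\{X_n\}_{n\ge0}$ is the time-homogeneous Markov chain on $\mathbb{Z}$ with transition probabilities $P_\omega(X_{n+1}=z+1\mid X_n=z)=\omega_z^+$, $P_\omega(X_{n+1}=z\mid X_n=z)=\omega_z^0$, $P_\omega(X_{n+1}=z-1\mid X_n=z)=\omega_z^-$. $P_\omega^v$ denotes its law (the quenched law) when $X_0=v$ almost surely. The annealed law is $\mathbb{P}^v(G)=\int_\Omega P_\omega^v(G)\,dP(\omega)$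 for Borel sets $G\subset\mathbb{Z}^{\mathbb{N}}$, and $\mathbb{P}^o$ denotes $\mathbb{P}^v$ with $v=0$. In $X_{n^h}$, a non-integer time $n^h$ is understood as its integer part. **Standing Assumption.** Put $\rho_z=\omega_z^-/\omega_z^+$. The measure $P$ is stationary (shift-invariant) and strongly mixing on $\Omega$, $P(\omega_0^++\omega_0^->0)=1$, $E_P\log\rho_0=0$, and there exists $\varepsilon>0$ such that $E_P|\log\rho_0|^{2+\varepsilon}<\infty$. Further, for some $\sigma_P>0$, the processes $\{k^{-1/2}S_{\lfloor kt\rfloor}/\sigma_P\}_{t\in\mathbb{R}}$ converge weakly under $P$, as $k\to\infty$, to a standard two-sided Brownian motion $\{B_t\}_{t\in\mathbb{R}}$ with $B_0=0$, where $S_m=\sum_{i=0}^{m-1}\log\rho_i$ for $m>0$, $S_0=0$, and $S_m=-\sum_{i=m}^{-1}\log\rho_i$ for $m<0$. *)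

theory Defs
  imports "HOL-Probability.Probability"
begin

text \<open>An element \<open>(a, b, c)\<close> of \<open>simplex3\<close> is a triple \<open>(\<omega>\<^sub>z\<^sup>-, \<omega>\<^sub>z\<^sup>0, \<omega>\<^sub>z\<^sup>+)\<close>.\<close>

definition simplex3 :: "(real \<times> real \<times> real) set" where
  "simplex3 = {(a, b, c). 0 \<le> a \<and> 0 \<le> b \<and> 0 \<le> c \<and> a + b + c = 1}"

type_synonym env = "int \<Rightarrow> real \<times> real \<times> real"

definition Omega :: "env set" where
  "Omega = {\<omega>. \<forall>z. \<omega> z \<in> simplex3}"

definition w_minus :: "env \<Rightarrow> int \<Rightarrow> real" where "w_minus \<omega> z = fst (\<omega> z)"
definition w_zero :: "env \<Rightarrow> int \<Rightarrow> real" where "w_zero \<omega> z = fst (snd (\<omega> z))"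
definition w_plus :: "env \<Rightarrow> int \<Rightarrow> real" where "w_plus \<omega> z = snd (snd (\<omega> z))"

definition shift :: "env \<Rightarrow> env" where
  "shift \<omega> = (\<lambda>z. \<omega> (z + 1))"

text \<open>The library topology on \<open>env\<close> is the product topology, so the measurable sets below are
  the Borel sets of the product topology on \<open>Omega\<close>.\<close>

definition env_law :: "env measure \<Rightarrow> bool" where
  "env_law P \<longleftrightarrow> prob_space P \<and> sets P = sets (restrict_space borel Omega)"

definition stationary :: "env measure \<Rightarrow> bool" where
  "stationary P \<longleftrightarrow> distr P P shift = P"

text \<open>Strong mixing of the shift, in the sense of ergodic theory.\<close>

definition strongly_mixing :: "env measure \<Rightarrow> bool" where
  "strongly_mixing P \<longleftrightarrow>
     (\<forall>A\<in>sets P. \<forall>B\<in>sets P.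
        (\<lambda>n. measure P (A \<inter> ((shift ^^ n) -` B \<inter> space P))) \<longlonglongrightarrow> measure P A * measure P B)"

definition log_rho :: "env \<Rightarrow> int \<Rightarrow> real" where
  "log_rho \<omega> z = ln (w_minus \<omega> z / w_plus \<omega> z)"

definition potential :: "env \<Rightarrow> int \<Rightarrow> real" where
  "potential \<omega> m =
     (if m > 0 then \<Sum>i\<in>{0..m-1}. log_rho \<omega> i
      else if m < 0 then - (\<Sum>i\<in>{m..-1}. log_rho \<omega> i)
      else 0)"

definition scaled_potential :: "real \<Rightarrow> nat \<Rightarrow> env \<Rightarrow> real \<Rightarrow> real" where
  "scaled_potential \<sigma> k \<omega> t = potential \<omega> \<lfloor>real k * t\<rfloor> / (sqrt (real k) * \<sigma>)"

definition cadlag :: "(real \<Rightarrow> real) set" where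
  "cadlag = {x. \<forall>t. continuous (at_right t) x \<and> (\<exists>l. (x \<longlongrightarrow> l) (at_left t))}"

text \<open>Basic neighbourhoods of the \<open>J\<^sub>1\<close> topology on \<open>D(\<real>)\<close>; a strictly increasing surjection
  \<open>\<lambda>\<close> of \<open>\<real>\<close> is a time change. A sequence \<open>x\<^sub>n\<close> is eventually in each \<open>skorokhod_nbhd x e\<close> iff
  there are time changes \<open>\<lambda>\<^sub>n\<close> such that \<open>\<lambda>\<^sub>n(t) - t \<rightarrow> 0\<close> uniformly and
  \<open>x\<^sub>n(\<lambda>\<^sub>n(t)) - x(t) \<rightarrow> 0\<close> uniformly on compact sets of times.\<close>

definition skorokhod_nbhd :: "(real \<Rightarrow> real) \<Rightarrow> real \<Rightarrow> (real \<Rightarrow> real) set" where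
  "skorokhod_nbhd x e =
     {y \<in> cadlag. \<exists>l :: real \<Rightarrow> real. strict_mono l \<and> surj l \<and> (\<forall>t. \<bar>l t - t\<bar> \<le> e) \<and>
        (\<forall>t. \<bar>t\<bar> \<le> 1 / e \<longrightarrow> \<bar>y (l t) - x t\<bar> \<le> e)}"

definition skorokhod :: "(real \<Rightarrow> real) topology" where
  "skorokhod = topology (\<lambda>U. U \<subseteq> cadlag \<and> (\<forall>x\<in>U. \<exists>e>0. skorokhod_nbhd x e \<subseteq> U))"

lemma skorokhod_nbhd_mono:
  assumes "0 < e" "e \<le> e'"
  shows "skorokhod_nbhd x e \<subseteq> skorokhod_nbhd x e'"
proof
  fix y assume "y \<in> skorokhod_nbhd x e"
  then obtain l :: "real \<Rightarrow> real" where y: "y \<in> cadlag" and l: "strict_mono l" "surj l"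
    "\<And>t. \<bar>l t - t\<bar> \<le> e" "\<And>t. \<bar>t\<bar> \<le> 1 / e \<Longrightarrow> \<bar>y (l t) - x t\<bar> \<le> e"
    by (auto simp: skorokhod_nbhd_def)
  have "1 / e' \<le> 1 / e"
    using assms by (simp add: frac_le)
  then have "\<forall>t. \<bar>t\<bar> \<le> 1 / e' \<longrightarrow> \<bar>y (l t) - x t\<bar> \<le> e'"
    using l(4) assms by (meson order_trans)
  moreover have "\<forall>t. \<bar>l t - t\<bar> \<le> e'"
    using l(3) assms by (meson order_trans)
  ultimately show "y \<in> skorokhod_nbhd x e'"
    using y l(1,2) by (auto simp: skorokhod_nbhd_def)
qed

lemma openin_skorokhod:
  "openin skorokhod U \<longleftrightarrow> U \<subseteq> cadlag \<and> (\<forall>x\<in>U. \<exists>e>0. skorokhod_nbhd x e \<subseteq> U)"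
proof -
  let ?L = "\<lambda>U. U \<subseteq> cadlag \<and> (\<forall>x\<in>U. \<exists>e>0. skorokhod_nbhd x e \<subseteq> U)"
  have int: "?L (S \<inter> T)" if S: "?L S" and T: "?L T" for S T
  proof (intro conjI ballI)
    fix x assume "x \<in> S \<inter> T"
    then obtain a b where "a > 0" "skorokhod_nbhd x a \<subseteq> S" "b > 0" "skorokhod_nbhd x b \<subseteq> T"
      using S T by blast
    then have "min a b > 0 \<and> skorokhod_nbhd x (min a b) \<subseteq> S \<inter> T"
      using skorokhod_nbhd_mono[of "min a b" a x] skorokhod_nbhd_mono[of "min a b" b x] by auto
    then show "\<exists>e>0. skorokhod_nbhd x e \<subseteq> S \<inter> T" by blast
  qed (use S in auto)
  have un: "?L (\<Union>K)" if K: "\<forall>S\<in>K. ?L S" for K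
  proof (intro conjI ballI)
    show "\<Union>K \<subseteq> cadlag" using K by blast
    fix x assume "x \<in> \<Union>K"
    then obtain S where S: "S \<in> K" "x \<in> S" by blast
    then obtain e where "e > 0" "skorokhod_nbhd x e \<subseteq> S" using K by blast
    then show "\<exists>e>0. skorokhod_nbhd x e \<subseteq> \<Union>K" using S by blast
  qed
  have "istopology ?L"
    unfolding istopology_def
  proof (rule conjI; intro allI impI)
    show "?L (S \<inter> T)" if "?L S" "?L T" for S T using that by (rule int)
    show "?L (\<Union>K)" if "\<forall>S\<in>K. ?L S" for K using that by (rule un)
  qed
  then show ?thesis
    unfolding skorokhod_def by (simp only: topology_inverse')
qed

lemma topspace_skorokhod: "topspace skorokhod = cadlag"
proof (rule subset_antisym)
  have "openin skorokhod (topspace skorokhod)" by (rule openin_topspace)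
  then show "topspace skorokhod \<subseteq> cadlag" unfolding openin_skorokhod by blast
  have "skorokhod_nbhd x 1 \<subseteq> cadlag" for x
    unfolding skorokhod_nbhd_def by blast
  then have "openin skorokhod cadlag"
    unfolding openin_skorokhod using zero_less_one by blast
  then show "cadlag \<subseteq> topspace skorokhod" by (rule openin_subset)
qed

text \<open>Convergence in distribution of \<open>T\<close>-valued random elements, \<open>Y k\<close> on \<open>M\<close> and \<open>Z\<close> on \<open>N\<close>.
  In the application the expectations are of bounded measurable functions, since the Borel
  \<open>\<sigma>\<close>-field of the \<open>J\<^sub>1\<close> topology is generated by the evaluation maps.\<close>

definition converges_weakly ::
    "'c topology \<Rightarrow> 'a measure \<Rightarrow> (nat \<Rightarrow> 'a \<Rightarrow> 'c) \<Rightarrow> 'b measure \<Rightarrow> ('b \<Rightarrow> 'c) \<Rightarrow> bool" where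
  "converges_weakly T M Y N Z \<longleftrightarrow>
     (\<forall>F :: 'c \<Rightarrow> real. continuous_map T euclideanreal F \<and> bounded (F ` topspace T) \<longrightarrow>
        (\<lambda>k. \<integral>\<omega>. F (Y k \<omega>) \<partial>M) \<longlonglongrightarrow> (\<integral>x. F (Z x) \<partial>N))"

definition two_sided_brownian :: "'b measure \<Rightarrow> (real \<Rightarrow> 'b \<Rightarrow> real) \<Rightarrow> bool" where
  "two_sided_brownian M B \<longleftrightarrow>
     prob_space M \<and>
     (\<forall>t. B t \<in> borel_measurable M) \<and>
     (\<forall>x\<in>space M. B 0 x = 0 \<and> continuous_on UNIV (\<lambda>t. B t x)) \<and>
     (\<forall>s t. s < t \<longrightarrow>
        distributed M lborel (\<lambda>x. B t x - B s x) (\<lambda>y. ennreal (normal_density 0 (sqrt (t - s)) y))) \<and>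
     (\<forall>(n::nat) (u :: nat \<Rightarrow> real). strict_mono u \<longrightarrow>
        prob_space.indep_vars M (\<lambda>_. borel) (\<lambda>i x. B (u (Suc i)) x - B (u i) x) {..<n})"

text \<open>In the moment condition \<open>\<bar>log \<rho>\<^sub>0\<bar>\<close> is infinite where \<open>\<omega>\<^sub>0\<^sup>- = 0\<close> or \<open>\<omega>\<^sub>0\<^sup>+ = 0\<close>, whereas
  \<open>ln\<close> and division are total in HOL; hence the explicit positivity. A Brownian motion on some
  probability space has a copy on one over the type of paths, so the choice of the type of \<open>W\<close>
  is no restriction.\<close>

definition standing_assumption :: "env measure \<Rightarrow> bool" where
  "standing_assumption P \<longleftrightarrow>
     env_law P \<and> stationary P \<and> strongly_mixing P \<and>
     measure P {\<omega>\<in>space P. w_plus \<omega> 0 + w_minus \<omega> 0 > 0} = 1 \<and>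
     (AE \<omega> in P. w_minus \<omega> 0 > 0 \<and> w_plus \<omega> 0 > 0) \<and>
     has_bochner_integral P (\<lambda>\<omega>. log_rho \<omega> 0) 0 \<and>
     (\<exists>\<epsilon>>0. integrable P (\<lambda>\<omega>. \<bar>log_rho \<omega> 0\<bar> powr (2 + \<epsilon>))) \<and>
     (\<exists>\<sigma>>0. \<exists>(W :: (real \<Rightarrow> real) measure) B. two_sided_brownian W B \<and>
        converges_weakly skorokhod P (scaled_potential \<sigma>) W (\<lambda>x t. B t x))"

definition step_prob :: "env \<Rightarrow> int \<Rightarrow> int \<Rightarrow> real" where
  "step_prob \<omega> z y =
     (if y = z + 1 then w_plus \<omega> z else if y = z then w_zero \<omega> z
      else if y = z - 1 then w_minus \<omega> z else 0)"

definition walk_kernel :: "env \<Rightarrow> int \<Rightarrow> nat \<Rightarrow> (nat \<Rightarrow> int) \<Rightarrow> int measure" where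
  "walk_kernel \<omega> v n x =
     measure_pmf (if n = 0 then return_pmf v else embed_pmf (step_prob \<omega> (x (n - 1))))"

text \<open>The law on \<open>\<int>\<^sup>\<nat>\<close> of the chain started at \<open>v\<close>, by the Ionescu-Tulcea theorem.\<close>

definition quenched_law :: "env \<Rightarrow> int \<Rightarrow> (nat \<Rightarrow> int) measure" where
  "quenched_law \<omega> v =
     projective_family.lim UNIV (Ionescu_Tulcea.CI (walk_kernel \<omega> v) (\<lambda>_. count_space UNIV))
       (\<lambda>_. count_space UNIV)"

definition annealed_prob :: "env measure \<Rightarrow> int \<Rightarrow> (nat \<Rightarrow> int) set \<Rightarrow> real" where
  "annealed_prob P v G = (\<integral>\<omega>. measure (quenched_law \<omega> v) G \<partial>P)"

lemma pmf_step:
  assumes "\<omega> \<in> Omega"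
  shows "pmf (embed_pmf (step_prob \<omega> z)) y = step_prob \<omega> z y"
proof (rule pmf_embed_pmf)
  obtain a b c where w: "\<omega> z = (a, b, c)" by (metis prod_cases3)
  with assms have abc: "0 \<le> a" "0 \<le> b" "0 \<le> c" "a + b + c = 1"
    by (auto simp: Omega_def simplex3_def dest: spec[of _ z])
  show "0 \<le> step_prob \<omega> z x" for x
    using abc w by (auto simp: step_prob_def w_plus_def w_zero_def w_minus_def)
  have "(\<integral>\<^sup>+x. ennreal (step_prob \<omega> z x) \<partial>count_space UNIV)
      = (\<Sum>x\<in>{z-1, z, z+1}. ennreal (step_prob \<omega> z x))"
    by (rule nn_integral_count_space') (auto simp: step_prob_def)
  also have "\<dots> = ennreal a + (ennreal b + ennreal c)"
    using w by (simp add: step_prob_def w_plus_def w_zero_def w_minus_def)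
  also have "\<dots> = 1"
    using abc by (simp flip: ennreal_plus)
  finally show "(\<integral>\<^sup>+x. ennreal (step_prob \<omega> z x) \<partial>count_space UNIV) = 1" .
qed

lemma Ionescu_Tulcea_walk: "Ionescu_Tulcea (walk_kernel \<omega> v) (\<lambda>_. count_space UNIV)"
proof (rule Ionescu_Tulcea.intro)
  fix i :: nat
  show "walk_kernel \<omega> v i \<in> measurable (PiM {0..<i} (\<lambda>_. count_space UNIV))
          (subprob_algebra (count_space UNIV))"
  proof (cases "i = 0")
    case True
    then show ?thesis
      by (auto simp: walk_kernel_def[abs_def] space_subprob_algebra
        intro!: measurable_const prob_space_imp_subprob_space measure_pmf.prob_space_axioms)
  next
    case False
    have "(\<lambda>z. measure_pmf (embed_pmf (step_prob \<omega> z)))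
        \<in> measurable (count_space UNIV) (subprob_algebra (count_space UNIV))"
      by (auto simp: space_subprob_algebra
        intro!: prob_space_imp_subprob_space measure_pmf.prob_space_axioms)
    moreover have "(\<lambda>x. x (i - 1)) \<in> measurable (PiM {0..<i} (\<lambda>_. count_space UNIV))
        (count_space (UNIV :: int set))"
      using False by (intro measurable_component_singleton) auto
    ultimately have "(\<lambda>x. measure_pmf (embed_pmf (step_prob \<omega> (x (i - 1)))))
        \<in> measurable (PiM {0..<i} (\<lambda>_. count_space UNIV)) (subprob_algebra (count_space UNIV))"
      by (rule measurable_compose[rotated])
    with False show ?thesis
      by (simp add: walk_kernel_def[abs_def])
  qed
next
  fix i :: nat and x :: "nat \<Rightarrow> int"
  show "prob_space (walk_kernel \<omega> v i x)"
    by (simp add: walk_kernel_def measure_pmf.prob_space_axioms)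
qed

text \<open>The finite-dimensional distributions, which determine \<open>quenched_law\<close>.\<close>

lemma quenched_law_cylinder:
  assumes "\<omega> \<in> Omega"
  shows "emeasure (quenched_law \<omega> v) {x. \<forall>i\<le>n. x i = y i} =
     ennreal (if y 0 = v then \<Prod>i<n. step_prob \<omega> (y i) (y (Suc i)) else 0)"
proof -
  let ?M = "\<lambda>_::nat. count_space (UNIV :: int set)"
  interpret Ionescu_Tulcea "walk_kernel \<omega> v" ?M
    by (rule Ionescu_Tulcea_walk)
  have nonneg: "0 \<le> step_prob \<omega> z x" for z x
    using pmf_nonneg pmf_step[OF assms] by metis
  have S: "PiE {0..<m} (\<lambda>i. {y i}) \<in> sets (PiM {0..<m} ?M)" for m
    by (intro sets_PiM_I_finite) auto
  have 0: "(\<lambda>_. undefined) \<in> space (PiM {0..<0} ?M)"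
    by (simp add: space_PiM)
  define k where "k i = (case i of 0 \<Rightarrow> if y 0 = v then 1 else 0
    | Suc j \<Rightarrow> step_prob \<omega> (y j) (y (Suc j)))" for i
  have k_nonneg: "0 \<le> k i" for i
    by (auto simp: k_def nonneg split: nat.split)
  have C: "emeasure (C 0 m (\<lambda>_. undefined)) (PiE {0..<m} (\<lambda>i. {y i})) = ennreal (\<Prod>i<m. k i)" for m
  proof (induction m)
    case 0
    show ?case
      using S[of 0] 0 by (simp add: emeasure_return)
  next
    case (Suc m)
    let ?A = "\<lambda>m. PiE {0..<m} (\<lambda>i. {y i})"
    let ?C = "C 0 m (\<lambda>_. undefined)"
    have sC: "sets ?C = sets (PiM {0..<m} ?M)" "space ?C = space (PiM {0..<m} ?M)"
      using sets_C[OF 0, of m] space_C[OF 0, of m] by simp_all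
    have "emeasure (C 0 (Suc m) (\<lambda>_. undefined)) (?A (Suc m)) = emeasure (?C \<bind> eP m) (?A (Suc m))"
      by simp
    also have "\<dots> = (\<integral>\<^sup>+x. emeasure (eP m x) (?A (Suc m)) \<partial>?C)"
    proof (rule emeasure_bind)
      show "space ?C \<noteq> {}"
        using prob_space_C[OF 0, of m] by (rule prob_space.not_empty)
      show "eP m \<in> measurable ?C (subprob_algebra (PiM {0..<Suc m} ?M))"
        by (subst measurable_cong_sets[OF sC(1) refl]) (rule measurable_eP)
    qed (rule S)
    also have "\<dots> = (\<integral>\<^sup>+x. ennreal (k m) * indicator (?A m) x \<partial>?C)"
    proof (rule nn_integral_cong)
      fix x assume "x \<in> space ?C"
      then have x: "x \<in> space (PiM {0..<m} ?M)" using sC by simp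
      then have ext: "x \<in> extensional {0..<m}"
        by (auto simp: space_PiM PiE_iff)
      have upd: "x(m := z) \<in> ?A (Suc m) \<longleftrightarrow> x \<in> ?A m \<and> z = y m" for z
      proof -
        have "x(m := z) \<in> extensional {0..<Suc m}"
          using ext by (simp add: extensional_def)
        moreover have "(\<forall>i\<in>{0..<Suc m}. (x(m := z)) i = y i) \<longleftrightarrow> (\<forall>i\<in>{0..<m}. x i = y i) \<and> z = y m"
          unfolding atLeast0_lessThan_Suc by auto
        ultimately show ?thesis
          using ext by (simp add: PiE_iff)
      qed
      have "emeasure (eP m x) (?A (Suc m)) =
          emeasure (walk_kernel \<omega> v m x) ((\<lambda>z. x(m := z)) -` ?A (Suc m) \<inter> space (?M m))"
        by (rule emeasure_eP[OF x S])
      also have "(\<lambda>z. x(m := z)) -` ?A (Suc m) \<inter> space (?M m) = (if x \<in> ?A m then {y m} else {})"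
        by (simp add: vimage_def upd)
      also have "emeasure (walk_kernel \<omega> v m x) \<dots> = ennreal (k m) * indicator (?A m) x"
      proof (cases "x \<in> ?A m")
        case True
        show ?thesis
        proof (cases m)
          case 0
          with True show ?thesis
            by (simp add: walk_kernel_def k_def emeasure_pmf_single)
        next
          case (Suc j)
          then have "x j = y j"
            using True by (simp add: PiE_iff)
          with True Suc show ?thesis
            by (simp add: walk_kernel_def k_def emeasure_pmf_single pmf_step[OF assms])
        qed
      qed simp
      finally show "emeasure (eP m x) (?A (Suc m)) = ennreal (k m) * indicator (?A m) x" .
    qed
    also have "\<dots> = ennreal (k m) * emeasure ?C (?A m)"
      using S[of m] sC by (intro nn_integral_cmult_indicator) simp
    also have "\<dots> = ennreal (\<Prod>i<Suc m. k i)"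
      using Suc.IH k_nonneg by (simp add: ennreal_mult prod_nonneg mult.commute)
    finally show ?case .
  qed
  have k: "(\<Prod>i<Suc n. k i) = (if y 0 = v then \<Prod>i<n. step_prob \<omega> (y i) (y (Suc i)) else 0)"
    by (subst prod.lessThan_Suc_shift) (simp add: k_def)
  have "{x. \<forall>i\<le>n. x i = y i} = prod_emb UNIV ?M {0..<Suc n} (PiE {0..<Suc n} (\<lambda>i. {y i}))"
    by (auto simp: prod_emb_def PiE_iff less_Suc_eq_le restrict_def)
  also have "emeasure (quenched_law \<omega> v) \<dots> = emeasure (CI {0..<Suc n}) (PiE {0..<Suc n} (\<lambda>i. {y i}))"
    unfolding quenched_law_def by (rule lim) (use S in auto)
  also have "\<dots> = emeasure (C 0 (Suc n) (\<lambda>_. undefined))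
      (prod_emb {0..<Suc n} ?M {0..<Suc n} (PiE {0..<Suc n} (\<lambda>i. {y i})))"
    by (rule emeasure_CI) (use S in auto)
  also have "prod_emb {0..<Suc n} ?M {0..<Suc n} (PiE {0..<Suc n} (\<lambda>i. {y i}))
      = PiE {0..<Suc n} (\<lambda>i. {y i})"
    by (intro prod_emb_id) auto
  finally show ?thesis
    by (simp only: C k)
qed

end

theory Submission
  imports Defs "HOL-Real_Asymp.Real_Asymp"
begin

text \<open>At time \<open>n\<^sup>H\<close> the quenched walk is, with probability close to one, near the bottom of the valley
  reached from the origin by crossing only barriers of height below \<open>H log n\<close>: reversibility keeps the
  walk near the bottom once it is there, and explicit supersolutions show that it gets there in time.
  On the scale \<open>(log n)\<^sup>2\<close> the potential is approximately a two-sided Brownian motion, and almost surely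
  its valley bottoms are stable under small perturbations. So \<open>\<bar>X(n\<^sup>h) - X(n)\<bar> / (log n)\<^sup>2\<close> is asymptotically a
  constant times the distance between the bottoms of the Brownian valleys of depths \<open>1\<close> and \<open>h\<close>, which has
  no atom except at \<open>0\<close>, and \<open>\<eta> \<rightarrow> 0\<close> leaves the probability that the two bottoms coincide.

  That probability only needs the exit probabilities of Brownian motion from intervals. On a lattice of
  mesh \<open>1 / N\<close> one decomposes the half path on the side of the valley into cells, each of which prescribes
  the order in which finitely many lattice levels are hit. Given the cell, the bottoms coincide up to
  lattice errors iff each half path hits one given level before another. Cell probabilities
  are products of exit probabilities, the two half paths are independent, and the sum over the cells is a
  Riemann sum with limit \<open>(1/6 + (2 - exp (1 - h)) / 3) / h\<^sup>2\<close> for each of the two sides.\<close>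

section \<open>The quenched walk\<close>

text \<open>Being at a given distance from a valley bottom is not a continuous functional of the
  potential, and weak convergence bounds probabilities only from below, on interiors. For a
  threshold c the proof therefore bounds from below both the probability that the two bottoms are
  stably nearer than c and the probability that they are stably farther. Each bound is an upper
  bound for the opposite event. Almost surely no two bottoms are at distance exactly c, so the two
  bounds add up to at least 1; that they add up to at most 1 is read off from the walk, which cannot
  be both near and far. The cells are used one-sidedly too: some lists of levels are sufficient for
  coinciding bottoms, others, shifted by one or two lattice units, are necessary, and both Riemann
  sums have the same limit. With x = j / N, cells with k = 0 have density x, those with k > 0 have
  density 1 - x times an exponential law for the further descent, and the left wall contributes 1 -
  x. Hence 1/6 and 1/3, the integrals of x (1 - x) and (1 - x)^2.\<close>

definition walk_op :: "env \<Rightarrow> (int \<Rightarrow> real) \<Rightarrow> int \<Rightarrow> real" where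
  "walk_op \<omega> f x = w_plus \<omega> x * f (x + 1) + w_zero \<omega> x * f x + w_minus \<omega> x * f (x - 1)"

lemma Omega_weights:
  assumes "\<omega> \<in> Omega"
  shows "0 \<le> w_plus \<omega> x" "0 \<le> w_zero \<omega> x" "0 \<le> w_minus \<omega> x"
    "w_plus \<omega> x + w_zero \<omega> x + w_minus \<omega> x = 1"
proof -
  obtain a b c where w: "\<omega> x = (a, b, c)" by (metis prod_cases3)
  with assms have "0 \<le> a" "0 \<le> b" "0 \<le> c" "a + b + c = 1"
    by (auto simp: Omega_def simplex3_def dest: spec[of _ x])
  with w show "0 \<le> w_plus \<omega> x" "0 \<le> w_zero \<omega> x" "0 \<le> w_minus \<omega> x"
    "w_plus \<omega> x + w_zero \<omega> x + w_minus \<omega> x = 1"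
    by (auto simp: w_plus_def w_zero_def w_minus_def)
qed

lemma walk_op_nonneg: "\<omega> \<in> Omega \<Longrightarrow> (\<And>x. 0 \<le> f x) \<Longrightarrow> 0 \<le> walk_op \<omega> f x"
  by (simp add: walk_op_def Omega_weights)

lemma walk_op_pow_nonneg: "\<omega> \<in> Omega \<Longrightarrow> (\<And>x. 0 \<le> f x) \<Longrightarrow> 0 \<le> (walk_op \<omega> ^^ n) f x"
  by (induction n arbitrary: x) (auto intro!: walk_op_nonneg)

lemma nn_integral_step:
  assumes "\<omega> \<in> Omega" "\<And>x. 0 \<le> f x"
  shows "(\<integral>\<^sup>+z. ennreal (f z) \<partial>measure_pmf (embed_pmf (step_prob \<omega> x))) = ennreal (walk_op \<omega> f x)"
proof -
  note w = Omega_weights[OF assms(1)]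
  have "(\<integral>\<^sup>+z. ennreal (f z) \<partial>measure_pmf (embed_pmf (step_prob \<omega> x)))
      = (\<integral>\<^sup>+z. ennreal (step_prob \<omega> x z) * ennreal (f z) \<partial>count_space UNIV)"
    by (simp add: nn_integral_measure_pmf pmf_step[OF assms(1)])
  also have "\<dots> = (\<Sum>z\<in>{x-1, x, x+1}. ennreal (step_prob \<omega> x z) * ennreal (f z))"
    by (rule nn_integral_count_space') (auto simp: step_prob_def)
  also have "\<dots> = ennreal (walk_op \<omega> f x)"
    using w assms(2) by (simp add: step_prob_def walk_op_def ac_simps flip: ennreal_mult ennreal_plus)
  finally show ?thesis .
qed

section \<open>Finite-dimensional marginals of the quenched law\<close>

lemma sets_quenched_law [measurable_cong]: "sets (quenched_law \<omega> v) = sets (PiM UNIV (\<lambda>_. count_space UNIV))"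
proof -
  interpret Ionescu_Tulcea "walk_kernel \<omega> v" "\<lambda>_. count_space UNIV"
    by (rule Ionescu_Tulcea_walk)
  show ?thesis unfolding quenched_law_def by simp
qed

lemma space_quenched_law [simp]: "space (quenched_law \<omega> v) = UNIV"
  using sets_eq_imp_space_eq[OF sets_quenched_law[of \<omega> v]] by (simp add: space_PiM)

text \<open>The projective limit is accessible only through its marginals. That of the first
  \<open>k\<close> times is the \<open>k\<close>-fold composition \<open>C\<close> of kernels, and
  an integral over \<open>C\<close> can be unfolded one kernel at a time.\<close>

lemma nn_integral_quenched_law_restrict:
  assumes [measurable]: "g \<in> borel_measurable (PiM {0..<k} (\<lambda>_. count_space (UNIV :: int set)))"
  shows "(\<integral>\<^sup>+X. g (restrict X {0..<k}) \<partial>quenched_law \<omega> v)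
    = (\<integral>\<^sup>+x. g x \<partial>Ionescu_Tulcea.C (walk_kernel \<omega> v) (\<lambda>_. count_space UNIV) 0 k (\<lambda>_. undefined))"
proof -
  let ?M = "\<lambda>_::nat. count_space (UNIV :: int set)"
  interpret Ionescu_Tulcea "walk_kernel \<omega> v" ?M
    by (rule Ionescu_Tulcea_walk)
  have 0: "(\<lambda>_. undefined) \<in> space (PiM {0..<0} ?M)"
    by (simp add: space_PiM)
  have "CI {0..<k} = C 0 k (\<lambda>_. undefined)"
  proof (rule measure_eqI)
    show "sets (CI {0..<k}) = sets (C 0 k (\<lambda>_. undefined))"
      using sets_C[OF 0, of k] by (simp add: PF.sets_P)
    fix A assume "A \<in> sets (CI {0..<k})"
    then have A: "A \<in> sets (PiM {0..<k} ?M)" by (simp add: PF.sets_P)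
    then have "prod_emb {0..<k} ?M {0..<k} A = A"
      using sets.sets_into_space[OF A] by (intro prod_emb_id) (auto simp: space_PiM)
    with emeasure_CI[OF order_refl A] show "emeasure (CI {0..<k}) A = emeasure (C 0 k (\<lambda>_. undefined)) A"
      by simp
  qed
  then have "(\<integral>\<^sup>+x. g x \<partial>C 0 k (\<lambda>_. undefined)) = (\<integral>\<^sup>+x. g x \<partial>distr PF.lim (PiM {0..<k} ?M) (\<lambda>x. restrict x {0..<k}))"
    by (simp add: distr_lim)
  also have "\<dots> = (\<integral>\<^sup>+X. g (restrict X {0..<k}) \<partial>PF.lim)"
    by (rule nn_integral_distr) (simp_all add: measurable_cong_sets[OF PF.sets_lim refl])
  finally show ?thesis by (simp add: quenched_law_def)
qed

lemma prob_space_quenched_law: "prob_space (quenched_law \<omega> v)"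
proof
  let ?M = "\<lambda>_::nat. count_space (UNIV :: int set)"
  interpret Ionescu_Tulcea "walk_kernel \<omega> v" ?M
    by (rule Ionescu_Tulcea_walk)
  have 0: "(\<lambda>_. undefined) \<in> space (PiM {0..<0} ?M)"
    by (simp add: space_PiM)
  have "(\<integral>\<^sup>+X. 1 \<partial>quenched_law \<omega> v) = (\<integral>\<^sup>+X. 1 \<partial>C 0 0 (\<lambda>_. undefined))"
    by (rule nn_integral_quenched_law_restrict) simp
  then show "emeasure (quenched_law \<omega> v) (space (quenched_law \<omega> v)) = 1"
    using prob_space.emeasure_space_1[OF prob_space_C[OF 0, of 0]] by simp
qed

lemma nn_integral_quenched_law_start:
  "(\<integral>\<^sup>+X. ennreal (f (X 0)) \<partial>quenched_law \<omega> v) = ennreal (f v)"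
proof -
  let ?M = "\<lambda>_::nat. count_space (UNIV :: int set)"
  interpret Ionescu_Tulcea "walk_kernel \<omega> v" ?M
    by (rule Ionescu_Tulcea_walk)
  have 0: "(\<lambda>_. undefined) \<in> space (PiM {0..<0} ?M)"
    by (simp add: space_PiM)
  have m[measurable]: "(\<lambda>x. ennreal (f (x 0))) \<in> borel_measurable (PiM {0..<Suc 0} ?M)"
    by (rule measurable_compose[OF measurable_component_singleton]) auto
  have "(\<integral>\<^sup>+X. ennreal (f (X 0)) \<partial>quenched_law \<omega> v) = (\<integral>\<^sup>+x. ennreal (f (x 0)) \<partial>C 0 (Suc 0) (\<lambda>_. undefined))"
    using nn_integral_quenched_law_restrict[OF m] by simp
  also have "\<dots> = (\<integral>\<^sup>+x. ennreal (f (x 0)) \<partial>eP 0 (\<lambda>_. undefined))"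
    using 0 measurable_eP[of 0] by (simp add: bind_return[where N="PiM {0..<Suc 0} ?M"])
  also have "\<dots> = ennreal (f v)"
    using 0 by (simp add: nn_integral_eP walk_kernel_def)
  finally show ?thesis .
qed

text \<open>The Markov property: the last step is integrated out while the position at one earlier
  time \<open>n\<close> is kept as a factor. One earlier time suffices for the joint law of two
  times.\<close>

lemma nn_integral_quenched_law_Suc:
  assumes "\<omega> \<in> Omega" "\<And>x. 0 \<le> f x" "n \<le> m"
  shows "(\<integral>\<^sup>+X. indicator A (X n) * ennreal (f (X (Suc m))) \<partial>quenched_law \<omega> v)
    = (\<integral>\<^sup>+X. indicator A (X n) * ennreal (walk_op \<omega> f (X m)) \<partial>quenched_law \<omega> v)"
proof -
  let ?M = "\<lambda>_::nat. count_space (UNIV :: int set)"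
  interpret Ionescu_Tulcea "walk_kernel \<omega> v" ?M
    by (rule Ionescu_Tulcea_walk)
  let ?C = "C 0 (Suc m) (\<lambda>_. undefined)"
  have 0: "(\<lambda>_. undefined) \<in> space (PiM {0..<0} ?M)"
    by (simp add: space_PiM)
  have m1: "(\<lambda>x. g (x i)) \<in> borel_measurable (PiM {0..<k} ?M)" if "i < k" for g :: "int \<Rightarrow> ennreal" and i k
    using that by (intro measurable_compose[OF measurable_component_singleton]) auto
  have G: "(\<lambda>x. indicator A (x n) * ennreal (f (x (Suc m)))) \<in> borel_measurable (PiM {0..<Suc (Suc m)} ?M)"
    using assms(3) by (intro borel_measurable_times_ennreal m1) auto
  have H: "(\<lambda>x. indicator A (x n) * ennreal (walk_op \<omega> f (x m))) \<in> borel_measurable (PiM {0..<Suc m} ?M)"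
    using assms(3) by (intro borel_measurable_times_ennreal m1) auto
  have sC: "sets ?C = sets (PiM {0..<Suc m} ?M)" "space ?C = space (PiM {0..<Suc m} ?M)"
    using sets_C[OF 0, of "Suc m"] space_C[OF 0, of "Suc m"] by (simp_all del: C.simps)
  have "(\<integral>\<^sup>+X. indicator A (X n) * ennreal (f (X (Suc m))) \<partial>quenched_law \<omega> v)
      = (\<integral>\<^sup>+x. indicator A (x n) * ennreal (f (x (Suc m))) \<partial>C 0 (Suc (Suc m)) (\<lambda>_. undefined))"
    using nn_integral_quenched_law_restrict[OF G] assms(3) by (simp del: C.simps)
  also have "\<dots> = (\<integral>\<^sup>+x. indicator A (x n) * ennreal (f (x (Suc m))) \<partial>(?C \<bind> eP (Suc m)))"
    by simp
  also have "\<dots> = (\<integral>\<^sup>+x. \<integral>\<^sup>+y. indicator A (y n) * ennreal (f (y (Suc m))) \<partial>eP (Suc m) x \<partial>?C)"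
    by (rule nn_integral_bind[OF G]) (subst measurable_cong_sets[OF sC(1) refl], rule measurable_eP)
  also have "\<dots> = (\<integral>\<^sup>+x. indicator A (x n) * ennreal (walk_op \<omega> f (x m)) \<partial>?C)"
  proof (rule nn_integral_cong)
    fix x assume "x \<in> space ?C"
    then have x: "x \<in> space (PiM {0..<Suc m} ?M)" using sC by (simp del: C.simps)
    show "(\<integral>\<^sup>+y. indicator A (y n) * ennreal (f (y (Suc m))) \<partial>eP (Suc m) x)
        = indicator A (x n) * ennreal (walk_op \<omega> f (x m))"
      using assms by (subst nn_integral_eP[OF x G])
        (simp add: walk_kernel_def nn_integral_cmult nn_integral_step)
  qed
  also have "\<dots> = (\<integral>\<^sup>+X. indicator A (X n) * ennreal (walk_op \<omega> f (X m)) \<partial>quenched_law \<omega> v)"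
    using nn_integral_quenched_law_restrict[OF H] assms(3) by (simp del: C.simps)
  finally show ?thesis .
qed

lemma nn_integral_quenched_law_add:
  assumes "\<omega> \<in> Omega" "\<And>x. 0 \<le> f x"
  shows "(\<integral>\<^sup>+X. indicator A (X n) * ennreal (f (X (n + k))) \<partial>quenched_law \<omega> v)
    = (\<integral>\<^sup>+X. indicator A (X n) * ennreal ((walk_op \<omega> ^^ k) f (X n)) \<partial>quenched_law \<omega> v)"
  using assms(2)
proof (induction k arbitrary: f)
  case (Suc k)
  then have "(\<integral>\<^sup>+X. indicator A (X n) * ennreal (f (X (n + Suc k))) \<partial>quenched_law \<omega> v)
      = (\<integral>\<^sup>+X. indicator A (X n) * ennreal (walk_op \<omega> f (X (n + k))) \<partial>quenched_law \<omega> v)"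
    using nn_integral_quenched_law_Suc[OF assms(1), of f n "n + k"] by simp
  also have "\<dots> = (\<integral>\<^sup>+X. indicator A (X n) * ennreal ((walk_op \<omega> ^^ k) (walk_op \<omega> f) (X n)) \<partial>quenched_law \<omega> v)"
    using Suc.prems assms(1) by (intro Suc.IH walk_op_nonneg)
  finally show ?case by (simp add: funpow_swap1)
qed simp

lemma quenched_law_component_measurable [measurable]:
  "(\<lambda>X. X n) \<in> measurable (quenched_law \<omega> v) (count_space UNIV)"
  by (subst measurable_cong_sets[OF sets_quenched_law refl]) (rule measurable_component_singleton, simp)

lemma nn_integral_quenched_law:
  assumes "\<omega> \<in> Omega" "\<And>x. 0 \<le> f x"
  shows "(\<integral>\<^sup>+X. ennreal (f (X n)) \<partial>quenched_law \<omega> v) = ennreal ((walk_op \<omega> ^^ n) f v)"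
  using nn_integral_quenched_law_add[OF assms, where A=UNIV and n=0 and k=n] nn_integral_quenched_law_start by simp

lemma quenched_law_marginal:
  assumes "\<omega> \<in> Omega"
  shows "measure (quenched_law \<omega> v) {X. X n \<in> A} = (walk_op \<omega> ^^ n) (indicator A) v"
proof -
  have [measurable]: "{X. X n \<in> A} \<in> sets (quenched_law \<omega> v)"
    using measurable_sets[OF quenched_law_component_measurable[of n \<omega> v], of A] by (simp add: vimage_def)
  have "emeasure (quenched_law \<omega> v) {X. X n \<in> A} = (\<integral>\<^sup>+X. ennreal (indicator A (X n)) \<partial>quenched_law \<omega> v)"
    by (subst nn_integral_indicator[of "{X. X n \<in> A}", symmetric])
      (auto simp del: nn_integral_indicator intro!: nn_integral_cong split: split_indicator)
  also have "\<dots> = ennreal ((walk_op \<omega> ^^ n) (indicator A) v)"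
    by (rule nn_integral_quenched_law[OF assms]) simp
  finally show ?thesis
    by (simp add: measure_def walk_op_pow_nonneg[OF assms])
qed

lemma quenched_law_joint:
  assumes "\<omega> \<in> Omega"
  shows "measure (quenched_law \<omega> v) {X. X n = a \<and> X (n + k) \<in> B}
    = (walk_op \<omega> ^^ n) (indicator {a}) v * (walk_op \<omega> ^^ k) (indicator B) a"
proof -
  have [measurable]: "{X. X n = a} \<in> sets (quenched_law \<omega> v)" "{X. X (n + k) \<in> B} \<in> sets (quenched_law \<omega> v)" 
    using measurable_sets[OF quenched_law_component_measurable[of n \<omega> v], of "{a}"]
     measurable_sets[OF quenched_law_component_measurable[of "n + k" \<omega> v], of B] by (simp_all add: vimage_def)
  have [measurable]: "{X. X n = a \<and> X (n + k) \<in> B} \<in> sets (quenched_law \<omega> v)"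
    using sets.Int[of "{X. X n = a}" _ "{X. X (n + k) \<in> B}"] by (simp add: Collect_conj_eq)
  have "emeasure (quenched_law \<omega> v) {X. X n = a \<and> X (n + k) \<in> B}
      = (\<integral>\<^sup>+X. indicator {a} (X n) * ennreal (indicator B (X (n + k))) \<partial>quenched_law \<omega> v)"
    by (subst nn_integral_indicator[of "{X. X n = a \<and> X (n + k) \<in> B}", symmetric])
      (auto simp del: nn_integral_indicator intro!: nn_integral_cong split: split_indicator)
  also have "\<dots> = (\<integral>\<^sup>+X. indicator {a} (X n) * ennreal ((walk_op \<omega> ^^ k) (indicator B) (X n)) \<partial>quenched_law \<omega> v)"
    by (rule nn_integral_quenched_law_add[OF assms]) simp
  also have "\<dots> = (\<integral>\<^sup>+X. ennreal ((walk_op \<omega> ^^ k) (indicator B) a) * indicator {X. X n = a} X \<partial>quenched_law \<omega> v)"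
    by (auto simp del: nn_integral_indicator intro!: nn_integral_cong split: split_indicator)
  also have "\<dots> = ennreal ((walk_op \<omega> ^^ k) (indicator B) a) * emeasure (quenched_law \<omega> v) {X. X n \<in> {a}}"
    by (subst nn_integral_cmult_indicator) auto
  also have "\<dots> = ennreal ((walk_op \<omega> ^^ k) (indicator B) a * (walk_op \<omega> ^^ n) (indicator {a}) v)"
    using prob_space.emeasure_le_1[OF prob_space_quenched_law]
      finite_measure.emeasure_eq_measure[OF prob_space.finite_measure[OF prob_space_quenched_law]]
    by (simp only: quenched_law_marginal[OF assms] ennreal_mult'' walk_op_pow_nonneg[OF assms] indicator_pos_le)
  finally show ?thesis
    by (simp add: measure_def walk_op_pow_nonneg[OF assms] mult.commute)
qed

section \<open>Calculus of the transition operator\<close>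

lemma walk_op_pow_Suc:
  "(walk_op \<omega> ^^ Suc n) f x = w_plus \<omega> x * (walk_op \<omega> ^^ n) f (x + 1)
     + w_zero \<omega> x * (walk_op \<omega> ^^ n) f x + w_minus \<omega> x * (walk_op \<omega> ^^ n) f (x - 1)"
  unfolding funpow.simps o_apply by (rule walk_op_def)

lemma walk_op_mono_local:
  assumes "\<omega> \<in> Omega" "\<And>y. \<bar>y - x\<bar> \<le> 1 \<Longrightarrow> f y \<le> g y"
  shows "walk_op \<omega> f x \<le> walk_op \<omega> g x"
  using assms(2)[of "x + 1"] assms(2)[of x] assms(2)[of "x - 1"] Omega_weights[OF assms(1), of x]
  unfolding walk_op_def by (intro add_mono mult_left_mono) auto

lemma walk_op_mono: "\<omega> \<in> Omega \<Longrightarrow> (\<And>y. f y \<le> g y) \<Longrightarrow> walk_op \<omega> f x \<le> walk_op \<omega> g x"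
  by (rule walk_op_mono_local)

lemma walk_op_const: "\<omega> \<in> Omega \<Longrightarrow> walk_op \<omega> (\<lambda>_. c) x = c"
  using Omega_weights(4)[of \<omega> x] by (simp add: walk_op_def flip: distrib_right)

lemma walk_op_pow_mono: "\<omega> \<in> Omega \<Longrightarrow> (\<And>y. f y \<le> g y) \<Longrightarrow> (walk_op \<omega> ^^ n) f x \<le> (walk_op \<omega> ^^ n) g x"
  by (induction n arbitrary: x) (auto intro!: walk_op_mono)

lemma walk_op_pow_const: "\<omega> \<in> Omega \<Longrightarrow> (walk_op \<omega> ^^ n) (\<lambda>_. c) x = c"
proof -
  assume "\<omega> \<in> Omega"
  then have "walk_op \<omega> (\<lambda>_. c) = (\<lambda>_. c)" by (simp add: walk_op_const fun_eq_iff)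
  then have "(walk_op \<omega> ^^ n) (\<lambda>_. c) = (\<lambda>_. c)" by (induction n) simp_all
  then show ?thesis by simp
qed

lemma walk_op_pow_le_1: "\<omega> \<in> Omega \<Longrightarrow> (walk_op \<omega> ^^ n) (indicator A) x \<le> 1"
  using walk_op_pow_mono[of \<omega> "indicator A" "\<lambda>_. 1" n x] by (simp add: walk_op_pow_const indicator_le_1)

lemma walk_op_add: "walk_op \<omega> (\<lambda>x. f x + g x) = (\<lambda>x. walk_op \<omega> f x + walk_op \<omega> g x)"
  by (simp add: walk_op_def fun_eq_iff algebra_simps)

lemma walk_op_cmult: "walk_op \<omega> (\<lambda>x. c * f x) = (\<lambda>x. c * walk_op \<omega> f x)"
  by (simp add: walk_op_def fun_eq_iff algebra_simps)

lemma walk_op_pow_add: "(walk_op \<omega> ^^ n) (\<lambda>x. f x + g x) = (\<lambda>x. (walk_op \<omega> ^^ n) f x + (walk_op \<omega> ^^ n) g x)"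
  by (induction n) (simp_all add: walk_op_add)

lemma walk_op_pow_cmult: "(walk_op \<omega> ^^ n) (\<lambda>x. c * f x) = (\<lambda>x. c * (walk_op \<omega> ^^ n) f x)"
  by (induction n) (simp_all add: walk_op_cmult)

lemma walk_op_pow_sum:
  "finite S \<Longrightarrow> (walk_op \<omega> ^^ n) (\<lambda>x. \<Sum>i\<in>S. f i x) = (\<lambda>x. \<Sum>i\<in>S. (walk_op \<omega> ^^ n) (f i) x)"
proof (induction rule: finite_induct)
  case empty
  have "(walk_op \<omega> ^^ n) (\<lambda>x. 0 * 0) = (\<lambda>x. 0 * (walk_op \<omega> ^^ n) (\<lambda>_. 0) x)"
    by (rule walk_op_pow_cmult)
  then show ?case by simp
qed (simp add: walk_op_pow_add)

lemma walk_op_pow_support: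
  assumes "\<And>y. \<bar>y - x\<bar> \<le> int n \<Longrightarrow> f y = 0"
  shows "(walk_op \<omega> ^^ n) f x = 0"
  using assms
proof (induction n arbitrary: x)
  case (Suc n)
  have "(walk_op \<omega> ^^ n) f y = 0" if "\<bar>y - x\<bar> \<le> 1" for y
    using that by (intro Suc.IH Suc.prems) auto
  then show ?case by (simp add: walk_op_pow_Suc del: funpow.simps)
qed simp

section \<open>Measurable dependence on the environment\<close>

lemma
  assumes "env_law P"
  shows w_plus_measurable: "(\<lambda>\<omega>. w_plus \<omega> z) \<in> borel_measurable P"
    and w_zero_measurable: "(\<lambda>\<omega>. w_zero \<omega> z) \<in> borel_measurable P"
    and w_minus_measurable: "(\<lambda>\<omega>. w_minus \<omega> z) \<in> borel_measurable P"
proof -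
  have P: "sets P = sets (restrict_space borel Omega)"
    using assms by (simp add: env_law_def)
  have c: "f \<in> borel_measurable P" if "continuous_on UNIV f" for f :: "env \<Rightarrow> real"
    using that by (subst measurable_cong_sets[OF P refl])
      (intro measurable_restrict_space1 borel_measurable_continuous_onI)
  show "(\<lambda>\<omega>. w_plus \<omega> z) \<in> borel_measurable P" "(\<lambda>\<omega>. w_zero \<omega> z) \<in> borel_measurable P"
    "(\<lambda>\<omega>. w_minus \<omega> z) \<in> borel_measurable P"
    unfolding w_plus_def w_zero_def w_minus_def
    by (intro c continuous_on_snd continuous_on_fst continuous_on_product_coordinates)+
qed

lemma space_env_law: "env_law P \<Longrightarrow> space P = Omega"
  unfolding env_law_def by (metis Int_UNIV_right sets_eq_imp_space_eq space_borel space_restrict_space)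

lemma walk_op_pow_measurable:
  assumes "env_law P"
  shows "(\<lambda>\<omega>. (walk_op \<omega> ^^ n) f x) \<in> borel_measurable P"
proof (induction n arbitrary: x)
  case (Suc n)
  note [measurable] = w_plus_measurable[OF assms] w_zero_measurable[OF assms] w_minus_measurable[OF assms] Suc.IH
  show ?case unfolding walk_op_pow_Suc by measurable
qed simp

text \<open>Within \<open>n\<close> steps only sites at distance at most \<open>n\<close> are
  reachable, so the probability is a finite sum of products of iterates of the operator. This makes
  it a measurable function of the environment.\<close>

lemma quenched_law_pair_event:
  assumes "\<omega> \<in> Omega"
  shows "measure (quenched_law \<omega> v) {X. R (X n) (X (n + k))}
    = (\<Sum>a\<in>{v - int n..v + int n}. (walk_op \<omega> ^^ n) (indicator {a}) v * (walk_op \<omega> ^^ k) (indicator {b. R a b}) a)"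
proof -
  interpret prob_space "quenched_law \<omega> v" by (rule prob_space_quenched_law)
  let ?I = "{v - int n..v + int n}"
  have m: "{X. X i \<in> A} \<in> events" for i A
    using measurable_sets[OF quenched_law_component_measurable[of i \<omega> v], of A] by (simp add: vimage_def)
  have m2: "{X. X n = a \<and> X (n + k) \<in> B} \<in> events" for a B
    using sets.Int[OF m[of n "{a}"] m[of "n + k" B]] by (simp add: Collect_conj_eq)
  have m3: "{X. R (X n) (X (n + k))} \<in> events"
  proof -
    have "{X. R (X n) (X (n + k))} = (\<Union>a. {X. X n = a \<and> X (n + k) \<in> {b. R a b}})" by auto
    also have "\<dots> \<in> events" by (intro sets.countable_UN'') (rule countableI_type, rule m2)
    finally show ?thesis .
  qed
  have "prob {X. X n \<in> - ?I} = 0"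
    unfolding quenched_law_marginal[OF assms] by (rule walk_op_pow_support) (auto simp: indicator_def)
  then have "AE X in quenched_law \<omega> v. X n \<in> ?I"
    using m[of n "-?I"] by (intro AE_I[where N="{X. X n \<in> - ?I}"]) (auto simp: emeasure_eq_measure)
  then have "prob {X. R (X n) (X (n + k))} = prob (\<Union>a\<in>?I. {X. X n = a \<and> X (n + k) \<in> {b. R a b}})"
    using m3 sets.finite_UN[of ?I "\<lambda>a. {X. X n = a \<and> X (n + k) \<in> {b. R a b}}", OF _ m2]
    by (intro finite_measure_eq_AE) auto
  also have "\<dots> = (\<Sum>a\<in>?I. prob {X. X n = a \<and> X (n + k) \<in> {b. R a b}})"
    by (intro finite_measure_finite_Union image_subsetI m2) (auto simp: disjoint_family_on_def)
  finally show ?thesis by (simp only: quenched_law_joint[OF assms])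
qed

lemma quenched_law_pair_measurable:
  assumes "env_law P"
  shows "(\<lambda>\<omega>. measure (quenched_law \<omega> v) {X. R (X n) (X (n + k))}) \<in> borel_measurable P"
proof -
  note [measurable] = walk_op_pow_measurable[OF assms]
  have "(\<lambda>\<omega>. \<Sum>a\<in>{v - int n..v + int n}. (walk_op \<omega> ^^ n) (indicator {a}) v * (walk_op \<omega> ^^ k) (indicator {b. R a b}) a)
      \<in> borel_measurable P"
    by measurable
  then show ?thesis
    by (rule measurable_cong[THEN iffD1, rotated]) (simp add: quenched_law_pair_event space_env_law[OF assms])
qed

section \<open>Reversibility and exit from intervals\<close>

lemma walk_op_indicator_singleton:
  "walk_op \<omega> (indicator {b}) = (\<lambda>x. w_plus \<omega> (b - 1) * indicator {b - 1} x + (w_zero \<omega> b * indicator {b} x + w_minus \<omega> (b + 1) * indicator {b + 1} x))"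
  by (auto simp: walk_op_def fun_eq_iff indicator_def)

text \<open>Detailed balance survives iteration: the left side is decomposed at its first step, the
  right side at its last one, and detailed balance matches the three terms.\<close>

lemma walk_reversible:
  assumes "\<And>x. \<mu> x * w_plus \<omega> x = \<mu> (x + 1) * w_minus \<omega> (x + 1)"
  shows "\<mu> b * (walk_op \<omega> ^^ n) (indicator {x}) b = \<mu> x * (walk_op \<omega> ^^ n) (indicator {b}) x"
proof (induction n arbitrary: b)
  case (Suc n)
  have "\<mu> b * (walk_op \<omega> ^^ Suc n) (indicator {x}) b
      = \<mu> b * w_plus \<omega> b * (walk_op \<omega> ^^ n) (indicator {x}) (b + 1)
        + w_zero \<omega> b * (\<mu> b * (walk_op \<omega> ^^ n) (indicator {x}) b)
        + \<mu> b * w_minus \<omega> b * (walk_op \<omega> ^^ n) (indicator {x}) (b - 1)"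
    unfolding walk_op_pow_Suc by (simp add: algebra_simps)
  also have "\<dots> = w_minus \<omega> (b + 1) * (\<mu> (b + 1) * (walk_op \<omega> ^^ n) (indicator {x}) (b + 1))
        + w_zero \<omega> b * (\<mu> b * (walk_op \<omega> ^^ n) (indicator {x}) b)
        + w_plus \<omega> (b - 1) * (\<mu> (b - 1) * (walk_op \<omega> ^^ n) (indicator {x}) (b - 1))"
    using assms[of b] assms[of "b - 1"] by (simp add: mult.commute mult.left_commute)
  also have "\<dots> = \<mu> x * (walk_op \<omega> ^^ Suc n) (indicator {b}) x"
    unfolding Suc.IH funpow_Suc_right o_def walk_op_indicator_singleton walk_op_pow_add walk_op_pow_cmult
    by (simp add: algebra_simps)
  finally show ?case .
qed (auto simp: indicator_def)

text \<open>A nearest-neighbour path that is outside at time \<open>n\<close> has visited an end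
  point at some time \<open>i \<le> n\<close>; the right side is the union bound over
  \<open>i\<close>.\<close>

lemma walk_leave_interval:
  assumes "\<omega> \<in> Omega" "a \<le> x" "x \<le> c"
  shows "(walk_op \<omega> ^^ n) (indicator (- {a..c})) x \<le> (\<Sum>i\<le>n. (walk_op \<omega> ^^ i) (indicator {a, c}) x)"
  using assms(2,3)
proof (induction n arbitrary: x)
  case (Suc n)
  have nn: "0 \<le> (walk_op \<omega> ^^ i) (indicator {a, c}) y" for i y
    by (rule walk_op_pow_nonneg[OF assms(1)]) simp
  show ?case
  proof (cases "x = a \<or> x = c")
    case True
    then have "1 \<le> (\<Sum>i\<le>0. (walk_op \<omega> ^^ i) (indicator {a, c}) x)" by auto
    also have "\<dots> \<le> (\<Sum>i\<le>Suc n. (walk_op \<omega> ^^ i) (indicator {a, c}) x)"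
      using nn by (intro sum_mono2) auto
    finally show ?thesis using walk_op_pow_le_1[OF assms(1)] by (meson order_trans)
  next
    case False
    have "(walk_op \<omega> ^^ Suc n) (indicator (- {a..c})) x
        \<le> walk_op \<omega> (\<lambda>y. \<Sum>i\<le>n. (walk_op \<omega> ^^ i) (indicator {a, c}) y) x"
      unfolding funpow.simps o_def
      by (rule walk_op_mono_local[OF assms(1)], rule Suc.IH) (use False Suc.prems in auto)
    also have "\<dots> = (\<Sum>i\<le>n. (walk_op \<omega> ^^ Suc i) (indicator {a, c}) x)"
      using walk_op_pow_sum[of "{..n}", where \<omega>=\<omega> and n=1 and f="\<lambda>i. (walk_op \<omega> ^^ i) (indicator {a, c})"] by (simp add: fun_eq_iff)
    also have "\<dots> \<le> (\<Sum>i\<le>Suc n. (walk_op \<omega> ^^ i) (indicator {a, c}) x)"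
      unfolding sum.atMost_Suc_shift[of _ n] using nn[of 0 x] by simp
    finally show ?thesis .
  qed
qed (auto simp: indicator_def)

text \<open>By reversibility, going from \<open>b\<close> to \<open>x\<close> has probability at
  most \<open>\<mu> x / \<mu> b\<close>, uniformly in time. Sites of \<open>A\<close> inside the
  interval are summed with this bound; being outside costs a visit to \<open>a\<close> or
  \<open>c\<close> at one of \<open>n + 1\<close> times.\<close>

lemma walk_localized_at_start:
  fixes a b c :: int and \<alpha> \<beta> :: real
  assumes \<omega>: "\<omega> \<in> Omega" and ab: "a \<le> b" "b \<le> c"
    and rev: "\<And>x. \<mu> x * w_plus \<omega> x = \<mu> (x + 1) * w_minus \<omega> (x + 1)" and pos: "\<And>x. 0 < \<mu> x"
    and small: "\<And>x. a \<le> x \<Longrightarrow> x \<le> c \<Longrightarrow> x \<in> A \<Longrightarrow> \<mu> x \<le> \<alpha> * \<mu> b"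
    and edge: "\<mu> a \<le> \<beta> * \<mu> b" "\<mu> c \<le> \<beta> * \<mu> b" and "0 \<le> \<alpha>"
  shows "(walk_op \<omega> ^^ n) (indicator A) b \<le> (c - a + 1) * \<alpha> + 2 * (n + 1) * \<beta>"
proof -
  have p: "(walk_op \<omega> ^^ i) (indicator {x}) b \<le> \<gamma>" if "\<mu> x \<le> \<gamma> * \<mu> b" for i x \<gamma>
  proof -
    have "\<mu> b * (walk_op \<omega> ^^ i) (indicator {x}) b \<le> \<mu> x"
      using walk_reversible[OF rev, where b=b and n=i and x=x] walk_op_pow_le_1[OF \<omega>, of i "{b}" x] pos[of x]
      by (simp add: mult_left_le)
    with that have "\<mu> b * (walk_op \<omega> ^^ i) (indicator {x}) b \<le> \<mu> b * \<gamma>" by (simp add: mult.commute)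
    then show ?thesis using pos[of b] by simp
  qed
  have "(walk_op \<omega> ^^ n) (indicator A) b
      \<le> (walk_op \<omega> ^^ n) (\<lambda>y. (\<Sum>x\<in>{a..c} \<inter> A. indicator {x} y) + indicator (- {a..c}) y) b"
    by (rule walk_op_pow_mono[OF \<omega>]) (auto simp: indicator_def)
  also have "\<dots> = (\<Sum>x\<in>{a..c} \<inter> A. (walk_op \<omega> ^^ n) (indicator {x}) b) + (walk_op \<omega> ^^ n) (indicator (- {a..c})) b"
    by (simp add: walk_op_pow_add walk_op_pow_sum)
  also have "(\<Sum>x\<in>{a..c} \<inter> A. (walk_op \<omega> ^^ n) (indicator {x}) b) \<le> (\<Sum>x\<in>{a..c} \<inter> A. \<alpha>)"
    using small by (intro sum_mono p) auto
  also have "\<dots> \<le> (\<Sum>x\<in>{a..c}. \<alpha>)"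
    using assms(9) by (intro sum_mono2) auto
  also have "\<dots> = (c - a + 1) * \<alpha>" using ab by simp
  also have "(walk_op \<omega> ^^ n) (indicator (- {a..c})) b \<le> (\<Sum>i\<le>n. (walk_op \<omega> ^^ i) (indicator {a, c}) b)"
    by (rule walk_leave_interval[OF \<omega> ab])
  also have "\<dots> \<le> (\<Sum>i\<le>n. 2 * \<beta>)"
  proof (rule sum_mono)
    fix i
    have "(walk_op \<omega> ^^ i) (indicator {a, c}) b \<le> (walk_op \<omega> ^^ i) (\<lambda>y. indicator {a} y + indicator {c} y) b"
      by (rule walk_op_pow_mono[OF \<omega>]) (auto simp: indicator_def)
    also have "\<dots> \<le> \<beta> + \<beta>"
      unfolding walk_op_pow_add by (intro add_mono p edge)
    finally show "(walk_op \<omega> ^^ i) (indicator {a, c}) b \<le> 2 * \<beta>" by simp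
  qed
  also have "\<dots> = 2 * (n + 1) * \<beta>" by simp
  finally show ?thesis by (simp add: add.commute)
qed

text \<open>Optional stopping as an induction over time: \<open>f\<close> dominates the expected exit time
  from \<open>I\<close> and \<open>g\<close> the probability of leaving through \<open>a\<close>.\<close>

lemma walk_hitting_bound:
  fixes U :: "nat \<Rightarrow> int \<Rightarrow> real"
  assumes \<omega>: "\<omega> \<in> Omega" and step: "\<And>k. U (Suc k) = walk_op \<omega> (U k)" and U1: "\<And>k x. U k x \<le> 1"
    and Ub: "\<And>k. k \<le> K \<Longrightarrow> U k b \<le> 0"
    and nbr: "\<And>x y. x \<in> I \<Longrightarrow> \<bar>y - x\<bar> \<le> 1 \<Longrightarrow> y \<in> insert a (insert b I)"
    and f: "\<And>x. x \<in> I \<Longrightarrow> walk_op \<omega> f x + 1 \<le> f x" and f0: "\<And>x. x \<in> insert a (insert b I) \<Longrightarrow> 0 \<le> f x"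
    and g: "\<And>x. x \<in> I \<Longrightarrow> walk_op \<omega> g x \<le> g x" and g0: "\<And>x. x \<in> insert a (insert b I) \<Longrightarrow> 0 \<le> g x" and ga: "1 \<le> g a"
    and x: "x \<in> insert a (insert b I)" and k: "k \<le> K"
  shows "k * (U k x - g x) \<le> f x"
  using x k
proof (induction k arbitrary: x)
  case (Suc k)
  show ?case
  proof (cases "x \<in> I")
    case False
    with Suc.prems have "U (Suc k) x \<le> g x"
      using Ub[of "Suc k"] U1[of "Suc k" x] g0[of x] ga by auto
    then have "Suc k * (U (Suc k) x - g x) \<le> 0" by (simp add: mult_nonneg_nonpos)
    with f0[OF Suc.prems(1)] show ?thesis by linarith
  next
    case True
    \<comment> \<open>Of the \<open>k + 1\<close> copies of \<open>U k - g\<close>, \<open>k\<close>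
      are controlled by the induction hypothesis; the remaining one is at most 1, which
      \<open>f\<close> loses on average in one step.\<close>
    have "Suc k * (U (Suc k) x - g x) \<le> Suc k * walk_op \<omega> (\<lambda>y. U k y - g y) x"
      using g[OF True] by (intro mult_left_mono) (auto simp: step walk_op_def algebra_simps)
    also have "\<dots> = walk_op \<omega> (\<lambda>y. k * (U k y - g y) + (U k y - g y)) x"
      by (simp add: walk_op_def algebra_simps)
    also have "\<dots> \<le> walk_op \<omega> (\<lambda>y. f y + 1) x"
    proof -
      have "k * (U k y - g y) + (U k y - g y) \<le> f y + 1" if "\<bar>y - x\<bar> \<le> 1" for y
        using Suc.IH[OF nbr[OF True that]] Suc.prems(2) U1[of k y] g0[OF nbr[OF True that]] by linarith
      then show ?thesis by (rule walk_op_mono_local[OF \<omega>])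
    qed
    also have "\<dots> = walk_op \<omega> f x + 1"
      by (simp add: walk_op_add walk_op_const[OF \<omega>])
    also have "\<dots> \<le> f x" by (rule f[OF True])
    finally show ?thesis .
  qed
qed (use f0 in auto)

section \<open>Potential and localisation\<close>

lemma potential_Suc: "potential \<omega> (m + 1) = potential \<omega> m + log_rho \<omega> m"
proof -
  consider "m > 0" | "m = 0" | "m = -1" | "m < -1" by linarith
  then show ?thesis
  proof cases
    case 1
    then have "{0..m} = insert m {0..m - 1}" by auto
    with 1 show ?thesis by (simp add: potential_def)
  next
    case 4
    then have "{m..-1} = insert m {m + 1..-1}" by auto
    with 4 show ?thesis by (simp add: potential_def)
  qed (simp_all add: potential_def)
qed

definition elliptic :: "real \<Rightarrow> env \<Rightarrow> bool" where
  "elliptic \<epsilon> \<omega> \<longleftrightarrow> \<omega> \<in> Omega \<and> (\<forall>z. \<epsilon> \<le> w_minus \<omega> z \<and> \<epsilon> \<le> w_plus \<omega> z)"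

lemma
  assumes "elliptic \<epsilon> \<omega>" "0 < \<epsilon>"
  shows elliptic_Omega: "\<omega> \<in> Omega"
    and elliptic_pos: "0 < w_minus \<omega> z" "0 < w_plus \<omega> z"
    and elliptic_inverse: "1 / w_minus \<omega> z \<le> 1 / \<epsilon>" "1 / w_plus \<omega> z \<le> 1 / \<epsilon>"
    and elliptic_le_1: "w_minus \<omega> z \<le> 1" "w_plus \<omega> z \<le> 1"
proof -
  show "\<omega> \<in> Omega" using assms by (simp add: elliptic_def)
  from Omega_weights[OF this, of z] show "w_minus \<omega> z \<le> 1" "w_plus \<omega> z \<le> 1" by linarith+
  have "\<epsilon> \<le> w_minus \<omega> z" "\<epsilon> \<le> w_plus \<omega> z" using assms by (auto simp: elliptic_def)
  with assms show "0 < w_minus \<omega> z" "0 < w_plus \<omega> z" "1 / w_minus \<omega> z \<le> 1 / \<epsilon>" "1 / w_plus \<omega> z \<le> 1 / \<epsilon>"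
    by (auto simp: frac_le)
qed

text \<open>This identity is behind two explicit objects:
  \<open>exp (- potential \<omega> x) / w_minus \<omega> x\<close> is a reversible measure, and a
  function with increment \<open>exp (potential \<omega> (x + 1))\<close> from \<open>x\<close> to
  \<open>x + 1\<close> is harmonic.\<close>

lemma exp_potential_Suc:
  assumes "elliptic \<epsilon> \<omega>" "0 < \<epsilon>"
  shows "exp (potential \<omega> (x + 1)) * w_plus \<omega> x = exp (potential \<omega> x) * w_minus \<omega> x"
  using elliptic_pos[OF assms, of x] by (simp add: potential_Suc log_rho_def exp_add)

lemma exp_potential_drop:
  assumes "elliptic \<epsilon> \<omega>" "0 < \<epsilon>"
  shows "exp (potential \<omega> x - potential \<omega> (x + 1)) \<le> 1 / \<epsilon>"
proof -
  have "exp (potential \<omega> x - potential \<omega> (x + 1)) = w_plus \<omega> x / w_minus \<omega> x"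
    using exp_potential_Suc[OF assms, of x] elliptic_pos[OF assms, of x] by (simp add: exp_diff field_simps)
  also have "\<dots> \<le> 1 / w_minus \<omega> x"
    using elliptic_le_1[OF assms, of x] elliptic_pos[OF assms, of x] by (simp add: divide_right_mono)
  finally show ?thesis using elliptic_inverse[OF assms, of x] by simp
qed

lemma int_sum_first: "x \<le> b \<Longrightarrow> (\<Sum>y\<in>{x..b}. h y) = h x + (\<Sum>y\<in>{x+1..b}. h y)" for x b :: int
proof -
  assume "x \<le> b"
  then have "{x..b} = insert x {x+1..b}" by auto
  then show ?thesis by simp
qed

lemma int_sum_last: "x \<le> b \<Longrightarrow> (\<Sum>y\<in>{x..b}. h y) = (\<Sum>y\<in>{x..b-1}. h y) + h b" for x b :: int
proof -
  assume "x \<le> b"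
  then have "{x..b} = insert b {x..b-1}" by auto
  then show ?thesis by (simp add: add.commute)
qed

text \<open>Ellipticity distorts the reversible measure by at most a factor
  \<open>1 / \<epsilon>\<close> against \<open>exp (- potential \<omega> x)\<close>. So sites at
  height \<open>\<kappa>\<close> above \<open>b\<close> are unlikely at every time, and walls of
  height \<open>\<Lambda>\<close> hold for times well below \<open>exp \<Lambda>\<close>.\<close>

lemma walk_localized:
  fixes a b c :: int and \<kappa> \<Lambda> :: real
  assumes el: "elliptic \<epsilon> \<omega>" "0 < \<epsilon>" and ab: "a \<le> b" "b \<le> c"
    and bot: "\<And>x. a \<le> x \<Longrightarrow> x \<le> c \<Longrightarrow> x \<in> A \<Longrightarrow> potential \<omega> b + \<kappa> \<le> potential \<omega> x"
    and edge: "potential \<omega> b + \<Lambda> \<le> potential \<omega> a" "potential \<omega> b + \<Lambda> \<le> potential \<omega> c"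
  shows "(walk_op \<omega> ^^ n) (indicator A) b \<le> (c - a + 1) * (exp (-\<kappa>) / \<epsilon>) + 2 * (n + 1) * (exp (-\<Lambda>) / \<epsilon>)"
proof (rule walk_localized_at_start[OF elliptic_Omega[OF el] ab, where \<mu>="\<lambda>x. exp (- potential \<omega> x) / w_minus \<omega> x"])
  note pos = elliptic_pos[OF el]
  fix x
  show "exp (- potential \<omega> x) / w_minus \<omega> x * w_plus \<omega> x = exp (- potential \<omega> (x + 1)) / w_minus \<omega> (x + 1) * w_minus \<omega> (x + 1)"
    using exp_potential_Suc[OF el, of x] pos[of x] pos[of "x+1"] by (simp add: exp_minus field_simps)
  show "0 < exp (- potential \<omega> x) / w_minus \<omega> x" using pos by simp
  have key: "exp (- potential \<omega> y) / w_minus \<omega> y \<le> exp (-l) / \<epsilon> * (exp (- potential \<omega> b) / w_minus \<omega> b)"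
    if "potential \<omega> b + l \<le> potential \<omega> y" for l y
  proof -
    have "exp (- potential \<omega> y) * (1 / w_minus \<omega> y) \<le> (exp (-l) * exp (- potential \<omega> b)) * (1 / \<epsilon>)"
      using that elliptic_inverse[OF el, of y] pos(1)[of y] by (intro mult_mono) (auto simp flip: exp_add)
    also have "\<dots> \<le> (exp (-l) * exp (- potential \<omega> b)) * (1 / \<epsilon>) * (1 / w_minus \<omega> b)"
    proof -
      have "1 \<le> 1 / w_minus \<omega> b" using elliptic_le_1[OF el, of b] pos[of b] by simp
      from mult_left_mono[OF this, of "exp (-l) * exp (- potential \<omega> b) * (1 / \<epsilon>)"] el(2) show ?thesis by simp
    qed
    finally show ?thesis by (simp add: mult.commute mult.left_commute)
  qed
  show "a \<le> x \<Longrightarrow> x \<le> c \<Longrightarrow> x \<in> A \<Longrightarrow>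
    exp (- potential \<omega> x) / w_minus \<omega> x \<le> exp (-\<kappa>) / \<epsilon> * (exp (- potential \<omega> b) / w_minus \<omega> b)"
    by (intro key bot)
  show "exp (- potential \<omega> a) / w_minus \<omega> a \<le> exp (-\<Lambda>) / \<epsilon> * (exp (- potential \<omega> b) / w_minus \<omega> b)"
    "exp (- potential \<omega> c) / w_minus \<omega> c \<le> exp (-\<Lambda>) / \<epsilon> * (exp (- potential \<omega> b) / w_minus \<omega> b)"
    by (intro key edge)+
  show "0 \<le> exp (-\<kappa>) / \<epsilon>" using el by simp
qed

lemma walk_op_diff_form:
  assumes "\<omega> \<in> Omega"
  shows "walk_op \<omega> u x = u x - w_plus \<omega> x * (u x - u (x + 1)) + w_minus \<omega> x * (u (x - 1) - u x)"
proof -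
  have w0: "w_zero \<omega> x = 1 - w_plus \<omega> x - w_minus \<omega> x" using Omega_weights[OF assms, of x] by simp
  show ?thesis unfolding walk_op_def w0 by (simp add: algebra_simps)
qed

text \<open>To be in \<open>A\<close> at time \<open>n\<close>, the walk must have left through
  \<open>a\<close>, or have met neither \<open>a\<close> nor \<open>b\<close> by time
  \<open>n\<close>, or have reached \<open>b\<close> and gone on to \<open>A\<close>. These
  contributions are bounded by \<open>g 0\<close>, by the mean exit time \<open>f 0\<close> divided
  by \<open>n\<close>, and by \<open>\<gamma>\<close>.\<close>

lemma walk_reach_from_left:
  fixes a b :: int and D \<kappa> :: real
  assumes el: "elliptic \<epsilon> \<omega>" "0 < \<epsilon>" and ab: "a \<le> 0" "0 \<le> b"
    and draw: "\<And>x y. a \<le> x \<Longrightarrow> x \<le> y \<Longrightarrow> y \<le> b \<Longrightarrow> potential \<omega> y - potential \<omega> x \<le> D"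
    and wall: "\<And>x. 0 \<le> x \<Longrightarrow> x \<le> b \<Longrightarrow> potential \<omega> x + \<kappa> \<le> potential \<omega> a"
    and loc: "\<And>k. k \<le> n \<Longrightarrow> (walk_op \<omega> ^^ k) (indicator A) b \<le> \<gamma>" and n: "0 < n" and \<gamma>: "0 \<le> \<gamma>"
  shows "(walk_op \<omega> ^^ n) (indicator A) 0 \<le> \<gamma> + (b - a) * exp (-\<kappa>) / \<epsilon> + (b - a)\<^sup>2 * exp D / (\<epsilon> * n)"
proof -
  note \<omega> = elliptic_Omega[OF el] and pos = elliptic_pos[OF el] and V = exp_potential_Suc[OF el]
  define V where "V = potential \<omega>"
  \<comment> \<open>\<open>d x\<close> solves the recursion for the mean time to get from
    \<open>x\<close> to \<open>x + 1\<close>, with value 0 at \<open>a\<close>, as if the walk were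
    put back from \<open>a\<close> to \<open>a + 1\<close> at once; \<open>f\<close> adds up these
    times until \<open>b\<close>.\<close>
  define d where "d x = (\<Sum>z\<in>{a+1..x}. exp (V (x + 1) - V (z + 1)) / w_plus \<omega> z)" for x
  define f where "f x = (\<Sum>y\<in>{x..b-1}. d y)" for x
  \<comment> \<open>Harmonic inside the interval and zero at \<open>b\<close>. The normalisation
    makes the increment at \<open>a\<close> equal to 1, hence \<open>1 \<le> g a\<close>.\<close>
  define g where "g x = (\<Sum>y\<in>{x..b-1}. exp (V (y + 1) - V (a + 1)))" for x
  have d0: "0 \<le> d x" for x
    using pos unfolding d_def by (intro sum_nonneg divide_nonneg_pos) auto
  have d_rec: "w_plus \<omega> x * d x = 1 + w_minus \<omega> x * d (x - 1)" if "a < x" for x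
  proof -
    have "w_plus \<omega> x * d x = (\<Sum>z\<in>{a+1..x-1}. w_plus \<omega> x * (exp (V (x + 1) - V (z + 1)) / w_plus \<omega> z)) + 1"
      using that pos[of x] by (simp add: d_def int_sum_last sum_distrib_left distrib_left)
    also have "(\<Sum>z\<in>{a+1..x-1}. w_plus \<omega> x * (exp (V (x + 1) - V (z + 1)) / w_plus \<omega> z))
        = (\<Sum>z\<in>{a+1..x-1}. w_minus \<omega> x * (exp (V x - V (z + 1)) / w_plus \<omega> z))"
      using V[of x] by (intro sum.cong) (auto simp: exp_diff V_def mult.commute)
    also have "\<dots> = w_minus \<omega> x * d (x - 1)" by (simp add: d_def sum_distrib_left)
    finally show ?thesis by simp
  qed
  let ?I = "{a+1..b-1}"
  have main: "n * ((walk_op \<omega> ^^ n) (indicator A) 0 - \<gamma> - g 0) \<le> f 0"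
  \<comment> \<open>Equality forces \<open>a = b = 0\<close>. The sum \<open>g a\<close> is then
    empty and cannot be at least 1, but the walk already starts at the bottom.\<close>
  proof (cases "a = b")
    case True
    with ab loc[of n] \<gamma> show ?thesis by (simp add: f_def g_def mult_le_0_iff)
  next
    case False
    then have ab': "a < b" using ab by simp
    show ?thesis
    proof (rule walk_hitting_bound[where I="?I" and a=a and b=b and K=n and U="\<lambda>k x. (walk_op \<omega> ^^ k) (indicator A) x - \<gamma>", OF \<omega>])
      show "(\<lambda>x. (walk_op \<omega> ^^ Suc k) (indicator A) x - \<gamma>) = walk_op \<omega> (\<lambda>x. (walk_op \<omega> ^^ k) (indicator A) x - \<gamma>)" for k
        using walk_op_add[of \<omega> "(walk_op \<omega> ^^ k) (indicator A)" "\<lambda>_. - \<gamma>"] by (simp add: walk_op_const[OF \<omega>])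
      show "(walk_op \<omega> ^^ k) (indicator A) x - \<gamma> \<le> 1" for k x
        using walk_op_pow_le_1[OF \<omega>, of k A x] \<gamma> by linarith
      show "walk_op \<omega> f x + 1 \<le> f x" if "x \<in> ?I" for x
        using that d_rec[of x] int_sum_first[of x "b-1" d] int_sum_first[of "x-1" "b-1" d]
        by (simp add: walk_op_diff_form[OF \<omega>] f_def)
      show "walk_op \<omega> g x \<le> g x" if "x \<in> ?I" for x
      proof -
        have "w_plus \<omega> x * exp (V (x + 1) - V (a + 1)) = w_minus \<omega> x * exp (V x - V (a + 1))"
          using V[of x] by (simp add: exp_diff V_def mult.commute)
        with that int_sum_first[of x "b-1" "\<lambda>y. exp (V (y + 1) - V (a + 1))"]
          int_sum_first[of "x-1" "b-1" "\<lambda>y. exp (V (y + 1) - V (a + 1))"]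
        show ?thesis by (simp add: walk_op_diff_form[OF \<omega>] g_def)
      qed
      show "1 \<le> g a"
        using int_sum_first[of a "b-1" "\<lambda>y. exp (V (y + 1) - V (a + 1))"] ab'
        by (simp add: g_def sum_nonneg)
    qed (use ab ab' loc d0 in \<open>auto simp: f_def g_def intro: sum_nonneg\<close>)
  qed
  have "g 0 \<le> (\<Sum>y\<in>{0..b-1}. exp (-\<kappa>) * (1 / \<epsilon>))"
    unfolding g_def
  proof (rule sum_mono)
    fix y assume y: "y \<in> {0..b-1}"
    \<comment> \<open>The wall is measured at \<open>a\<close> and the normalisation at
      \<open>a + 1\<close>; ellipticity bounds the difference.\<close>
    have "exp (V (y + 1) - V (a + 1)) = exp (V (y + 1) - V a) * exp (V a - V (a + 1))"
      by (simp flip: exp_add)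
    also have "\<dots> \<le> exp (-\<kappa>) * (1 / \<epsilon>)"
      using wall[of "y + 1"] y exp_potential_drop[OF el, of a] by (intro mult_mono) (auto simp: V_def)
    finally show "exp (V (y + 1) - V (a + 1)) \<le> exp (-\<kappa>) * (1 / \<epsilon>)" .
  qed
  also have "\<dots> \<le> (b - a) * exp (-\<kappa>) / \<epsilon>"
    using ab el by (simp add: divide_right_mono mult_right_mono)
  finally have g: "g 0 \<le> (b - a) * exp (-\<kappa>) / \<epsilon>" .
  have "f 0 \<le> (\<Sum>y\<in>{0..b-1}. (b - a) * (exp D / \<epsilon>))"
    unfolding f_def
  proof (rule sum_mono)
    fix y assume y: "y \<in> {0..b-1}"
    have "d y \<le> (\<Sum>z\<in>{a+1..y}. exp D / \<epsilon>)"
      unfolding d_def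
    proof (rule sum_mono)
      fix z assume z: "z \<in> {a+1..y}"
      have "exp (V (y + 1) - V (z + 1)) * (1 / w_plus \<omega> z) \<le> exp D * (1 / \<epsilon>)"
        using draw[of "z + 1" "y + 1"] y z elliptic_inverse[OF el, of z] pos[of z]
        by (intro mult_mono) (auto simp: V_def)
      then show "exp (V (y + 1) - V (z + 1)) / w_plus \<omega> z \<le> exp D / \<epsilon>" by simp
    qed
    also have "\<dots> = of_int (y - a) * (exp D / \<epsilon>)" using y ab by simp
    also have "\<dots> \<le> (b - a) * (exp D / \<epsilon>)" using y el by (intro mult_right_mono) auto
    finally show "d y \<le> (b - a) * (exp D / \<epsilon>)" by simp
  qed
  also have "\<dots> = b * ((b - a) * (exp D / \<epsilon>))" using ab by simp
  also have "\<dots> \<le> (b - a) * ((b - a) * (exp D / \<epsilon>))"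
    using ab el by (intro mult_right_mono) auto
  finally have f: "f 0 \<le> (b - a)\<^sup>2 * exp D / \<epsilon>" by (simp add: power2_eq_square mult.assoc)
  have "(walk_op \<omega> ^^ n) (indicator A) 0 - \<gamma> - g 0 \<le> (b - a)\<^sup>2 * exp D / \<epsilon> / n"
    using order_trans[OF main f] n by (simp only: pos_le_divide_eq of_nat_0_less_iff mult.commute)
  also have "\<dots> = (b - a)\<^sup>2 * exp D / (\<epsilon> * n)" by simp
  finally show ?thesis using g by linarith
qed

text \<open>The mirror image, carried out anew: reflecting the environment shifts the potential by
  one site, so the indices in \<open>d\<close> and \<open>g\<close> change, and \<open>g\<close> is
  normalised at the wall \<open>c\<close> itself.\<close>

lemma walk_reach_from_right:
  fixes b c :: int and D \<kappa> :: real
  assumes el: "elliptic \<epsilon> \<omega>" "0 < \<epsilon>" and bc: "b \<le> 0" "0 \<le> c"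
    and draw: "\<And>x y. b \<le> x \<Longrightarrow> x \<le> y \<Longrightarrow> y \<le> c \<Longrightarrow> potential \<omega> x - potential \<omega> y \<le> D"
    and wall: "\<And>x. b \<le> x \<Longrightarrow> x \<le> 0 \<Longrightarrow> potential \<omega> x + \<kappa> \<le> potential \<omega> c"
    and loc: "\<And>k. k \<le> n \<Longrightarrow> (walk_op \<omega> ^^ k) (indicator A) b \<le> \<gamma>" and n: "0 < n" and \<gamma>: "0 \<le> \<gamma>"
  shows "(walk_op \<omega> ^^ n) (indicator A) 0 \<le> \<gamma> + (c - b) * exp (-\<kappa>) / \<epsilon> + (c - b)\<^sup>2 * exp D / (\<epsilon> * n)"
proof -
  note \<omega> = elliptic_Omega[OF el] and pos = elliptic_pos[OF el] and V = exp_potential_Suc[OF el]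
  define V where "V = potential \<omega>"
  define d where "d x = (\<Sum>z\<in>{x..c-1}. exp (V x - V z) / w_minus \<omega> z)" for x
  define f where "f x = (\<Sum>y\<in>{b+1..x}. d y)" for x
  define g where "g x = (\<Sum>y\<in>{b+1..x}. exp (V y - V c))" for x
  have d0: "0 \<le> d x" for x
    using pos unfolding d_def by (intro sum_nonneg divide_nonneg_pos) auto
  have d_rec: "w_minus \<omega> x * d x = 1 + w_plus \<omega> x * d (x + 1)" if "x < c" for x
  proof -
    have "w_minus \<omega> x * d x = 1 + (\<Sum>z\<in>{x+1..c-1}. w_minus \<omega> x * (exp (V x - V z) / w_minus \<omega> z))"
      using that pos[of x] by (simp add: d_def int_sum_first sum_distrib_left distrib_left)
    also have "(\<Sum>z\<in>{x+1..c-1}. w_minus \<omega> x * (exp (V x - V z) / w_minus \<omega> z))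
        = (\<Sum>z\<in>{x+1..c-1}. w_plus \<omega> x * (exp (V (x + 1) - V z) / w_minus \<omega> z))"
      using V[of x] by (intro sum.cong) (auto simp: exp_diff V_def mult.commute)
    also have "\<dots> = w_plus \<omega> x * d (x + 1)" by (simp add: d_def sum_distrib_left)
    finally show ?thesis by simp
  qed
  let ?I = "{b+1..c-1}"
  have main: "n * ((walk_op \<omega> ^^ n) (indicator A) 0 - \<gamma> - g 0) \<le> f 0"
  proof (cases "b = c")
    case True
    with bc loc[of n] \<gamma> show ?thesis by (simp add: f_def g_def mult_le_0_iff)
  next
    case False
    then have bc': "b < c" using bc by simp
    show ?thesis
    proof (rule walk_hitting_bound[where I="?I" and a=c and b=b and K=n and U="\<lambda>k x. (walk_op \<omega> ^^ k) (indicator A) x - \<gamma>", OF \<omega>])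
      show "(\<lambda>x. (walk_op \<omega> ^^ Suc k) (indicator A) x - \<gamma>) = walk_op \<omega> (\<lambda>x. (walk_op \<omega> ^^ k) (indicator A) x - \<gamma>)" for k
        using walk_op_add[of \<omega> "(walk_op \<omega> ^^ k) (indicator A)" "\<lambda>_. - \<gamma>"] by (simp add: walk_op_const[OF \<omega>])
      show "(walk_op \<omega> ^^ k) (indicator A) x - \<gamma> \<le> 1" for k x
        using walk_op_pow_le_1[OF \<omega>, of k A x] \<gamma> by linarith
      show "walk_op \<omega> f x + 1 \<le> f x" if "x \<in> ?I" for x
        using that d_rec[of x] int_sum_last[of "b+1" x d] int_sum_last[of "b+1" "x+1" d]
        by (simp add: walk_op_diff_form[OF \<omega>] f_def)
      show "walk_op \<omega> g x \<le> g x" if "x \<in> ?I" for x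
      proof -
        have "w_plus \<omega> x * exp (V (x + 1) - V c) = w_minus \<omega> x * exp (V x - V c)"
          using V[of x] by (simp add: exp_diff V_def mult.commute)
        with that int_sum_last[of "b+1" x "\<lambda>y. exp (V y - V c)"] int_sum_last[of "b+1" "x+1" "\<lambda>y. exp (V y - V c)"]
        show ?thesis by (simp add: walk_op_diff_form[OF \<omega>] g_def)
      qed
      show "1 \<le> g c"
        using int_sum_last[of "b+1" c "\<lambda>y. exp (V y - V c)"] bc' by (simp add: g_def sum_nonneg)
    qed (use bc bc' loc d0 in \<open>auto simp: f_def g_def intro: sum_nonneg\<close>)
  qed
  have "\<epsilon> \<le> 1" using el(1) elliptic_le_1(1)[OF el, of 0] unfolding elliptic_def by (meson order_trans)
  then have e1: "exp (-\<kappa>) \<le> exp (-\<kappa>) / \<epsilon>" using el(2) by (simp add: pos_le_divide_eq mult_left_le)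
  have "g 0 \<le> (\<Sum>y\<in>{b+1..0}. exp (-\<kappa>) / \<epsilon>)"
    unfolding g_def
  proof (rule sum_mono)
    fix y assume y: "y \<in> {b+1..0}"
    have "exp (V y - V c) \<le> exp (-\<kappa>)"
      using wall[of y] y by (simp add: V_def)
    with e1 show "exp (V y - V c) \<le> exp (-\<kappa>) / \<epsilon>" by linarith
  qed
  also have "\<dots> = (- b) * (exp (-\<kappa>) / \<epsilon>)" using bc by simp
  also have "\<dots> \<le> (c - b) * (exp (-\<kappa>) / \<epsilon>)"
    using bc el by (intro mult_right_mono) auto
  also have "\<dots> = (c - b) * exp (-\<kappa>) / \<epsilon>" by simp
  finally have g: "g 0 \<le> (c - b) * exp (-\<kappa>) / \<epsilon>" .
  have "f 0 \<le> (\<Sum>y\<in>{b+1..0}. (c - b) * (exp D / \<epsilon>))"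
    unfolding f_def
  proof (rule sum_mono)
    fix y assume y: "y \<in> {b+1..0}"
    have "d y \<le> (\<Sum>z\<in>{y..c-1}. exp D / \<epsilon>)"
      unfolding d_def
    proof (rule sum_mono)
      fix z assume z: "z \<in> {y..c-1}"
      have "exp (V y - V z) * (1 / w_minus \<omega> z) \<le> exp D * (1 / \<epsilon>)"
        using draw[of y z] y z elliptic_inverse[OF el, of z] pos[of z]
        by (intro mult_mono) (auto simp: V_def)
      then show "exp (V y - V z) / w_minus \<omega> z \<le> exp D / \<epsilon>" by simp
    qed
    also have "\<dots> = of_int (c - y) * (exp D / \<epsilon>)" using y bc by simp
    also have "\<dots> \<le> (c - b) * (exp D / \<epsilon>)" using y el by (intro mult_right_mono) auto
    finally show "d y \<le> (c - b) * (exp D / \<epsilon>)" by simp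
  qed
  also have "\<dots> = (- b) * ((c - b) * (exp D / \<epsilon>))" using bc by simp
  also have "\<dots> \<le> (c - b) * ((c - b) * (exp D / \<epsilon>))"
    using bc el by (intro mult_right_mono) auto
  finally have f: "f 0 \<le> (c - b)\<^sup>2 * exp D / \<epsilon>" by (simp add: power2_eq_square mult.assoc)
  have "(walk_op \<omega> ^^ n) (indicator A) 0 - \<gamma> - g 0 \<le> (c - b)\<^sup>2 * exp D / \<epsilon> / n"
    using order_trans[OF main f] n by (simp only: pos_le_divide_eq of_nat_0_less_iff mult.commute)
  also have "\<dots> = (c - b)\<^sup>2 * exp D / (\<epsilon> * n)" by simp
  finally show ?thesis using g by linarith
qed

section \<open>The Skorokhod topology and weak convergence\<close>

lemma skorokhod_nbhd_refl: "x \<in> cadlag \<Longrightarrow> 0 < e \<Longrightarrow> x \<in> skorokhod_nbhd x e"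
  unfolding skorokhod_nbhd_def by (auto intro!: exI[of _ "\<lambda>t. t"] simp: strict_mono_def)

text \<open>Time changes compose. A time in the window \<open>1 / (a + b)\<close> moves by at most
  \<open>a\<close> and remains in the window \<open>1 / b\<close>, since
  \<open>1 / b - 1 / (a + b) = a / (b * (a + b))\<close> is at least \<open>a\<close> when
  \<open>a + b \<le> 1\<close>.\<close>

lemma skorokhod_nbhd_trans:
  assumes "y \<in> skorokhod_nbhd x a" "z \<in> skorokhod_nbhd y b" "0 < a" "0 < b" "a + b \<le> 1"
  shows "z \<in> skorokhod_nbhd x (a + b)"
proof -
  obtain l :: "real \<Rightarrow> real" where l: "strict_mono l" "surj l" "\<And>t. \<bar>l t - t\<bar> \<le> a"
    "\<And>t. \<bar>t\<bar> \<le> 1 / a \<Longrightarrow> \<bar>y (l t) - x t\<bar> \<le> a"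
    using assms(1) by (auto simp: skorokhod_nbhd_def)
  obtain m :: "real \<Rightarrow> real" where m: "z \<in> cadlag" "strict_mono m" "surj m" "\<And>t. \<bar>m t - t\<bar> \<le> b"
    "\<And>t. \<bar>t\<bar> \<le> 1 / b \<Longrightarrow> \<bar>z (m t) - y t\<bar> \<le> b"
    using assms(2) by (auto simp: skorokhod_nbhd_def)
  have "\<bar>z ((m \<circ> l) t) - x t\<bar> \<le> a + b" if t: "\<bar>t\<bar> \<le> 1 / (a + b)" for t
  proof -
    have "1 / (a + b) \<le> 1 / a" using assms by (intro divide_left_mono) auto
    with t have 1: "\<bar>y (l t) - x t\<bar> \<le> a" by (intro l) linarith
    have "a \<le> a / (b * (a + b))"
      using assms by (simp add: pos_le_divide_eq mult_left_le mult_le_one)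
    also have "\<dots> = 1 / b - 1 / (a + b)" using assms by (simp add: divide_simps)
    finally have "\<bar>l t\<bar> \<le> 1 / b" using t l(3)[of t] by linarith
    from m(5)[OF this] 1 show ?thesis by simp
  qed
  moreover have "\<bar>(m \<circ> l) t - t\<bar> \<le> a + b" for t
    using m(4)[of "l t"] l(3)[of t] by simp
  moreover have "strict_mono (m \<circ> l)" using l(1) m(2) by (simp add: strict_mono_def)
  moreover have "surj (m \<circ> l)" using l(2) m(3) by (rule comp_surj)
  ultimately show ?thesis using m(1) unfolding skorokhod_nbhd_def by blast
qed

text \<open>Time changes invert. Doubling the radius shortens the window enough to absorb the
  displacement \<open>a\<close> of the inverse.\<close>

lemma skorokhod_nbhd_sym:
  assumes "y \<in> skorokhod_nbhd x a" "x \<in> cadlag" "0 < a" "a \<le> 1/2"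
  shows "x \<in> skorokhod_nbhd y (2 * a)"
proof -
  obtain l :: "real \<Rightarrow> real" where l: "strict_mono l" "surj l" "\<And>t. \<bar>l t - t\<bar> \<le> a"
    "\<And>t. \<bar>t\<bar> \<le> 1 / a \<Longrightarrow> \<bar>y (l t) - x t\<bar> \<le> a"
    using assms(1) by (auto simp: skorokhod_nbhd_def)
  define m where "m = inv l"
  have inj: "inj l" using l(1) by (rule strict_mono_imp_inj_on)
  have lm: "l (m s) = s" for s using l(2) by (simp add: m_def surj_f_inv_f)
  have "strict_mono m"
    unfolding strict_mono_def using l(1) lm by (metis strict_mono_less)
  moreover have "surj m" using inj by (simp add: m_def inj_imp_surj_inv)
  moreover have ms: "\<bar>m s - s\<bar> \<le> a" for s using l(3)[of "m s"] lm[of s] by simp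
  moreover have "\<bar>x (m s) - y s\<bar> \<le> a" if "\<bar>s\<bar> \<le> 1 / (2 * a)" for s
  proof -
    have "a * a \<le> (1/2) * (1/2)" using assms by (intro mult_mono) auto
    then have "a \<le> 1 / (2 * a)" using assms by (simp add: pos_le_divide_eq)
    moreover have "1 / (2 * a) + 1 / (2 * a) = 1 / a" using assms by (simp add: field_simps)
    ultimately have "\<bar>m s\<bar> \<le> 1 / a" using that ms[of s] by linarith
    from l(4)[OF this] lm show ?thesis by (simp add: abs_minus_commute)
  qed
  ultimately show ?thesis
    using assms unfolding skorokhod_nbhd_def
    by (auto intro!: exI[of _ m]) (metis add_increasing2 ms mult_2 order_less_imp_le order_trans dual_order.trans)+
qed

text \<open>The neighbourhoods do not come from an explicit metric. Since time changes can be composed and inverted,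
  this function is nevertheless a continuous substitute for the distance to \<open>S\<close>.\<close>

definition skorokhod_gap :: "(real \<Rightarrow> real) set \<Rightarrow> (real \<Rightarrow> real) \<Rightarrow> real" where
  "skorokhod_gap S y = Inf (insert (1/4) {e. 0 < e \<and> e \<le> 1/4 \<and> skorokhod_nbhd y e \<inter> S \<noteq> {}})"

lemma skorokhod_gap_bdd: "bdd_below (insert (1/4) {e. 0 < e \<and> e \<le> 1/4 \<and> skorokhod_nbhd y e \<inter> S \<noteq> {}})"
  by (rule bdd_belowI[of _ 0]) auto

lemma skorokhod_gap_nonneg: "0 \<le> skorokhod_gap S y"
  unfolding skorokhod_gap_def by (rule cInf_greatest) auto

lemma skorokhod_gap_le: "skorokhod_gap S y \<le> 1/4"
  unfolding skorokhod_gap_def by (rule cInf_lower[OF _ skorokhod_gap_bdd]) simp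

lemma skorokhod_gap_le_meet:
  assumes "0 < e" "skorokhod_nbhd y e \<inter> S \<noteq> {}" shows "skorokhod_gap S y \<le> e"
proof (cases "e \<le> 1/4")
  case True
  with assms show ?thesis unfolding skorokhod_gap_def by (intro cInf_lower skorokhod_gap_bdd) auto
qed (use skorokhod_gap_le[of S y] in linarith)

lemma skorokhod_gap_ge:
  assumes "0 < e" "e \<le> 1/4" "skorokhod_nbhd y e \<inter> S = {}" shows "e \<le> skorokhod_gap S y"
  unfolding skorokhod_gap_def
proof (rule cInf_greatest)
  fix d assume "d \<in> insert (1/4) {e. 0 < e \<and> e \<le> 1/4 \<and> skorokhod_nbhd y e \<inter> S \<noteq> {}}"
  with assms skorokhod_nbhd_mono[of d e y] show "e \<le> d" by (cases "d < e") auto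
qed simp

lemma skorokhod_gap_pos_iff: "0 < skorokhod_gap S y \<longleftrightarrow> (\<exists>e>0. skorokhod_nbhd y e \<inter> S = {})"
proof
  assume "0 < skorokhod_gap S y"
  then show "\<exists>e>0. skorokhod_nbhd y e \<inter> S = {}"
    using skorokhod_gap_le_meet[of "skorokhod_gap S y / 2" y S] by (intro exI[of _ "skorokhod_gap S y / 2"]) auto
next
  assume "\<exists>e>0. skorokhod_nbhd y e \<inter> S = {}"
  then obtain e where "e > 0" "skorokhod_nbhd y e \<inter> S = {}" by blast
  then have "min e (1/4) \<le> skorokhod_gap S y"
    using skorokhod_nbhd_mono[of "min e (1/4)" e y] by (intro skorokhod_gap_ge) auto
  with \<open>e > 0\<close> show "0 < skorokhod_gap S y" by linarith
qed

lemma skorokhod_gap_eq_0: "y \<in> cadlag \<Longrightarrow> y \<in> S \<Longrightarrow> skorokhod_gap S y = 0"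
  using skorokhod_gap_pos_iff[of S y] skorokhod_gap_nonneg[of S y] skorokhod_nbhd_refl[of y]
  by (metis IntI empty_iff order_le_imp_less_or_eq)

text \<open>Composition needs radii with sum at most 1. The cap \<open>1/4\<close> in the gap
  guarantees this for small \<open>a\<close>, and makes the inequality trivial for large
  \<open>a\<close>.\<close>

lemma skorokhod_gap_triangle:
  assumes "z \<in> skorokhod_nbhd y a" "0 < a" shows "skorokhod_gap S y \<le> skorokhod_gap S z + a"
proof (cases "a \<le> 1/4")
  case True
  have "skorokhod_gap S y - a \<le> skorokhod_gap S z"
    unfolding skorokhod_gap_def[of S z]
  proof (rule cInf_greatest)
    fix e assume "e \<in> insert (1/4) {e. 0 < e \<and> e \<le> 1/4 \<and> skorokhod_nbhd z e \<inter> S \<noteq> {}}"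
    then consider "e = 1/4" | "0 < e" "e \<le> 1/4" "skorokhod_nbhd z e \<inter> S \<noteq> {}" by blast
    then show "skorokhod_gap S y - a \<le> e"
    proof cases
      case 1 then show ?thesis using skorokhod_gap_le[of S y] assms by linarith
    next
      case 2
      then have "skorokhod_nbhd y (a + e) \<inter> S \<noteq> {}"
        using skorokhod_nbhd_trans[OF assms(1) _ assms(2)] True by fastforce
      from skorokhod_gap_le_meet[OF _ this] assms 2 show ?thesis by simp
    qed
  qed simp
  then show ?thesis by simp
qed (use skorokhod_gap_le[of S y] skorokhod_gap_nonneg[of S z] in linarith)

lemma continuous_map_skorokhodI:
  assumes "\<And>x e. x \<in> cadlag \<Longrightarrow> 0 < e \<Longrightarrow> \<exists>a>0. \<forall>y\<in>skorokhod_nbhd x a. \<bar>F y - F x\<bar> < (e::real)"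
  shows "continuous_map skorokhod euclideanreal F"
  unfolding continuous_map_def topspace_skorokhod
proof (intro conjI allI impI)
  fix U :: "real set" assume "openin euclideanreal U"
  then have U: "open U" by simp
  show "openin skorokhod {x \<in> cadlag. F x \<in> U}"
    unfolding openin_skorokhod
  proof (intro conjI ballI)
    fix x assume x: "x \<in> {x \<in> cadlag. F x \<in> U}"
    with U obtain e where e: "e > 0" "ball (F x) e \<subseteq> U"
      by (auto elim: openE)
    from assms[of x, OF _ e(1)] x obtain a where "a > 0" "\<forall>y\<in>skorokhod_nbhd x a. \<bar>F y - F x\<bar> < e" by blast
    moreover have "y \<in> {x \<in> cadlag. F x \<in> U}" if "y \<in> skorokhod_nbhd x a" "\<bar>F y - F x\<bar> < e" for y
    proof -
      have "F y \<in> ball (F x) e" using that(2) by (simp add: dist_real_def abs_minus_commute)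
      with e(2) that(1) show ?thesis unfolding skorokhod_nbhd_def by blast
    qed
    ultimately show "\<exists>a>0. skorokhod_nbhd x a \<subseteq> {x \<in> cadlag. F x \<in> U}" by blast
  qed auto
qed auto

lemma continuous_map_skorokhodD:
  assumes "continuous_map skorokhod euclideanreal F" "x \<in> cadlag" "0 < e"
  shows "\<exists>a>0. \<forall>y\<in>skorokhod_nbhd x a. \<bar>F y - F x\<bar> < e"
proof -
  have "openin skorokhod {y \<in> topspace skorokhod. F y \<in> ball (F x) e}"
    by (rule openin_continuous_map_preimage[OF assms(1)]) simp
  moreover have "x \<in> {y \<in> topspace skorokhod. F y \<in> ball (F x) e}"
    using assms by (simp add: topspace_skorokhod)
  ultimately obtain a where "a > 0" "skorokhod_nbhd x a \<subseteq> {y \<in> topspace skorokhod. F y \<in> ball (F x) e}"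
    unfolding openin_skorokhod by blast
  then show ?thesis by (intro exI[of _ a]) (auto simp: dist_real_def abs_minus_commute)
qed

text \<open>The triangle inequality is applied in both directions; the neighbourhoods are not
  symmetric, so the reversed direction costs a factor 2 in the radius.\<close>

lemma continuous_map_skorokhod_gap: "continuous_map skorokhod euclideanreal (skorokhod_gap S)"
proof (rule continuous_map_skorokhodI)
  fix x and e :: real assume x: "x \<in> cadlag" "0 < e"
  let ?a = "min (1/4) (e/4)"
  have "\<bar>skorokhod_gap S y - skorokhod_gap S x\<bar> < e" if y: "y \<in> skorokhod_nbhd x ?a" for y
  proof -
    have a: "0 < ?a" "?a \<le> 1/2" "2 * ?a < e" using x(2) by auto
    with skorokhod_gap_triangle[OF y, of S] skorokhod_gap_triangle[OF skorokhod_nbhd_sym[OF y x(1)], of S]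
    show ?thesis by linarith
  qed
  with x(2) show "\<exists>a>0. \<forall>y\<in>skorokhod_nbhd x a. \<bar>skorokhod_gap S y - skorokhod_gap S x\<bar> < e"
    by (intro exI[of _ ?a]) auto
qed

section \<open>Measurability of continuous functionals\<close>

lemma cadlag_floor:
  assumes "0 < r" shows "(\<lambda>t. f \<lfloor>r * t\<rfloor>) \<in> cadlag"
  unfolding cadlag_def
proof (intro CollectI allI conjI)
  fix t :: real
  have "eventually (\<lambda>s. f \<lfloor>r * s\<rfloor> = f \<lfloor>r * t\<rfloor>) (at_right t)"
    unfolding eventually_at_right_field
  proof (intro exI[of _ "(of_int \<lfloor>r * t\<rfloor> + 1) / r"] conjI allI impI)
    show "t < (of_int \<lfloor>r * t\<rfloor> + 1) / r" using assms by (simp add: pos_less_divide_eq mult.commute)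
    fix s assume s: "t < s" "s < (of_int \<lfloor>r * t\<rfloor> + 1) / r"
    then have "r * t < r * s" "r * s < of_int \<lfloor>r * t\<rfloor> + 1" using assms by (auto simp: pos_less_divide_eq mult.commute)
    then have "\<lfloor>r * s\<rfloor> = \<lfloor>r * t\<rfloor>" by linarith
    then show "f \<lfloor>r * s\<rfloor> = f \<lfloor>r * t\<rfloor>" by simp
  qed
  then show "continuous (at_right t) (\<lambda>t. f \<lfloor>r * t\<rfloor>)"
    unfolding continuous_within by (rule tendsto_eventually)
  have "eventually (\<lambda>s. f \<lfloor>r * s\<rfloor> = f (\<lceil>r * t\<rceil> - 1)) (at_left t)"
    unfolding eventually_at_left_field
  proof (intro exI[of _ "(of_int \<lceil>r * t\<rceil> - 1) / r"] conjI allI impI)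
    show "(of_int \<lceil>r * t\<rceil> - 1) / r < t" using assms ceiling_correct[of "r * t"] by (simp add: pos_divide_less_eq mult.commute)
    fix s assume s: "s < t" "(of_int \<lceil>r * t\<rceil> - 1) / r < s"
    then have "r * s < r * t" "of_int \<lceil>r * t\<rceil> - 1 < r * s" using assms by (auto simp: pos_divide_less_eq mult.commute)
    then have "\<lfloor>r * s\<rfloor> = \<lceil>r * t\<rceil> - 1" by linarith
    then show "f \<lfloor>r * s\<rfloor> = f (\<lceil>r * t\<rceil> - 1)" by simp
  qed
  then show "\<exists>l. ((\<lambda>t. f \<lfloor>r * t\<rfloor>) \<longlongrightarrow> l) (at_left t)"
    by (intro exI) (rule tendsto_eventually)
qed

lemma cadlag_scaled_potential: "0 < k \<Longrightarrow> scaled_potential \<sigma> k \<omega> \<in> cadlag"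
  unfolding scaled_potential_def[abs_def] by (rule cadlag_floor) simp

lemma cadlag_continuous: "continuous_on UNIV f \<Longrightarrow> f \<in> cadlag"
  unfolding cadlag_def
  by (auto simp: continuous_on_eq_continuous_within continuous_within
      intro: tendsto_within_subset[where S=UNIV] exI[of _ "f _"])

text \<open>Step functions with finitely many values: a continuous functional of the potential is a pointwise
  limit of continuous functions of finitely many coordinates, hence measurable.\<close>

definition grid_fun :: "real \<Rightarrow> int \<Rightarrow> (int \<Rightarrow> real) \<Rightarrow> real \<Rightarrow> real" where
  "grid_fun r N v t = v (max (- N) (min N \<lfloor>r * t\<rfloor>))"

lemma cadlag_grid_fun: "0 < r \<Longrightarrow> grid_fun r N v \<in> cadlag"
  unfolding grid_fun_def[abs_def] by (rule cadlag_floor)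

text \<open>Step functions with close values at the finitely many sites are uniformly close with the
  identity as time change, so composition with \<open>F\<close> is continuous for the product
  topology.\<close>

lemma continuous_grid_fun:
  assumes F: "continuous_map skorokhod euclideanreal F" and r: "0 < r" and N: "0 \<le> N"
  shows "continuous_on UNIV (\<lambda>v. F (grid_fun r N v))"
  unfolding continuous_on_open_vimage[OF open_UNIV]
proof (intro allI impI)
  fix U :: "real set" assume U: "open U"
  show "open ((\<lambda>v. F (grid_fun r N v)) -` U \<inter> UNIV)"
  proof (subst open_subopen, intro ballI)
    fix v assume "v \<in> (\<lambda>v. F (grid_fun r N v)) -` U \<inter> UNIV"
    with U obtain e where e: "e > 0" "ball (F (grid_fun r N v)) e \<subseteq> U"
      by (auto elim: openE)
    obtain a where a: "a > 0" "\<And>y. y \<in> skorokhod_nbhd (grid_fun r N v) a \<Longrightarrow> \<bar>F y - F (grid_fun r N v)\<bar> < e"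
      using continuous_map_skorokhodD[OF F cadlag_grid_fun[OF r] e(1)] by blast
    let ?T = "\<Inter>i\<in>{-N..N}. {u :: int \<Rightarrow> real. dist (u i) (v i) < a}"
    have "open ?T"
      by (intro open_INT ballI open_Collect_less continuous_on_dist continuous_on_product_coordinates continuous_on_const) auto
    moreover have "v \<in> ?T" using a by simp
    moreover have "?T \<subseteq> (\<lambda>v. F (grid_fun r N v)) -` U \<inter> UNIV"
    proof
      fix u assume u: "u \<in> ?T"
      have "\<bar>grid_fun r N u t - grid_fun r N v t\<bar> \<le> a" for t
      proof -
        let ?i = "max (- N) (min N \<lfloor>r * t\<rfloor>)"
        have "?i \<in> {-N..N}" using N by auto
        with u have "dist (u ?i) (v ?i) < a" by blast
        then show ?thesis by (simp add: grid_fun_def dist_real_def)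
      qed
      then have "grid_fun r N u \<in> skorokhod_nbhd (grid_fun r N v) a"
        unfolding skorokhod_nbhd_def using a
        by (auto intro!: exI[of _ "\<lambda>t. t"] simp: strict_mono_def cadlag_grid_fun[OF r])
      from a(2)[OF this] have "F (grid_fun r N u) \<in> ball (F (grid_fun r N v)) e"
        by (simp add: dist_real_def abs_minus_commute)
      with e(2) show "u \<in> (\<lambda>v. F (grid_fun r N v)) -` U \<inter> UNIV" by auto
    qed
    ultimately show "\<exists>T. open T \<and> v \<in> T \<and> T \<subseteq> (\<lambda>v. F (grid_fun r N v)) -` U \<inter> UNIV" by blast
  qed
qed

lemma measurable_grid_fun:
  assumes "continuous_map skorokhod euclideanreal F" "0 < r" "0 \<le> N"
    and "\<And>i :: int. (\<lambda>\<omega>. Z i \<omega>) \<in> borel_measurable M"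
  shows "(\<lambda>\<omega>. F (grid_fun r N (\<lambda>i. Z i \<omega>))) \<in> borel_measurable M"
proof -
  have "(\<lambda>\<omega> i. Z i \<omega>) \<in> measurable M borel"
    by (rule measurable_coordinatewise_then_product) (rule assms(4))
  from measurable_compose[OF this borel_measurable_continuous_onI[OF continuous_grid_fun[OF assms(1-3)]]]
  show ?thesis .
qed

lemma skorokhod_limit:
  assumes "continuous_map skorokhod euclideanreal F" "x \<in> cadlag"
    and "\<And>e. 0 < e \<Longrightarrow> eventually (\<lambda>n. y n \<in> skorokhod_nbhd x e) sequentially"
  shows "(\<lambda>n. F (y n)) \<longlonglongrightarrow> F x"
proof (rule tendstoI)
  fix e :: real assume "0 < e"
  from continuous_map_skorokhodD[OF assms(1,2) this]
  obtain a where a: "a > 0" "\<And>y. y \<in> skorokhod_nbhd x a \<Longrightarrow> \<bar>F y - F x\<bar> < e" by blast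
  from assms(3)[OF a(1)] show "\<forall>\<^sub>F n in sequentially. dist (F (y n)) (F x) < e"
    by eventually_elim (auto simp: dist_real_def a)
qed

lemma skorokhod_nbhd_uniformI:
  assumes "y \<in> cadlag" "0 < e" "\<And>t. \<bar>t\<bar> \<le> 1 / e \<Longrightarrow> \<bar>y t - x t\<bar> \<le> e"
  shows "y \<in> skorokhod_nbhd x e"
  unfolding skorokhod_nbhd_def using assms by (auto intro!: exI[of _ "\<lambda>t. t"] simp: strict_mono_def)

lemma measurable_skorokhod_floor:
  assumes F: "continuous_map skorokhod euclideanreal F" and r: "0 < r"
    and Z: "\<And>i :: int. (\<lambda>\<omega>. Z i \<omega>) \<in> borel_measurable M"
  shows "(\<lambda>\<omega>. F (\<lambda>t. Z \<lfloor>r * t\<rfloor> \<omega>)) \<in> borel_measurable M"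
proof (rule borel_measurable_LIMSEQ_real)
  show "(\<lambda>\<omega>. F (grid_fun r (int n) (\<lambda>i. Z i \<omega>))) \<in> borel_measurable M" for n
    by (rule measurable_grid_fun[OF F r _ Z]) simp
  fix \<omega>
  show "(\<lambda>n. F (grid_fun r (int n) (\<lambda>i. Z i \<omega>))) \<longlonglongrightarrow> F (\<lambda>t. Z \<lfloor>r * t\<rfloor> \<omega>)"
  proof (rule skorokhod_limit[OF F cadlag_floor[OF r]])
    fix e :: real assume e: "0 < e"
    show "\<forall>\<^sub>F n in sequentially. grid_fun r (int n) (\<lambda>i. Z i \<omega>) \<in> skorokhod_nbhd (\<lambda>t. Z \<lfloor>r * t\<rfloor> \<omega>) e"
      using eventually_ge_at_top[of "nat \<lceil>r * (1 / e) + 1\<rceil>"]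
    proof eventually_elim
      case (elim n)
      show ?case
      proof (rule skorokhod_nbhd_uniformI[OF cadlag_grid_fun[OF r] e])
        fix t assume t: "\<bar>t\<bar> \<le> 1 / e"
        have "\<bar>r * t\<bar> \<le> r * (1 / e)" using t r by (simp add: abs_mult mult_left_mono del: times_divide_eq_right)
        with elim have "- int n \<le> \<lfloor>r * t\<rfloor>" "\<lfloor>r * t\<rfloor> \<le> int n" by linarith+
        with e show "\<bar>grid_fun r (int n) (\<lambda>i. Z i \<omega>) t - Z \<lfloor>r * t\<rfloor> \<omega>\<bar> \<le> e" by (simp add: grid_fun_def)
      qed
    qed
  qed
qed

lemma measurable_skorokhod_continuous:
  assumes F: "continuous_map skorokhod euclideanreal F"
    and B: "\<And>t. B t \<in> borel_measurable M" and c: "\<And>x. x \<in> space M \<Longrightarrow> continuous_on UNIV (\<lambda>t. B t x)"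
  shows "(\<lambda>x. F (\<lambda>t. B t x)) \<in> borel_measurable M"
proof (rule borel_measurable_LIMSEQ_real)
  \<comment> \<open>Mesh \<open>1 / (n + 1)\<close> with indices up to \<open>(n + 1)^2\<close>
    covers the times up to \<open>n + 1\<close>, so mesh and window improve together.\<close>
  define g where "g n x = grid_fun (real (Suc n)) ((int (Suc n))\<^sup>2) (\<lambda>i. B (of_int i / real (Suc n)) x)" for n x
  show "(\<lambda>x. F (g n x)) \<in> borel_measurable M" for n
    unfolding g_def by (rule measurable_grid_fun[OF F _ _ B]) simp_all
  fix x assume x: "x \<in> space M"
  show "(\<lambda>n. F (g n x)) \<longlonglongrightarrow> F (\<lambda>t. B t x)"
  proof (rule skorokhod_limit[OF F cadlag_continuous[OF c[OF x]]])
    fix e :: real assume e: "0 < e"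
    have "uniformly_continuous_on {- (1 / e) - 1..1 / e + 1} (\<lambda>t. B t x)"
      by (intro compact_uniformly_continuous continuous_on_subset[OF c[OF x]]) auto
    then obtain d where d: "d > 0" "\<And>s t. s \<in> {- (1 / e) - 1..1 / e + 1} \<Longrightarrow> t \<in> {- (1 / e) - 1..1 / e + 1} \<Longrightarrow>
        dist s t < d \<Longrightarrow> dist (B s x) (B t x) < e"
      using e unfolding uniformly_continuous_on_def by metis
    have "\<forall>\<^sub>F n in sequentially. 1 / e + 1 \<le> real (Suc n)" "\<forall>\<^sub>F n in sequentially. 1 / d < real (Suc n)"
      by real_asymp+
    then show "\<forall>\<^sub>F n in sequentially. g n x \<in> skorokhod_nbhd (\<lambda>t. B t x) e"
    proof eventually_elim
      case (elim n)
      let ?r = "real (Suc n)"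
      show ?case
      proof (rule skorokhod_nbhd_uniformI[OF _ e])
        show "g n x \<in> cadlag" unfolding g_def by (rule cadlag_grid_fun) simp
        fix t assume t: "\<bar>t\<bar> \<le> 1 / e"
        let ?i = "\<lfloor>?r * t\<rfloor>"
        have "\<bar>?r * t\<bar> = ?r * \<bar>t\<bar>" by (simp add: abs_mult)
        also have "\<dots> \<le> ?r * (?r - 1)" using elim t by (intro mult_left_mono) auto
        finally have "\<bar>?r * t\<bar> \<le> ?r\<^sup>2 - 1" using elim e by (simp add: power2_eq_square algebra_simps)
        then have "real_of_int (- ((int (Suc n))\<^sup>2)) \<le> ?r * t - 1" "?r * t \<le> real_of_int ((int (Suc n))\<^sup>2)"
          by (auto simp: abs_le_iff)
        then have i: "- ((int (Suc n))\<^sup>2) \<le> ?i" "?i \<le> (int (Suc n))\<^sup>2" by linarith+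
        have "of_int ?i \<le> ?r * t" "?r * t < of_int ?i + 1" by linarith+
        then have s: "of_int ?i / ?r \<le> t" "t < of_int ?i / ?r + 1 / ?r"
          by (auto simp: divide_le_eq mult.commute less_divide_eq simp flip: add_divide_distrib simp del: of_nat_Suc)
        have "1 / ?r \<le> 1" "1 / ?r < d" using elim d e by (auto simp: field_simps)
        then have "dist (B (of_int ?i / ?r) x) (B t x) < e"
        proof (intro d)
          show "t \<in> {- (1 / e) - 1..1 / e + 1}" using t unfolding atLeastAtMost_iff by linarith
          show "of_int ?i / ?r \<in> {- (1 / e) - 1..1 / e + 1}"
            using s t \<open>1 / ?r \<le> 1\<close> unfolding atLeastAtMost_iff by linarith
          show "dist (of_int ?i / ?r) t < d" using s \<open>1 / ?r < d\<close> unfolding dist_real_def by linarith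
        qed
        then show "\<bar>g n x t - B t x\<bar> \<le> e" using i by (simp add: g_def grid_fun_def dist_real_def)
      qed
    qed
  qed
qed

lemma potential_measurable:
  assumes "env_law P"
  shows "(\<lambda>\<omega>. potential \<omega> m) \<in> borel_measurable P"
proof -
  note [measurable] = w_plus_measurable[OF assms] w_minus_measurable[OF assms]
  show ?thesis unfolding potential_def log_rho_def by simp
qed

lemma scaled_potential_functional_measurable:
  assumes "env_law P" "continuous_map skorokhod euclideanreal F" "0 < k"
  shows "(\<lambda>\<omega>. F (scaled_potential \<sigma> k \<omega>)) \<in> borel_measurable P"
  unfolding scaled_potential_def[abs_def]
  using assms potential_measurable[OF assms(1)] 
  by (intro measurable_skorokhod_floor[OF assms(2), of "real k" "\<lambda>i \<omega>. potential \<omega> i / (sqrt (real k) * \<sigma>)"]) auto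

lemma
  assumes "two_sided_brownian W B"
  shows brownian_prob_space: "prob_space W"
    and brownian_measurable: "B t \<in> borel_measurable W"
    and brownian_0: "x \<in> space W \<Longrightarrow> B 0 x = 0"
    and brownian_continuous: "x \<in> space W \<Longrightarrow> continuous_on UNIV (\<lambda>t. B t x)"
  using assms by (simp_all add: two_sided_brownian_def)

lemma skorokhod_gap_brownian_measurable:
  assumes "two_sided_brownian W B"
  shows "(\<lambda>x. skorokhod_gap S (\<lambda>t. B t x)) \<in> borel_measurable W"
  by (rule measurable_skorokhod_continuous[OF continuous_map_skorokhod_gap brownian_measurable[OF assms]
      brownian_continuous[OF assms]])

text \<open>The open-set half of the portmanteau theorem in functional form:
  \<open>min 1 (j * gap)\<close> increases to the indicator of a positive gap, so some
  \<open>j\<close> already has mean above \<open>c\<close>. Returning a function instead of an event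
  avoids measurability of \<open>S\<close> under \<open>P\<close>.\<close>

lemma portmanteau:
  assumes P: "env_law P" and B: "two_sided_brownian W B"
    and conv: "converges_weakly skorokhod P (scaled_potential \<sigma>) W (\<lambda>x t. B t x)"
    and c: "c < measure W {x \<in> space W. 0 < skorokhod_gap S (\<lambda>t. B t x)}"
  obtains F where "\<And>y. 0 \<le> F y" "\<And>y. F y \<le> 1" "\<And>y. y \<in> cadlag \<Longrightarrow> y \<in> S \<Longrightarrow> F y = 0"
    "\<And>k. 0 < k \<Longrightarrow> (\<lambda>\<omega>. F (scaled_potential \<sigma> k \<omega>)) \<in> borel_measurable P"
    "eventually (\<lambda>k. c < (\<integral>\<omega>. F (scaled_potential \<sigma> k \<omega>) \<partial>P)) sequentially"
proof -
  interpret W: prob_space W by (rule brownian_prob_space[OF B])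
  define G where "G j y = min 1 (real j * skorokhod_gap S y)" for j y
  have [measurable]: "(\<lambda>x. skorokhod_gap S (\<lambda>t. B t x)) \<in> borel_measurable W"
    by (rule skorokhod_gap_brownian_measurable[OF B])
  have G01: "0 \<le> G j y" "G j y \<le> 1" for j y
    by (auto simp: G_def skorokhod_gap_nonneg)
  have Gc: "continuous_map skorokhod euclideanreal (G j)" for j
    unfolding G_def by (intro continuous_map_real_min continuous_map_real_mult_left continuous_map_skorokhod_gap) auto
  have "(\<lambda>j. \<integral>x. G j (\<lambda>t. B t x) \<partial>W) \<longlonglongrightarrow> (\<integral>x. indicator {x \<in> space W. 0 < skorokhod_gap S (\<lambda>t. B t x)} x \<partial>W)"
  proof (rule integral_dominated_convergence[where w="\<lambda>_. 1"])
    show "AE x in W. (\<lambda>j. G j (\<lambda>t. B t x)) \<longlonglongrightarrow> indicator {x \<in> space W. 0 < skorokhod_gap S (\<lambda>t. B t x)} x"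
    proof (rule AE_I2)
      fix x assume x: "x \<in> space W"
      define g where "g = skorokhod_gap S (\<lambda>t. B t x)"
      show "(\<lambda>j. G j (\<lambda>t. B t x)) \<longlonglongrightarrow> indicator {x \<in> space W. 0 < skorokhod_gap S (\<lambda>t. B t x)} x"
      proof (cases "0 < g")
        case True
        then have "eventually (\<lambda>j. 1 \<le> real j * g) sequentially" by real_asymp
        then have "eventually (\<lambda>j. G j (\<lambda>t. B t x) = 1) sequentially"
          by eventually_elim (simp add: G_def g_def)
        with True x show ?thesis by (simp add: g_def tendsto_eventually)
      next
        case False
        then have "g = 0" using skorokhod_gap_nonneg[of S "\<lambda>t. B t x"] by (simp add: g_def)
        then show ?thesis by (simp add: G_def g_def)
      qed
    qed
    show "(\<lambda>x. G j (\<lambda>t. B t x)) \<in> borel_measurable W" for j unfolding G_def by measurable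
    show "AE x in W. norm (G j (\<lambda>t. B t x)) \<le> 1" for j using G01 by auto
  qed auto
  then have "(\<lambda>j. \<integral>x. G j (\<lambda>t. B t x) \<partial>W) \<longlonglongrightarrow> measure W {x \<in> space W. 0 < skorokhod_gap S (\<lambda>t. B t x)}"
    by (simp add: Int_absorb2 Collect_restrict)
  from order_tendstoD(1)[OF this c] obtain j where j: "c < (\<integral>x. G j (\<lambda>t. B t x) \<partial>W)"
    unfolding eventually_sequentially by blast
  have "bounded (G j ` topspace skorokhod)"
    unfolding bounded_iff using G01 by (intro exI[of _ 1]) auto
  with conv Gc have "(\<lambda>k. \<integral>\<omega>. G j (scaled_potential \<sigma> k \<omega>) \<partial>P) \<longlonglongrightarrow> (\<integral>x. G j (\<lambda>t. B t x) \<partial>W)"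
    unfolding converges_weakly_def by blast
  from order_tendstoD(1)[OF this j] show ?thesis
    using G01 skorokhod_gap_eq_0[of _ S] scaled_potential_functional_measurable[OF P Gc]
    by (intro that[of "G j"]) (auto simp: G_def)
qed

section \<open>Brownian motion\<close>

text \<open>For time reversal, which lists the increments of a partition in the opposite
  order.\<close>

lemma (in prob_space) indep_vars_reindex:
  assumes X: "indep_vars M' X (g ` I)" and g: "inj_on g I"
  shows "indep_vars (\<lambda>i. M' (g i)) (\<lambda>i. X (g i)) I"
  unfolding indep_vars_def
proof (intro conjI ballI indep_setsI)
  let ?F = "\<lambda>i. sigma_sets (space M) {X i -` A \<inter> space M |A. A \<in> sets (M' i)}"
  have ind: "indep_sets ?F (g ` I)" and rv: "\<And>i. i \<in> g ` I \<Longrightarrow> random_variable (M' i) (X i)"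
    using X by (auto simp: indep_vars_def)
  show "random_variable (M' (g i)) (X (g i))" if "i \<in> I" for i using rv that by auto
  show "?F (g i) \<subseteq> events" if "i \<in> I" for i using ind that by (auto simp: indep_sets_def)
  fix A J assume J: "J \<noteq> {}" "J \<subseteq> I" "finite J" "\<forall>j\<in>J. A j \<in> ?F (g j)"
  have gJ: "inj_on g J" using g J(2) by (rule inj_on_subset)
  let ?A = "\<lambda>k. A (inv_into J g k)"
  have inv: "j \<in> J \<Longrightarrow> ?A (g j) = A j" for j using gJ by simp
  have "prob (\<Inter>k\<in>g ` J. ?A k) = (\<Prod>k\<in>g ` J. prob (?A k))"
    using J inv by (intro indep_setsD[OF ind]) auto
  then show "prob (\<Inter>j\<in>J. A j) = (\<Prod>j\<in>J. prob (A j))"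
    using gJ inv by (simp add: prod.reindex cong: INF_cong prod.cong)
qed

locale brownian =
  fixes W :: "'w measure" and B :: "real \<Rightarrow> 'w \<Rightarrow> real"
  assumes brownian: "two_sided_brownian W B"

sublocale brownian \<subseteq> prob_space W
  by (rule brownian_prob_space[OF brownian])

context brownian
begin

lemmas B_measurable [measurable] = brownian_measurable[OF brownian]
lemmas B_0 = brownian_0[OF brownian]
lemmas B_continuous = brownian_continuous[OF brownian]

lemma increment_normal:
  "s < t \<Longrightarrow> distributed W lborel (\<lambda>x. B t x - B s x) (\<lambda>y. ennreal (normal_density 0 (sqrt (t - s)) y))"
  using brownian by (simp add: two_sided_brownian_def)

lemma increments_indep:
  "strict_mono (u :: nat \<Rightarrow> real) \<Longrightarrow> indep_vars (\<lambda>_. borel) (\<lambda>i x. B (u (Suc i)) x - B (u i) x) {..<n}"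
  using brownian by (simp add: two_sided_brownian_def)

lemma brownian_reflect: "two_sided_brownian W (\<lambda>t. B (- t))"
  unfolding two_sided_brownian_def
proof (intro conjI allI ballI impI)
  fix s t :: real assume "s < t"
  have "distributed W lborel (\<lambda>x. 0 + (-1) * (B (-s) x - B (-t) x))
      (\<lambda>y. ennreal (normal_density (0 + (-1) * 0) (\<bar>-1\<bar> * sqrt (- s - - t)) y))"
    using \<open>s < t\<close> increment_normal[of "-t" "-s"] by (intro normal_density_affine) simp_all
  then show "distributed W lborel (\<lambda>x. B (-t) x - B (-s) x) (\<lambda>y. ennreal (normal_density 0 (sqrt (t - s)) y))"
    by simp
next
  fix n and u :: "nat \<Rightarrow> real" assume u: "strict_mono u"
  \<comment> \<open>The negated times in increasing order. Beyond index \<open>n\<close> they are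
    continued arbitrarily, since independence of increments is given for sequences that increase on
    all of \<open>nat\<close>.\<close>
  define v where "v j = (if j \<le> n then - u (n - j) else - u 0 + real (j - n))" for j
  have v: "strict_mono v"
  proof (rule strict_mono_Suc_iff[THEN iffD2], rule allI)
    fix j show "v j < v (Suc j)"
      using strict_monoD[OF u, of "n - Suc j" "n - j"] by (auto simp: v_def Suc_diff_le)
  qed
  have "indep_vars (\<lambda>_. borel) (\<lambda>i x. B (v (Suc (n - Suc i))) x - B (v (n - Suc i)) x) {..<n}"
  proof (rule indep_vars_reindex[where g="\<lambda>i. n - Suc i"])
    show inj: "inj_on (\<lambda>i. n - Suc i) {..<n}" by (auto simp: inj_on_def)
    have "(\<lambda>i. n - Suc i) ` {..<n} = {..<n}"
      using inj by (intro endo_inj_surj) auto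
    then show "indep_vars (\<lambda>_. borel) (\<lambda>i x. B (v (Suc i)) x - B (v i) x) ((\<lambda>i. n - Suc i) ` {..<n})"
      using increments_indep[OF v, of n] by simp
  qed
  then have "indep_vars (\<lambda>_. borel) (\<lambda>i x. B (- u i) x - B (- u (Suc i)) x) {..<n}"
    by (rule indep_vars_cong[THEN iffD1, rotated -1]) (auto simp: v_def Suc_diff_Suc)
  from indep_vars_compose2[OF this, of "\<lambda>_ y. - y" "\<lambda>_. borel"]
  show "indep_vars (\<lambda>_. borel) (\<lambda>i x. B (- u (Suc i)) x - B (- u i) x) {..<n}" by simp
next
  fix x assume "x \<in> space W"
  then show "continuous_on UNIV (\<lambda>t. B (- t) x)"
    by (intro continuous_on_compose2[OF B_continuous]) (auto intro: continuous_intros)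
qed (auto simp: B_0 prob_space_axioms)

lemma brownian_shift: "two_sided_brownian W (\<lambda>t x. B (a + t) x - B a x)"
  unfolding two_sided_brownian_def
proof (intro conjI allI ballI impI)
  fix s t :: real assume "s < t"
  with increment_normal[of "a + s" "a + t"]
  show "distributed W lborel (\<lambda>x. (B (a + t) x - B a x) - (B (a + s) x - B a x)) (\<lambda>y. ennreal (normal_density 0 (sqrt (t - s)) y))"
    by simp
next
  fix n and u :: "nat \<Rightarrow> real" assume "strict_mono u"
  then have "strict_mono (\<lambda>i. a + u i)" by (simp add: strict_mono_def)
  from increments_indep[OF this]
  show "indep_vars (\<lambda>_. borel) (\<lambda>i x. (B (a + u (Suc i)) x - B a x) - (B (a + u i) x - B a x)) {..<n}"
    by simp
next
  fix x assume "x \<in> space W"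
  then show "continuous_on UNIV (\<lambda>t. B (a + t) x - B a x)"
    by (intro continuous_on_diff continuous_on_compose2[OF B_continuous]) (auto intro: continuous_intros)
qed (auto simp: prob_space_axioms)

lemma
  assumes "s < t"
  shows increment_mean: "expectation (\<lambda>x. B t x - B s x) = 0"
    and increment_square: "expectation (\<lambda>x. (B t x - B s x)\<^sup>2) = t - s"
    and increment_integrable: "integrable W (\<lambda>x. B t x - B s x)"
    and increment_square_integrable: "integrable W (\<lambda>x. (B t x - B s x)\<^sup>2)"
proof -
  note D = increment_normal[OF assms]
  have sd: "0 < sqrt (t - s)" using assms by simp
  show "expectation (\<lambda>x. B t x - B s x) = 0"
    by (rule normal_distributed_expectation[OF sd D])
  with normal_distributed_variance[OF sd D] assms
  show "expectation (\<lambda>x. (B t x - B s x)\<^sup>2) = t - s" by simp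
  show "integrable W (\<lambda>x. B t x - B s x)"
    using integrable_normal_moment_nz_1[OF sd, of 0] distributed_integrable[OF D, of "\<lambda>y. y"] by simp
  show "integrable W (\<lambda>x. (B t x - B s x)\<^sup>2)"
    using integrable_normal_moment[OF sd, of 0 2] distributed_integrable[OF D, of "\<lambda>y. y\<^sup>2"] by simp
qed

lemma increment_small_prob:
  assumes "s < t" "0 \<le> K"
  shows "prob {x \<in> space W. \<bar>B t x - B s x - c\<bar> \<le> K} \<le> 2 * K / sqrt (2 * pi * (t - s))"
proof -
  note D = increment_normal[OF assms(1)]
  let ?A = "{c - K..c + K}"
  have "{x \<in> space W. \<bar>B t x - B s x - c\<bar> \<le> K} = (\<lambda>x. B t x - B s x) -` ?A \<inter> space W" by auto
  then have "emeasure W {x \<in> space W. \<bar>B t x - B s x - c\<bar> \<le> K}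
      = (\<integral>\<^sup>+y. ennreal (normal_density 0 (sqrt (t - s)) y) * indicator ?A y \<partial>lborel)"
    using distributed_emeasure[OF D, of ?A] by simp
  also have "\<dots> \<le> (\<integral>\<^sup>+y. ennreal (1 / sqrt (2 * pi * (t - s))) * indicator ?A y \<partial>lborel)"
  proof (intro nn_integral_mono mult_right_mono ennreal_leI)
    fix y show "normal_density 0 (sqrt (t - s)) y \<le> 1 / sqrt (2 * pi * (t - s))"
      using assms mult_left_le[of "exp (- (y - 0)\<^sup>2 / (2 * (sqrt (t - s))\<^sup>2))" "1 / sqrt (2 * pi * (t - s))"]
      by (simp add: normal_density_def divide_nonneg_pos)
  qed simp
  also have "\<dots> = ennreal (1 / sqrt (2 * pi * (t - s))) * ennreal (2 * K)"
    using assms by (subst nn_integral_cmult_indicator) (auto simp: algebra_simps)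
  also have "\<dots> = ennreal (2 * K / sqrt (2 * pi * (t - s)))"
    using assms by (subst ennreal_mult[symmetric]) auto
  finally show ?thesis
    using assms by (simp add: emeasure_eq_measure)
qed

text \<open>Increments generate it, not values: for \<open>0 < s < t\<close> the value
  \<open>B t\<close> contains the increment over \<open>[0, s]\<close>, so only with increments are
  \<open>incr {..s}\<close> and \<open>incr {s..}\<close> independent. If \<open>0\<close> is in the
  set, its values are included because \<open>B 0\<close> vanishes.\<close>

definition incr :: "real set \<Rightarrow> 'w measure" where
  "incr D = sigma (space W) {(\<lambda>x. B s x - B u x) -` A \<inter> space W | s u A. s \<in> D \<and> u \<in> D \<and> A \<in> sets borel}"

lemma space_incr [simp]: "space (incr D) = space W"
  unfolding incr_def by (rule space_measure_of) auto

lemma sets_incr: "sets (incr D) = sigma_sets (space W)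
    {(\<lambda>x. B s x - B u x) -` A \<inter> space W | s u A. s \<in> D \<and> u \<in> D \<and> A \<in> sets borel}"
  unfolding incr_def by (rule sets_measure_of) auto

lemma sets_incr_subset: "sets (incr D) \<subseteq> events"
  unfolding sets_incr by (rule sets.sigma_sets_subset) auto

lemma sets_incr_mono: "D \<subseteq> D' \<Longrightarrow> sets (incr D) \<subseteq> sets (incr D')"
  unfolding sets_incr by (rule sigma_sets_mono') blast

lemma increment_incr: "s \<in> D \<Longrightarrow> u \<in> D \<Longrightarrow> (\<lambda>x. B s x - B u x) \<in> borel_measurable (incr D)"
  by (rule measurableI) (auto simp: sets_incr intro!: sigma_sets.Basic)

lemma B_incr: "0 \<in> D \<Longrightarrow> s \<in> D \<Longrightarrow> B s \<in> borel_measurable (incr D)"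
  by (rule measurable_cong[THEN iffD1, OF _ increment_incr[of s D 0]]) (auto simp: B_0)

lemma measurable_incr_events: "f \<in> borel_measurable (incr D) \<Longrightarrow> f \<in> borel_measurable W"
  using sets_incr_subset measurable_sets[of f "incr D" borel] by (intro measurableI) auto

text \<open>Independence is available only along one increasing sequence of times. Both finite sets
  are merged into such a sequence, which is cut at the index of \<open>Max F\<close> and continued
  by unit steps beyond the last time.\<close>

lemma increments_block_indep:
  assumes "finite F" "finite F'" "F \<noteq> {}" "\<And>s t. s \<in> F \<Longrightarrow> t \<in> F' \<Longrightarrow> s \<le> t"
  obtains n m and u :: "nat \<Rightarrow> real" where "strict_mono u" "m \<le> n" "F \<subseteq> u ` {..m}" "F' \<subseteq> u ` {m..n}"
proof -
  let ?G = "F \<union> F'"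
  define L where "L = sorted_list_of_set ?G"
  define l where "l = length L"
  have fin: "finite ?G" using assms by simp
  have L: "set L = ?G" "sorted_wrt (<) L" using fin by (auto simp: L_def)
  have l0: "0 < l" using assms(3) L by (auto simp: l_def)
  define u where "u i = (if i < l then L ! i else L ! (l - 1) + real (i + 1 - l))" for i
  have u: "strict_mono u"
  proof (rule strict_mono_Suc_iff[THEN iffD2], rule allI)
    fix i
    consider "Suc i < l" | "Suc i = l" | "l \<le> i" by linarith
    then show "u i < u (Suc i)"
    proof cases
      case 1
      then show ?thesis using sorted_wrt_nth_less[OF L(2), of i "Suc i"] by (simp add: u_def l_def)
    next
      case 2
      then show ?thesis by (auto simp: u_def)
    next
      case 3
      then show ?thesis by (simp add: u_def)
    qed
  qed
  have ex: "\<exists>i<l. u i = s" if "s \<in> ?G" for s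
    using that L(1) unfolding l_def u_def by (metis in_set_conv_nth)
  obtain m where m: "m < l" "u m = Max F" using ex[of "Max F"] assms(1,3) by auto
  show ?thesis
  proof (rule that[OF u])
    show "m \<le> l - 1" using m by simp
    show "F \<subseteq> u ` {..m}"
    proof
      fix s assume s: "s \<in> F"
      then obtain i where "i < l" "u i = s" using ex by blast
      moreover have "s \<le> Max F" using s assms(1) by simp
      ultimately show "s \<in> u ` {..m}" using m strict_mono_less_eq[OF u, of i m] by auto
    qed
    show "F' \<subseteq> u ` {m..l - 1}"
    proof
      fix s assume s: "s \<in> F'"
      then obtain i where i: "i < l" "u i = s" using ex by blast
      moreover have "Max F \<le> s" using s assms(1,3,4) by simp
      ultimately show "s \<in> u ` {m..l - 1}" using m strict_mono_less_eq[OF u, of m i] by auto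
    qed
  qed
qed

definition cyl :: "(real \<times> real \<times> real set) set \<Rightarrow> 'w set" where
  "cyl K = {x \<in> space W. \<forall>(s, u, A)\<in>K. B s x - B u x \<in> A}"

text \<open>On the grid \<open>u\<close> the value at a time, relative to \<open>u m\<close>, is a
  sum of elementary increments; so a cylinder over the block depends on these alone.
  \<open>idx\<close> recovers the grid index of a time.\<close>

lemma cyl_block:
  assumes K: "finite K" "\<And>s t A. (s, t, A) \<in> K \<Longrightarrow> s \<in> u ` {m..n} \<and> t \<in> u ` {m..n} \<and> A \<in> sets borel"
  obtains A where "A \<in> sets (PiM {m..<n} (\<lambda>_. borel))"
    "cyl K = (\<lambda>x. restrict (\<lambda>i. B (u (Suc i)) x - B (u i) x) {m..<n}) -` A \<inter> space W"
proof -
  let ?P = "PiM {m..<n} (\<lambda>_. borel :: real measure)"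
  define idx where "idx s = (SOME i. i \<in> {m..n} \<and> u i = s)" for s
  have idx: "idx s \<in> {m..n} \<and> u (idx s) = s" if "s \<in> u ` {m..n}" for s
    unfolding idx_def by (rule someI_ex) (use that in auto)
  define S where "S s y = (\<Sum>i\<in>{m..<idx s}. y i)" for s and y :: "nat \<Rightarrow> real"
  have S[measurable]: "S s \<in> borel_measurable ?P" if "s \<in> u ` {m..n}" for s
    unfolding S_def using idx[OF that] by (intro borel_measurable_sum measurable_component_singleton) auto
  have SB: "S s (restrict (\<lambda>i. B (u (Suc i)) x - B (u i) x) {m..<n}) = B s x - B (u m) x" if "s \<in> u ` {m..n}" for s x
  proof -
    have "S s (restrict (\<lambda>i. B (u (Suc i)) x - B (u i) x) {m..<n}) = (\<Sum>i\<in>{m..<idx s}. B (u (Suc i)) x - B (u i) x)"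
      unfolding S_def using idx[OF that] by (intro sum.cong) auto
    also have "\<dots> = B s x - B (u m) x"
      using idx[OF that] by (subst sum_Suc_diff') auto
    finally show ?thesis .
  qed
  let ?A = "{y \<in> space ?P. \<forall>k\<in>K. S (fst k) y - S (fst (snd k)) y \<in> snd (snd k)}"
  show ?thesis
  proof
    show "?A \<in> sets ?P"
    proof (intro sets.sets_Collect_finite_All K(1))
      fix k assume k: "k \<in> K"
      obtain s t A where [simp]: "k = (s, t, A)" by (cases k)
      have [measurable]: "S s \<in> borel_measurable ?P" "S t \<in> borel_measurable ?P" "A \<in> sets borel"
        using K(2)[of s t A] k S by auto
      have "(\<lambda>y. S s y - S t y) -` A \<inter> space ?P \<in> sets ?P" by measurable
      then show "{y \<in> space ?P. S (fst k) y - S (fst (snd k)) y \<in> snd (snd k)} \<in> sets ?P"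
        by (simp add: vimage_def Int_def conj_commute)
    qed
    show "cyl K = (\<lambda>x. restrict (\<lambda>i. B (u (Suc i)) x - B (u i) x) {m..<n}) -` ?A \<inter> space W"
    proof -
      have "S (fst k) (restrict (\<lambda>i. B (u (Suc i)) x - B (u i) x) {m..<n}) - S (fst (snd k)) (restrict (\<lambda>i. B (u (Suc i)) x - B (u i) x) {m..<n})
          = B (fst k) x - B (fst (snd k)) x" if "k \<in> K" for k x
      proof -
        obtain s t A where "k = (s, t, A)" by (cases k)
        with K(2)[of s t A] that show ?thesis by (simp add: SB)
      qed
      then show ?thesis by (auto simp: cyl_def space_PiM case_prod_beta')
    qed
  qed
qed

lemma indep_cyl:
  assumes K: "finite K" "\<And>s t A. (s, t, A) \<in> K \<Longrightarrow> s \<in> D \<and> t \<in> D \<and> A \<in> sets borel"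
    and K': "finite K'" "\<And>s t A. (s, t, A) \<in> K' \<Longrightarrow> s \<in> D' \<and> t \<in> D' \<and> A \<in> sets borel"
    and le: "\<And>s t. s \<in> D \<Longrightarrow> t \<in> D' \<Longrightarrow> s \<le> t"
  shows "prob (cyl K \<inter> cyl K') = prob (cyl K) * prob (cyl K')"
proof (cases "K = {}")
  case True
  then have "cyl K = space W" "cyl K \<inter> cyl K' = cyl K'" by (auto simp: cyl_def)
  then show ?thesis by (simp add: prob_space)
next
  case False
  define F F' where "F = fst ` K \<union> (fst \<circ> snd) ` K" and "F' = fst ` K' \<union> (fst \<circ> snd) ` K'"
  have FK: "s \<in> F \<and> t \<in> F" if "(s, t, A) \<in> K" for s t A using that by (force simp: F_def)
  have FK': "s \<in> F' \<and> t \<in> F'" if "(s, t, A) \<in> K'" for s t A using that by (force simp: F'_def)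
  have "finite F" "finite F'" "F \<noteq> {}" using K(1) K'(1) False by (auto simp: F_def F'_def)
  moreover have "F \<subseteq> D" "F' \<subseteq> D'" using K(2) K'(2) by (force simp: F_def F'_def)+
  ultimately obtain n m and u :: "nat \<Rightarrow> real" where u: "strict_mono u" "m \<le> n" "F \<subseteq> u ` {..m}" "F' \<subseteq> u ` {m..n}"
    using increments_block_indep[of F F'] le by (metis subsetD)
  have KB: "s \<in> u ` {0..m} \<and> t \<in> u ` {0..m} \<and> A \<in> sets borel" if "(s, t, A) \<in> K" for s t A
    using FK[OF that] K(2)[OF that] u(3) unfolding atLeast0AtMost by blast
  have KB': "s \<in> u ` {m..n} \<and> t \<in> u ` {m..n} \<and> A \<in> sets borel" if "(s, t, A) \<in> K'" for s t A
    using FK'[OF that] K'(2)[OF that] u(4) by blast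
  obtain A where A: "A \<in> sets (PiM {0..<m} (\<lambda>_. borel))"
    "cyl K = (\<lambda>x. restrict (\<lambda>i. B (u (Suc i)) x - B (u i) x) {0..<m}) -` A \<inter> space W"
    by (rule cyl_block[OF K(1) KB])
  obtain A' where A': "A' \<in> sets (PiM {m..<n} (\<lambda>_. borel))"
    "cyl K' = (\<lambda>x. restrict (\<lambda>i. B (u (Suc i)) x - B (u i) x) {m..<n}) -` A' \<inter> space W"
    by (rule cyl_block[OF K'(1) KB'])
  have "indep_var (PiM {0..<m} (\<lambda>_. borel)) (\<lambda>x. restrict (\<lambda>i. B (u (Suc i)) x - B (u i) x) {0..<m})
      (PiM {m..<n} (\<lambda>_. borel)) (\<lambda>x. restrict (\<lambda>i. B (u (Suc i)) x - B (u i) x) {m..<n})"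
    using u(2) by (intro indep_var_restrict[OF increments_indep[OF u(1), of n]]) auto
  from indep_varD[OF this A(1) A'(1)] show ?thesis
    unfolding A(2) A'(2) by (simp add: vimage_def Int_def conj_ac)
qed

text \<open>Finite cylinders generate and are stable under intersection, so their independence
  extends by the pi-lambda theorem.\<close>

lemma indep_incr:
  assumes le: "\<And>s t. s \<in> D \<Longrightarrow> t \<in> D' \<Longrightarrow> s \<le> t"
  shows "indep_set (sets (incr D)) (sets (incr D'))"
proof -
  define ok :: "real set \<Rightarrow> (real \<times> real \<times> real set) set \<Rightarrow> bool" where
    "ok D K \<longleftrightarrow> finite K \<and> (\<forall>s t A. (s, t, A) \<in> K \<longrightarrow> s \<in> D \<and> t \<in> D \<and> A \<in> sets borel)" for D K
  have cyl_meas: "cyl K \<in> sets (incr D)" if "ok D K" for D K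
    unfolding cyl_def
  proof -
    have "{x \<in> space (incr D). \<forall>k\<in>K. B (fst k) x - B (fst (snd k)) x \<in> snd (snd k)} \<in> sets (incr D)"
    proof (intro sets.sets_Collect_finite_All)
      fix k assume "k \<in> K"
      moreover obtain s t A where "k = (s, t, A)" by (cases k)
      ultimately have k: "k = (s, t, A)" "s \<in> D" "t \<in> D" "A \<in> sets borel"
        using that by (auto simp: ok_def)
      have "(\<lambda>x. B s x - B t x) -` A \<inter> space (incr D) \<in> sets (incr D)"
        by (rule measurable_sets[OF increment_incr[OF k(2,3)] k(4)])
      then show "{x \<in> space (incr D). B (fst k) x - B (fst (snd k)) x \<in> snd (snd k)} \<in> sets (incr D)"
        by (simp add: k vimage_def Int_def conj_commute)
    qed (use that in \<open>simp add: ok_def\<close>)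
    then show "{x \<in> space W. \<forall>(s, u, A)\<in>K. B s x - B u x \<in> A} \<in> sets (incr D)"
      by (simp add: case_prod_beta')
  qed
  have gen: "sets (incr D) = sigma_sets (space W) (cyl ` Collect (ok D))" for D
  proof
    show "sets (incr D) \<subseteq> sigma_sets (space W) (cyl ` Collect (ok D))"
      unfolding sets_incr
    proof (rule sigma_sets_mono', rule subsetI)
      fix X assume "X \<in> {(\<lambda>x. B s x - B u x) -` A \<inter> space W |s u A. s \<in> D \<and> u \<in> D \<and> A \<in> sets borel}"
      then obtain s u A where X: "X = (\<lambda>x. B s x - B u x) -` A \<inter> space W" "s \<in> D" "u \<in> D" "A \<in> sets borel" by blast
      then have "X = cyl {(s, u, A)}" "ok D {(s, u, A)}" by (auto simp: cyl_def ok_def)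
      then show "X \<in> cyl ` Collect (ok D)" by blast
    qed
    show "sigma_sets (space W) (cyl ` Collect (ok D)) \<subseteq> sets (incr D)"
      using cyl_meas sets.sigma_sets_subset[of "cyl ` Collect (ok D)" "incr D"] by auto
  qed
  have stable: "Int_stable (cyl ` Collect (ok D))" for D
  proof (rule Int_stableI)
    fix X Y assume "X \<in> cyl ` Collect (ok D)" "Y \<in> cyl ` Collect (ok D)"
    then obtain K L where K: "X = cyl K" "ok D K" "Y = cyl L" "ok D L" by blast
    have "X \<inter> Y = cyl (K \<union> L)" unfolding K cyl_def ball_Un by blast
    moreover have "ok D (K \<union> L)" using K unfolding ok_def by blast
    ultimately show "X \<inter> Y \<in> cyl ` Collect (ok D)" by blast
  qed
  have "indep_set (cyl ` Collect (ok D)) (cyl ` Collect (ok D'))"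
  proof (rule indep_setI)
    show "cyl ` Collect (ok D) \<subseteq> events" "cyl ` Collect (ok D') \<subseteq> events"
      using cyl_meas sets_incr_subset by auto
    fix X Y assume "X \<in> cyl ` Collect (ok D)" "Y \<in> cyl ` Collect (ok D')"
    then obtain K L where "X = cyl K" "ok D K" "Y = cyl L" "ok D' L" by blast
    with indep_cyl[of K D L D'] le show "prob (X \<inter> Y) = prob X * prob Y" by (simp add: ok_def)
  qed
  from indep_set_sigma_sets[OF this stable stable] show ?thesis unfolding gen .
qed

lemma indep_var_incr:
  assumes "\<And>s t. s \<in> D \<Longrightarrow> t \<in> D' \<Longrightarrow> s \<le> t"
    and X: "X \<in> borel_measurable (incr D)" and Y: "Y \<in> borel_measurable (incr D')"
  shows "indep_var borel X borel Y"
  unfolding indep_var_eq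
proof (intro conjI)
  have sub: "sigma_sets (space W) {Z -` A \<inter> space W |A. A \<in> sets borel} \<subseteq> sets (incr E)"
    if "Z \<in> borel_measurable (incr E)" for Z :: "'w \<Rightarrow> 'c :: topological_space" and E
    using sets.sigma_sets_subset[of "{Z -` A \<inter> space W |A. A \<in> sets borel}" "incr E"] measurable_sets[OF that]
    by auto
  show "random_variable borel X" "random_variable borel Y"
    using X Y by (auto intro: measurable_incr_events)
  show "indep_set (sigma_sets (space W) {X -` A \<inter> space W |A. A \<in> sets borel})
      (sigma_sets (space W) {Y -` A \<inter> space W |A. A \<in> sets borel})"
  proof (rule indep_setI)
    have ind: "indep_set (sets (incr D)) (sets (incr D'))" by (rule indep_incr) (rule assms(1))
    fix U V assume "U \<in> sigma_sets (space W) {X -` A \<inter> space W |A. A \<in> sets borel}"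
      "V \<in> sigma_sets (space W) {Y -` A \<inter> space W |A. A \<in> sets borel}"
    with sub[OF X] sub[OF Y] show "prob (U \<inter> V) = prob U * prob V" by (intro indep_setD[OF ind]) auto
  qed (use sub[OF X] sub[OF Y] sets_incr_subset in blast)+
qed

end

text \<open>The summands telescope between the first dyadic points at or after \<open>s\<close> and
  \<open>t\<close>, and continuity gives the limit. This is the pathwise integral of the indicator
  of \<open>[s, t)\<close>, where \<open>s\<close> and \<open>t\<close> will be random
  times.\<close>

lemma dyadic_stopped_sum:
  fixes w :: "real \<Rightarrow> real"
  assumes w: "continuous_on UNIV w" and s: "0 \<le> s" "s \<le> t" "t \<le> real N"
  shows "(\<lambda>m. \<Sum>j<N * 2 ^ m. (w (real (Suc j) / 2 ^ m) - w (real j / 2 ^ m)) * of_bool (s \<le> real j / 2 ^ m \<and> real j / 2 ^ m < t))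
    \<longlonglongrightarrow> w t - w s"
proof -
  define a where "a r m = nat \<lceil>r * 2 ^ m\<rceil>" for r :: real and m :: nat
  have a_iff: "a r m \<le> j \<longleftrightarrow> r \<le> real j / 2 ^ m" if "0 \<le> r" for r m j
    using that by (simp add: a_def pos_le_divide_eq nat_le_iff ceiling_le_iff)
  have tN: "a t m \<le> N * 2 ^ m" for m using s a_iff[of t m "N * 2 ^ m"] by simp
  have st: "a s m \<le> a t m" for m unfolding a_def using s by (intro nat_mono ceiling_mono mult_right_mono) auto
  have "(\<Sum>j<N * 2 ^ m. (w (real (Suc j) / 2 ^ m) - w (real j / 2 ^ m)) * of_bool (s \<le> real j / 2 ^ m \<and> real j / 2 ^ m < t))
      = w (real (a t m) / 2 ^ m) - w (real (a s m) / 2 ^ m)" for m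
  proof -
    have iff: "(s \<le> real j / 2 ^ m \<and> real j / 2 ^ m < t) \<longleftrightarrow> j \<in> {a s m..<a t m}" for j
    proof -
      have "real j / 2 ^ m < t \<longleftrightarrow> j < a t m" using a_iff[of t m j] s by linarith
      with a_iff[OF s(1), of m j] show ?thesis unfolding atLeastLessThan_iff by blast
    qed
    have "(\<Sum>j<N * 2 ^ m. (w (real (Suc j) / 2 ^ m) - w (real j / 2 ^ m)) * of_bool (j \<in> {a s m..<a t m}))
        = (\<Sum>j\<in>{a s m..<a t m}. w (real (Suc j) / 2 ^ m) - w (real j / 2 ^ m))"
      using tN[of m] by (intro sum.mono_neutral_cong_right) auto
    also have "\<dots> = w (real (a t m) / 2 ^ m) - w (real (a s m) / 2 ^ m)"
      using sum_Suc_diff'[OF st, of "\<lambda>j. w (real j / 2 ^ m)" m] by simp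
    finally show ?thesis unfolding iff .
  qed
  moreover have "(\<lambda>m. w (real (a r m) / 2 ^ m)) \<longlonglongrightarrow> w r" if r: "0 \<le> r" for r
  proof (rule continuous_on_tendsto_compose[OF w])
    show "(\<lambda>m. real (a r m) / 2 ^ m) \<longlonglongrightarrow> r"
    proof (rule tendsto_sandwich[of "\<lambda>_. r" _ _ "\<lambda>m. r + 1 / 2 ^ m"])
      have "r \<le> real (a r m) / 2 ^ m" for m using a_iff[OF r, of m "a r m"] by simp
      then show "\<forall>\<^sub>F m in sequentially. r \<le> real (a r m) / 2 ^ m" by simp
      have "real (a r m) \<le> r * 2 ^ m + 1" for m
        unfolding a_def using r of_int_ceiling_le_add_one[of "r * 2 ^ m"] by (simp add: of_nat_nat)
      then have "real (a r m) / 2 ^ m \<le> r + 1 / 2 ^ m" for m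
        by (simp add: pos_divide_le_eq distrib_right)
      then show "\<forall>\<^sub>F m in sequentially. real (a r m) / 2 ^ m \<le> r + 1 / 2 ^ m" by simp
      show "(\<lambda>m. r + 1 / 2 ^ m) \<longlonglongrightarrow> r" by real_asymp
    qed simp
  qed auto
  ultimately show ?thesis using s by (auto intro: tendsto_diff)
qed

context brownian
begin

section \<open>Optional stopping by dyadic sums\<close>

lemma incr_increment_integral:
  assumes "s < t" and Z: "Z \<in> borel_measurable (incr {..s})" "integrable W Z"
  shows "integrable W (\<lambda>x. (B t x - B s x) * Z x)" "expectation (\<lambda>x. (B t x - B s x) * Z x) = 0"
proof -
  have "(\<lambda>x. B t x - B s x) \<in> borel_measurable (incr {s..})"
    using assms(1) by (intro increment_incr) auto
  then have ind: "indep_var borel Z borel (\<lambda>x. B t x - B s x)"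
    using Z(1) by (intro indep_var_incr[of "{..s}" "{s..}"]) auto
  show "integrable W (\<lambda>x. (B t x - B s x) * Z x)"
    using indep_var_integrable[OF ind Z(2) increment_integrable[OF assms(1)]] by (simp add: mult.commute)
  show "expectation (\<lambda>x. (B t x - B s x) * Z x) = 0"
    using indep_var_lebesgue_integral[OF ind Z(2) increment_integrable[OF assms(1)]] increment_mean[OF assms(1)]
    by (simp add: mult.commute)
qed

lemma incr_mono_measurable: "D \<subseteq> D' \<Longrightarrow> f \<in> borel_measurable (incr D) \<Longrightarrow> f \<in> borel_measurable (incr D')"
  using sets_incr_mono[of D D'] measurable_sets[of f "incr D" borel] by (intro measurableI) auto

text \<open>A martingale transform with stakes \<open>indicator (J t)\<close>: an increment is
  independent of its stake and of all earlier summands, so mixed terms vanish and the second moment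
  is at most the elapsed time \<open>n * h\<close>.\<close>

lemma stopped_sum_moments:
  fixes J :: "real \<Rightarrow> 'w set"
  assumes J: "\<And>t. 0 \<le> t \<Longrightarrow> J t \<in> sets (incr {..t})" and h: "0 < h"
  defines "X \<equiv> \<lambda>j x. (B (real (Suc j) * h) x - B (real j * h) x) * indicator (J (real j * h)) x"
  shows "integrable W (\<lambda>x. \<Sum>j<n. X j x)" "expectation (\<lambda>x. \<Sum>j<n. X j x) = 0"
    "integrable W (\<lambda>x. (\<Sum>j<n. X j x)\<^sup>2)" "expectation (\<lambda>x. (\<Sum>j<n. X j x)\<^sup>2) \<le> n * h"
proof -
  have lt: "real j * h < real (Suc j) * h" for j using h by simp
  have JW: "J (real j * h) \<in> events" for j
    using J[of "real j * h"] sets_incr_subset h by auto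
  have ind[measurable]: "indicat_real (J (real j * h)) \<in> borel_measurable (incr {..real j * h})" for j
    using J[of "real j * h"] h by (intro borel_measurable_indicator) auto
  have indi: "integrable W (indicat_real (J (real j * h)))" for j
    using JW by (simp add: emeasure_eq_measure)
  have XF: "X j \<in> borel_measurable (incr {..t})" if "real (Suc j) * h \<le> t" for j t
  proof -
    have "(\<lambda>x. B (real (Suc j) * h) x - B (real j * h) x) \<in> borel_measurable (incr {..t})"
      using that lt[of j] by (intro increment_incr) auto
    moreover have "indicat_real (J (real j * h)) \<in> borel_measurable (incr {..t})"
      using that lt[of j] by (intro incr_mono_measurable[OF _ ind]) auto
    ultimately show ?thesis unfolding X_def by (rule borel_measurable_times)
  qed
  have Xm[measurable]: "X j \<in> borel_measurable W" for j
    by (rule measurable_incr_events[OF XF[OF order_refl]])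
  have Xi: "integrable W (X j)" "expectation (X j) = 0" for j
    unfolding X_def using incr_increment_integral[OF lt ind indi] by auto
  have sq: "integrable W (\<lambda>x. (X j x)\<^sup>2)" "expectation (\<lambda>x. (X j x)\<^sup>2) \<le> h" for j
  proof -
    note inc = increment_square_integrable[OF lt[of j]] increment_square[OF lt[of j]]
    show i: "integrable W (\<lambda>x. (X j x)\<^sup>2)"
    proof (rule Bochner_Integration.integrable_bound[OF inc(1)])
      show "(\<lambda>x. (X j x)\<^sup>2) \<in> borel_measurable W" by measurable
    qed (auto simp: X_def power_mult_distrib indicator_def)
    have "expectation (\<lambda>x. (X j x)\<^sup>2) \<le> expectation (\<lambda>x. (B (real (Suc j) * h) x - B (real j * h) x)\<^sup>2)"
      by (rule integral_mono[OF i inc(1)]) (auto simp: X_def power_mult_distrib indicator_def)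
    also have "\<dots> = h" unfolding inc(2) by (simp add: algebra_simps)
    finally show "expectation (\<lambda>x. (X j x)\<^sup>2) \<le> h" .
  qed
  have prod_int: "integrable W (\<lambda>x. X i x * X j x)" for i j
  proof (rule Bochner_Integration.integrable_bound[where f="\<lambda>x. (X i x)\<^sup>2 + (X j x)\<^sup>2"])
    have "\<bar>a * b\<bar> \<le> a\<^sup>2 + b\<^sup>2" for a b :: real
    proof -
      have "2 * \<bar>a\<bar> * \<bar>b\<bar> \<le> a\<^sup>2 + b\<^sup>2" using sum_squares_bound[of "\<bar>a\<bar>" "\<bar>b\<bar>"] by simp
      moreover have "0 \<le> \<bar>a\<bar> * \<bar>b\<bar>" by simp
      ultimately show ?thesis unfolding abs_mult by linarith
    qed
    then show "AE x in W. norm (X i x * X j x) \<le> norm ((X i x)\<^sup>2 + (X j x)\<^sup>2)" by simp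
  qed (use sq in auto)
  have orth: "expectation (\<lambda>x. X i x * X j x) = 0" if "i < j" for i j
  proof -
    have le: "real (Suc i) * h \<le> real j * h" using that h by (intro mult_right_mono) auto
    have "(\<lambda>x. X i x * indicat_real (J (real j * h)) x) \<in> borel_measurable (incr {..real j * h})"
      by (intro borel_measurable_times XF[OF le] ind)
    moreover have "integrable W (\<lambda>x. X i x * indicat_real (J (real j * h)) x)"
      using JW Xi(1) by (rule integrable_real_mult_indicator)
    ultimately have "expectation (\<lambda>x. (B (real (Suc j) * h) x - B (real j * h) x) * (X i x * indicat_real (J (real j * h)) x)) = 0"
      by (rule incr_increment_integral(2)[OF lt])
    then show ?thesis by (simp add: X_def mult_ac)
  qed
  show "integrable W (\<lambda>x. \<Sum>j<n. X j x)" "expectation (\<lambda>x. \<Sum>j<n. X j x) = 0"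
    using Xi by auto
  have "(\<Sum>j<n. X j x)\<^sup>2 = (\<Sum>i<n. \<Sum>j<n. X i x * X j x)" for x
    by (simp add: power2_eq_square sum_product)
  moreover have "integrable W (\<lambda>x. \<Sum>i<n. \<Sum>j<n. X i x * X j x)" using prod_int by auto
  ultimately show "integrable W (\<lambda>x. (\<Sum>j<n. X j x)\<^sup>2)" by simp
  have "expectation (\<lambda>x. (\<Sum>j<n. X j x)\<^sup>2) = (\<Sum>i<n. \<Sum>j<n. expectation (\<lambda>x. X i x * X j x))"
    using prod_int by (simp add: power2_eq_square sum_product)
  also have "\<dots> = (\<Sum>i<n. \<Sum>j<n. if i = j then expectation (\<lambda>x. (X i x)\<^sup>2) else 0)"
  proof (intro sum.cong refl)
    fix i j :: nat
    consider "i < j" | "i = j" | "j < i" by linarith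
    then show "expectation (\<lambda>x. X i x * X j x) = (if i = j then expectation (\<lambda>x. (X i x)\<^sup>2) else 0)"
      by cases (auto simp: orth power2_eq_square orth[of j i, unfolded mult.commute[of "X j _"]])
  qed
  also have "\<dots> = (\<Sum>i<n. expectation (\<lambda>x. (X i x)\<^sup>2))" by simp
  also have "\<dots> \<le> (\<Sum>i<n. h)" by (intro sum_mono sq(2))
  finally show "expectation (\<lambda>x. (\<Sum>j<n. X j x)\<^sup>2) \<le> n * h" by simp
qed

text \<open>A sequence bounded in L2 is uniformly integrable, so means pass to the pointwise limit.
  Concretely, the difference is truncated at \<open>K\<close>: dominated convergence treats the
  truncation, and second moments bound the excess by a multiple of \<open>1 / K\<close>.\<close>

lemma expectation_L2_limit:
  fixes D :: "nat \<Rightarrow> 'w \<Rightarrow> real"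
  assumes D: "\<And>m. integrable W (D m)" "\<And>m. expectation (D m) = 0"
    "\<And>m. integrable W (\<lambda>x. (D m x)\<^sup>2)" "\<And>m. expectation (\<lambda>x. (D m x)\<^sup>2) \<le> S"
    and lim: "\<And>x. x \<in> space W \<Longrightarrow> (\<lambda>m. D m x) \<longlonglongrightarrow> E x"
    and E: "E \<in> borel_measurable W" "\<And>x. \<bar>E x\<bar> \<le> C"
  shows "expectation E = 0"
proof -
  have C: "0 \<le> C" using E(2) abs_ge_zero order_trans by blast
  have Ei: "integrable W E" by (rule integrable_const_bound[of _ C]) (use E in auto)
  have Dm[measurable]: "D m \<in> borel_measurable W" for m using D(1) by auto
  note [measurable] = E(1)
  have bound: "\<bar>expectation E\<bar> \<le> 2 * (S + C\<^sup>2) / K" if K: "0 < K" for K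
  proof (rule LIMSEQ_le)
    let ?T = "\<lambda>m. expectation (\<lambda>x. min \<bar>E x - D m x\<bar> K)"
    have "?T \<longlonglongrightarrow> expectation (\<lambda>x. 0)"
    proof (rule integral_dominated_convergence[where w="\<lambda>_. K"])
      show "AE x in W. (\<lambda>m. min \<bar>E x - D m x\<bar> K) \<longlonglongrightarrow> 0"
      proof (rule AE_I2)
        fix x assume "x \<in> space W"
        from tendsto_min[OF tendsto_rabs[OF tendsto_diff[OF tendsto_const lim[OF this], of "E x"]] tendsto_const[of K]] K
        show "(\<lambda>m. min \<bar>E x - D m x\<bar> K) \<longlonglongrightarrow> 0" by simp
      qed
      show "AE x in W. norm (min \<bar>E x - D m x\<bar> K) \<le> K" for m using K by auto
    qed auto
    then show "(\<lambda>m. ?T m + 2 * (S + C\<^sup>2) / K) \<longlonglongrightarrow> 2 * (S + C\<^sup>2) / K"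
      using tendsto_add[OF _ tendsto_const, of ?T 0 sequentially "2 * (S + C\<^sup>2) / K"] by simp
    show "(\<lambda>m. \<bar>expectation E\<bar>) \<longlonglongrightarrow> \<bar>expectation E\<bar>" by simp
    show "\<exists>N. \<forall>m\<ge>N. \<bar>expectation E\<bar> \<le> ?T m + 2 * (S + C\<^sup>2) / K"
    proof (intro exI[of _ 0] allI impI)
      fix m
      have Ti: "integrable W (\<lambda>x. min \<bar>E x - D m x\<bar> K)"
        by (rule integrable_const_bound[of _ K]) (use K in auto)
      have pt: "\<bar>E x - D m x\<bar> \<le> min \<bar>E x - D m x\<bar> K + 2 * ((D m x)\<^sup>2 + C\<^sup>2) / K" for x
      proof (cases "\<bar>E x - D m x\<bar> \<le> K")
        case True then show ?thesis using K by simp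
      next
        case False
        let ?y = "\<bar>E x - D m x\<bar>"
        have "K * ?y \<le> ?y\<^sup>2" using False unfolding power2_eq_square by (intro mult_right_mono) auto
        also have "\<dots> \<le> 2 * ((D m x)\<^sup>2 + (E x)\<^sup>2)"
          using zero_le_power2[of "E x + D m x"] by (simp add: power2_eq_square algebra_simps)
        also have "(E x)\<^sup>2 \<le> C\<^sup>2" using E(2)[of x] C by (metis power2_abs power_mono abs_ge_zero)
        finally have "?y \<le> 2 * ((D m x)\<^sup>2 + C\<^sup>2) / K" using K by (simp add: pos_le_divide_eq mult.commute)
        then show ?thesis using K by simp
      qed
      have "\<bar>expectation E\<bar> = \<bar>expectation (\<lambda>x. E x - D m x)\<bar>" using Ei D by simp
      also have "\<dots> \<le> expectation (\<lambda>x. \<bar>E x - D m x\<bar>)" by (rule integral_abs_bound)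
      also have "\<dots> \<le> expectation (\<lambda>x. min \<bar>E x - D m x\<bar> K + 2 * ((D m x)\<^sup>2 + C\<^sup>2) / K)"
        using Ei D(1,3) Ti pt by (intro integral_mono) auto
      also have "\<dots> = ?T m + 2 * (expectation (\<lambda>x. (D m x)\<^sup>2) + C\<^sup>2) / K"
        using D(3) Ti by (simp add: prob_space)
      also have "\<dots> \<le> ?T m + 2 * (S + C\<^sup>2) / K"
        using D(4)[of m] K by (simp add: divide_right_mono)
      finally show "\<bar>expectation E\<bar> \<le> ?T m + 2 * (S + C\<^sup>2) / K" .
    qed
  qed
  have "((\<lambda>K. 2 * (S + C\<^sup>2) / K) \<longlongrightarrow> 0) at_top" by real_asymp
  then have "\<bar>expectation E\<bar> \<le> 0"
  proof (rule tendsto_le[OF _ _ tendsto_const, rotated])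
    show "\<forall>\<^sub>F K in at_top. \<bar>expectation E\<bar> \<le> 2 * (S + C\<^sup>2) / K"
      using eventually_gt_at_top[of "0::real"] by eventually_elim (rule bound)
  qed simp
  then show ?thesis by simp
qed

text \<open>\<open>J t\<close> is the event that the stake is held at time \<open>t\<close>. The
  second moments are bounded by \<open>N\<close> whatever the dyadic mesh, which is what the passage
  to the limit requires.\<close>

lemma optional_stopping:
  fixes J :: "real \<Rightarrow> 'w set"
  assumes J: "\<And>t. 0 \<le> t \<Longrightarrow> J t \<in> sets (incr {..t})"
    and lim: "\<And>x. x \<in> space W \<Longrightarrow> (\<lambda>m. \<Sum>j<N * 2 ^ m. (B (real (Suc j) / 2 ^ m) x - B (real j / 2 ^ m) x) * indicator (J (real j / 2 ^ m)) x) \<longlonglongrightarrow> E x"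
    and E: "E \<in> borel_measurable W" "\<And>x. \<bar>E x\<bar> \<le> C"
  shows "expectation E = 0"
proof (rule expectation_L2_limit[where S="real N", OF _ _ _ _ lim E])
  fix m :: nat
  note M = stopped_sum_moments[OF J, of "1 / 2 ^ m" "N * 2 ^ m", simplified]
  show "integrable W (\<lambda>x. \<Sum>j<N * 2 ^ m. (B (real (Suc j) / 2 ^ m) x - B (real j / 2 ^ m) x) * indicator (J (real j / 2 ^ m)) x)"
    "expectation (\<lambda>x. \<Sum>j<N * 2 ^ m. (B (real (Suc j) / 2 ^ m) x - B (real j / 2 ^ m) x) * indicator (J (real j / 2 ^ m)) x) = 0"
    "integrable W (\<lambda>x. (\<Sum>j<N * 2 ^ m. (B (real (Suc j) / 2 ^ m) x - B (real j / 2 ^ m) x) * indicator (J (real j / 2 ^ m)) x)\<^sup>2)"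
    "expectation (\<lambda>x. (\<Sum>j<N * 2 ^ m. (B (real (Suc j) / 2 ^ m) x - B (real j / 2 ^ m) x) * indicator (J (real j / 2 ^ m)) x)\<^sup>2) \<le> real N"
    using M by simp_all
qed

end

section \<open>Exit probabilities\<close>

text \<open>The first exit after \<open>s\<close> from the open interval between \<open>c\<close>
  and \<open>d\<close>, taking place at \<open>c\<close>. With \<open>min\<close> and
  \<open>max\<close>, upward and downward exits are treated alike.\<close>

definition hits :: "(real \<Rightarrow> real) \<Rightarrow> real \<Rightarrow> real \<Rightarrow> real \<Rightarrow> real \<Rightarrow> bool" where
  "hits w s c d t \<longleftrightarrow> s < t \<and> w t = c \<and> (\<forall>r\<in>{s..<t}. min c d < w r \<and> w r < max c d)"

text \<open>The list is in reverse chronological order: its head \<open>(c, d)\<close> asks the path to hit \<open>c\<close>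
  before \<open>d\<close>, counting from the time \<open>s\<close> at which the tail has been followed.\<close>

primrec follows :: "(real \<Rightarrow> real) \<Rightarrow> (real \<times> real) list \<Rightarrow> real \<Rightarrow> bool" where
  "follows w [] t \<longleftrightarrow> t = 0"
| "follows w (p # ps) t \<longleftrightarrow> (\<exists>s. follows w ps s \<and> hits w s (fst p) (snd p) t)"

fun endpoint :: "(real \<times> real) list \<Rightarrow> real" where
  "endpoint [] = 0"
| "endpoint (p # _) = fst p"

primrec admissible :: "(real \<times> real) list \<Rightarrow> bool" where
  "admissible [] \<longleftrightarrow> True"
| "admissible (p # ps) \<longleftrightarrow> admissible ps \<and>
     (fst p < endpoint ps \<and> endpoint ps < snd p \<or> snd p < endpoint ps \<and> endpoint ps < fst p)"

text \<open>A product of exit probabilities of Brownian motion: started at \<open>e\<close>, it hits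
  \<open>c\<close> before \<open>d\<close> with probability
  \<open>(e - d) / (c - d)\<close>.\<close>

primrec path_prob :: "(real \<times> real) list \<Rightarrow> real" where
  "path_prob [] = 1"
| "path_prob (p # ps) = path_prob ps * ((endpoint ps - snd p) / (fst p - snd p))"

lemma hits_same_time:
  assumes "hits w s c d t" "hits w s c' d' t'" "{c', d'} = {c, d}" shows "t = t'"
proof (rule ccontr)
  assume "t \<noteq> t'"
  have m: "min c' d' = min c d" "max c' d' = max c d"
    using assms(3) by (auto simp: doubleton_eq_iff min.commute max.commute)
  consider "t < t'" | "t' < t" using \<open>t \<noteq> t'\<close> by linarith
  then show False
  proof cases
    case 1
    then have "min c d < w t \<and> w t < max c d" using assms(1,2) m unfolding hits_def by fastforce
    moreover have "w t = c" using assms(1) by (simp add: hits_def)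
    ultimately show False by auto
  next
    case 2
    then have "min c d < w t' \<and> w t' < max c d" using assms(1,2) unfolding hits_def by fastforce
    moreover have "w t' = c'" using assms(2) by (simp add: hits_def)
    ultimately show False using assms(3) by (auto simp: doubleton_eq_iff)
  qed
qed

lemma hits_exclusive: "hits w s c d t \<Longrightarrow> hits w s d c t' \<Longrightarrow> False"
  using hits_same_time[of w s c d t d c t'] unfolding hits_def by fastforce

lemma follows_unique: "follows w ps s \<Longrightarrow> follows w ps t \<Longrightarrow> s = t"
proof (induction ps arbitrary: s t)
  case (Cons p ps)
  then obtain s' t' where "follows w ps s'" "hits w s' (fst p) (snd p) s" "follows w ps t'" "hits w t' (fst p) (snd p) t"
    by auto
  with Cons.IH[of s' t'] hits_same_time show ?case by blast
qed simp

lemma follows_nonneg: "follows w ps t \<Longrightarrow> 0 \<le> t"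
  by (induction ps arbitrary: t) (force simp: hits_def)+

lemma follows_endpoint: "follows w ps t \<Longrightarrow> w 0 = 0 \<Longrightarrow> w t = endpoint ps"
  by (cases ps) (auto simp: hits_def)

lemma first_exit_unit_interval:
  fixes g :: "real \<Rightarrow> real"
  assumes g: "continuous_on UNIV g" and gs: "0 < g s" "g s < 1" and p: "s \<le> p" "\<not> (0 < g p \<and> g p < 1)"
  obtains t where "s < t" "t \<le> p" "g t = 0 \<or> g t = 1" "\<And>r. s \<le> r \<Longrightarrow> r < t \<Longrightarrow> 0 < g r \<and> g r < 1"
proof -
  have cont: "continuous_on A g" for A using g by (rule continuous_on_subset) simp
  have isc: "isCont g t" for t using g by (simp add: continuous_on_eq_continuous_at)
  define Z where "Z = {r \<in> {s..p}. g r \<le> 0 \<or> 1 \<le> g r}"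
  have Z: "p \<in> Z" "bdd_below Z" using p by (auto simp: Z_def intro!: bdd_belowI[of _ s])
  have "closed Z"
  proof -
    have "Z = {s..p} \<inter> ({r. g r \<le> 0} \<union> {r. 1 \<le> g r})" by (auto simp: Z_def)
    then show ?thesis using cont by (auto intro!: closed_Int closed_Un closed_Collect_le)
  qed
  define t where "t = Inf Z"
  have tZ: "t \<in> Z" unfolding t_def using Z \<open>closed Z\<close> by (intro closed_contains_Inf) auto
  have below: "0 < g r \<and> g r < 1" if "s \<le> r" "r < t" for r
  proof (rule ccontr)
    assume "\<not> (0 < g r \<and> g r < 1)"
    then have "r \<in> Z" using that tZ by (auto simp: Z_def)
    then have "t \<le> r" unfolding t_def using Z(2) by (rule cInf_lower)
    with that show False by simp
  qed
  have st: "s < t" using tZ gs by (cases "s = t") (auto simp: Z_def)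
  have lim: "(g \<longlongrightarrow> g t) (at_left t)" using isc[of t] by (simp add: isCont_def filterlim_at_split)
  have ev: "eventually (\<lambda>r. 0 < g r \<and> g r < 1) (at_left t)"
    unfolding eventually_at_left_field using st below by (intro exI[of _ s]) auto
  have "0 \<le> g t" by (rule tendsto_lowerbound[OF lim]) (use ev in \<open>auto elim: eventually_mono\<close>)
  moreover have "g t \<le> 1" by (rule tendsto_upperbound[OF lim]) (use ev in \<open>auto elim: eventually_mono\<close>)
  ultimately show ?thesis using tZ st below by (intro that[of t]) (auto simp: Z_def)
qed

text \<open>Hitting 1 before 0 by time \<open>T\<close> is expressed through rational times. For the
  converse, suppose the first exit were at 0. Up to it the path would stay below some
  \<open>1 - 1 / (n + 1)\<close>, so the witness \<open>q\<close> would lie beyond it; but just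
  after the exit the positive lower bound required up to \<open>q\<close> fails.\<close>

lemma hits_unit_interval_iff:
  fixes g :: "real \<Rightarrow> real"
  assumes g: "continuous_on UNIV g" and gs: "0 < g s" "g s < 1"
  shows "(\<exists>t\<le>T. s < t \<and> g t = 1 \<and> (\<forall>r\<in>{s..<t}. 0 < g r \<and> g r < 1)) \<longleftrightarrow>
    (\<forall>n::nat. \<exists>q::rat. s \<le> of_rat q \<and> of_rat q \<le> T \<and> 1 - 1 / real (Suc n) < g (of_rat q) \<and>
      (\<exists>m::nat. \<forall>r::rat. s \<le> of_rat r \<longrightarrow> of_rat r \<le> (of_rat q :: real) \<longrightarrow> 1 / real (Suc m) \<le> g (of_rat r)))"
    (is "?L \<longleftrightarrow> ?R")
proof
  have cont: "continuous_on A g" for A using g by (rule continuous_on_subset) simp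
  have isc: "isCont g t" for t using g by (simp add: continuous_on_eq_continuous_at)
  assume ?L
  then obtain t where t: "t \<le> T" "s < t" "g t = 1" "\<And>r. s \<le> r \<Longrightarrow> r < t \<Longrightarrow> 0 < g r \<and> g r < 1" by auto
  show ?R
  proof
    fix n :: nat
    have "eventually (\<lambda>r. 1 - 1 / real (Suc n) < g r) (at t)"
      using isc[of t] t(3) by (intro order_tendstoD) (auto simp: isCont_def)
    then obtain d where d: "d > 0" "\<And>r. r \<noteq> t \<Longrightarrow> dist r t < d \<Longrightarrow> 1 - 1 / real (Suc n) < g r"
      unfolding eventually_at by auto
    have "max s (t - d) < t" using t(2) d(1) by simp
    then obtain q :: rat where q: "max s (t - d) < of_rat q" "of_rat q < t" using of_rat_dense by blast
    obtain z where z: "z \<in> {s..of_rat q}" "\<And>y. y \<in> {s..of_rat q} \<Longrightarrow> g z \<le> g y"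
      using continuous_attains_inf[OF compact_Icc _ cont, of s "of_rat q"] q by auto
    have "0 < g z" using z q t(4)[of z] by auto
    then obtain m where m: "1 / real (Suc m) < g z" using nat_approx_posE by blast
    show "\<exists>q::rat. s \<le> of_rat q \<and> of_rat q \<le> T \<and> 1 - 1 / real (Suc n) < g (of_rat q) \<and>
      (\<exists>m::nat. \<forall>r::rat. s \<le> of_rat r \<longrightarrow> of_rat r \<le> (of_rat q :: real) \<longrightarrow> 1 / real (Suc m) \<le> g (of_rat r))"
    proof (intro exI[of _ q] conjI exI[of _ m] allI impI)
      show "1 - 1 / real (Suc n) < g (of_rat q)" using q by (intro d) (auto simp: dist_real_def)
      show "1 / real (Suc m) \<le> g (of_rat r)" if "s \<le> of_rat r" "of_rat r \<le> (of_rat q :: real)" for r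
        using z(2)[of "of_rat r"] m that by auto
    qed (use q t in auto)
  qed
next
  have cont: "continuous_on A g" for A using g by (rule continuous_on_subset) simp
  have isc: "isCont g t" for t using g by (simp add: continuous_on_eq_continuous_at)
  assume R: ?R
  then obtain q0 :: rat where q0: "s \<le> of_rat q0" "of_rat q0 \<le> T" by blast
  obtain p where p: "p \<in> {s..T}" "\<And>y. y \<in> {s..T} \<Longrightarrow> g y \<le> g p"
    using continuous_attains_sup[OF compact_Icc _ cont, of s T] q0 by auto
  have approx: "1 \<le> v" if "\<And>n. 1 - 1 / real (Suc n) < v" for v :: real
  proof (rule ccontr)
    assume "\<not> 1 \<le> v"
    then obtain n where "1 / real (Suc n) < 1 - v" using nat_approx_posE[of "1 - v"] by auto
    with that[of n] show False by simp
  qed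
  have gp: "1 \<le> g p"
  proof (rule approx)
    fix n from R obtain q :: rat where "s \<le> of_rat q" "of_rat q \<le> T" "1 - 1 / real (Suc n) < g (of_rat q)" by blast
    with p(2)[of "of_rat q"] show "1 - 1 / real (Suc n) < g p" by auto
  qed
  obtain t where t: "s < t" "t \<le> p" "g t = 0 \<or> g t = 1" and below: "\<And>r. s \<le> r \<Longrightarrow> r < t \<Longrightarrow> 0 < g r \<and> g r < 1"
  proof (rule first_exit_unit_interval[OF g gs])
    show "s \<le> p" "\<not> (0 < g p \<and> g p < 1)" using p(1) gp by auto
  qed blast
  have st: "s < t" by (rule t)
  have "g t \<noteq> 0"
  proof
    assume gt0: "g t = 0"
    obtain y where y: "y \<in> {s..t}" "\<And>r. r \<in> {s..t} \<Longrightarrow> g r \<le> g y"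
      using continuous_attains_sup[OF compact_Icc _ cont, of s t] st by auto
    have "g y < 1" using y(1) below[of y] gt0 by (cases "y = t") auto
    then obtain n where n: "g y \<le> 1 - 1 / real (Suc n)" using nat_approx_posE[of "1 - g y"] by (smt (verit))
    from R obtain q :: rat and m where q: "s \<le> of_rat q" "1 - 1 / real (Suc n) < g (of_rat q)"
      "\<And>r::rat. s \<le> of_rat r \<Longrightarrow> of_rat r \<le> (of_rat q :: real) \<Longrightarrow> 1 / real (Suc m) \<le> g (of_rat r)" by blast
    have tq: "t < of_rat q"
    proof (rule ccontr)
      assume "\<not> t < of_rat q"
      with y(2)[of "of_rat q"] q n show False by auto
    qed
    have "eventually (\<lambda>r. g r < 1 / real (Suc m)) (at t)"
      using isc[of t] gt0 by (intro order_tendstoD) (auto simp: isCont_def)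
    then obtain d where d: "d > 0" "\<And>r. r \<noteq> t \<Longrightarrow> dist r t < d \<Longrightarrow> g r < 1 / real (Suc m)"
      unfolding eventually_at by auto
    have "t < min (of_rat q) (t + d)" using tq d(1) by simp
    then obtain r :: rat where r: "t < of_rat r" "of_rat r < min (of_rat q) (t + d)" using of_rat_dense by blast
    have "g (of_rat r) < 1 / real (Suc m)" using r by (intro d) (auto simp: dist_real_def)
    moreover have "1 / real (Suc m) \<le> g (of_rat r)" using r st by (intro q) auto
    ultimately show False by simp
  qed
  with t(3) have "g t = 1" by simp
  with t p below show ?L by (intro exI[of _ t]) auto
qed

lemma hits_normalize:
  assumes "c \<noteq> d"
  shows "hits w s c d t \<longleftrightarrow> s < t \<and> (w t - d) / (c - d) = 1 \<and> (\<forall>r\<in>{s..<t}. 0 < (w r - d) / (c - d) \<and> (w r - d) / (c - d) < 1)"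
proof -
  have "min c d < w r \<and> w r < max c d \<longleftrightarrow> 0 < (w r - d) / (c - d) \<and> (w r - d) / (c - d) < 1" for r
    using assms by (cases "c < d") (auto simp: zero_less_divide_iff divide_less_eq)
  with assms show ?thesis unfolding hits_def by (simp add: divide_eq_eq)
qed

lemma first_exit:
  assumes w: "continuous_on UNIV w" and s: "min c d < w s" "w s < max c d" and p: "s \<le> p" "\<not> (min c d < w p \<and> w p < max c d)"
  obtains t where "t \<le> p" "hits w s c d t \<or> hits w s d c t"
proof -
  define g where "g r = (w r - d) / (c - d)" for r
  have cd: "c \<noteq> d" using s by auto
  have gi: "0 < g r \<and> g r < 1 \<longleftrightarrow> min c d < w r \<and> w r < max c d" for r
    using cd unfolding g_def by (cases "c < d") (auto simp: zero_less_divide_iff divide_less_eq)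
  have "continuous_on UNIV g" unfolding g_def using cd by (intro continuous_intros w) auto
  then obtain t where t: "s < t" "t \<le> p" "g t = 0 \<or> g t = 1" "\<And>r. s \<le> r \<Longrightarrow> r < t \<Longrightarrow> 0 < g r \<and> g r < 1"
    using first_exit_unit_interval[of g s p] gi s p by metis
  from t(3) cd have "w t = c \<or> w t = d" by (auto simp: g_def)
  with t gi have "hits w s c d t \<or> hits w s d c t" by (auto simp: hits_def min.commute max.commute)
  with t(2) show ?thesis by (rule that)
qed

context brownian
begin

definition reached :: "(real \<times> real) list \<Rightarrow> real \<Rightarrow> 'w set" where
  "reached ps t = {x \<in> space W. \<exists>s\<le>t. follows (\<lambda>r. B r x) ps s}"

lemma reached_mono: "s \<le> t \<Longrightarrow> reached ps s \<subseteq> reached ps t"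
  unfolding reached_def using order_trans by blast

lemma reached_iff: "follows (\<lambda>r. B r x) ps s \<Longrightarrow> x \<in> space W \<Longrightarrow> x \<in> reached ps t \<longleftrightarrow> s \<le> t"
  using follows_unique[of "\<lambda>r. B r x" ps] by (auto simp: reached_def)

text \<open>These events are adapted. The random time \<open>s\<close> at which the tail has been
  followed is eliminated by reading \<open>s \<le> r\<close>, for rational \<open>r\<close>, as
  membership in \<open>reached ps r\<close>; this turns the rational description of an exit into
  countably many adapted conditions.\<close>

lemma reached_measurable:
  assumes "admissible ps" "0 \<le> t" shows "reached ps t \<in> sets (incr {0..t})"
  using assms
proof (induction ps arbitrary: t)
  case Nil
  then have "reached [] t = space (incr {0..t})" by (auto simp: reached_def)
  then show ?case by (metis sets.top)
next
  case (Cons p ps)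
  obtain c d where p: "p = (c, d)" by (cases p)
  define g where "g r x = (B r x - d) / (c - d)" for r x
  have cd: "c \<noteq> d" and adm: "admissible ps" and e: "0 < (endpoint ps - d) / (c - d)" "(endpoint ps - d) / (c - d) < 1"
    using Cons.prems by (auto simp: p zero_less_divide_iff divide_less_eq)
  define A where "A n q = (if 0 \<le> q \<and> q \<le> t then {x \<in> space W. x \<in> reached ps q \<and> 1 - 1 / real (Suc n) < g q x \<and>
      (\<exists>m::nat. \<forall>r::rat. 0 \<le> (of_rat r :: real) \<and> of_rat r \<le> q \<longrightarrow> x \<in> reached ps (of_rat r) \<longrightarrow> 1 / real (Suc m) \<le> g (of_rat r) x)}
    else {})" for n :: nat and q :: real
  have gm: "g q \<in> borel_measurable (incr {0..t})" if "0 \<le> q" "q \<le> t" for q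
    unfolding g_def using that by (intro borel_measurable_divide borel_measurable_diff B_incr borel_measurable_const) auto
  have rm: "{x \<in> space (incr {0..t}). x \<in> reached ps q} \<in> sets (incr {0..t})" if "0 \<le> q" "q \<le> t" for q
  proof -
    have "reached ps q \<in> sets (incr {0..t})"
      using Cons.IH[OF adm that(1)] sets_incr_mono[of "{0..q}" "{0..t}"] that by auto
    moreover have "{x \<in> space (incr {0..t}). x \<in> reached ps q} = reached ps q" by (auto simp: reached_def)
    ultimately show ?thesis by simp
  qed
  have Am: "A n q \<in> sets (incr {0..t})" for n q
  proof (cases "0 \<le> q \<and> q \<le> t")
    case True
    have "{x \<in> space (incr {0..t}). x \<in> reached ps q \<and> 1 - 1 / real (Suc n) < g q x \<and>
      (\<exists>m::nat. \<forall>r::rat. 0 \<le> (of_rat r :: real) \<and> of_rat r \<le> q \<longrightarrow> x \<in> reached ps (of_rat r) \<longrightarrow> 1 / real (Suc m) \<le> g (of_rat r) x)}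
      \<in> sets (incr {0..t})"
    proof (intro sets.sets_Collect_conj sets.sets_Collect_countable_Ex sets.sets_Collect_countable_All)
      show "{x \<in> space (incr {0..t}). x \<in> reached ps q} \<in> sets (incr {0..t})" using True by (intro rm) auto
      show "{x \<in> space (incr {0..t}). 1 - 1 / real (Suc n) < g q x} \<in> sets (incr {0..t})"
        using True by (intro borel_measurable_less gm borel_measurable_const) auto
      fix m :: nat and r :: rat
      show "{x \<in> space (incr {0..t}). 0 \<le> (of_rat r :: real) \<and> of_rat r \<le> q \<longrightarrow> x \<in> reached ps (of_rat r) \<longrightarrow> 1 / real (Suc m) \<le> g (of_rat r) x}
        \<in> sets (incr {0..t})"
      proof (cases "0 \<le> (of_rat r :: real) \<and> of_rat r \<le> q")
        case r: True
        have "{x \<in> space (incr {0..t}). x \<in> reached ps (of_rat r) \<longrightarrow> 1 / real (Suc m) \<le> g (of_rat r) x} \<in> sets (incr {0..t})"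
          using True r by (intro sets.sets_Collect_imp rm borel_measurable_le gm borel_measurable_const) auto
        with r show ?thesis by simp
      next
        case False
        then have "{x \<in> space (incr {0..t}). 0 \<le> (of_rat r :: real) \<and> of_rat r \<le> q \<longrightarrow> x \<in> reached ps (of_rat r) \<longrightarrow> 1 / real (Suc m) \<le> g (of_rat r) x}
          = space (incr {0..t})" by blast
        then show ?thesis by (metis sets.top)
      qed
    qed
    with True show ?thesis by (simp add: A_def)
  qed (auto simp: A_def)
  have "reached (p # ps) t = (\<Inter>n. \<Union>q::rat. A n (of_rat q))"
  proof (intro set_eqI iffI)
    fix x assume x: "x \<in> reached (p # ps) t"
    then obtain s u where xs: "x \<in> space W" "follows (\<lambda>r. B r x) ps s" "hits (\<lambda>r. B r x) s c d u" "u \<le> t"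
      by (auto simp: reached_def p)
    have s0: "0 \<le> s" using follows_nonneg[OF xs(2)] .
    have gs: "0 < g s x" "g s x < 1"
      using e follows_endpoint[OF xs(2)] B_0[OF xs(1)] by (auto simp: g_def)
    have gc: "continuous_on UNIV (\<lambda>r. g r x)"
      unfolding g_def using cd by (intro continuous_intros B_continuous xs) auto
    have "\<exists>u\<le>t. s < u \<and> g u x = 1 \<and> (\<forall>r\<in>{s..<u}. 0 < g r x \<and> g r x < 1)"
      using xs(3,4) unfolding hits_normalize[OF cd] g_def by blast
    then have R: "\<forall>n::nat. \<exists>q::rat. s \<le> of_rat q \<and> of_rat q \<le> t \<and> 1 - 1 / real (Suc n) < g (of_rat q) x \<and>
      (\<exists>m::nat. \<forall>r::rat. s \<le> of_rat r \<longrightarrow> of_rat r \<le> (of_rat q :: real) \<longrightarrow> 1 / real (Suc m) \<le> g (of_rat r) x)"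
      by (subst (asm) hits_unit_interval_iff[OF gc gs])
    have "\<exists>q::rat. x \<in> A n (of_rat q)" for n
    proof -
      obtain q :: rat and m where q: "s \<le> of_rat q" "of_rat q \<le> t" "1 - 1 / real (Suc n) < g (of_rat q) x"
        "\<And>r::rat. s \<le> of_rat r \<Longrightarrow> of_rat r \<le> (of_rat q :: real) \<Longrightarrow> 1 / real (Suc m) \<le> g (of_rat r) x"
        using R by blast
      have "x \<in> A n (of_rat q)"
      proof -
        have "0 \<le> (of_rat q :: real)" using q(1) s0 by linarith
        moreover have "\<exists>m::nat. \<forall>r::rat. 0 \<le> (of_rat r :: real) \<and> of_rat r \<le> (of_rat q :: real) \<longrightarrow> x \<in> reached ps (of_rat r) \<longrightarrow> 1 / real (Suc m) \<le> g (of_rat r) x"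
          unfolding reached_iff[OF xs(2,1)] using q(4) by blast
        ultimately show ?thesis
          using q(1-3) xs(1) unfolding A_def by (simp add: reached_iff[OF xs(2,1)] del: zero_le_of_rat_iff)
      qed
      then show ?thesis by blast
    qed
    then show "x \<in> (\<Inter>n. \<Union>q::rat. A n (of_rat q))" by blast
  next
    fix x assume x: "x \<in> (\<Inter>n. \<Union>q::rat. A n (of_rat q))"
    then obtain q0 :: rat where "x \<in> A 0 (of_rat q0)" by blast
    then have "x \<in> reached ps (of_rat q0)" "x \<in> space W" by (auto simp: A_def split: if_splits)
    then obtain s where xs: "x \<in> space W" "follows (\<lambda>r. B r x) ps s" by (auto simp: reached_def)
    have s0: "0 \<le> s" using follows_nonneg[OF xs(2)] .
    have gs: "0 < g s x" "g s x < 1"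
      using e follows_endpoint[OF xs(2)] B_0[OF xs(1)] by (auto simp: g_def)
    have gc: "continuous_on UNIV (\<lambda>r. g r x)"
      unfolding g_def using cd by (intro continuous_intros B_continuous xs) auto
    have "\<exists>q::rat. s \<le> of_rat q \<and> of_rat q \<le> t \<and> 1 - 1 / real (Suc n) < g (of_rat q) x \<and>
      (\<exists>m::nat. \<forall>r::rat. s \<le> of_rat r \<longrightarrow> of_rat r \<le> (of_rat q :: real) \<longrightarrow> 1 / real (Suc m) \<le> g (of_rat r) x)" for n :: nat
    proof -
      obtain q :: rat where "x \<in> A n (of_rat q)" using x by blast
      then have q: "of_rat q \<le> t" "x \<in> reached ps (of_rat q)" "1 - 1 / real (Suc n) < g (of_rat q) x"
        "\<exists>m::nat. \<forall>r::rat. 0 \<le> (of_rat r :: real) \<and> of_rat r \<le> (of_rat q :: real) \<longrightarrow> x \<in> reached ps (of_rat r) \<longrightarrow> 1 / real (Suc m) \<le> g (of_rat r) x"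
        unfolding A_def by (auto split: if_splits)
      from q(4) obtain m :: nat where m: "\<And>r::rat. 0 \<le> (of_rat r :: real) \<Longrightarrow> of_rat r \<le> (of_rat q :: real) \<Longrightarrow> s \<le> of_rat r
          \<Longrightarrow> 1 / real (Suc m) \<le> g (of_rat r) x"
        unfolding reached_iff[OF xs(2,1)] by blast
      have "1 / real (Suc m) \<le> g (of_rat r) x" if "s \<le> of_rat r" "of_rat r \<le> (of_rat q :: real)" for r
        by (rule m[OF order_trans[OF s0 that(1)] that(2,1)])
      with q(1-3) show ?thesis unfolding reached_iff[OF xs(2,1)] by blast
    qed
    then have "\<exists>u\<le>t. s < u \<and> g u x = 1 \<and> (\<forall>r\<in>{s..<u}. 0 < g r x \<and> g r x < 1)"
      by (subst hits_unit_interval_iff[OF gc gs]) blast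
    then show "x \<in> reached (p # ps) t"
      using xs unfolding reached_def p follows.simps fst_conv snd_conv hits_normalize[OF cd] g_def by blast
  qed
  then show ?case using Am by (auto intro!: sets.countable_INT sets.countable_UN)
qed

definition followed :: "(real \<times> real) list \<Rightarrow> 'w set" where
  "followed ps = {x \<in> space W. \<exists>t. follows (\<lambda>r. B r x) ps t}"

lemma followed_eq: "followed ps = (\<Union>n::nat. reached ps (real n))"
  unfolding followed_def reached_def using real_arch_simple by blast

lemma followed_measurable: "admissible ps \<Longrightarrow> followed ps \<in> sets (incr {0..})"
  unfolding followed_eq
proof (intro sets.countable_UN image_subsetI)
  fix n :: nat assume "admissible ps"
  then show "reached ps (real n) \<in> sets (incr {0..})"
    using reached_measurable[of ps "real n"] sets_incr_mono[of "{0..real n}" "{0..}"] by auto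
qed

lemma followed_event: "admissible ps \<Longrightarrow> followed ps \<in> events"
  using followed_measurable sets_incr_subset by blast

lemma prob_reached_limit:
  assumes "A \<in> events" "admissible ps"
  shows "(\<lambda>n::nat. prob (A \<inter> reached ps (real n))) \<longlonglongrightarrow> prob (A \<inter> followed ps)"
proof -
  have "(\<lambda>n::nat. prob (A \<inter> reached ps (real n))) \<longlonglongrightarrow> prob (\<Union>n::nat. A \<inter> reached ps (real n))"
  proof (rule finite_Lim_measure_incseq)
    show "range (\<lambda>n::nat. A \<inter> reached ps (real n)) \<subseteq> events"
    proof (intro image_subsetI sets.Int assms(1))
      fix n :: nat
      have "reached ps (real n) \<in> sets (incr {0..real n})" by (rule reached_measurable) (use assms in auto)
      then show "reached ps (real n) \<in> events" using sets_incr_subset by blast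
    qed
    show "incseq (\<lambda>n::nat. A \<inter> reached ps (real n))"
      unfolding incseq_def by (intro allI impI Int_mono reached_mono) auto
  qed
  then show ?thesis by (simp add: followed_eq)
qed

lemma increment_small_prob_tendsto:
  "0 \<le> K \<Longrightarrow> (\<lambda>n::nat. prob {x \<in> space W. \<bar>B (real n) x - c\<bar> \<le> K}) \<longlonglongrightarrow> 0"
proof (rule tendsto_sandwich[of "\<lambda>_. 0" _ _ "\<lambda>n. 2 * K / sqrt (2 * pi * (real n - 0))"])
  assume K: "0 \<le> K"
  show "\<forall>\<^sub>F n in sequentially. prob {x \<in> space W. \<bar>B (real n) x - c\<bar> \<le> K} \<le> 2 * K / sqrt (2 * pi * (real n - 0))"
    using eventually_gt_at_top[of 0]
  proof eventually_elim
    case (elim n)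
    have "{x \<in> space W. \<bar>B (real n) x - c\<bar> \<le> K} = {x \<in> space W. \<bar>B (real n) x - B 0 x - c\<bar> \<le> K}"
      by (auto simp: B_0)
    then show ?case using increment_small_prob[of 0 "real n" K c] elim K by simp
  qed
  show "(\<lambda>n. 2 * K / sqrt (2 * pi * (real n - 0))) \<longlonglongrightarrow> 0" by real_asymp
qed auto

lemma follows_ConsD: "follows w (p # ps) t \<Longrightarrow> \<exists>s<t. follows w ps s"
  by (auto simp: hits_def)


text \<open>Optional stopping in place of the strong Markov property: a bet held from the end of the
  tail until the exit wins \<open>c - e\<close> or \<open>d - e\<close> and has mean zero. No exit
  by time \<open>n\<close> becomes improbable, because \<open>B n\<close> would lie in a bounded
  interval. The event \<open>A\<close> from the past of 0 is carried along; it will give the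
  independence of the two half paths.\<close>

lemma prob_followed_Cons:
  assumes A: "A \<in> sets (incr {..0})" and adm: "admissible ((c, d) # ps)"
  shows "prob (A \<inter> followed ((c, d) # ps)) = prob (A \<inter> followed ps) * ((endpoint ps - d) / (c - d))"
proof -
  define e where "e = endpoint ps"
  let ?U = "(c, d) # ps" and ?L = "(d, c) # ps"
  have admL: "admissible ?L" and admp: "admissible ps" using adm by auto
  have e: "min c d < e" "e < max c d" and cd: "c \<noteq> d" using adm by (auto simp: e_def)
  have AW: "A \<in> events" using A sets_incr_subset by blast
  have Rm: "reached qs t \<in> sets (incr {..t})" if "admissible qs" "0 \<le> t" for qs t
    using reached_measurable[OF that] sets_incr_mono[of "{0..t}" "{..t}"] by auto
  have Re: "reached qs (real n) \<in> events" if "admissible qs" for qs and n :: nat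
    using Rm[OF that, of "real n"] sets_incr_subset by auto
  have sub: "reached (p # ps) t \<subseteq> reached ps t" for p t
  proof
    fix x assume "x \<in> reached (p # ps) t"
    then obtain u where "x \<in> space W" "u \<le> t" "follows (\<lambda>r. B r x) (p # ps) u" unfolding reached_def by blast
    moreover from follows_ConsD[OF this(3)] obtain s where "s < u" "follows (\<lambda>r. B r x) ps s" by blast
    ultimately show "x \<in> reached ps t" unfolding reached_def by (intro CollectI conjI exI[of _ s]) simp_all
  qed
  have disj: "reached ?U t \<inter> reached ?L t' = {}" for t t'
  proof -
    have False if "follows w ?U s" "follows w ?L s'" for w s s'
    proof -
      from that obtain a b where "follows w ps a" "hits w a c d s" "follows w ps b" "hits w b d c s'" by auto
      with follows_unique[of w ps a b] hits_exclusive[of w a c d s s'] show False by blast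
    qed
    then show ?thesis unfolding reached_def by blast
  qed
  \<comment> \<open>The bet is on while the tail has been followed and neither level has yet been
    hit.\<close>
  define J where "J t = A \<inter> (reached ps t - reached ?U t - reached ?L t)" for t
  have Jm: "J t \<in> sets (incr {..t})" if "0 \<le> t" for t
    unfolding J_def using that Rm[OF admp] Rm[OF adm] Rm[OF admL] A sets_incr_mono[of "{..0}" "{..t}"] by auto
  define E where "E n x = indicator A x * (if x \<in> reached ?U (real n) then c - e else if x \<in> reached ?L (real n) then d - e
    else if x \<in> reached ps (real n) then B (real n) x - e else 0)" for n :: nat and x
  have inside: "min c d < B (real n) x \<and> B (real n) x < max c d"
    if x: "x \<in> reached ps (real n)" "x \<notin> reached ?U (real n)" "x \<notin> reached ?L (real n)" for x n
  proof (rule ccontr)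
    assume out: "\<not> ?thesis"
    obtain s where s: "x \<in> space W" "s \<le> real n" "follows (\<lambda>r. B r x) ps s" using x(1) by (auto simp: reached_def)
    have "B s x = e" using follows_endpoint[OF s(3)] B_0[OF s(1)] by (simp add: e_def)
    with e out s(2) obtain t where "t \<le> real n" "hits (\<lambda>r. B r x) s c d t \<or> hits (\<lambda>r. B r x) s d c t"
      using first_exit[OF B_continuous[OF s(1)], of c d s "real n"] by auto
    with s x(2,3) show False unfolding reached_def by auto
  qed
  let ?S = "\<lambda>n x m. \<Sum>j<n * 2 ^ m. (B (real (Suc j) / 2 ^ m) x - B (real j / 2 ^ m) x) * indicator (J (real j / 2 ^ m)) x"
  have lim: "?S n x \<longlonglongrightarrow> E n x" if x: "x \<in> space W" for n x
  proof (cases "x \<in> A \<and> x \<in> reached ps (real n)")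
    case False
    have "x \<notin> J (real j / 2 ^ m)" if "j < n * 2 ^ m" for j m
    proof -
      have "real j \<le> real n * 2 ^ m" using that by (metis less_imp_le of_nat_le_iff of_nat_mult of_nat_numeral of_nat_power)
      then have "real j / 2 ^ m \<le> real n" by (simp add: divide_le_eq)
      with False reached_mono[of "real j / 2 ^ m" "real n" ps] show ?thesis by (auto simp: J_def)
    qed
    then have "?S n x m = 0" for m by (intro sum.neutral) auto
    moreover have "E n x = 0" using False sub by (auto simp: E_def)
    ultimately show ?thesis by simp
  next
    case True
    then obtain s where s: "s \<le> real n" "follows (\<lambda>r. B r x) ps s" by (auto simp: reached_def)
    have Bs: "B s x = e" using follows_endpoint[OF s(2)] B_0[OF x] by (simp add: e_def)
    have s0: "0 \<le> s" using follows_nonneg[OF s(2)] .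
    obtain t where t: "s \<le> t" "t \<le> real n" "E n x = B t x - B s x"
      "\<And>r. r < real n \<Longrightarrow> x \<in> J r \<longleftrightarrow> s \<le> r \<and> r < t"
    proof -
      consider "x \<in> reached ?U (real n)" | "x \<in> reached ?L (real n)" | "x \<notin> reached ?U (real n)" "x \<notin> reached ?L (real n)" by blast
      then show ?thesis
      proof cases
        case 1
        then obtain t where t: "t \<le> real n" "follows (\<lambda>r. B r x) ?U t" by (auto simp: reached_def)
        have st: "s < t" using follows_ConsD[OF t(2)] follows_unique[OF s(2)] by blast
        show ?thesis
        proof (rule that[of t])
          show "E n x = B t x - B s x" using 1 True follows_endpoint[OF t(2)] B_0[OF x] Bs by (simp add: E_def)
          show "x \<in> J r \<longleftrightarrow> s \<le> r \<and> r < t" for r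
          proof -
            have "x \<notin> reached ?L r" using 1 disj[of "real n" r] by blast
            with True show ?thesis unfolding J_def by (simp add: reached_iff[OF s(2) x] reached_iff[OF t(2) x] not_le)
          qed
        qed (use st t in auto)
      next
        case 2
        then obtain t where t: "t \<le> real n" "follows (\<lambda>r. B r x) ?L t" by (auto simp: reached_def)
        have st: "s < t" using follows_ConsD[OF t(2)] follows_unique[OF s(2)] by blast
        show ?thesis
        proof (rule that[of t])
          show "E n x = B t x - B s x" using 2 True disj[of "real n" "real n"] follows_endpoint[OF t(2)] B_0[OF x] Bs by (auto simp: E_def)
          show "x \<in> J r \<longleftrightarrow> s \<le> r \<and> r < t" for r
          proof -
            have "x \<notin> reached ?U r" using 2 disj[of r "real n"] by blast
            with True show ?thesis unfolding J_def by (simp add: reached_iff[OF s(2) x] reached_iff[OF t(2) x] not_le)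
          qed
        qed (use st t in auto)
      next
        case 3
        show ?thesis
        proof (rule that[of "real n"])
          show "E n x = B (real n) x - B s x" using 3 True Bs by (simp add: E_def)
          show "x \<in> J r \<longleftrightarrow> s \<le> r \<and> r < real n" if "r < real n" for r
            using True 3 that reached_mono[of r "real n" ?U] reached_mono[of r "real n" ?L] unfolding J_def
            by (auto simp: reached_iff[OF s(2) x])
        qed (use s in auto)
      qed
    qed
    have "?S n x m = (\<Sum>j<n * 2 ^ m. (B (real (Suc j) / 2 ^ m) x - B (real j / 2 ^ m) x) * of_bool (s \<le> real j / 2 ^ m \<and> real j / 2 ^ m < t))" for m
    proof (intro sum.cong refl arg_cong2[where f="(*)"])
      fix j assume "j \<in> {..<n * 2 ^ m}"
      then have "real j < real (n * 2 ^ m)" by (simp only: lessThan_iff of_nat_less_iff)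
      then have "real j / 2 ^ m < real n" by (simp add: divide_less_eq)
      from t(4)[OF this] show "indicator (J (real j / 2 ^ m)) x = (of_bool (s \<le> real j / 2 ^ m \<and> real j / 2 ^ m < t) :: real)"
        by (simp only: indicator_def)
    qed
    then show ?thesis using dyadic_stopped_sum[OF B_continuous[OF x] s0 t(1,2)] t(3) by simp
  qed
  have Em: "E n \<in> borel_measurable W" for n
    unfolding E_def using AW Re[OF adm] Re[OF admL] Re[OF admp] by measurable
  have Eb: "\<bar>E n x\<bar> \<le> \<bar>c - d\<bar>" for n x
    using e inside[of x n] by (auto simp: E_def indicator_def min_def max_def split: if_splits)
  have E0: "expectation (E n) = 0" for n
    by (rule optional_stopping[OF Jm lim Em Eb])
  let ?K = "\<bar>c - d\<bar>"
  let ?R = "\<lambda>n. A \<inter> (reached ps (real n) - reached ?U (real n) - reached ?L (real n))"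
  let ?u = "\<lambda>n::nat. prob (A \<inter> reached ?U (real n))" and ?l = "\<lambda>n::nat. prob (A \<inter> reached ?L (real n))"
    and ?p = "\<lambda>n::nat. prob (A \<inter> reached ps (real n))"
  have RW: "?R n \<in> events" for n using AW Re[OF adm] Re[OF admL] Re[OF admp] by auto
  have R0: "(\<lambda>n. prob (?R n)) \<longlonglongrightarrow> 0"
  proof (rule tendsto_sandwich[OF _ _ tendsto_const increment_small_prob_tendsto[of ?K e]])
    have "prob (?R n) \<le> prob {x \<in> space W. \<bar>B (real n) x - e\<bar> \<le> ?K}" for n
    proof (rule finite_measure_mono)
      show "?R n \<subseteq> {x \<in> space W. \<bar>B (real n) x - e\<bar> \<le> ?K}"
      proof
        fix x assume x: "x \<in> ?R n"
        then have "min c d < B (real n) x \<and> B (real n) x < max c d" by (intro inside) auto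
        then have "\<bar>B (real n) x - e\<bar> \<le> ?K" using e by (auto simp: min_def max_def split: if_splits)
        moreover have "x \<in> space W" using x by (simp add: reached_def)
        ultimately show "x \<in> {x \<in> space W. \<bar>B (real n) x - e\<bar> \<le> ?K}" by simp
      qed
    qed measurable
    then show "\<forall>\<^sub>F n in sequentially. prob (?R n) \<le> prob {x \<in> space W. \<bar>B (real n) x - e\<bar> \<le> ?K}" by simp
  qed auto
  have split: "?p n = ?u n + ?l n + prob (?R n)" for n
  proof -
    have "A \<inter> reached ps (real n) = (A \<inter> reached ?U (real n) \<union> A \<inter> reached ?L (real n)) \<union> ?R n"
      using sub by blast
    moreover have "prob \<dots> = prob (A \<inter> reached ?U (real n) \<union> A \<inter> reached ?L (real n)) + prob (?R n)"
      using AW Re[OF adm] Re[OF admL] RW by (intro finite_measure_Union) auto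
    moreover have "prob (A \<inter> reached ?U (real n) \<union> A \<inter> reached ?L (real n)) = ?u n + ?l n"
    proof (rule finite_measure_Union)
      show "(A \<inter> reached ?U (real n)) \<inter> (A \<inter> reached ?L (real n)) = {}"
        using disj[of "real n" "real n"] by blast
    qed (use AW Re[OF adm] Re[OF admL] in auto)
    ultimately show ?thesis by simp
  qed
  have mart: "\<bar>(c - e) * ?u n + (d - e) * ?l n\<bar> \<le> ?K * prob (?R n)" for n
  proof -
    have eq: "E n x = (c - e) * indicator (A \<inter> reached ?U (real n)) x + (d - e) * indicator (A \<inter> reached ?L (real n)) x
        + (E n x * indicator (?R n) x)" for x
      using disj[of "real n" "real n"] sub[of "(c, d)" "real n"] sub[of "(d, c)" "real n"] by (auto simp: E_def indicator_def)
    have Ei: "integrable W (\<lambda>x. E n x * indicator (?R n) x)"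
      by (rule integrable_real_mult_indicator[OF RW integrable_const_bound[of _ ?K]]) (use Em[of n] Eb in auto)
    have Ki: "integrable W (\<lambda>x. ?K * indicator (?R n) x)"
      by (rule integrable_real_mult_indicator[OF RW]) simp
    have "0 = expectation (\<lambda>x. (c - e) * indicator (A \<inter> reached ?U (real n)) x + (d - e) * indicator (A \<inter> reached ?L (real n)) x
        + (E n x * indicator (?R n) x))"
      using E0[of n] eq by simp
    also have "\<dots> = (c - e) * ?u n + (d - e) * ?l n + expectation (\<lambda>x. E n x * indicator (?R n) x)"
      using AW Re[OF adm] Re[OF admL] Ei by (simp add: emeasure_eq_measure)
    finally have "\<bar>(c - e) * ?u n + (d - e) * ?l n\<bar> = \<bar>expectation (\<lambda>x. E n x * indicator (?R n) x)\<bar>" by linarith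
    also have "\<dots> \<le> expectation (\<lambda>x. \<bar>E n x * indicator (?R n) x\<bar>)" by (rule integral_abs_bound)
    also have "\<dots> \<le> expectation (\<lambda>x. ?K * indicator (?R n) x)"
    proof (rule integral_mono[OF integrable_abs[OF Ei] Ki])
      fix x show "\<bar>E n x * indicator (?R n) x\<bar> \<le> ?K * indicator (?R n) x"
        using Eb[of n x] by (simp add: indicator_def)
    qed
    also have "\<dots> = ?K * prob (?R n)" using RW[of n] by simp
    finally show ?thesis .
  qed
  note lims = prob_reached_limit[OF AW adm] prob_reached_limit[OF AW admL] prob_reached_limit[OF AW admp]
  let ?PU = "prob (A \<inter> followed ?U)" and ?PL = "prob (A \<inter> followed ?L)" and ?PP = "prob (A \<inter> followed ps)"
  have "?p \<longlonglongrightarrow> ?PU + ?PL + 0"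
    unfolding split by (intro tendsto_add lims R0)
  from LIMSEQ_unique[OF lims(3) this] have sum: "?PP = ?PU + ?PL" by simp
  have "(\<lambda>n. (c - e) * ?u n + (d - e) * ?l n) \<longlonglongrightarrow> (c - e) * ?PU + (d - e) * ?PL"
    by (intro tendsto_intros lims)
  moreover have "(\<lambda>n. (c - e) * ?u n + (d - e) * ?l n) \<longlonglongrightarrow> 0"
  proof (rule Lim_null_comparison)
    show "\<forall>\<^sub>F n in sequentially. norm ((c - e) * ?u n + (d - e) * ?l n) \<le> ?K * prob (?R n)"
      unfolding real_norm_def by (intro always_eventually allI mart)
    show "(\<lambda>n. ?K * prob (?R n)) \<longlonglongrightarrow> 0" by (rule tendsto_mult_right_zero[OF R0])
  qed
  ultimately have "(c - e) * ?PU + (d - e) * ?PL = 0" by (rule LIMSEQ_unique)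
  \<comment> \<open>Conservation of mass and of the mean are two linear relations that determine
    \<open>?PU\<close>.\<close>
  then have "?PU * (c - d) = ?PP * (e - d)" unfolding sum by (simp add: algebra_simps)
  then show ?thesis using cd by (simp add: e_def eq_divide_eq)
qed

lemma prob_followed:
  assumes "A \<in> sets (incr {..0})" "admissible ps"
  shows "prob (A \<inter> followed ps) = prob A * path_prob ps"
  using assms(2)
proof (induction ps)
  case Nil
  have "A \<inter> followed [] = A" using sets.sets_into_space[OF assms(1)] by (auto simp: followed_def)
  then show ?case by simp
next
  case (Cons p ps)
  then show ?case using prob_followed_Cons[OF assms(1), of "fst p" "snd p" ps] by simp
qed

definition followed_left :: "(real \<times> real) list \<Rightarrow> 'w set" where
  "followed_left ps = {x \<in> space W. \<exists>t. follows (\<lambda>r. B (- r) x) ps t}"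

lemma
  assumes "admissible qs"
  shows followed_left_measurable: "followed_left qs \<in> sets (incr {..0})"
    and followed_left_event: "followed_left qs \<in> events"
    and prob_followed_left: "prob (followed_left qs) = path_prob qs"
proof -
  interpret R: brownian W "\<lambda>t. B (- t)" by unfold_locales (rule brownian_reflect)
  have "sets (R.incr {0..}) \<subseteq> sets (incr {..0})"
    unfolding sets_incr R.sets_incr
  proof (rule sigma_sets_mono', rule subsetI)
    fix X assume "X \<in> {(\<lambda>x. B (- s) x - B (- u) x) -` A \<inter> space W |s u A. s \<in> {0..} \<and> u \<in> {0..} \<and> A \<in> sets borel}"
    then obtain s u A where "X = (\<lambda>x. B (- s) x - B (- u) x) -` A \<inter> space W" "s \<ge> 0" "u \<ge> 0" "A \<in> sets borel" by auto
    then show "X \<in> {(\<lambda>x. B s x - B u x) -` A \<inter> space W |s u A. s \<in> {..0} \<and> u \<in> {..0} \<and> A \<in> sets borel}"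
      by (intro CollectI exI[of _ "-s"] exI[of _ "-u"] exI[of _ A]) auto
  qed
  moreover have eq: "followed_left qs = R.followed qs" by (simp add: followed_left_def R.followed_def)
  ultimately show "followed_left qs \<in> sets (incr {..0})" using R.followed_measurable[OF assms] by auto
  then show "followed_left qs \<in> events" using sets_incr_subset by blast
  have "R.followed qs = space W \<inter> R.followed qs" by (auto simp: R.followed_def)
  then show "prob (followed_left qs) = path_prob qs"
    using R.prob_followed[OF _ assms, of "space W"] sets.top[of "R.incr {..0}"] by (simp add: eq prob_space)
qed

lemma prob_followed_both:
  assumes "admissible ps" "admissible qs"
  shows "prob (followed ps \<inter> followed_left qs) = path_prob ps * path_prob qs"
  using prob_followed[OF followed_left_measurable[OF assms(2)] assms(1)] prob_followed_left[OF assms(2)]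
  by (simp add: Int_commute mult.commute)

end

section \<open>Minima of Brownian motion\<close>

text \<open>Fubini: given the value of \<open>Y\<close>, the event asks \<open>X\<close> to take one
  prescribed value.\<close>

lemma (in prob_space) indep_atomless_add:
  fixes X Y :: "'a \<Rightarrow> real"
  assumes ind: "indep_var borel X borel Y" and X: "\<And>c. prob {x \<in> space M. X x = c} = 0"
  shows "prob {x \<in> space M. X x + Y x = c} = 0"
proof -
  have [measurable]: "random_variable borel X" "random_variable borel Y"
    using ind by (auto dest: indep_var_rv1 indep_var_rv2)
  have dist: "distr M (borel \<Otimes>\<^sub>M borel) (\<lambda>x. (X x, Y x)) = distr M borel X \<Otimes>\<^sub>M distr M borel Y"
    using ind by (simp add: indep_var_distribution_eq)
  have X0: "emeasure M {x \<in> space M. X x = d} = 0" for d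
    using X[of d] by (simp add: emeasure_eq_measure)
  interpret DX: prob_space "distr M borel X" by (rule prob_space_distr) simp
  interpret DY: prob_space "distr M borel Y" by (rule prob_space_distr) simp
  interpret pair_prob_space "distr M borel X" "distr M borel Y" ..
  let ?A = "{z :: real \<times> real. fst z + snd z = c}"
  have "{z \<in> space (borel \<Otimes>\<^sub>M borel). fst z + snd z = c} \<in> sets (borel \<Otimes>\<^sub>M (borel :: real measure))"
    by measurable
  then have A[measurable]: "?A \<in> sets (borel \<Otimes>\<^sub>M borel)" by (simp add: space_pair_measure)
  have "emeasure M {x \<in> space M. X x + Y x = c} = emeasure (distr M (borel \<Otimes>\<^sub>M borel) (\<lambda>x. (X x, Y x))) ?A"
    by (subst emeasure_distr) (auto intro!: arg_cong[where f="emeasure M"])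
  also have "\<dots> = emeasure (distr M borel X \<Otimes>\<^sub>M distr M borel Y) ?A"
    by (simp only: dist)
  also have "\<dots> = (\<integral>\<^sup>+y. emeasure (distr M borel X) ((\<lambda>x. (x, y)) -` ?A) \<partial>distr M borel Y)"
    by (rule emeasure_pair_measure_alt2) simp
  also have "\<dots> = (\<integral>\<^sup>+y. 0 \<partial>distr M borel Y)"
  proof (rule nn_integral_cong)
    fix y
    have "emeasure (distr M borel X) ((\<lambda>x. (x, y)) -` ?A) = emeasure M {x \<in> space M. X x = c - y}"
      by (subst emeasure_distr) (auto intro!: arg_cong[where f="emeasure M"])
    then show "emeasure (distr M borel X) ((\<lambda>x. (x, y)) -` ?A) = 0"
      using X0[of "c - y"] by simp
  qed
  finally show ?thesis by (simp add: measure_def)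
qed

lemma (in prob_space) indep_set_swap: "indep_set F G \<Longrightarrow> indep_set G F"
proof (rule indep_setI)
  assume ind: "indep_set F G"
  show "G \<subseteq> events" "F \<subseteq> events" using ind by (rule indep_setD_ev2, rule indep_setD_ev1)
  fix a b assume "a \<in> G" "b \<in> F"
  then have "prob (b \<inter> a) = prob b * prob a" by (intro indep_setD[OF ind])
  then show "prob (a \<inter> b) = prob a * prob b" by (simp only: Int_commute mult.commute)
qed

lemma (in prob_space) indep_var_swap: "indep_var S X T Y \<Longrightarrow> indep_var T Y S X"
  unfolding indep_var_eq using indep_set_swap by blast

definition path_min :: "(real \<Rightarrow> real) \<Rightarrow> real \<Rightarrow> real \<Rightarrow> real" where
  "path_min w p q = Inf (w ` {p..q})"

lemma path_min:
  assumes "continuous_on UNIV w" "p \<le> q"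
  shows "\<And>t. p \<le> t \<Longrightarrow> t \<le> q \<Longrightarrow> path_min w p q \<le> w t" "\<exists>t\<in>{p..q}. w t = path_min w p q"
proof -
  have c: "continuous_on {p..q} w" using assms(1) by (rule continuous_on_subset) simp
  obtain t where t: "t \<in> {p..q}" "\<And>s. s \<in> {p..q} \<Longrightarrow> w t \<le> w s"
    using continuous_attains_inf[OF compact_Icc _ c] assms(2) by auto
  have "path_min w p q = w t"
    unfolding path_min_def using t by (intro cInf_eq_minimum) auto
  then show "\<And>t. p \<le> t \<Longrightarrow> t \<le> q \<Longrightarrow> path_min w p q \<le> w t" "\<exists>t\<in>{p..q}. w t = path_min w p q"
    using t by auto
qed

text \<open>Rational fractions of the interval are dense in it and include both end points, whatever
  the real numbers \<open>p\<close> and \<open>q\<close> are; in particular \<open>p = q\<close> is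
  covered.\<close>

lemma path_min_ge_iff:
  assumes "continuous_on UNIV w" "p \<le> q"
  shows "c \<le> path_min w p q \<longleftrightarrow> (\<forall>r::rat. 0 \<le> r \<and> r \<le> 1 \<longrightarrow> c \<le> w (p + (q - p) * of_rat r))"
proof
  assume c: "c \<le> path_min w p q"
  show "\<forall>r::rat. 0 \<le> r \<and> r \<le> 1 \<longrightarrow> c \<le> w (p + (q - p) * of_rat r)"
  proof (intro allI impI)
    fix r :: rat assume "0 \<le> r \<and> r \<le> 1"
    then have "0 \<le> (of_rat r :: real)" "(of_rat r :: real) \<le> 1" by auto
    then have "0 \<le> (q - p) * of_rat r" "(q - p) * of_rat r \<le> q - p" using assms(2) by (auto simp: mult_left_le)
    then show "c \<le> w (p + (q - p) * of_rat r)" using path_min(1)[OF assms, of "p + (q - p) * of_rat r"] c by simp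
  qed
next
  assume R: "\<forall>r::rat. 0 \<le> r \<and> r \<le> 1 \<longrightarrow> c \<le> w (p + (q - p) * of_rat r)"
  obtain t where t: "t \<in> {p..q}" "w t = path_min w p q" using path_min(2)[OF assms] by blast
  show "c \<le> path_min w p q"
  proof (rule ccontr)
    assume "\<not> ?thesis"
    then have wt: "w t < c" using t by simp
    have "p \<noteq> q" using R[rule_format, of 0] wt t by auto
    then have pq: "p < q" using assms(2) by simp
    have "isCont w t" using assms(1) by (simp add: continuous_on_eq_continuous_at)
    with wt have "eventually (\<lambda>s. w s < c) (at t)" by (intro order_tendstoD) (auto simp: isCont_def)
    then obtain d where d: "d > 0" "\<And>s. s \<noteq> t \<Longrightarrow> dist s t < d \<Longrightarrow> w s < c"
      unfolding eventually_at by auto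
    let ?l = "max 0 ((t - d - p) / (q - p))" and ?u = "min 1 ((t + d - p) / (q - p))"
    have "0 < (t + d - p) / (q - p)" "(t - d - p) / (q - p) < 1" "(t - d - p) / (q - p) < (t + d - p) / (q - p)"
      using pq t(1) d(1) by (auto simp: divide_strict_right_mono)
    then have "?l < ?u" by simp
    then obtain r :: rat where r: "?l < of_rat r" "of_rat r < ?u" using of_rat_dense by blast
    then have "0 < (of_rat r :: real)" "(of_rat r :: real) < 1" by auto
    then have "0 \<le> r" "r \<le> 1" by auto
    have "t - d < p + (q - p) * of_rat r" "p + (q - p) * of_rat r < t + d"
      using r pq by (auto simp: pos_divide_less_eq pos_less_divide_eq mult.commute)
    then have "w (p + (q - p) * of_rat r) < c"
      using d(2)[of "p + (q - p) * of_rat r"] wt by (cases "p + (q - p) * of_rat r = t") (auto simp: dist_real_def)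
    with R[rule_format, of r] \<open>0 \<le> r\<close> \<open>r \<le> 1\<close> show False by simp
  qed
qed

text \<open>Choosing the leftmost minimiser makes \<open>path_argmin_le_iff\<close> an equivalence
  for every continuous path, whether or not there are ties.\<close>

definition path_argmin :: "(real \<Rightarrow> real) \<Rightarrow> real \<Rightarrow> real \<Rightarrow> real" where
  "path_argmin w p q = Inf {t \<in> {p..q}. w t = path_min w p q}"

lemma path_argmin:
  assumes "continuous_on UNIV w" "p \<le> q"
  shows "p \<le> path_argmin w p q" "path_argmin w p q \<le> q" "w (path_argmin w p q) = path_min w p q"
    "\<And>t. p \<le> t \<Longrightarrow> t < path_argmin w p q \<Longrightarrow> path_min w p q < w t"
proof -
  let ?S = "{t \<in> {p..q}. w t = path_min w p q}"
  have "closed ?S"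
  proof -
    have "?S = {p..q} \<inter> {t. w t = path_min w p q}" by auto
    then show ?thesis using assms(1) by (auto intro!: closed_Int closed_Collect_eq continuous_on_const)
  qed
  moreover have ne: "?S \<noteq> {}" using path_min(2)[OF assms] by auto
  moreover have bdd: "bdd_below ?S" by (auto intro: bdd_belowI[of _ p])
  ultimately have "path_argmin w p q \<in> ?S" unfolding path_argmin_def by (intro closed_contains_Inf)
  then show "p \<le> path_argmin w p q" and q: "path_argmin w p q \<le> q" and "w (path_argmin w p q) = path_min w p q" by auto
  fix t assume t: "p \<le> t" "t < path_argmin w p q"
  have "t \<notin> ?S"
  proof
    assume "t \<in> ?S"
    then have "path_argmin w p q \<le> t" unfolding path_argmin_def by (intro cInf_lower bdd)
    with t show False by simp
  qed
  with t q path_min(1)[OF assms, of t] show "path_min w p q < w t" by (auto simp: less_le)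
qed

lemma path_argmin_le_iff:
  assumes "continuous_on UNIV w" "p \<le> t" "t \<le> q"
  shows "path_argmin w p q \<le> t \<longleftrightarrow> path_min w p t \<le> path_min w t q"
proof
  have pq: "p \<le> q" using assms by simp
  note am = path_argmin[OF assms(1) pq]
  {
    assume "path_argmin w p q \<le> t"
    then have "path_min w p t \<le> path_min w p q"
      using path_min(1)[OF assms(1,2), of "path_argmin w p q"] am by simp
    also obtain s where s: "s \<in> {t..q}" "w s = path_min w t q" using path_min(2)[OF assms(1,3)] by blast
    have "path_min w p q \<le> path_min w t q" using path_min(1)[OF assms(1) pq, of s] s assms(2) by auto
    finally show "path_min w p t \<le> path_min w t q" .
  next
    assume le: "path_min w p t \<le> path_min w t q"
    obtain s where s: "s \<in> {p..t}" "w s = path_min w p t" using path_min(2)[OF assms(1,2)] by blast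
    show "path_argmin w p q \<le> t"
    proof (rule ccontr)
      assume "\<not> ?thesis"
      then have "path_min w p q < w s" "path_min w t q \<le> path_min w p q"
        using am(4)[of s] s path_min(1)[OF assms(1,3), of "path_argmin w p q"] am by auto
      with le s show False by simp
    qed
  }
qed

context brownian
begin

abbreviation path :: "'w \<Rightarrow> real \<Rightarrow> real" where "path x \<equiv> \<lambda>t. B t x"

lemma path_min_measurable:
  assumes "p \<le> q" "{p..q} \<subseteq> D" "u \<in> D"
  shows "(\<lambda>x. path_min (path x) p q - B u x) \<in> borel_measurable (incr D)"
proof (rule borel_measurableI_ge)
  fix c
  have "{x \<in> space (incr D). \<forall>r::rat. 0 \<le> r \<and> r \<le> 1 \<longrightarrow> c \<le> B (p + (q - p) * of_rat r) x - B u x} \<in> sets (incr D)"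
  proof (intro sets.sets_Collect_countable_All)
    fix r :: rat
    show "{x \<in> space (incr D). 0 \<le> r \<and> r \<le> 1 \<longrightarrow> c \<le> B (p + (q - p) * of_rat r) x - B u x} \<in> sets (incr D)"
    proof (cases "0 \<le> r \<and> r \<le> 1")
      case True
      then have "0 \<le> (of_rat r :: real)" "(of_rat r :: real) \<le> 1" by auto
      then have "0 \<le> (q - p) * of_rat r" "(q - p) * of_rat r \<le> q - p" using assms(1) by (auto simp: mult_left_le)
      then have "(\<lambda>x. B (p + (q - p) * of_rat r) x - B u x) \<in> borel_measurable (incr D)"
        using assms(2,3) by (intro increment_incr) auto
      then have "{x \<in> space (incr D). c \<le> B (p + (q - p) * of_rat r) x - B u x} \<in> sets (incr D)"
        by (intro borel_measurable_le borel_measurable_const)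
      with True show ?thesis by simp
    next
      case False
      then have "{x \<in> space (incr D). 0 \<le> r \<and> r \<le> 1 \<longrightarrow> c \<le> B (p + (q - p) * of_rat r) x - B u x} = space (incr D)" by blast
      then show ?thesis by (metis sets.top)
    qed
  qed
  moreover have "c \<le> path_min (path x) p q - B u x \<longleftrightarrow> (\<forall>r::rat. 0 \<le> r \<and> r \<le> 1 \<longrightarrow> c \<le> B (p + (q - p) * of_rat r) x - B u x)"
    if "x \<in> space W" for x
    using path_min_ge_iff[OF B_continuous[OF that] assms(1), of "c + B u x"] by (simp only: le_diff_eq)
  then have "{x \<in> space (incr D). c \<le> path_min (path x) p q - B u x}
      = {x \<in> space (incr D). \<forall>r::rat. 0 \<le> r \<and> r \<le> 1 \<longrightarrow> c \<le> B (p + (q - p) * of_rat r) x - B u x}" by auto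
  ultimately show "{x \<in> space (incr D). c \<le> path_min (path x) p q - B u x} \<in> sets (incr D)" by simp
qed

lemma path_argmin_measurable:
  assumes "p \<le> q" "{p..q} \<subseteq> D"
  shows "(\<lambda>x. path_argmin (path x) p q) \<in> borel_measurable (incr D)"
proof (rule borel_measurableI_le)
  fix t
  consider "t < p" | "q < t" | "p \<le> t" "t \<le> q" by linarith
  then show "{x \<in> space (incr D). path_argmin (path x) p q \<le> t} \<in> sets (incr D)"
  proof cases
    case 1
    then have eq: "{x \<in> space (incr D). path_argmin (path x) p q \<le> t} = {}"
      using path_argmin(1)[OF B_continuous assms(1)] by fastforce
    show ?thesis unfolding eq by (rule sets.empty_sets)
  next
    case 2
    then have "{x \<in> space (incr D). path_argmin (path x) p q \<le> t} = space (incr D)"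
      using path_argmin(2)[OF B_continuous assms(1)] by fastforce
    then show ?thesis by (metis sets.top)
  next
    case 3
    have "{x \<in> space (incr D). path_min (path x) p t - B t x \<le> path_min (path x) t q - B t x} \<in> sets (incr D)"
      using assms 3 by (intro borel_measurable_le path_min_measurable) auto
    moreover have "{x \<in> space (incr D). path_argmin (path x) p q \<le> t} = {x \<in> space (incr D). path_min (path x) p t - B t x \<le> path_min (path x) t q - B t x}"
      using path_argmin_le_iff[OF B_continuous 3] by auto
    ultimately show ?thesis by simp
  qed
qed

lemma increment_atomless:
  assumes "s < t" shows "prob {x \<in> space W. B t x - B s x = c} = 0"
  using increment_small_prob[OF assms, of 0 c] measure_nonneg[of W "{x \<in> space W. B t x - B s x = c}"] by simp

text \<open>The difference of the minima contains the increment from \<open>q\<close> to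
  \<open>r\<close> as an independent summand. This increment has no atoms because
  \<open>q < r\<close>, and adding independent summands creates none.\<close>

lemma path_min_ne:
  assumes "p \<le> q" "q < r" "r \<le> s"
  shows "AE x in W. path_min (path x) p q \<noteq> path_min (path x) r s"
proof -
  let ?X = "\<lambda>x. B r x - B q x" and ?Y1 = "\<lambda>x. path_min (path x) p q - B q x" and ?Y2 = "\<lambda>x. path_min (path x) r s - B r x"
  have Y2: "?Y2 \<in> borel_measurable (incr {r..})" using assms by (intro path_min_measurable) auto
  have Y1: "?Y1 \<in> borel_measurable (incr {..q})" using assms by (intro path_min_measurable) auto
  have "indep_var borel ?X borel ?Y2"
    by (rule indep_var_incr[of "{q..r}" "{r..}"]) (use assms Y2 in \<open>auto intro: increment_incr\<close>)
  then have Z0: "prob {x \<in> space W. ?X x + ?Y2 x = c} = 0" for c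
    using increment_atomless[OF assms(2)] by (rule indep_atomless_add)
  have X: "?X \<in> borel_measurable (incr {q..})" using assms by (intro increment_incr) auto
  have Z: "(\<lambda>x. ?X x + ?Y2 x) \<in> borel_measurable (incr {q..})"
    using assms by (intro borel_measurable_add X incr_mono_measurable[OF _ Y2]) auto
  have "indep_var borel (\<lambda>x. - ?Y1 x) borel (\<lambda>x. ?X x + ?Y2 x)"
    by (rule indep_var_incr[of "{..q}" "{q..}", OF _ borel_measurable_uminus[OF Y1] Z]) auto
  then have i: "indep_var borel (\<lambda>x. ?X x + ?Y2 x) borel (\<lambda>x. - ?Y1 x)"
    by (rule indep_var_swap)
  let ?N = "{x \<in> space W. path_min (path x) r s = path_min (path x) p q}"
  have N: "?N = {x \<in> space W. ?X x + ?Y2 x = ?Y1 x}" "?N = {x \<in> space W. ?X x + ?Y2 x + - ?Y1 x = 0}" by auto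
  have "?N \<in> null_sets W"
  proof (rule null_setsI)
    show "emeasure W ?N = 0"
      unfolding N(2) emeasure_eq_measure indep_atomless_add[OF i Z0, of 0] by simp
    show "?N \<in> events"
      unfolding N(1) using measurable_incr_events[OF Z] measurable_incr_events[OF Y1] by (rule borel_measurable_eq)
  qed
  from AE_not_in[OF this] show ?thesis
    by (rule AE_mp) (auto intro!: AE_I2)
qed


text \<open>A path that is nonnegative up to time \<open>l\<close> hits \<open>a\<close> before
  \<open>- a^2\<close> or is within \<open>a\<close> of 0 at time \<open>l\<close>. The first event
  has probability \<open>a^2 / (a + a^2)\<close>: with a lower level of smaller order than
  \<open>a\<close>, both bounds vanish as \<open>a\<close> tends to 0.\<close>

lemma nonneg_null:
  assumes l: "0 < l"
  shows "{x \<in> space W. 0 \<le> path_min (path x) 0 l} \<in> null_sets W"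
proof -
  let ?Z = "{x \<in> space W. 0 \<le> path_min (path x) 0 l}"
  have "{x \<in> space (incr {0..}). 0 \<le> path_min (path x) 0 l - B 0 x} \<in> sets (incr {0..})"
    using l by (intro borel_measurable_le path_min_measurable borel_measurable_const) auto
  moreover have "?Z = {x \<in> space (incr {0..}). 0 \<le> path_min (path x) 0 l - B 0 x}" by (auto simp: B_0)
  ultimately have "?Z \<in> sets (incr {0..})" by (simp only:)
  then have Z: "?Z \<in> events" by (rule subsetD[OF sets_incr_subset])
  have bound: "prob ?Z \<le> a / (1 + a) + 2 * a / sqrt (2 * pi * l)" if a: "0 < a" for a
  proof -
    let ?ps = "[(a, - a\<^sup>2)]"
    have adm: "admissible ?ps" using a by simp
    have "?Z \<subseteq> followed ?ps \<union> {x \<in> space W. \<bar>B l x - B 0 x - 0\<bar> \<le> a}"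
    proof
      fix x assume x: "x \<in> ?Z"
      then have xW: "x \<in> space W" by simp
      have nn: "0 \<le> B t x" if "0 \<le> t" "t \<le> l" for t
        using path_min(1)[OF B_continuous[OF xW], of 0 l t] x that l by auto
      show "x \<in> followed ?ps \<union> {x \<in> space W. \<bar>B l x - B 0 x - 0\<bar> \<le> a}"
      proof (cases "\<bar>B l x\<bar> \<le> a")
        case True
        then show ?thesis using xW B_0[OF xW] by simp
      next
        case False
        obtain t where t: "t \<le> l" "hits (path x) 0 a (- a\<^sup>2) t \<or> hits (path x) 0 (- a\<^sup>2) a t"
        proof (rule first_exit[OF B_continuous[OF xW], of a "- a\<^sup>2" 0 l])
          have sq: "0 < a\<^sup>2" using a by (rule zero_less_power)
          have m1: "min a (- a\<^sup>2) = - a\<^sup>2" by (rule min_absorb2) (use a sq in linarith)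
          have m2: "max a (- a\<^sup>2) = a" by (rule max_absorb1) (use a sq in linarith)
          show "min a (- a\<^sup>2) < B 0 x" "B 0 x < max a (- a\<^sup>2)"
            unfolding m1 m2 B_0[OF xW] using a sq by linarith+
          show "\<not> (min a (- a\<^sup>2) < B l x \<and> B l x < max a (- a\<^sup>2))"
            unfolding m1 m2 using False nn[of l] l by linarith
        qed (use l in auto)
        have "\<not> hits (path x) 0 (- a\<^sup>2) a t"
        proof
          assume "hits (path x) 0 (- a\<^sup>2) a t"
          then have "0 < t" "B t x = - a\<^sup>2" by (auto simp: hits_def)
          with nn[of t] t(1) a show False by simp
        qed
        with t xW show ?thesis by (auto simp: followed_def)
      qed
    qed
    then have "prob ?Z \<le> prob (followed ?ps \<union> {x \<in> space W. \<bar>B l x - B 0 x - 0\<bar> \<le> a})"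
      using followed_event[OF adm] by (intro finite_measure_mono) auto
    also have "\<dots> \<le> prob (followed ?ps) + prob {x \<in> space W. \<bar>B l x - B 0 x - 0\<bar> \<le> a}"
      using followed_event[OF adm] by (intro measure_Un_le) auto
    also have "prob (followed ?ps) = a / (1 + a)"
    proof -
      have "prob (followed ?ps) = prob (space W \<inter> followed ?ps)" by (rule arg_cong[where f=prob]) (auto simp: followed_def)
      also have "\<dots> = prob (space W) * path_prob ?ps"
        by (rule prob_followed[OF _ adm]) (metis sets.top space_incr)
      also have "\<dots> = a * a / (a * (1 + a))" by (simp add: prob_space power2_eq_square distrib_left)
      also have "\<dots> = a / (1 + a)" using a by simp
      finally show ?thesis .
    qed
    also have "prob {x \<in> space W. \<bar>B l x - B 0 x - 0\<bar> \<le> a} \<le> 2 * a / sqrt (2 * pi * (l - 0))"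
      using l a by (intro increment_small_prob) auto
    finally show ?thesis by (simp only: diff_0_right add_left_mono)
  qed
  have "((\<lambda>a. a / (1 + a) + 2 * a / sqrt (2 * pi * l)) \<longlongrightarrow> 0) (at_right 0)"
    using l by (auto intro!: tendsto_eq_intros)
  then have "prob ?Z \<le> 0"
  proof (rule tendsto_lowerbound)
    show "\<forall>\<^sub>F a in at_right 0. prob ?Z \<le> a / (1 + a) + 2 * a / sqrt (2 * pi * l)"
      using eventually_at_right_less[of "0::real"] by eventually_elim (rule bound)
  qed simp
  then show ?thesis using Z by (intro null_setsI) (simp_all only: emeasure_eq_measure measure_le_0_iff ennreal_0)
qed

lemma path_min_at_left_end_null:
  assumes "s < q" shows "AE x in W. path_min (path x) s q < B s x"
proof -
  interpret S: brownian W "\<lambda>t x. B (s + t) x - B s x" by unfold_locales (rule brownian_shift)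
  have "AE x in W. x \<notin> {x \<in> space W. 0 \<le> path_min (\<lambda>t. B (s + t) x - B s x) 0 (q - s)}"
    using assms by (intro AE_not_in S.nonneg_null) simp
  then show ?thesis
  proof (rule AE_mp, intro AE_I2 impI)
    fix x assume x: "x \<in> space W" "x \<notin> {x \<in> space W. 0 \<le> path_min (\<lambda>t. B (s + t) x - B s x) 0 (q - s)}"
    then have "path_min (\<lambda>t. B (s + t) x - B s x) 0 (q - s) < 0" by simp
    then obtain t where t: "0 \<le> t" "t \<le> q - s" "B (s + t) x < B s x"
      using path_min(2)[OF S.B_continuous[OF x(1)], of 0 "q - s"] assms by force
    then have "path_min (path x) s q \<le> B (s + t) x"
      using path_min(1)[OF B_continuous[OF x(1)], of s q "s + t"] assms by simp
    with t show "path_min (path x) s q < B s x" by simp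
  qed
qed

lemma path_min_at_right_end_null:
  assumes "p < s" shows "AE x in W. path_min (path x) p s < B s x"
proof -
  interpret R: brownian W "\<lambda>t. B (- t)" by unfold_locales (rule brownian_reflect)
  have "AE x in W. path_min (\<lambda>t. B (- t) x) (- s) (- p) < B (- (- s)) x"
    using assms by (intro R.path_min_at_left_end_null) simp
  moreover have "path_min (\<lambda>t. B (- t) x) (- s) (- p) = path_min (path x) p s" for x
  proof -
    have "(\<lambda>t. B (- t) x) ` {- s..- p} = path x ` (uminus ` {- s..- p})" by (rule image_image[symmetric])
    then show ?thesis by (simp add: path_min_def)
  qed
  ultimately show ?thesis by simp
qed

text \<open>At a minimiser \<open>s\<close> the path does not go below \<open>B s\<close> on either
  side of \<open>s\<close> within the interval, and this is a null event on each nondegenerate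
  side.\<close>

lemma path_argmin_atomless:
  assumes "p < q" shows "prob {x \<in> space W. path_argmin (path x) p q = s} = 0"
proof -
  have "AE x in W. path_argmin (path x) p q \<noteq> s"
  proof -
    consider "s < p \<or> q < s" | "p \<le> s" "s < q" | "p < s" "s = q" using assms by linarith
    then show ?thesis
    proof cases
      case 1
      then show ?thesis using path_argmin(1,2)[OF B_continuous, of _ p q] assms by (intro AE_I2) force
    next
      case 2
      from path_min_at_left_end_null[OF 2(2)] show ?thesis
      proof (rule AE_mp, intro AE_I2 impI notI)
        fix x assume x: "x \<in> space W" "path_min (path x) s q < B s x" "path_argmin (path x) p q = s"
        obtain t where "t \<in> {s..q}" "B t x = path_min (path x) s q"
          using path_min(2)[OF B_continuous[OF x(1)], of s q] 2 by auto
        with path_min(1)[OF B_continuous[OF x(1)], of p q t] path_argmin(3)[OF B_continuous[OF x(1)], of p q] x 2 assms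
        show False by auto
      qed
    next
      case 3
      from path_min_at_right_end_null[OF 3(1)] show ?thesis
      proof (rule AE_mp, intro AE_I2 impI notI)
        fix x assume x: "x \<in> space W" "path_min (path x) p s < B s x" "path_argmin (path x) p q = s"
        with path_argmin(3)[OF B_continuous[OF x(1)], of p q] 3 show False by auto
      qed
    qed
  qed
  moreover have "(\<lambda>x. path_argmin (path x) p q) \<in> borel_measurable W"
    using path_argmin_measurable[of p q UNIV] assms by (auto intro: measurable_incr_events)
  ultimately show ?thesis by (subst prob_eq_0) auto
qed

lemma path_argmin_gap:
  assumes "p < q" "q \<le> r" "r < s"
  shows "AE x in W. path_argmin (path x) r s - path_argmin (path x) p q \<noteq> c"
proof -
  have a: "(\<lambda>x. path_argmin (path x) p q) \<in> borel_measurable (incr {p..q})"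
    "(\<lambda>x. path_argmin (path x) r s) \<in> borel_measurable (incr {r..s})"
    using assms by (auto intro!: path_argmin_measurable)
  have "indep_var borel (\<lambda>x. - path_argmin (path x) p q) borel (\<lambda>x. path_argmin (path x) r s)"
    by (rule indep_var_incr[of "{p..q}" "{r..s}"]) (use assms a in auto)
  moreover have "prob {x \<in> space W. - path_argmin (path x) p q = d} = 0" for d
  proof -
    have "{x \<in> space W. - path_argmin (path x) p q = d} = {x \<in> space W. path_argmin (path x) p q = - d}" by auto
    then show ?thesis using path_argmin_atomless[OF assms(1), of "-d"] by simp
  qed
  ultimately have "prob {x \<in> space W. - path_argmin (path x) p q + path_argmin (path x) r s = c} = 0"
    by (rule indep_atomless_add)
  moreover have "random_variable borel (\<lambda>x. - path_argmin (path x) p q + path_argmin (path x) r s)"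
    using a[THEN measurable_incr_events] by measurable
  ultimately have "AE x in W. - path_argmin (path x) p q + path_argmin (path x) r s \<noteq> c"
    by (subst (asm) prob_eq_0) auto
  then show ?thesis by (rule AE_mp) auto
qed

end

section \<open>Valleys\<close>

text \<open>A particle that starts at \<open>0\<close> and crosses only barriers lower than \<open>H\<close> is led to the bottom \<open>b \<ge> 0\<close>
  and is held there between the walls \<open>a\<close> and \<open>c\<close>. Bottoms on the left are those of the reflected path.\<close>

definition valley :: "real \<Rightarrow> (real \<Rightarrow> real) \<Rightarrow> real \<Rightarrow> bool" where
  "valley H w b \<longleftrightarrow> 0 \<le> b \<and> (\<exists>a c. a \<le> 0 \<and> b < c \<and> (\<forall>t\<in>{a..c}. w b \<le> w t) \<and> w b + H < w a \<and> w b + H < w c \<and>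
     (\<forall>s t. a \<le> s \<longrightarrow> s \<le> t \<longrightarrow> t \<le> b \<longrightarrow> w t - w s < H) \<and> (\<forall>t\<in>{0..b}. w t < w a))"

text \<open>The conditions of a valley with slack \<open>\<delta>\<close> and with walls inside
  \<open>[-T, T]\<close>. The path must exceed the bottom only at distance \<open>r\<close> or more,
  since no uniform slack is possible close to the bottom.\<close>

definition margin_valley :: "real \<Rightarrow> real \<Rightarrow> real \<Rightarrow> real \<Rightarrow> (real \<Rightarrow> real) \<Rightarrow> real \<Rightarrow> bool" where
  "margin_valley H \<delta> T r w b \<longleftrightarrow> 0 \<le> b \<and> (\<exists>a c. - T \<le> a \<and> a \<le> 0 \<and> b \<le> c \<and> c \<le> T \<and>
     (\<forall>t\<in>{a..c}. r \<le> \<bar>t - b\<bar> \<longrightarrow> w b + \<delta> \<le> w t) \<and> w b + H + \<delta> \<le> w a \<and> w b + H + \<delta> \<le> w c \<and>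
     (\<forall>s t. a \<le> s \<longrightarrow> s \<le> t \<longrightarrow> t \<le> b \<longrightarrow> w t - w s \<le> H - \<delta>) \<and> (\<forall>t\<in>{0..b}. w t + \<delta> \<le> w a))"

lemma margin_valley_mono:
  assumes "margin_valley H \<delta> T r w b" "\<delta>' \<le> \<delta>" "T \<le> T'"
  shows "margin_valley H \<delta>' T' r w b"
proof -
  obtain a c where ac: "- T \<le> a" "a \<le> 0" "b \<le> c" "c \<le> T" "\<And>t. t \<in> {a..c} \<Longrightarrow> r \<le> \<bar>t - b\<bar> \<Longrightarrow> w b + \<delta> \<le> w t"
    "w b + H + \<delta> \<le> w a" "w b + H + \<delta> \<le> w c" "\<And>s t. a \<le> s \<Longrightarrow> s \<le> t \<Longrightarrow> t \<le> b \<Longrightarrow> w t - w s \<le> H - \<delta>"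
    "\<And>t. t \<in> {0..b} \<Longrightarrow> w t + \<delta> \<le> w a" "0 \<le> b"
    using assms(1) unfolding margin_valley_def by blast
  show ?thesis
    unfolding margin_valley_def
  proof (rule conjI[OF ac(10)], rule exI[of _ a], rule exI[of _ c], intro conjI ballI impI allI)
    show "w b + \<delta>' \<le> w t" if "t \<in> {a..c}" "r \<le> \<bar>t - b\<bar>" for t using ac(5)[OF that] assms(2) by linarith
    show "w t - w s \<le> H - \<delta>'" if "a \<le> s" "s \<le> t" "t \<le> b" for s t using ac(8)[OF that] assms(2) by linarith
    show "w t + \<delta>' \<le> w a" if "t \<in> {0..b}" for t using ac(9)[OF that] assms(2) by linarith
  qed (use ac assms in linarith)+
qed

text \<open>Every condition compares two values of the path, and each moves by at most
  \<open>\<delta> / 4\<close>; half of the slack survives.\<close>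

lemma margin_valley_perturb:
  assumes "margin_valley H \<delta> T r w b" "\<And>t. \<bar>t\<bar> \<le> T \<Longrightarrow> \<bar>y t - w t\<bar> \<le> \<delta> / 4"
  shows "margin_valley H (\<delta> / 2) T r y b"
proof -
  obtain a c where ac: "- T \<le> a" "a \<le> 0" "b \<le> c" "c \<le> T" "\<And>t. t \<in> {a..c} \<Longrightarrow> r \<le> \<bar>t - b\<bar> \<Longrightarrow> w b + \<delta> \<le> w t"
    "w b + H + \<delta> \<le> w a" "w b + H + \<delta> \<le> w c" "\<And>s t. a \<le> s \<Longrightarrow> s \<le> t \<Longrightarrow> t \<le> b \<Longrightarrow> w t - w s \<le> H - \<delta>"
    "\<And>t. t \<in> {0..b} \<Longrightarrow> w t + \<delta> \<le> w a" "0 \<le> b"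
    using assms(1) unfolding margin_valley_def by blast
  have near: "y t \<le> w t + \<delta> / 4" "w t \<le> y t + \<delta> / 4" if "a \<le> t" "t \<le> c" for t
  proof -
    have "\<bar>y t - w t\<bar> \<le> \<delta> / 4" using that ac(1,4) by (intro assms(2)) auto
    then show "y t \<le> w t + \<delta> / 4" "w t \<le> y t + \<delta> / 4" by linarith+
  qed
  have nb: "y b \<le> w b + \<delta> / 4" "w b \<le> y b + \<delta> / 4" using near[of b] ac by auto
  have na: "y a \<le> w a + \<delta> / 4" "w a \<le> y a + \<delta> / 4" using near[of a] ac by auto
  have nc: "y c \<le> w c + \<delta> / 4" "w c \<le> y c + \<delta> / 4" using near[of c] ac by auto
  show ?thesis
    unfolding margin_valley_def
  proof (rule conjI[OF ac(10)], rule exI[of _ a], rule exI[of _ c], intro conjI ballI impI allI)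
    show "y b + \<delta> / 2 \<le> y t" if "t \<in> {a..c}" "r \<le> \<bar>t - b\<bar>" for t
      using ac(5)[OF that] near[of t] nb that by auto
    show "y t - y s \<le> H - \<delta> / 2" if "a \<le> s" "s \<le> t" "t \<le> b" for s t
      using ac(8)[OF that] near[of s] near[of t] that ac(3) by auto
    show "y t + \<delta> / 2 \<le> y a" if "t \<in> {0..b}" for t
    proof -
      have "a \<le> t" "t \<le> c" using that ac(2,3) by auto
      with ac(9)[OF that] near[of t] na show ?thesis by linarith
    qed
  qed (use ac na nb nc in linarith)+
qed

text \<open>Each strict inequality holds on a compact set of times or of pairs of times, hence with
  a positive margin. Uniqueness of the minimiser makes the bottom strictly lowest away from
  \<open>b\<close>.\<close>

lemma valley_margin:
  assumes w: "continuous_on UNIV w" and v: "valley H w b" and r: "0 < r"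
    and uniq: "\<And>p q t. p < b \<Longrightarrow> b < q \<Longrightarrow> (\<And>s. s \<in> {p..q} \<Longrightarrow> w b \<le> w s) \<Longrightarrow> p < t \<Longrightarrow> t < q \<Longrightarrow> t \<noteq> b \<Longrightarrow> w b < w t"
    and H: "0 < H"
  obtains \<delta> T where "0 < \<delta>" "margin_valley H \<delta> T r w b"
proof -
  obtain a c where ac: "0 \<le> b" "a \<le> 0" "b < c" "\<And>t. t \<in> {a..c} \<Longrightarrow> w b \<le> w t" "w b + H < w a" "w b + H < w c"
     "\<And>s t. a \<le> s \<Longrightarrow> s \<le> t \<Longrightarrow> t \<le> b \<Longrightarrow> w t - w s < H" "\<And>t. t \<in> {0..b} \<Longrightarrow> w t < w a"
    using v unfolding valley_def by blast
  have cont: "continuous_on A w" for A using w by (rule continuous_on_subset) simp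
  have ab: "a < b" using ac(1,2,5) H by (cases "a = b") auto
  have strict: "w b < w t" if "t \<in> {a..c}" "t \<noteq> b" for t
  proof (cases "t = a \<or> t = c")
    case False
    then show ?thesis using that by (intro uniq[OF ab ac(3,4)]) auto
  qed (use ac(5,6) H in auto)
  obtain d1 where d1: "0 < d1" "\<And>t. t \<in> {a..c} \<Longrightarrow> r \<le> \<bar>t - b\<bar> \<Longrightarrow> w b + d1 \<le> w t"
  proof (cases "{t \<in> {a..c}. r \<le> \<bar>t - b\<bar>} = {}")
    case True
    then show ?thesis by (intro that[of 1]) auto
  next
    case False
    let ?S = "{t \<in> {a..c}. r \<le> \<bar>t - b\<bar>}"
    have "?S = {a..c} \<inter> {t. r \<le> \<bar>t - b\<bar>}" by auto
    then have "compact ?S"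
      by (simp add: compact_Int_closed closed_Collect_le continuous_on_const continuous_on_rabs continuous_on_diff continuous_on_id)
    then obtain z where z: "z \<in> ?S" "\<And>t. t \<in> ?S \<Longrightarrow> w z \<le> w t"
      using continuous_attains_inf[OF _ False cont] by blast
    have "w b < w z" using z(1) r by (intro strict) auto
    then show ?thesis using z(2) by (intro that[of "w z - w b"]) auto
  qed
  obtain d2 where d2: "0 < d2" "\<And>s t. a \<le> s \<Longrightarrow> s \<le> t \<Longrightarrow> t \<le> b \<Longrightarrow> w t - w s \<le> H - d2"
  proof -
    let ?S = "{p \<in> {a..b} \<times> {a..b}. fst p \<le> snd p}"
    have "?S = ({a..b} \<times> {a..b}) \<inter> {p. fst p \<le> snd p}" by auto
    moreover have "closed {p :: real \<times> real. fst p \<le> snd p}"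
      by (intro closed_Collect_le continuous_intros)
    ultimately have "compact ?S" by (simp add: compact_Int_closed compact_Times)
    moreover have "?S \<noteq> {}" using ab by (auto intro!: exI[of _ a])
    moreover have "continuous_on ?S (\<lambda>p. w (snd p) - w (fst p))"
      by (intro continuous_intros continuous_on_compose2[OF w]) auto
    ultimately obtain z where z: "z \<in> ?S" "\<And>p. p \<in> ?S \<Longrightarrow> w (snd p) - w (fst p) \<le> w (snd z) - w (fst z)"
      using continuous_attains_sup[of ?S "\<lambda>p. w (snd p) - w (fst p)"] by blast
    have "w (snd z) - w (fst z) < H" using z(1) by (intro ac(7)) auto
    moreover have "w t - w s \<le> w (snd z) - w (fst z)" if "a \<le> s" "s \<le> t" "t \<le> b" for s t
      using z(2)[of "(s, t)"] that by auto
    ultimately show ?thesis by (intro that[of "H - (w (snd z) - w (fst z))"]) auto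
  qed
  obtain d3 where d3: "0 < d3" "\<And>t. t \<in> {0..b} \<Longrightarrow> w t + d3 \<le> w a"
  proof -
    obtain z where z: "z \<in> {0..b}" "\<And>t. t \<in> {0..b} \<Longrightarrow> w t \<le> w z"
      using continuous_attains_sup[OF compact_Icc _ cont, of 0 b] ac(1) by auto
    show ?thesis using ac(8)[OF z(1)] z(2) by (intro that[of "w a - w z"]) auto
  qed
  define \<delta> where "\<delta> = min (min d1 d2) (min d3 (min (w a - w b - H) (w c - w b - H)))"
  have \<delta>: "\<delta> \<le> d1" "\<delta> \<le> d2" "\<delta> \<le> d3" "\<delta> \<le> w a - w b - H" "\<delta> \<le> w c - w b - H" by (auto simp: \<delta>_def)
  have "margin_valley H \<delta> (max (- a) c) r w b"
    unfolding margin_valley_def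
  proof (rule conjI[OF ac(1)], rule exI[of _ a], rule exI[of _ c], intro conjI ballI impI allI)
    show "w b + \<delta> \<le> w t" if "t \<in> {a..c}" "r \<le> \<bar>t - b\<bar>" for t using d1(2)[OF that] \<delta> by linarith
    show "w t - w s \<le> H - \<delta>" if "a \<le> s" "s \<le> t" "t \<le> b" for s t using d2(2)[OF that] \<delta> by linarith
    show "w t + \<delta> \<le> w a" if "t \<in> {0..b}" for t using d3(2)[OF that] \<delta> by linarith
  qed (use ac \<delta> in auto)
  moreover have "0 < \<delta>" using d1 d2 d3 ac by (simp add: \<delta>_def)
  ultimately show ?thesis by (rule that[rotated])
qed

lemma valley_scale:
  assumes "0 < u" shows "valley H (\<lambda>t. w t / u) b \<longleftrightarrow> valley (u * H) w b"
proof -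
  have "w b / u + H < w t / u \<longleftrightarrow> w b + u * H < w t" "w t / u - w s / u < H \<longleftrightarrow> w t - w s < u * H" for s t
  proof -
    have "w b / u + H = (w b + u * H) / u" "w t / u - w s / u = (w t - w s) / u" "H = (u * H) / u"
      using assms by (simp_all add: add_divide_distrib diff_divide_distrib)
    then show "w b / u + H < w t / u \<longleftrightarrow> w b + u * H < w t" "w t / u - w s / u < H \<longleftrightarrow> w t - w s < u * H"
      using assms by (metis divide_less_cancel order_less_asym)+
  qed
  then show ?thesis using assms unfolding valley_def by (simp add: divide_le_cancel divide_less_cancel)
qed

text \<open>The left wall is placed where the left half path first reaches \<open>y\<close>. As this
  happens before a fall to \<open>y - H\<close>, the path stays in a band of height
  \<open>H\<close>, which bounds the climbs on the left and those from the left into the right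
  half.\<close>

lemma valleyI:
  assumes b: "0 \<le> b" "b < c" and low: "\<And>t. t \<in> {0..c} \<Longrightarrow> w b \<le> w t" and wc: "w b + H < w c"
    and draw: "\<And>s t. 0 \<le> s \<Longrightarrow> s \<le> t \<Longrightarrow> t \<le> b \<Longrightarrow> w t - w s < H" and top: "\<And>t. t \<in> {0..b} \<Longrightarrow> w t < y"
    and y: "w b + H < y" and left: "hits (\<lambda>t. w (- t)) 0 y (y - H) s" and H: "0 < H"
  shows "valley H w b"
proof -
  have s: "0 < s" "w (- s) = y" using left by (auto simp: hits_def)
  have in': "y - H < w t \<and> w t < y" if "- s < t" "t \<le> 0" for t
    using left that H unfolding hits_def by (auto simp: min_def max_def dest!: bspec[of _ _ "- t"])
  have ge: "y - H < w t \<and> w t \<le> y" if "- s \<le> t" "t \<le> 0" for t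
    using in'[of t] that s(2) H by (cases "t = - s") auto
  show ?thesis
    unfolding valley_def
  proof (rule conjI[OF b(1)], rule exI[of _ "- s"], rule exI[of _ c], intro conjI ballI impI allI)
    show "w b \<le> w t" if "t \<in> {- s..c}" for t
      using low[of t] ge[of t] y that by (cases "t \<le> 0") auto
    show "w t - w t' < H" if "- s \<le> t'" "t' \<le> t" "t \<le> b" for t t'
    proof -
      consider "t \<le> 0" | "t' \<le> 0" "0 < t" | "0 < t'" by linarith
      then show ?thesis
      proof cases
        case 1 then show ?thesis using ge[of t] ge[of t'] that by auto
      next
        case 2 then show ?thesis using ge[of t'] top[of t] that by auto
      next
        case 3 then show ?thesis using draw[of t' t] that by auto
      qed
    qed
    show "w t < w (- s)" if "t \<in> {0..b}" for t using top[OF that] s by simp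
  qed (use b s y wc in auto)
qed

text \<open>A left half path that descends by \<open>H\<close> from below \<open>x\<close> before exceeding \<open>x\<close> rules out a valley
  of depth \<open>H\<close> on the right which the walk can leave only above \<open>x\<close>.\<close>

lemma valley_left_descent:
  assumes v: "valley H w b" and s: "0 < s" "w (- s) = x - H" "\<And>t. 0 \<le> t \<Longrightarrow> t < s \<Longrightarrow> w (- t) < x" and H: "0 < H"
    and x: "(\<exists>t\<in>{0..b}. x \<le> w t) \<or> x < w b + H"
  shows False
proof -
  obtain a c where ac: "0 \<le> b" "a \<le> 0" "b < c" "\<And>t. t \<in> {a..c} \<Longrightarrow> w b \<le> w t" "w b + H < w a"
     "\<And>s t. a \<le> s \<Longrightarrow> s \<le> t \<Longrightarrow> t \<le> b \<Longrightarrow> w t - w s < H" "\<And>t. t \<in> {0..b} \<Longrightarrow> w t < w a"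
    using v unfolding valley_def by blast
  have "x < w a" using x ac(5) ac(7) by force
  then have as: "a < - s" using s(2) s(3)[of "- a"] ac(2) H by (cases "- a < s"; cases "a = - s") auto
  from x show False
  proof
    assume "\<exists>t\<in>{0..b}. x \<le> w t"
    then obtain t where "t \<in> {0..b}" "x \<le> w t" by blast
    with ac(6)[of "- s" t] as s show False by auto
  next
    assume "x < w b + H"
    with ac(4)[of "- s"] as s ac show False by auto
  qed
qed

text \<open>Heights are measured in units of \<open>1 / N\<close> of the depth. The index \<open>j\<close> is the least integer such that
  the right half path hits \<open>j - N\<close> before \<open>j\<close>, so the wall on the left has to reach about \<open>j\<close>. The index
  \<open>k\<close> is \<open>0\<close> if already \<open>j - N\<close> is hit before \<open>j - 1\<close>, and otherwise \<open>k - 1\<close> is the number of further descents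
  by one level before the climb of about \<open>N\<close> that ends the cell; the minimum is then within one unit
  below \<open>level N j k\<close>.\<close>

definition level :: "nat \<Rightarrow> nat \<Rightarrow> nat \<Rightarrow> real" where
  "level N j k = real j - real N - real (k - 1)"

text \<open>Indices 0 and 1 end at the same height \<open>j - N\<close>, as the subtraction in
  \<open>level\<close> is truncated; they differ in whether \<open>j - 1\<close> was visited before.
  Each further index descends one level before a rise of \<open>N - 1\<close>.\<close>

fun approach :: "nat \<Rightarrow> nat \<Rightarrow> nat \<Rightarrow> (real \<times> real) list" where
  "approach N j 0 = [(real j - real N, real j - 1)]"
| "approach N j (Suc 0) = [(real j - real N, real j), (real j - 1, real j - real N)]"
| "approach N j (Suc (Suc i)) = (level N j (Suc i) - 1, level N j (Suc i) + real N - 1) # approach N j (Suc i)"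

text \<open>The ascent has two stages because the minimum is known only up to one unit: with
  \<open>m\<close> the level, it lies in \<open>(m - 1, m]\<close>. Until \<open>m + N - 1\<close>
  is reached, before \<open>m - 1\<close>, the climbs are below \<open>N\<close>; going on to
  \<open>m + N + 1\<close> without a return to \<open>m\<close> makes the climb from the minimum
  exceed \<open>N\<close>.\<close>

definition cell :: "nat \<Rightarrow> nat \<Rightarrow> nat \<Rightarrow> (real \<times> real) list" where
  "cell N j k = (level N j k + real N + 1, level N j k) # (level N j k + real N - 1, level N j k - 1) # approach N j k"

lemma level_le: "level N j k \<le> real j - real N"
  by (simp add: level_def)

lemma level_Suc: "level N j (Suc (Suc i)) = level N j (Suc i) - 1"
  by (simp add: level_def)

lemma endpoint_approach: "endpoint (approach N j k) = level N j k"
  by (induction N j k rule: approach.induct) (auto simp: level_def)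

text \<open>The distance 3 from both ends of the range leaves room for the shifts by one or two
  units in the lists for the left half path.\<close>

lemma admissible_approach: "3 \<le> j \<Longrightarrow> j + 3 \<le> N \<Longrightarrow> admissible (approach N j k)"
  by (induction N j k rule: approach.induct) (auto simp: endpoint_approach simp del: of_nat_Suc)

lemma admissible_cell: "3 \<le> j \<Longrightarrow> j + 3 \<le> N \<Longrightarrow> admissible (cell N j k)"
  by (auto simp: cell_def admissible_approach endpoint_approach)

lemma endpoint_cell: "endpoint (cell N j k) = level N j k + real N + 1"
  by (simp add: cell_def)

text \<open>Further descents succeed with probability \<open>(N - 1) / N\<close> each. Their number,
  in units of \<open>N\<close>, becomes exponential with mean 1.\<close>

lemma path_prob_approach:
  assumes "3 \<le> j" "j + 3 \<le> N"
  shows "path_prob (approach N j 0) = (real j - 1) / (real N - 1)"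
    "path_prob (approach N j (Suc i)) = (real N - real j) / (real N - 1) / real N * ((real N - 1) / real N) ^ i"
proof -
  have N: "real N - 1 > 0" "real N > 0" using assms by auto
  show "path_prob (approach N j 0) = (real j - 1) / (real N - 1)"
    using N by (simp add: divide_simps) (simp add: algebra_simps)
  show "path_prob (approach N j (Suc i)) = (real N - real j) / (real N - 1) / real N * ((real N - 1) / real N) ^ i"
  proof (induction i)
    case 0
    show ?case using N by (simp add: divide_simps)
  next
    case (Suc i)
    have "(endpoint (approach N j (Suc i)) - (level N j (Suc i) + real N - 1)) / (level N j (Suc i) - 1 - (level N j (Suc i) + real N - 1))
        = (real N - 1) / real N"
      using N by (simp add: endpoint_approach divide_simps)
    then show ?case by (simp only: approach.simps path_prob.simps fst_conv snd_conv Suc.IH) simp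
  qed
qed

lemma path_prob_cell:
  assumes "3 \<le> j" "j + 3 \<le> N"
  shows "path_prob (cell N j 0) = (real j - 1) / (real N * (real N + 1))"
    "path_prob (cell N j (Suc i)) = (real N - real j) / (real N * (real N + 1)) * (((real N - 1) / real N) ^ i / real N)"
proof -
  have N: "real N - 1 > 0" "real N > 0" "real N + 1 > 0" using assms by auto
  have "path_prob (cell N j k) = path_prob (approach N j k) * (1 / real N) * ((real N - 1) / (real N + 1))" for k
    using N by (simp add: cell_def endpoint_approach)
  then show "path_prob (cell N j 0) = (real j - 1) / (real N * (real N + 1))"
    "path_prob (cell N j (Suc i)) = (real N - real j) / (real N * (real N + 1)) * (((real N - 1) / real N) ^ i / real N)"
    using N by (simp_all add: path_prob_approach[OF assms] del: approach.simps)
qed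

text \<open>The last fact is a dichotomy that later determines how high the left wall must be:
  either the path has come within one unit of \<open>j\<close>, or its level is still
  \<open>j - N\<close>.\<close>

lemma approach_facts:
  assumes "follows w (approach N j k) \<tau>" "w 0 = 0" "3 \<le> j" "j + 3 \<le> N"
  shows "0 \<le> \<tau>" "w \<tau> = level N j k" "\<And>t. 0 \<le> t \<Longrightarrow> t < \<tau> \<Longrightarrow> level N j k < w t \<and> w t < real j"
    "\<And>s t. 0 \<le> s \<Longrightarrow> s \<le> t \<Longrightarrow> t \<le> \<tau> \<Longrightarrow> w t - w s < real N"
    "(\<exists>t\<in>{0..\<tau>}. real j - 1 \<le> w t) \<or> real j \<le> level N j k + real N"
proof -
  have "0 \<le> \<tau> \<and> w \<tau> = level N j k \<and> (\<forall>t. 0 \<le> t \<longrightarrow> t < \<tau> \<longrightarrow> level N j k < w t \<and> w t < real j) \<and>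
    (\<forall>s t. 0 \<le> s \<longrightarrow> s \<le> t \<longrightarrow> t \<le> \<tau> \<longrightarrow> w t - w s < real N) \<and>
    ((\<exists>t\<in>{0..\<tau>}. real j - 1 \<le> w t) \<or> real j \<le> level N j k + real N)"
    using assms
  proof (induction N j k arbitrary: \<tau> rule: approach.induct)
    case (1 N j)
    then have h: "hits w 0 (real j - real N) (real j - 1) \<tau>" by simp
    then have \<tau>: "0 < \<tau>" "w \<tau> = real j - real N" by (auto simp: hits_def)
    have i: "real j - real N < w t \<and> w t < real j - 1" if "0 \<le> t" "t < \<tau>" for t
      using h that 1(4) unfolding hits_def by (auto simp: min_def max_def)
    have d: "w t - w s < real N" if "0 \<le> s" "s \<le> t" "t \<le> \<tau>" for s t
      using i[of s] i[of t] \<tau> that 1(4) by (cases "t = \<tau>"; cases "s = \<tau>") auto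
    show ?case using \<tau> i d by (force simp: level_def)
  next
    case (2 N j)
    then obtain s1 where s1: "hits w 0 (real j - 1) (real j - real N) s1" "hits w s1 (real j - real N) (real j) \<tau>" by auto
    then have t: "0 < s1" "s1 < \<tau>" "w s1 = real j - 1" "w \<tau> = real j - real N" by (auto simp: hits_def)
    have i: "real j - real N < w t \<and> w t < real j" if "0 \<le> t" "t < \<tau>" for t
    proof (cases "t < s1")
      case True
      then show ?thesis using s1(1) that 2(4) unfolding hits_def by (auto simp: min_def max_def dest!: bspec[of _ _ t])
    next
      case False
      then show ?thesis using s1(2) that 2(4) unfolding hits_def by (auto simp: min_def max_def dest!: bspec[of _ _ t])
    qed
    have d: "w t - w s < real N" if "0 \<le> s" "s \<le> t" "t \<le> \<tau>" for s t
      using i[of s] i[of t] t that 2(4) by (cases "t = \<tau>"; cases "s = \<tau>") auto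
    have "\<exists>t\<in>{0..\<tau>}. real j - 1 \<le> w t" using t by (intro bexI[of _ s1]) auto
    then show ?case using t i d by (simp add: level_def)
  next
    case (3 N j i)
    let ?m = "level N j (Suc i)"
    obtain s where s: "follows w (approach N j (Suc i)) s" "hits w s (?m - 1) (?m + real N - 1) \<tau>" using 3(2) by auto
    have IH: "0 \<le> s" "w s = ?m" "\<And>t. 0 \<le> t \<Longrightarrow> t < s \<Longrightarrow> ?m < w t \<and> w t < real j"
      "\<And>a t. 0 \<le> a \<Longrightarrow> a \<le> t \<Longrightarrow> t \<le> s \<Longrightarrow> w t - w a < real N"
      "(\<exists>t\<in>{0..s}. real j - 1 \<le> w t) \<or> real j \<le> ?m + real N"
      using 3(1)[OF s(1) 3(3-5)] by blast+
    have \<tau>: "s < \<tau>" "w \<tau> = ?m - 1" using s(2) by (auto simp: hits_def)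
    have h: "?m - 1 < w t \<and> w t < ?m + real N - 1" if "s \<le> t" "t < \<tau>" for t
      using s(2) that 3(5) unfolding hits_def by (auto simp: min_def max_def dest!: bspec[of _ _ t])
    have mj: "?m + real N \<le> real j" using level_le[of N j "Suc i"] by simp
    have in': "?m - 1 < w t \<and> w t < real j" if "0 \<le> t" "t < \<tau>" for t
      using IH(3)[of t] h[of t] that mj by (cases "t < s") auto
    have d: "w t - w a < real N" if "0 \<le> a" "a \<le> t" "t \<le> \<tau>" for a t
    proof -
      consider "t \<le> s" | "s < t" "a \<le> s" "t < \<tau>" | "s < a" "t < \<tau>" | "\<tau> \<le> t" using that by linarith
      then show ?thesis
      proof cases
        case 1 then show ?thesis using IH(4) that by simp
      next
        case 2
        then have "?m \<le> w a" using IH(2) IH(3)[of a] that by (cases "a = s") auto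
        with h[of t] 2 show ?thesis by auto
      next
        case 3 then show ?thesis using h[of a] h[of t] that by auto
      next
        case 4
        then have "t = \<tau>" using that by simp
        then have "w t \<le> w a" using in'[of a] that \<tau> by (cases "a = t") auto
        then show ?thesis using 3(5) by simp
      qed
    qed
    have mx: "\<exists>t\<in>{0..\<tau>}. real j - 1 \<le> w t"
    proof (cases "\<exists>t\<in>{0..s}. real j - 1 \<le> w t")
      case True then show ?thesis using \<tau> by force
    next
      case False
      then have "real j \<le> ?m + real N" using IH(5) by blast
      then have "i = 0" by (simp add: level_def)
      with s(1) obtain s1 where "hits w 0 (real j - 1) (real j - real N) s1" "s1 < s" by (auto simp: hits_def)
      then show ?thesis using \<tau> by (intro bexI[of _ s1]) (auto simp: hits_def)
    qed
    show ?case unfolding level_Suc using IH(1) \<tau> in' d mx by auto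
  qed
  then show "0 \<le> \<tau>" "w \<tau> = level N j k" "\<And>t. 0 \<le> t \<Longrightarrow> t < \<tau> \<Longrightarrow> level N j k < w t \<and> w t < real j"
    "\<And>s t. 0 \<le> s \<Longrightarrow> s \<le> t \<Longrightarrow> t \<le> \<tau> \<Longrightarrow> w t - w s < real N"
    "(\<exists>t\<in>{0..\<tau>}. real j - 1 \<le> w t) \<or> real j \<le> level N j k + real N"
    by blast+
qed

lemma cell_facts:
  assumes "follows w (cell N j k) e2" "w 0 = 0" "3 \<le> j" "j + 3 \<le> N"
  obtains \<tau> e1 where "follows w (approach N j k) \<tau>" "\<tau> < e1" "e1 < e2"
    "w e1 = level N j k + real N - 1" "w e2 = level N j k + real N + 1"
    "\<And>t. \<tau> \<le> t \<Longrightarrow> t < e1 \<Longrightarrow> level N j k - 1 < w t \<and> w t < level N j k + real N - 1"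
    "\<And>t. e1 \<le> t \<Longrightarrow> t < e2 \<Longrightarrow> level N j k < w t \<and> w t < level N j k + real N + 1"
proof -
  let ?m = "level N j k"
  obtain \<tau> e1 where t: "follows w (approach N j k) \<tau>" "hits w \<tau> (?m + real N - 1) (?m - 1) e1" "hits w e1 (?m + real N + 1) ?m e2"
    using assms(1) by (auto simp: cell_def)
  show ?thesis
  proof (rule that[OF t(1)])
    show "?m - 1 < w t \<and> w t < ?m + real N - 1" if "\<tau> \<le> t" "t < e1" for t
      using t(2) that assms(4) unfolding hits_def by (auto simp: min_def max_def dest!: bspec[of _ _ t])
    show "?m < w t \<and> w t < ?m + real N + 1" if "e1 \<le> t" "t < e2" for t
      using t(3) that assms(4) unfolding hits_def by (auto simp: min_def max_def dest!: bspec[of _ _ t])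
  qed (use t in \<open>auto simp: hits_def\<close>)
qed

text \<open>The bottom is a minimiser between the end of the approach and the end of the first
  ascent; on the other pieces the path stays above \<open>level N j k\<close>, hence above the
  bottom.\<close>

lemma cell_bottom:
  assumes "follows w (cell N j k) e2" "w 0 = 0" "3 \<le> j" "j + 3 \<le> N" and w: "continuous_on UNIV w"
  obtains b where "0 \<le> b" "b < e2" "w b \<le> level N j k" "\<And>t. t \<in> {0..e2} \<Longrightarrow> w b \<le> w t" "w e2 = level N j k + real N + 1"
    "\<And>t. t \<in> {0..b} \<Longrightarrow> w t < real j" "\<And>s t. 0 \<le> s \<Longrightarrow> s \<le> t \<Longrightarrow> t \<le> b \<Longrightarrow> w t - w s < real N"
proof -
  let ?m = "level N j k"
  obtain \<tau> e1 where t: "follows w (approach N j k) \<tau>" "\<tau> < e1" "e1 < e2" "w e1 = ?m + real N - 1" "w e2 = ?m + real N + 1"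
    "\<And>t. \<tau> \<le> t \<Longrightarrow> t < e1 \<Longrightarrow> ?m - 1 < w t \<and> w t < ?m + real N - 1"
    "\<And>t. e1 \<le> t \<Longrightarrow> t < e2 \<Longrightarrow> ?m < w t \<and> w t < ?m + real N + 1"
    using assms by (elim cell_facts) auto
  note ap = approach_facts[OF t(1) assms(2-4)]
  have mj: "?m + real N \<le> real j" using level_le[of N j k] by simp
  obtain b where b: "b \<in> {\<tau>..e1}" "\<And>t. t \<in> {\<tau>..e1} \<Longrightarrow> w b \<le> w t"
    using continuous_attains_inf[OF compact_Icc _ continuous_on_subset[OF w], of \<tau> e1] t(2) by auto
  have bm: "w b \<le> ?m" using b(2)[of \<tau>] ap(2) t(2) by simp
  have be: "b < e1" using bm t(4) b(1) assms(4) by (cases "b = e1") auto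
  show ?thesis
  proof (rule that[of b])
    show "w b \<le> w t" if "t \<in> {0..e2}" for t
    proof -
      have t0: "0 \<le> t" "t \<le> e2" using that by auto
      consider "t < \<tau>" | "\<tau> \<le> t" "t \<le> e1" | "e1 < t" "t < e2" | "e2 \<le> t" by linarith
      then show ?thesis
      proof cases
        case 1 then show ?thesis using ap(3)[OF t0(1)] bm by simp
      next
        case 2 then show ?thesis using b(2)[of t] by simp
      next
        case 3 then show ?thesis using t(7)[of t] bm by simp
      next
        case 4 then show ?thesis using t0 t(5) bm by simp
      qed
    qed
    show "w t < real j" if "t \<in> {0..b}" for t
      using ap(3)[of t] t(6)[of t] mj that be by (cases "t < \<tau>") auto
    show "w t - w s < real N" if "0 \<le> s" "s \<le> t" "t \<le> b" for s t
    proof -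
      consider "t \<le> \<tau>" | "\<tau> < t" "s \<le> \<tau>" | "\<tau> < s" by linarith
      then show ?thesis
      proof cases
        case 1 then show ?thesis using ap(4) that by simp
      next
        case 2
        then have "?m \<le> w s" using ap(2) ap(3)[of s] that by (cases "s = \<tau>") auto
        with t(6)[of t] 2 that be show ?thesis by auto
      next
        case 3 then show ?thesis using t(6)[of s] t(6)[of t] that be by auto
      qed
    qed
  qed (use b be ap t bm in auto)
qed

section \<open>Compatibility and uniqueness of cells\<close>

lemma hits_D:
  assumes "hits w s c d t"
  shows "s < t" "w t = c" "\<And>r. s \<le> r \<Longrightarrow> r < t \<Longrightarrow> min c d < w r \<and> w r < max c d"
  using assms by (auto simp: hits_def)

lemma hits_widen:
  "hits w s c d t \<Longrightarrow> min c d' \<le> min c d \<Longrightarrow> max c d \<le> max c d' \<Longrightarrow> hits w s c d' t"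
  unfolding hits_def by fastforce

lemma hits_append:
  assumes "hits w s c' d' t" "hits w t c d u" "min c d \<le> min c' d'" "max c' d' \<le> max c d"
  shows "hits w s c d u"
proof -
  have "min c d < w r \<and> w r < max c d" if "s \<le> r" "r < u" for r
  proof (cases "r < t")
    case True
    with hits_D(3)[OF assms(1) that(1)] assms(3,4) show ?thesis by linarith
  next
    case False
    with hits_D(3)[OF assms(2)] that show ?thesis by simp
  qed
  then show ?thesis using hits_D(1,2)[OF assms(1)] hits_D(1,2)[OF assms(2)] by (auto simp: hits_def)
qed

text \<open>At the earlier of the two times the path is already outside the band prescribed for the
  other hit; equal times would give two different values.\<close>

lemma hits_incompatible:
  assumes "hits w 0 (x - H) x s" "hits w 0 y (y - H) t" "x \<le> y" "0 < H"
  shows False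
proof -
  have s: "0 < s" "w s = x - H" "\<And>r. 0 \<le> r \<Longrightarrow> r < s \<Longrightarrow> w r < x"
    using hits_D[OF assms(1)] assms(4) by (auto simp: max_def)
  have t: "0 < t" "w t = y" "\<And>r. 0 \<le> r \<Longrightarrow> r < t \<Longrightarrow> y - H < w r"
    using hits_D[OF assms(2)] assms(4) by (auto simp: min_def)
  have "\<not> s < t" using t(3)[of s] s assms(3) by auto
  moreover have "\<not> t < s" using s(3)[of t] t assms(3) by auto
  ultimately show False using s t assms(3,4) by auto
qed

lemma approach_down:
  assumes "follows w (approach N j k) \<tau>" "3 \<le> j" "j + 3 \<le> N"
  shows "\<exists>s. hits w 0 (real j - real N) (real j) s"
  using assms
proof (induction N j k arbitrary: \<tau> rule: approach.induct)
  case (1 N j)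
  then have h: "hits w 0 (real j - real N) (real j - 1) \<tau>" by simp
  have "hits w 0 (real j - real N) (real j) \<tau>" by (rule hits_widen[OF h]) (use 1(3) in auto)
  then show ?case by blast
next
  case (2 N j)
  then obtain s where s: "hits w 0 (real j - 1) (real j - real N) s" "hits w s (real j - real N) (real j) \<tau>" by auto
  have "hits w 0 (real j - real N) (real j) \<tau>" by (rule hits_append[OF s]) (use 2(3) in auto)
  then show ?case by blast
next
  case (3 N j i)
  from 3(2) obtain s where "follows w (approach N j (Suc i)) s" by auto
  from 3(1)[OF this 3(3,4)] show ?case .
qed

lemma approach_up:
  assumes "follows w (approach N j (Suc i)) \<tau>"
  shows "\<exists>s. hits w 0 (real j - 1) (real j - real N) s"
  using assms
proof (induction i arbitrary: \<tau>)
  case (Suc i)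
  then obtain s where "follows w (approach N j (Suc i)) s" by auto
  then show ?case by (rule Suc.IH)
qed auto

lemma cell_down:
  assumes "follows w (cell N j k) e" "3 \<le> j" "j + 3 \<le> N"
  shows "\<exists>s. hits w 0 (real j - real N) (real j) s"
proof -
  from assms(1) obtain \<tau> where "follows w (approach N j k) \<tau>" by (auto simp: cell_def)
  from approach_down[OF this assms(2,3)] show ?thesis .
qed

lemma cell_up:
  assumes "follows w (cell N j k) e" "3 \<le> j" "j + 3 \<le> N"
  shows "\<exists>s. hits w 0 (real j - 1) (real j - 1 - real N) s"
proof -
  from assms(1) obtain \<tau> e1 where t: "follows w (approach N j k) \<tau>" "hits w \<tau> (level N j k + real N - 1) (level N j k - 1) e1"
    by (auto simp: cell_def)
  show ?thesis
  proof (cases k)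
    case 0
    have h: "hits w 0 (real j - real N) (real j - 1) \<tau>" "hits w \<tau> (real j - 1) (real j - 1 - real N) e1"
      using t 0 by (auto simp: level_def algebra_simps)
    have "hits w 0 (real j - 1) (real j - 1 - real N) e1"
      by (rule hits_append[OF h]) (use assms(3) in auto)
    then show ?thesis by blast
  next
    case (Suc i)
    with t(1) approach_up obtain s where h: "hits w 0 (real j - 1) (real j - real N) s" by blast
    have "hits w 0 (real j - 1) (real j - 1 - real N) s" by (rule hits_widen[OF h]) (use assms(3) in auto)
    then show ?thesis by blast
  qed
qed

text \<open>Up to \<open>e\<close> the path stays above the deeper level, so the deeper approach
  ends only after \<open>e\<close>. It then contains the climb of \<open>N + 1\<close> from
  \<open>\<tau>\<close> to \<open>e\<close>, whereas climbs within an approach are below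
  \<open>N\<close>.\<close>

lemma cell_deeper_False:
  assumes c: "follows w (cell N j k) e" and c': "follows w (cell N j k') e'" and w0: "w 0 = 0" and j: "3 \<le> j" "j + 3 \<le> N"
    and lv: "level N j k' \<le> level N j k - 1"
  shows False
proof -
  let ?m = "level N j k"
  obtain \<tau> e1 where t: "follows w (approach N j k) \<tau>" "\<tau> < e1" "e1 < e" "w e = ?m + real N + 1"
    "\<And>t. \<tau> \<le> t \<Longrightarrow> t < e1 \<Longrightarrow> ?m - 1 < w t \<and> w t < ?m + real N - 1" "w e1 = ?m + real N - 1"
    "\<And>t. e1 \<le> t \<Longrightarrow> t < e \<Longrightarrow> ?m < w t \<and> w t < ?m + real N + 1"
    using c w0 j by (elim cell_facts) auto
  note ap = approach_facts[OF t(1) w0 j]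
  obtain \<tau>' where t': "follows w (approach N j k') \<tau>'" using c' by (auto simp: cell_def)
  note ap' = approach_facts[OF t' w0 j]
  have "\<not> \<tau>' \<le> e"
  proof
    assume "\<tau>' \<le> e"
    have wt: "w \<tau>' \<le> ?m - 1" using ap'(2) lv by simp
    consider "\<tau>' < \<tau>" | "\<tau> \<le> \<tau>'" "\<tau>' < e1" | "e1 \<le> \<tau>'" "\<tau>' < e" | "\<tau>' = e" using \<open>\<tau>' \<le> e\<close> by linarith
    then show False
      by cases (use wt ap(3)[of \<tau>'] ap'(1) t(5)[of \<tau>'] t(7)[of \<tau>'] t(4) in auto)
  qed
  then have "w e - w \<tau> < real N" using ap'(4)[of \<tau> e] ap(1) t(2,3) by auto
  then show False using t(4) ap(2) by simp
qed

text \<open>By \<open>cell_down\<close> and \<open>cell_up\<close> the index \<open>j\<close> is a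
  threshold for the side on which a band of width \<open>N\<close> is left, and
  \<open>hits_incompatible\<close> allows only one. For \<open>k\<close>, zero is told apart from
  positive values by whether \<open>j - 1\<close> or \<open>j - N\<close> is hit first, and positive
  values are told apart by depth.\<close>

lemma cell_unique:
  assumes c: "follows w (cell N j k) e" and c': "follows w (cell N j' k') e'" and w0: "w 0 = 0"
    and j: "3 \<le> j" "j + 3 \<le> N" "3 \<le> j'" "j' + 3 \<le> N"
  shows "j = j' \<and> k = k'"
proof -
  have N: "0 < real N" using j by simp
  have less: False if less: "follows w (cell N a p) e1" "follows w (cell N b q) e2" "a < b" "3 \<le> a" "a + 3 \<le> N" "3 \<le> b" "b + 3 \<le> N" for a b p q e1 e2
  proof -
    obtain s t where "hits w 0 (real a - real N) (real a) s" "hits w 0 (real b - 1) (real b - 1 - real N) t"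
      using cell_down[OF less(1,4,5)] cell_up[OF less(2,6,7)] by blast
    with less(3) N show False using hits_incompatible[of w "real a" "real N" s "real b - 1" t] by auto
  qed
  have jj: "j = j'"
  proof (rule ccontr)
    assume "j \<noteq> j'"
    then consider "j < j'" | "j' < j" by linarith
    then show False by cases (rule less[OF c c' _ j(1,2,3,4)], assumption, rule less[OF c' c _ j(3,4,1,2)], assumption)
  qed
  have lt: False if lt: "p < q" "follows w (cell N j p) e1" "follows w (cell N j q) e2" for p q e1 e2
  proof (cases p)
    case 0
    then obtain i where q: "q = Suc i" using lt(1) by (cases q) auto
    from lt(2) obtain \<tau> where "hits w 0 (real j - real N) (real j - 1) \<tau>" by (auto simp: cell_def 0)
    moreover from lt(3) obtain \<tau>' where "follows w (approach N j (Suc i)) \<tau>'" by (auto simp: cell_def q)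
    then obtain s where "hits w 0 (real j - 1) (real j - real N) s" using approach_up by blast
    ultimately show False using hits_exclusive by blast
  next
    case (Suc i)
    then have "level N j q \<le> level N j p - 1" using that(1) by (auto simp: level_def)
    from cell_deeper_False[OF that(2,3) w0 j(1,2) this] show False .
  qed
  have "k = k'"
  proof (rule ccontr)
    assume "k \<noteq> k'"
    then consider "k < k'" | "k' < k" by linarith
    then show False using lt c c' jj by cases blast+
  qed
  with jj show ?thesis by simp
qed

text \<open>The lower level is \<open>j + 2 - N\<close>, not \<open>j + 1 - N\<close>: when the wall
  is continued upwards, the lower level of the next band can be as high as \<open>j + 2 - N\<close>,
  and the next band has to contain this one.\<close>

definition exit_left :: "nat \<Rightarrow> nat \<Rightarrow> (real \<times> real) list" where
  "exit_left N j = [(real j + 1, real j + 2 - real N)]"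

text \<open>Take the cell with the smaller index, say \<open>j\<close>. Its half path falls to
  \<open>j - N\<close> before reaching \<open>j\<close>, but as the wall of the other cell it would
  have to rise by more than \<open>j\<close> before falling that far.\<close>

lemma cells_sides_False:
  assumes c: "follows w (cell N j k) e" and l: "follows (\<lambda>t. w (- t)) (exit_left N j) s"
    and c': "follows (\<lambda>t. w (- t)) (cell N j' k') e'" and l': "follows w (exit_left N j') s'"
    and j: "3 \<le> j" "j + 3 \<le> N" "3 \<le> j'" "j' + 3 \<le> N"
  shows False
proof -
  have N: "0 < real N" using j by simp
  have up: "hits v 0 (real i + 1) (real i + 1 - real N) t" if "follows v (exit_left N i) t" "i + 3 \<le> N" for v i t
  proof -
    have h: "hits v 0 (real i + 1) (real i + 2 - real N) t" using that(1) by (simp add: exit_left_def)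
    show ?thesis by (rule hits_widen[OF h]) (use that(2) in auto)
  qed
  obtain a b where "hits w 0 (real j - real N) (real j) a" "hits (\<lambda>t. w (- t)) 0 (real j' - real N) (real j') b"
    using cell_down[OF c j(1,2)] cell_down[OF c' j(3,4)] by blast
  then show False
    using hits_incompatible[of w "real j" "real N" a "real j' + 1" s'] hits_incompatible[of "\<lambda>t. w (- t)" "real j'" "real N" b "real j + 1" s]
      up[OF l j(2)] up[OF l' j(4)] N by (cases "j \<le> j'") auto
qed

section \<open>Valleys from hitting patterns\<close>

lemma single_valley:
  assumes c: "follows w (cell N j k) e" and l: "follows (\<lambda>t. w (- t)) (exit_left N j) s"
    and w: "continuous_on UNIV w" "w 0 = 0" and j: "3 \<le> j" "j + 3 \<le> N"
  shows "\<exists>b. valley (real N) w b"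
proof -
  obtain b where b: "0 \<le> b" "b < e" "w b \<le> level N j k" "\<And>t. t \<in> {0..e} \<Longrightarrow> w b \<le> w t" "w e = level N j k + real N + 1"
    "\<And>t. t \<in> {0..b} \<Longrightarrow> w t < real j" "\<And>s t. 0 \<le> s \<Longrightarrow> s \<le> t \<Longrightarrow> t \<le> b \<Longrightarrow> w t - w s < real N"
    using cell_bottom[OF c w(2) j w(1)] by blast
  have h: "hits (\<lambda>t. w (- t)) 0 (real j + 1) (real j + 2 - real N) s" using l by (simp add: exit_left_def)
  have h': "hits (\<lambda>t. w (- t)) 0 (real j + 1) (real j + 1 - real N) s" by (rule hits_widen[OF h]) (use j in auto)
  have "valley (real N) w b"
  proof (rule valleyI[OF b(1,2,4) _ b(7) _ _ h'])
    show "w t < real j + 1" if "t \<in> {0..b}" for t using b(6)[OF that] by simp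
  qed (use b(3,5) level_le[of N j k] j in auto)
  then show ?thesis by blast
qed

text \<open>A left wall of height \<open>j + excess N K k\<close> dominates the right half path up to its bottom at
  \<open>level N j k\<close> and is at least \<open>K\<close> above that bottom.\<close>

definition excess :: "nat \<Rightarrow> real \<Rightarrow> nat \<Rightarrow> real" where
  "excess N K k = max 0 (K - real N - real (k - 1))"

text \<open>The bottom for depth \<open>N\<close> also serves depth \<open>K\<close> if the right
  half path climbs to more than \<open>K\<close> above it without returning to its level, and the
  left wall is continued far enough. The second left band contains the first, so the two stages form
  a single hit of the wider band.\<close>

lemma common_valley:
  assumes c: "follows w ((level N j k + K + 1, level N j k) # cell N j k) e"
    and l: "follows (\<lambda>t. w (- t)) ((real j + 2 + excess N K k, real j + 2 + excess N K k - K) # exit_left N j) s"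
    and w: "continuous_on UNIV w" "w 0 = 0" and j: "3 \<le> j" "j + 3 \<le> N" and K: "real N < K"
  shows "\<exists>b. valley (real N) w b \<and> valley K w b"
proof -
  let ?m = "level N j k" and ?y = "real j + 2 + excess N K k"
  obtain e2 where e2: "follows w (cell N j k) e2" "hits w e2 (?m + K + 1) ?m e" using c by auto
  obtain s1 where s1: "hits (\<lambda>t. w (- t)) 0 (real j + 1) (real j + 2 - real N) s1" "hits (\<lambda>t. w (- t)) s1 ?y (?y - K) s"
    using l by (auto simp: exit_left_def)
  obtain b where b: "0 \<le> b" "b < e2" "w b \<le> ?m" "\<And>t. t \<in> {0..e2} \<Longrightarrow> w b \<le> w t" "w e2 = ?m + real N + 1"
    "\<And>t. t \<in> {0..b} \<Longrightarrow> w t < real j" "\<And>s t. 0 \<le> s \<Longrightarrow> s \<le> t \<Longrightarrow> t \<le> b \<Longrightarrow> w t - w s < real N"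
    using cell_bottom[OF e2(1) w(2) j w(1)] by blast
  have m: "?m + real N \<le> real j" using level_le[of N j k] by simp
  have ex: "0 \<le> excess N K k" "excess N K k \<le> K - real N" "?m + K \<le> real j + excess N K k"
    using K by (auto simp: excess_def level_def)
  have h': "hits (\<lambda>t. w (- t)) 0 (real j + 1) (real j + 1 - real N) s1" by (rule hits_widen[OF s1(1)]) (use j in auto)
  have v1: "valley (real N) w b"
  proof (rule valleyI[OF b(1,2,4) _ b(7) _ _ h'])
    show "w t < real j + 1" if "t \<in> {0..b}" for t using b(6)[OF that] by simp
  qed (use b(3,5) m j in auto)
  have h: "hits (\<lambda>t. w (- t)) 0 ?y (?y - K) s"
    by (rule hits_append[OF s1]) (use ex K j in auto)
  have low: "w b \<le> w t" if "t \<in> {0..e}" for t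
  proof -
    have t: "0 \<le> t" "t \<le> e" using that by auto
    consider "t \<le> e2" | "e2 \<le> t" "t < e" | "e \<le> t" by linarith
    then show ?thesis
    proof cases
      case 1 then show ?thesis using t by (intro b(4)) auto
    next
      case 2
      then have "?m < w t" using hits_D(3)[OF e2(2), of t] K by (auto simp: min_def split: if_splits)
      then show ?thesis using b(3) by simp
    next
      case 3 then show ?thesis using t hits_D(2)[OF e2(2)] b(3) K by simp
    qed
  qed
  have "valley K w b"
  proof (rule valleyI[OF b(1) _ low _ _ _ _ h])
    show "b < e" using b(2) hits_D(1)[OF e2(2)] by simp
    show "w t - w s < K" if "0 \<le> s" "s \<le> t" "t \<le> b" for s t
      using b(7)[OF that] K by simp
    show "w t < ?y" if "t \<in> {0..b}" for t using b(6)[OF that] ex by simp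
  qed (use b(3) ex K hits_D(2)[OF e2(2)] in auto)
  with v1 show ?thesis by blast
qed

text \<open>A bottom for depth \<open>N\<close> lies in the cell, less than one unit below the
  level. It cannot serve both depths if the right half path undercuts it before climbing by
  \<open>K\<close>, or if the left half path falls too far before the wall is high enough. The
  shifts by one or two units make this hold wherever in that unit the bottom is.\<close>

lemma common_valley_necessary:
  assumes c: "follows w (cell N j k) e" and w0: "w 0 = 0" and j: "3 \<le> j" "j + 3 \<le> N" and K: "real N + 2 < K"
    and v: "valley (real N) w b" "valley K w b"
  shows "\<not> hits w e (level N j k - 1) (level N j k - 1 + K) t"
    "\<not> hits (\<lambda>t. w (- t)) 0 (real j - 2 - real N) (real j - 2) s"
    "hits (\<lambda>t. w (- t)) 0 (real j - 2) (real j - 2 - real N) s1 \<Longrightarrow>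
      \<not> hits (\<lambda>t. w (- t)) s1 (real j - 1 + excess N K k - K) (real j - 1 + excess N K k) s2"
proof -
  let ?m = "level N j k"
  have N: "0 < real N" using j by simp
  obtain \<tau> e1 where t: "follows w (approach N j k) \<tau>" "\<tau> < e1" "e1 < e" "w e1 = ?m + real N - 1" "w e = ?m + real N + 1"
    "\<And>t. \<tau> \<le> t \<Longrightarrow> t < e1 \<Longrightarrow> ?m - 1 < w t \<and> w t < ?m + real N - 1"
    "\<And>t. e1 \<le> t \<Longrightarrow> t < e \<Longrightarrow> ?m < w t \<and> w t < ?m + real N + 1"
    using c w0 j by (elim cell_facts) auto
  note ap = approach_facts[OF t(1) w0 j]
  obtain a c1 where vN: "0 \<le> b" "a \<le> 0" "b < c1" "\<And>t. t \<in> {a..c1} \<Longrightarrow> w b \<le> w t" "w b + real N < w c1"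
     "\<And>s t. a \<le> s \<Longrightarrow> s \<le> t \<Longrightarrow> t \<le> b \<Longrightarrow> w t - w s < real N"
    using v(1) unfolding valley_def by blast
  \<comment> \<open>Otherwise the climb of \<open>N + 1\<close> from \<open>\<tau>\<close> to
    \<open>e\<close> would precede the bottom.\<close>
  have be: "b < e"
  proof (rule ccontr)
    assume "\<not> b < e"
    then have "w e - w \<tau> < real N" using vN(2) ap(1) t(2,3) by (intro vN(6)) auto
    then show False using t(5) ap(2) by simp
  qed
  have wbm: "w b \<le> ?m"
  proof (rule ccontr)
    assume neg: "\<not> w b \<le> ?m"
    have "\<tau> \<notin> {a..c1}" using vN(4)[of \<tau>] ap(2) neg by auto
    then have "c1 < \<tau>" using vN(2) ap(1) by auto
    then have "w c1 - w b < real N" using vN(1,3) by (intro ap(4)) auto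
    then show False using vN(5) by simp
  qed
  have b\<tau>: "\<tau> \<le> b"
  proof (rule ccontr)
    assume "\<not> \<tau> \<le> b"
    with ap(3)[of b] vN(1) wbm show False by auto
  qed
  have wbm1: "?m - 1 < w b" using t(6)[of b] t(7)[of b] b\<tau> be by (cases "b < e1") auto
  have top: "(\<exists>t\<in>{0..b}. real j - 1 \<le> w t) \<or> real j - 1 < w b + real N"
    using ap(5) b\<tau> wbm1 by auto
  show "\<not> hits w e (?m - 1) (?m - 1 + K) t"
  proof
    assume h: "hits w e (?m - 1) (?m - 1 + K) t"
    obtain a' c' where vK: "b < c'" "\<And>t. t \<in> {a'..c'} \<Longrightarrow> w b \<le> w t" "w b + K < w c'" "a' \<le> 0"
      using v(2) unfolding valley_def by blast
    have "c' < t"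
    proof (rule ccontr)
      assume "\<not> c' < t"
      then have "w b \<le> w t" using hits_D(1)[OF h] be vN(1) vK(4) by (intro vK(2)) auto
      then show False using hits_D(2)[OF h] wbm1 by simp
    qed
    moreover have "w c' < ?m - 1 + K" if "c' < t"
    proof -
      consider "c' < e1" | "e1 \<le> c'" "c' < e" | "e \<le> c'" by linarith
      then show ?thesis
      proof cases
        case 1 then show ?thesis using t(6)[of c'] b\<tau> vK(1) K by auto
      next
        case 2 then show ?thesis using t(7)[of c'] K by auto
      next
        case 3 then show ?thesis using hits_D(3)[OF h, of c'] that K by auto
      qed
    qed
    ultimately show False using vK(3) wbm1 by simp
  qed
  show "\<not> hits (\<lambda>t. w (- t)) 0 (real j - 2 - real N) (real j - 2) s"
  proof
    assume h: "hits (\<lambda>t. w (- t)) 0 (real j - 2 - real N) (real j - 2) s"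
    have "w (- t) < real j - 2" if "0 \<le> t" "t < s" for t
      using hits_D(3)[OF h that] N by auto
    moreover have "(\<exists>t\<in>{0..b}. real j - 2 \<le> w t) \<or> real j - 2 < w b + real N" using top by force
    ultimately show False
      by (intro valley_left_descent[OF v(1) hits_D(1,2)[OF h] _ N]) auto
  qed
  assume h1: "hits (\<lambda>t. w (- t)) 0 (real j - 2) (real j - 2 - real N) s1"
  show "\<not> hits (\<lambda>t. w (- t)) s1 (real j - 1 + excess N K k - K) (real j - 1 + excess N K k) s2"
  proof
    let ?y = "real j - 1 + excess N K k"
    assume h: "hits (\<lambda>t. w (- t)) s1 (?y - K) ?y s2"
    have ex: "0 \<le> excess N K k" by (simp add: excess_def)
    have below: "w (- t) < ?y" if "0 \<le> t" "t < s2" for t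
    proof (cases "t < s1")
      case True
      then show ?thesis using hits_D(3)[OF h1 that(1)] N ex by auto
    next
      case False
      then show ?thesis using hits_D(3)[OF h, of t] that K N by auto
    qed
    have "(\<exists>t\<in>{0..b}. ?y \<le> w t) \<or> ?y < w b + K"
    proof (cases "0 < K - real N - real (k - 1)")
      case True
      then have "?y = ?m - 1 + K" by (simp add: excess_def level_def)
      then show ?thesis using wbm1 by simp
    next
      case False
      then have "?y = real j - 1" by (simp add: excess_def)
      then show ?thesis using top K by auto
    qed
    moreover have "0 < s2" using hits_D(1)[OF h] hits_D(1)[OF h1] by simp
    ultimately show False
      using K N by (intro valley_left_descent[OF v(2) _ hits_D(2)[OF h] below]) auto
  qed
qed

section \<open>Sums over cells\<close>

text \<open>Power sums with the terms for 1 and 2 removed, hence the constants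
  \<open>3 = 1 + 2\<close> and \<open>5 = 1 + 4\<close>.\<close>

lemma sum_from_3:
  fixes \<alpha> \<beta> :: real
  assumes "2 \<le> n"
  shows "(\<Sum>j\<in>{3..n}. (real j - 1) * (\<alpha> - \<beta> * real j))
      = (\<alpha> + \<beta>) * (real n * (real n + 1) / 2 - 3) - \<beta> * (real n * (real n + 1) * (2 * real n + 1) / 6 - 5) - \<alpha> * (real n - 2)"
    "(\<Sum>j\<in>{3..n}. (a - real j) * (\<alpha> - \<beta> * real j))
      = a * \<alpha> * (real n - 2) - (a * \<beta> + \<alpha>) * (real n * (real n + 1) / 2 - 3) + \<beta> * (real n * (real n + 1) * (2 * real n + 1) / 6 - 5)"
proof -
  have *: "{3..Suc m} = insert (Suc m) {3..m}" if "2 \<le> m" for m :: nat using that by auto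
  show "(\<Sum>j\<in>{3..n}. (real j - 1) * (\<alpha> - \<beta> * real j))
      = (\<alpha> + \<beta>) * (real n * (real n + 1) / 2 - 3) - \<beta> * (real n * (real n + 1) * (2 * real n + 1) / 6 - 5) - \<alpha> * (real n - 2)"
    using assms by (induction rule: dec_induct) (simp_all add: * field_simps)
  show "(\<Sum>j\<in>{3..n}. (a - real j) * (\<alpha> - \<beta> * real j))
      = a * \<alpha> * (real n - 2) - (a * \<beta> + \<alpha>) * (real n * (real n + 1) / 2 - 3) + \<beta> * (real n * (real n + 1) * (2 * real n + 1) / 6 - 5)"
    using assms by (induction rule: dec_induct) (simp_all add: * field_simps)
qed

text \<open>The cut at \<open>N^2\<close> is far beyond the typical order \<open>N\<close> of
  \<open>k\<close>: the sum stays finite and the lost mass vanishes.\<close>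

definition cell_sum :: "nat \<Rightarrow> (nat \<Rightarrow> nat \<Rightarrow> real) \<Rightarrow> real" where
  "cell_sum N f = (\<Sum>j\<in>{3..N - 3}. \<Sum>k\<le>N\<^sup>2. path_prob (cell N j k) * f j k)"

lemma cell_sum_eq:
  assumes "6 \<le> N"
  shows "cell_sum N (\<lambda>j k. \<alpha> j * \<beta> k) =
    (\<Sum>j\<in>{3..N - 3}. (real j - 1) * \<alpha> j) / (real N * (real N + 1)) * \<beta> 0
    + (\<Sum>j\<in>{3..N - 3}. (real N - real j) * \<alpha> j) / (real N * (real N + 1))
      * (\<Sum>i<N\<^sup>2. ((real N - 1) / real N) ^ i / real N * \<beta> (Suc i))"
proof -
  let ?g = "\<Sum>i<N\<^sup>2. ((real N - 1) / real N) ^ i / real N * \<beta> (Suc i)" and ?d = "real N * (real N + 1)"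
  have "(\<Sum>k\<le>N\<^sup>2. path_prob (cell N j k) * (\<alpha> j * \<beta> k)) = (real j - 1) * \<alpha> j / ?d * \<beta> 0 + (real N - real j) * \<alpha> j / ?d * ?g"
    if j: "j \<in> {3..N - 3}" for j
  proof -
    have j': "3 \<le> j" "j + 3 \<le> N" using j assms by auto
    have "(\<Sum>k\<le>N\<^sup>2. path_prob (cell N j k) * (\<alpha> j * \<beta> k))
        = path_prob (cell N j 0) * (\<alpha> j * \<beta> 0) + (\<Sum>i<N\<^sup>2. path_prob (cell N j (Suc i)) * (\<alpha> j * \<beta> (Suc i)))"
      by (rule sum.atMost_shift)
    also have "(\<Sum>i<N\<^sup>2. path_prob (cell N j (Suc i)) * (\<alpha> j * \<beta> (Suc i))) = (real N - real j) * \<alpha> j / ?d * ?g"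
      unfolding sum_distrib_left path_prob_cell[OF j'] by (intro sum.cong) (auto simp: field_simps)
    finally show ?thesis by (simp add: path_prob_cell[OF j'])
  qed
  then show ?thesis
    unfolding cell_sum_def by (simp add: sum.distrib sum_divide_distrib sum_distrib_right)
qed

lemma geometric_sum_limit:
  "(\<lambda>N. \<Sum>i<N\<^sup>2. ((real N - 1) / real N) ^ i / real N) \<longlonglongrightarrow> 1"
proof -
  have eq: "(\<Sum>i<M. ((real N - 1) / real N) ^ i / real N) = 1 - ((real N - 1) / real N) ^ M" if "0 < N" for N M :: nat
  proof (induction M)
    case (Suc M)
    have "((real N - 1) / real N) ^ M / real N - ((real N - 1) / real N) ^ M = - (((real N - 1) / real N) ^ Suc M)"
      using that by (simp add: field_simps)
    with Suc show ?case by simp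
  qed simp
  have "\<forall>\<^sub>F N in sequentially. 1 - ((real N - 1) / real N) ^ N\<^sup>2 = (\<Sum>i<N\<^sup>2. ((real N - 1) / real N) ^ i / real N)"
    using eventually_gt_at_top[of 0] by eventually_elim (simp add: eq)
  moreover have "(\<lambda>N. 1 - ((real N - 1) / real N) ^ N\<^sup>2) \<longlonglongrightarrow> 1"
    by real_asymp
  ultimately show ?thesis by (rule Lim_transform_eventually[rotated])
qed

text \<open>A Riemann sum for the integral of \<open>exp (- y) * max 0 (\<kappa> - y)\<close> over
  positive \<open>y\<close>.\<close>

lemma truncated_sum_limit:
  fixes \<kappa> :: real
  assumes \<kappa>: "0 < \<kappa>"
  shows "(\<lambda>N. \<Sum>i<N\<^sup>2. ((real N - 1) / real N) ^ i / real N * max 0 (\<kappa> - real i / real N)) \<longlonglongrightarrow> \<kappa> - 1 + exp (- \<kappa>)"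
proof -
  \<comment> \<open>The first index beyond \<open>\<kappa> * N\<close>; from here on the truncated
    factor vanishes.\<close>
  define M where "M N = Suc (nat \<lfloor>\<kappa> * real N\<rfloor>)" for N
  define r where "r N = (real N - 1) / real N" for N
  have eq: "(\<Sum>i<m. r N ^ i / real N * (\<kappa> - real i / real N)) = \<kappa> * (1 - r N ^ m) - r N + r N ^ m * (real m / real N + r N)"
    if "0 < N" for N m :: nat
  proof -
    \<comment> \<open>With \<open>x = 1 - 1 / N\<close> each factor \<open>1 / N\<close> becomes
      \<open>1 - x\<close>, and the sum has a closed form.\<close>
    have *: "(\<Sum>i<m. x ^ i * (1 - x) * (\<kappa> - real i * (1 - x))) = \<kappa> * (1 - x ^ m) - x + x ^ m * (real m * (1 - x) + x)" for x :: real
      by (induction m) (simp_all add: algebra_simps)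
    have "1 / real N = 1 - r N" using that by (simp add: r_def diff_divide_distrib)
    then have "a / real N = a * (1 - r N)" for a by (metis divide_inverse inverse_eq_divide)
    then show ?thesis using *[of "r N"] by simp
  qed
  have sum_eq: "(\<Sum>i<N\<^sup>2. r N ^ i / real N * max 0 (\<kappa> - real i / real N)) = \<kappa> * (1 - r N ^ M N) - r N + r N ^ M N * (real (M N) / real N + r N)"
    if N: "0 < N" "\<kappa> * real N + 1 \<le> (real N)\<^sup>2" for N
  proof -
    have k0: "0 \<le> \<kappa> * real N" using \<kappa> by simp
    have "real (M N) \<le> real (N\<^sup>2)" using N k0 unfolding M_def by simp linarith
    then have MN: "M N \<le> N\<^sup>2" by (simp only: of_nat_le_iff)
    have lt: "i < M N \<longleftrightarrow> real i \<le> \<kappa> * real N" for i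
      using k0 unfolding M_def less_Suc_eq_le by (simp add: le_nat_iff le_floor_iff)
    have "(\<Sum>i<N\<^sup>2. r N ^ i / real N * max 0 (\<kappa> - real i / real N)) = (\<Sum>i<M N. r N ^ i / real N * (\<kappa> - real i / real N))"
    proof (rule sum.mono_neutral_cong_right)
      have pos: "0 \<le> \<kappa> - real i / real N \<longleftrightarrow> i < M N" for i
        unfolding lt using N(1) by (simp add: pos_divide_le_eq)
      show "\<forall>i\<in>{..<N\<^sup>2} - {..<M N}. r N ^ i / real N * max 0 (\<kappa> - real i / real N) = 0"
      proof
        fix i assume "i \<in> {..<N\<^sup>2} - {..<M N}"
        then have "\<not> 0 \<le> \<kappa> - real i / real N" using pos[of i] by blast
        then have "\<kappa> - real i / real N \<le> 0" by linarith
        then have "max 0 (\<kappa> - real i / real N) = 0" by (rule max_absorb1)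
        then show "r N ^ i / real N * max 0 (\<kappa> - real i / real N) = 0" by (simp only: mult_zero_right)
      qed
      show "r N ^ i / real N * max 0 (\<kappa> - real i / real N) = r N ^ i / real N * (\<kappa> - real i / real N)" if "i \<in> {..<M N}" for i
      proof -
        have "0 \<le> \<kappa> - real i / real N" using pos[of i] that by (simp only: lessThan_iff)
        then show ?thesis by (simp only: max_absorb2)
      qed
    qed (use MN in auto)
    with eq[OF N(1), of "M N"] show ?thesis by simp
  qed
  have large: "\<forall>\<^sub>F N in sequentially. \<kappa> * real N + 1 \<le> (real N)\<^sup>2" by real_asymp
  have ev: "\<forall>\<^sub>F N in sequentially. \<kappa> * (1 - r N ^ M N) - r N + r N ^ M N * (real (M N) / real N + r N)
      = (\<Sum>i<N\<^sup>2. r N ^ i / real N * max 0 (\<kappa> - real i / real N))"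
    using eventually_gt_at_top[of "0::nat"] large by eventually_elim (rule sum_eq[symmetric])
  have r1: "r \<longlonglongrightarrow> 1" unfolding r_def by real_asymp
  have MN: "(\<lambda>N. real (M N) / real N) \<longlonglongrightarrow> \<kappa>"
  proof (rule tendsto_sandwich[of "\<lambda>N. \<kappa>" _ _ "\<lambda>N. \<kappa> + 1 / real N"])
    have b: "\<kappa> * real N \<le> real (M N)" "real (M N) \<le> \<kappa> * real N + 1" for N
    proof -
      have "0 \<le> \<kappa> * real N" using \<kappa> by simp
      then show "\<kappa> * real N \<le> real (M N)" "real (M N) \<le> \<kappa> * real N + 1" unfolding M_def by (simp_all add: of_nat_nat) linarith+
    qed
    show "\<forall>\<^sub>F N in sequentially. \<kappa> \<le> real (M N) / real N"
      using eventually_gt_at_top[of "0::nat"] by eventually_elim (use b in \<open>simp add: pos_le_divide_eq\<close>)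
    show "\<forall>\<^sub>F N in sequentially. real (M N) / real N \<le> \<kappa> + 1 / real N"
      using eventually_gt_at_top[of "0::nat"]
    proof eventually_elim
      case (elim N) then show ?case using b(2)[of N] by (simp add: pos_divide_le_eq distrib_right)
    qed
    show "(\<lambda>N. \<kappa> + 1 / real N) \<longlonglongrightarrow> \<kappa>" by real_asymp
  qed simp
  have rM: "(\<lambda>N. r N ^ M N) \<longlonglongrightarrow> exp (- \<kappa>)"
  proof -
    have "(\<lambda>N. real N * ln (r N)) \<longlonglongrightarrow> -1" unfolding r_def by real_asymp
    from tendsto_mult[OF MN this] have "(\<lambda>N. real (M N) / real N * (real N * ln (r N))) \<longlonglongrightarrow> - \<kappa>" by simp
    from tendsto_exp[OF this] have l: "(\<lambda>N. exp (real (M N) / real N * (real N * ln (r N)))) \<longlonglongrightarrow> exp (- \<kappa>)" .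
    have "\<forall>\<^sub>F N in sequentially. exp (real (M N) / real N * (real N * ln (r N))) = r N ^ M N"
      using eventually_gt_at_top[of "1::nat"]
    proof eventually_elim
      case (elim N)
      then have "0 < r N" by (simp add: r_def)
      then have "r N ^ M N = exp (real (M N) * ln (r N))" by (simp add: exp_of_nat_mult)
      with elim show ?case by simp
    qed
    from Lim_transform_eventually[OF l this] show ?thesis .
  qed
  have "(\<lambda>N. \<kappa> * (1 - r N ^ M N) - r N + r N ^ M N * (real (M N) / real N + r N)) \<longlonglongrightarrow> \<kappa> * (1 - exp (- \<kappa>)) - 1 + exp (- \<kappa>) * (\<kappa> + 1)"
    by (intro tendsto_intros rM r1 MN)
  from Lim_transform_eventually[OF this ev] show ?thesis by (simp add: r_def algebra_simps)
qed

text \<open>The two halves are the integrals of \<open>x\<close> and \<open>1 - x\<close> over the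
  unit interval: asymptotically the cells exhaust the right half paths.\<close>

lemma cell_sum_total: "(\<lambda>N. cell_sum N (\<lambda>j k. 1)) \<longlonglongrightarrow> 1"
proof -
  have "\<forall>\<^sub>F N in sequentially.
      ((\<Sum>j\<in>{3..N - 3}. (real j - 1) * (1 - 0 * real j)) / (real N * (real N + 1))
      + (\<Sum>j\<in>{3..N - 3}. (real N - real j) * (1 - 0 * real j)) / (real N * (real N + 1)) * (\<Sum>i<N\<^sup>2. ((real N - 1) / real N) ^ i / real N))
      = cell_sum N (\<lambda>j k. 1)"
    using eventually_ge_at_top[of 6] by eventually_elim (use cell_sum_eq[of _ "\<lambda>_. 1" "\<lambda>_. 1"] in simp)
  moreover have "(\<lambda>N. ((\<Sum>j\<in>{3..N - 3}. (real j - 1) * (1 - 0 * real j)) / (real N * (real N + 1))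
      + (\<Sum>j\<in>{3..N - 3}. (real N - real j) * (1 - 0 * real j)) / (real N * (real N + 1)) * (\<Sum>i<N\<^sup>2. ((real N - 1) / real N) ^ i / real N)))
      \<longlonglongrightarrow> 1 / 2 + 1 / 2 * 1"
  proof (intro tendsto_add tendsto_mult geometric_sum_limit)
    have ev: "\<forall>\<^sub>F N in sequentially. 2 \<le> N - 3 \<and> real (N - 3) = real N - 3"
      using eventually_ge_at_top[of "5::nat"] by eventually_elim auto
    have "\<forall>\<^sub>F N in sequentially. ((1 + 0) * ((real N - 3) * ((real N - 3) + 1) / 2 - 3) - 0 * ((real N - 3) * ((real N - 3) + 1) * (2 * (real N - 3) + 1) / 6 - 5) - 1 * ((real N - 3) - 2)) / (real N * (real N + 1))
        = (\<Sum>j\<in>{3..N - 3}. (real j - 1) * (1 - 0 * real j)) / (real N * (real N + 1))"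
      using ev by eventually_elim (simp only: sum_from_3)
    moreover have "(\<lambda>N. ((1 + 0) * ((real N - 3) * ((real N - 3) + 1) / 2 - 3) - 0 * ((real N - 3) * ((real N - 3) + 1) * (2 * (real N - 3) + 1) / 6 - 5) - 1 * ((real N - 3) - 2)) / (real N * (real N + 1))) \<longlonglongrightarrow> 1 / 2"
      by real_asymp
    ultimately show "(\<lambda>N. (\<Sum>j\<in>{3..N - 3}. (real j - 1) * (1 - 0 * real j)) / (real N * (real N + 1))) \<longlonglongrightarrow> 1 / 2"
      by (rule Lim_transform_eventually[rotated])
    have "\<forall>\<^sub>F N in sequentially. (real N * 1 * ((real N - 3) - 2) - (real N * 0 + 1) * ((real N - 3) * ((real N - 3) + 1) / 2 - 3) + 0 * ((real N - 3) * ((real N - 3) + 1) * (2 * (real N - 3) + 1) / 6 - 5)) / (real N * (real N + 1))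
        = (\<Sum>j\<in>{3..N - 3}. (real N - real j) * (1 - 0 * real j)) / (real N * (real N + 1))"
      using ev by eventually_elim (simp only: sum_from_3)
    moreover have "(\<lambda>N. (real N * 1 * ((real N - 3) - 2) - (real N * 0 + 1) * ((real N - 3) * ((real N - 3) + 1) / 2 - 3) + 0 * ((real N - 3) * ((real N - 3) + 1) * (2 * (real N - 3) + 1) / 6 - 5)) / (real N * (real N + 1))) \<longlonglongrightarrow> 1 / 2"
      by real_asymp
    ultimately show "(\<lambda>N. (\<Sum>j\<in>{3..N - 3}. (real N - real j) * (1 - 0 * real j)) / (real N * (real N + 1))) \<longlonglongrightarrow> 1 / 2"
      by (rule Lim_transform_eventually[rotated])
  qed
  ultimately show ?thesis using Lim_transform_eventually[of _ 1] by simp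
qed

text \<open>The conditions on \<open>A\<close> and \<open>B\<close> say that the weight is close to
  \<open>1 - j / N\<close>. They tolerate bounded shifts of levels, so one statement serves all
  lists.\<close>

lemma cell_sum_limit:
  fixes A B :: "nat \<Rightarrow> real"
  assumes A: "(\<lambda>N. A N / real N) \<longlonglongrightarrow> 1" and B: "(\<lambda>N. B N * real N) \<longlonglongrightarrow> 1"
    and \<beta>0: "(\<lambda>N. \<beta> N 0) \<longlonglongrightarrow> b" and \<Gamma>: "(\<lambda>N. \<Sum>i<N\<^sup>2. ((real N - 1) / real N) ^ i / real N * \<beta> N (Suc i)) \<longlonglongrightarrow> c"
  shows "(\<lambda>N. cell_sum N (\<lambda>j k. (A N * B N - B N * real j) * \<beta> N k)) \<longlonglongrightarrow> b / 6 + c / 3"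
proof -
  let ?n = "\<lambda>N. real N - 3" and ?d = "\<lambda>N. real N * (real N + 1)"
  let ?s1 = "\<lambda>N. ?n N * (?n N + 1) / 2 - 3" and ?s2 = "\<lambda>N. ?n N * (?n N + 1) * (2 * ?n N + 1) / 6 - 5"
  let ?P = "\<lambda>N. ((A N * B N + B N) * ?s1 N - B N * ?s2 N - A N * B N * (?n N - 2)) / ?d N"
  let ?Q = "\<lambda>N. (real N * (A N * B N) * (?n N - 2) - (real N * B N + A N * B N) * ?s1 N + B N * ?s2 N) / ?d N"
  have ev: "\<forall>\<^sub>F N in sequentially. ?P N * \<beta> N 0 + ?Q N * (\<Sum>i<N\<^sup>2. ((real N - 1) / real N) ^ i / real N * \<beta> N (Suc i))
      = cell_sum N (\<lambda>j k. (A N * B N - B N * real j) * \<beta> N k)"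
    using eventually_ge_at_top[of 6]
  proof eventually_elim
    case (elim N)
    then have "2 \<le> N - 3" "real (N - 3) = real N - 3" by auto
    then show ?case
      unfolding cell_sum_eq[OF elim, of "\<lambda>j. A N * B N - B N * real j" "\<beta> N"] sum_from_3[OF \<open>2 \<le> N - 3\<close>] by simp
  qed
  have P: "?P \<longlonglongrightarrow> 1 / 6"
  proof -
    have l: "(\<lambda>N. (A N / real N) * (B N * real N) * ((?s1 N - (?n N - 2)) / ?d N) + (B N * real N) * ((?s1 N - ?s2 N) / (real N * ?d N))) \<longlonglongrightarrow> 1 * 1 * (1 / 2) + 1 * (- 1 / 3)"
    proof (intro tendsto_add tendsto_mult A B)
      show "(\<lambda>N. (?s1 N - (?n N - 2)) / ?d N) \<longlonglongrightarrow> 1 / 2" by real_asymp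
      show "(\<lambda>N. (?s1 N - ?s2 N) / (real N * ?d N)) \<longlonglongrightarrow> - 1 / 3" by real_asymp
    qed
    have "\<forall>\<^sub>F N in sequentially. (A N / real N) * (B N * real N) * ((?s1 N - (?n N - 2)) / ?d N) + (B N * real N) * ((?s1 N - ?s2 N) / (real N * ?d N)) = ?P N"
      using eventually_gt_at_top[of 0]
    proof eventually_elim
      case (elim N)
      have 1: "(A N / real N) * (B N * real N) = A N * B N" using elim by simp
      have 2: "(B N * real N) * (s / (real N * d)) = B N * s / d" for s d :: real using elim by simp
      show ?case unfolding 1 2 unfolding times_divide_eq_right add_divide_distrib[symmetric] by (rule arg_cong2[where f="(/)"]) (simp_all only: algebra_simps)
    qed
    from Lim_transform_eventually[OF l this] show ?thesis by simp
  qed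
  have Q: "?Q \<longlonglongrightarrow> 1 / 3"
  proof -
    have l: "(\<lambda>N. (A N / real N) * (B N * real N) * ((real N * (?n N - 2) - ?s1 N) / ?d N) + (B N * real N) * ((?s2 N - real N * ?s1 N) / (real N * ?d N))) \<longlonglongrightarrow> 1 * 1 * (1 / 2) + 1 * (- 1 / 6)"
    proof (intro tendsto_add tendsto_mult A B)
      show "(\<lambda>N. (real N * (?n N - 2) - ?s1 N) / ?d N) \<longlonglongrightarrow> 1 / 2" by real_asymp
      show "(\<lambda>N. (?s2 N - real N * ?s1 N) / (real N * ?d N)) \<longlonglongrightarrow> - 1 / 6" by real_asymp
    qed
    have "\<forall>\<^sub>F N in sequentially. (A N / real N) * (B N * real N) * ((real N * (?n N - 2) - ?s1 N) / ?d N) + (B N * real N) * ((?s2 N - real N * ?s1 N) / (real N * ?d N)) = ?Q N"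
      using eventually_gt_at_top[of 0]
    proof eventually_elim
      case (elim N)
      have 1: "(A N / real N) * (B N * real N) = A N * B N" using elim by simp
      have 2: "(B N * real N) * (s / (real N * d)) = B N * s / d" for s d :: real using elim by simp
      show ?case unfolding 1 2 unfolding times_divide_eq_right add_divide_distrib[symmetric] by (rule arg_cong2[where f="(/)"]) (simp_all only: algebra_simps)
    qed
    from Lim_transform_eventually[OF l this] show ?thesis by simp
  qed
  have "(\<lambda>N. ?P N * \<beta> N 0 + ?Q N * (\<Sum>i<N\<^sup>2. ((real N - 1) / real N) ^ i / real N * \<beta> N (Suc i))) \<longlonglongrightarrow> 1 / 6 * b + 1 / 3 * c"
    by (intro tendsto_add tendsto_mult P Q \<beta>0 \<Gamma>)
  from Lim_transform_eventually[OF this ev] show ?thesis by simp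
qed

text \<open>\<open>C\<close> stands for the climb on the right from about \<open>N\<close> to about
  \<open>h * N\<close> before the bottom is undercut, \<open>g\<close> for continuing the left wall
  by \<open>excess\<close>. The second limit is the mean of
  \<open>(1 - max 0 (h - 1 - y) / h) / h\<close> for an exponential variable
  \<open>y\<close>.\<close>

lemma excess_sum_limit:
  fixes h :: real and C :: "nat \<Rightarrow> real"
  assumes h: "1 < h" and C: "C \<longlonglongrightarrow> 1 / h"
  defines "g \<equiv> \<lambda>N k. (h * real N - 1 - excess N (h * real N) k) / (h * real N)"
  shows "(\<lambda>N. C N * g N 0) \<longlonglongrightarrow> 1 / h\<^sup>2"
    "(\<lambda>N. \<Sum>i<N\<^sup>2. ((real N - 1) / real N) ^ i / real N * (C N * g N (Suc i))) \<longlonglongrightarrow> (2 - exp (- (h - 1))) / h\<^sup>2"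
proof -
  have "\<forall>\<^sub>F N in sequentially. (real N - 1) / (h * real N) = g N 0"
    using eventually_gt_at_top[of 0]
  proof eventually_elim
    case (elim N)
    have "1 * real N \<le> h * real N" using h by (intro mult_right_mono) auto
    then show ?case by (simp add: g_def excess_def)
  qed
  moreover have "(\<lambda>N. (real N - 1) / (h * real N)) \<longlonglongrightarrow> 1 / h"
    unfolding inverse_eq_divide[symmetric] using h by real_asymp
  ultimately have "(\<lambda>N. g N 0) \<longlonglongrightarrow> 1 / h" by (rule Lim_transform_eventually[rotated])
  from tendsto_mult[OF C this] show "(\<lambda>N. C N * g N 0) \<longlonglongrightarrow> 1 / h\<^sup>2" by (simp add: power2_eq_square)
  let ?q = "\<lambda>N i. ((real N - 1) / real N) ^ i / real N"
  have gi: "g N (Suc i) = (1 - 1 / (h * real N)) - 1 / h * max 0 ((h - 1) - real i / real N)" if "0 < N" for N i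
  proof -
    define z where "z = max 0 ((h - 1) - real i / real N)"
    have "h * real N - real N - real i = real N * ((h - 1) - real i / real N)" using that by (simp add: right_diff_distrib mult.commute)
    then have ex: "excess N (h * real N) (Suc i) = real N * z"
      unfolding z_def max_mult_distrib_left by (simp add: excess_def)
    show ?thesis unfolding g_def ex z_def[symmetric] using that h by (simp add: diff_divide_distrib)
  qed
  have ev: "\<forall>\<^sub>F N in sequentially. C N * ((1 - 1 / (h * real N)) * (\<Sum>i<N\<^sup>2. ?q N i) - 1 / h * (\<Sum>i<N\<^sup>2. ?q N i * max 0 ((h - 1) - real i / real N)))
      = (\<Sum>i<N\<^sup>2. ?q N i * (C N * g N (Suc i)))"
    using eventually_gt_at_top[of 0]
  proof eventually_elim
    case (elim N)
    have "?q N i * (C N * g N (Suc i)) = C N * ((1 - 1 / (h * real N)) * ?q N i - 1 / h * (?q N i * max 0 ((h - 1) - real i / real N)))" for i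
      unfolding gi[OF elim] by (simp only: algebra_simps)
    then have "(\<Sum>i<N\<^sup>2. ?q N i * (C N * g N (Suc i)))
        = (\<Sum>i<N\<^sup>2. C N * ((1 - 1 / (h * real N)) * ?q N i - 1 / h * (?q N i * max 0 ((h - 1) - real i / real N))))"
      by (intro sum.cong refl)
    then show ?case unfolding sum_distrib_left[symmetric] sum_subtractf by (rule sym)
  qed
  have "(\<lambda>N. 1 - 1 / (h * real N)) \<longlonglongrightarrow> 1" using h by real_asymp
  then have "(\<lambda>N. C N * ((1 - 1 / (h * real N)) * (\<Sum>i<N\<^sup>2. ?q N i) - 1 / h * (\<Sum>i<N\<^sup>2. ?q N i * max 0 ((h - 1) - real i / real N))))
      \<longlonglongrightarrow> 1 / h * (1 * 1 - 1 / h * ((h - 1) - 1 + exp (- (h - 1))))"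
    using h by (intro tendsto_mult[OF C] tendsto_diff tendsto_mult tendsto_const geometric_sum_limit truncated_sum_limit) auto
  from Lim_transform_eventually[OF this ev]
  show "(\<lambda>N. \<Sum>i<N\<^sup>2. ?q N i * (C N * g N (Suc i))) \<longlonglongrightarrow> (2 - exp (- (h - 1))) / h\<^sup>2"
    using h by (simp add: field_simps power2_eq_square)
qed

text \<open>One half is the share of the right side; together with the mirrored cells this gives
  total mass 1, hence the existence of a valley.\<close>

lemma cell_sum_single:
  "(\<lambda>N. cell_sum N (\<lambda>j k. (real N - real j - 2) / (real N - 1))) \<longlonglongrightarrow> 1 / 2"
proof -
  have "(\<lambda>N. cell_sum N (\<lambda>j k. ((real N - 2) * (1 / (real N - 1)) - 1 / (real N - 1) * real j) * 1)) \<longlonglongrightarrow> 1 / 6 + 1 / 3"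
  proof (rule cell_sum_limit)
    show "(\<lambda>N. (real N - 2) / real N) \<longlonglongrightarrow> 1" by real_asymp
    show "(\<lambda>N. 1 / (real N - 1) * real N) \<longlonglongrightarrow> 1" by real_asymp
  qed (use geometric_sum_limit in auto)
  moreover have "((real N - 2) * (1 / (real N - 1)) - 1 / (real N - 1) * real j) * 1 = (real N - real j - 2) / (real N - 1)" for N j
    by (simp add: diff_divide_distrib)
  ultimately show ?thesis by simp
qed

definition aging_prob :: "real \<Rightarrow> real" where
  "aging_prob h = 1 / h\<^sup>2 * (5 / 3 - 2 / 3 * exp (- (h - 1)))"

text \<open>The first sum belongs to the sufficient lists, the second to the necessary ones; the
  shifts between them disappear in the limit.\<close>

lemma cell_sum_common:
  fixes h :: real
  assumes h: "1 < h"
  shows "(\<lambda>N. cell_sum N (\<lambda>j k. (real N - real j - 2) / (real N - 1) * ((real N + 1) / (h * real N + 1) * ((h * real N - 1 - excess N (h * real N) k) / (h * real N)))))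
      \<longlonglongrightarrow> aging_prob h / 2"
    "(\<lambda>N. cell_sum N (\<lambda>j k. (real N - real j + 2) / real N * ((real N + 2) / (h * real N) * ((h * real N - 1 - excess N (h * real N) k) / (h * real N)))))
      \<longlonglongrightarrow> aging_prob h / 2"
proof -
  have val: "(1 / h\<^sup>2) / 6 + ((2 - exp (- (h - 1))) / h\<^sup>2) / 3 = aging_prob h / 2"
    using h by (simp add: aging_prob_def field_simps)
  have C1: "(\<lambda>N. (real N + 1) / (h * real N + 1)) \<longlonglongrightarrow> 1 / h" unfolding inverse_eq_divide[symmetric] using h by real_asymp
  have C2: "(\<lambda>N. (real N + 2) / (h * real N)) \<longlonglongrightarrow> 1 / h" unfolding inverse_eq_divide[symmetric] using h by real_asymp
  have A1: "(\<lambda>N. (real N - 2) / real N) \<longlonglongrightarrow> 1" "(\<lambda>N. 1 / (real N - 1) * real N) \<longlonglongrightarrow> 1"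
    and A2: "(\<lambda>N. (real N + 2) / real N) \<longlonglongrightarrow> 1" "(\<lambda>N. 1 / real N * real N) \<longlonglongrightarrow> 1" by real_asymp+
  note L1 = cell_sum_limit[OF A1 excess_sum_limit[OF h C1], unfolded val]
  note L2 = cell_sum_limit[OF A2 excess_sum_limit[OF h C2], unfolded val]
  have e1: "(real N - 2) * (1 / (real N - 1)) - 1 / (real N - 1) * real j = (real N - real j - 2) / (real N - 1)" for N j
    by (simp add: diff_divide_distrib)
  have e2: "(real N + 2) * (1 / real N) - 1 / real N * real j = (real N - real j + 2) / real N" for N j
    by (simp add: diff_divide_distrib add_divide_distrib)
  show "(\<lambda>N. cell_sum N (\<lambda>j k. (real N - real j - 2) / (real N - 1) * ((real N + 1) / (h * real N + 1) * ((h * real N - 1 - excess N (h * real N) k) / (h * real N)))))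
      \<longlonglongrightarrow> aging_prob h / 2" using L1 unfolding e1 .
  show "(\<lambda>N. cell_sum N (\<lambda>j k. (real N - real j + 2) / real N * ((real N + 2) / (h * real N) * ((h * real N - 1 - excess N (h * real N) k) / (h * real N)))))
      \<longlonglongrightarrow> aging_prob h / 2" using L2 unfolding e2 .
qed

section \<open>Probabilities of valleys\<close>

definition scale_levels :: "real \<Rightarrow> (real \<times> real) list \<Rightarrow> (real \<times> real) list" where
  "scale_levels u ps = map (\<lambda>(c, d). (u * c, u * d)) ps"

lemma hits_scale: 
  assumes "0 < u" shows "hits (\<lambda>t. w t / u) s c d t \<longleftrightarrow> hits w s (u * c) (u * d) t"
proof -
  have "min (u * c) (u * d) = u * min c d" "max (u * c) (u * d) = u * max c d"
    using assms by (simp_all add: min_mult_distrib_left max_mult_distrib_left)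
  then show ?thesis
    using assms by (simp add: hits_def pos_divide_less_eq pos_less_divide_eq nonzero_divide_eq_eq mult.commute)
qed

lemma follows_scale:
  assumes "0 < u" shows "follows (\<lambda>t. w t / u) ps t \<longleftrightarrow> follows w (scale_levels u ps) t"
  using assms by (induction ps arbitrary: t) (auto simp: scale_levels_def hits_scale)

lemma endpoint_scale: "endpoint (scale_levels u ps) = u * endpoint ps"
  by (cases ps) (auto simp: scale_levels_def)

lemma admissible_scale: 
  assumes "0 < u" shows "admissible (scale_levels u ps) \<longleftrightarrow> admissible ps"
proof (induction ps)
  case (Cons p ps)
  have "scale_levels u (p # ps) = (u * fst p, u * snd p) # scale_levels u ps" by (simp add: scale_levels_def case_prod_beta)
  with Cons assms show ?case by (simp add: endpoint_scale)
qed (simp add: scale_levels_def)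

lemma path_prob_scale: 
  assumes "0 < u" shows "path_prob (scale_levels u ps) = path_prob ps"
proof (induction ps)
  case (Cons p ps)
  have "scale_levels u (p # ps) = (u * fst p, u * snd p) # scale_levels u ps" by (simp add: scale_levels_def case_prod_beta)
  then have "path_prob (scale_levels u (p # ps)) = path_prob ps * ((u * endpoint ps - u * snd p) / (u * fst p - u * snd p))"
    using Cons by (simp add: endpoint_scale)
  also have "(u * endpoint ps - u * snd p) / (u * fst p - u * snd p) = (endpoint ps - snd p) / (fst p - snd p)"
    unfolding right_diff_distrib[symmetric] using assms by simp
  finally show ?case by simp
qed (simp add: scale_levels_def)

lemma follows_tl: "follows w (p # ps) t \<Longrightarrow> \<exists>s. follows w ps s"
  by auto

context brownian
begin

definition traced :: "real \<Rightarrow> (real \<times> real) list \<Rightarrow> (real \<times> real) list \<Rightarrow> 'w set" where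
  "traced u rs ls = followed (scale_levels u rs) \<inter> followed_left (scale_levels u ls)"

definition traced_mirror :: "real \<Rightarrow> (real \<times> real) list \<Rightarrow> (real \<times> real) list \<Rightarrow> 'w set" where
  "traced_mirror u rs ls = followed (scale_levels u ls) \<inter> followed_left (scale_levels u rs)"

lemma traced_iff:
  assumes "0 < u"
  shows "x \<in> traced u rs ls \<longleftrightarrow> x \<in> space W \<and> (\<exists>t. follows (\<lambda>t. path x t / u) rs t) \<and> (\<exists>t. follows (\<lambda>t. path x (- t) / u) ls t)"
    "x \<in> traced_mirror u rs ls \<longleftrightarrow> x \<in> space W \<and> (\<exists>t. follows (\<lambda>t. path x (- t) / u) rs t) \<and> (\<exists>t. follows (\<lambda>t. path x t / u) ls t)"
  unfolding traced_def traced_mirror_def followed_def followed_left_def follows_scale[OF assms, of "path x"] follows_scale[OF assms, of "\<lambda>t. path x (- t)"]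
  by auto

lemma traced_events:
  assumes "0 < u" "admissible rs" "admissible ls"
  shows "traced u rs ls \<in> events" "traced_mirror u rs ls \<in> events"
    "prob (traced u rs ls) = path_prob rs * path_prob ls" "prob (traced_mirror u rs ls) = path_prob rs * path_prob ls"
  unfolding traced_def traced_mirror_def
  using assms by (auto simp: prob_followed_both admissible_scale path_prob_scale followed_event followed_left_event)

lemma scaled_path:
  assumes "x \<in> space W"
  shows "continuous_on UNIV (\<lambda>t. path x t / u)" "path x 0 / u = 0"
    "continuous_on UNIV (\<lambda>t. path x (- t) / u)" "path x (- 0) / u = 0"
  using B_continuous[OF assms] B_0[OF assms]
  by (auto intro!: continuous_on_mult_right continuous_on_compose2[OF B_continuous[OF assms]] continuous_intros simp: divide_inverse)

text \<open>Events on one side are disjoint by \<open>cell_unique\<close>, and events on opposite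
  sides by \<open>cells_sides_False\<close>. Hence the probabilities add up, and the factor 2 counts
  the sides.\<close>

lemma traced_cells:
  assumes u: "0 < u" and N: "6 \<le> N"
    and rs: "\<And>j k. j \<in> {3..N - 3} \<Longrightarrow> admissible (rs j k)" "\<And>j k w t. follows w (rs j k) t \<Longrightarrow> \<exists>s. follows w (cell N j k) s"
    and ls: "\<And>j k. j \<in> {3..N - 3} \<Longrightarrow> admissible (ls j k)" "\<And>j k w t. follows w (ls j k) t \<Longrightarrow> \<exists>s. follows w (exit_left N j) s"
    and f: "\<And>j k. j \<in> {3..N - 3} \<Longrightarrow> path_prob (rs j k) * path_prob (ls j k) = path_prob (cell N j k) * f j k"
  defines "G \<equiv> (\<Union>j\<in>{3..N - 3}. \<Union>k\<in>{..N\<^sup>2}. traced u (rs j k) (ls j k) \<union> traced_mirror u (rs j k) (ls j k))"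
  shows "G \<in> events" "prob G = 2 * cell_sum N f"
proof -
  let ?I = "{3..N - 3} \<times> {..N\<^sup>2}"
  define E where "E p = traced u (rs (fst p) (snd p)) (ls (fst p) (snd p))" for p
  define E' where "E' p = traced_mirror u (rs (fst p) (snd p)) (ls (fst p) (snd p))" for p
  have j: "3 \<le> j" "j + 3 \<le> N" if "j \<in> {3..N - 3}" for j using that N by auto
  have ev: "E p \<in> events" "E' p \<in> events" "prob (E p) = path_prob (cell N (fst p) (snd p)) * f (fst p) (snd p)"
    "prob (E' p) = path_prob (cell N (fst p) (snd p)) * f (fst p) (snd p)" if "p \<in> ?I" for p
  proof -
    have "fst p \<in> {3..N - 3}" using that by auto
    note t = traced_events[OF u rs(1)[OF this] ls(1)[OF this], of "snd p" "snd p"] 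
    show "E p \<in> events" "E' p \<in> events" unfolding E_def E'_def by (rule t)+
    show "prob (E p) = path_prob (cell N (fst p) (snd p)) * f (fst p) (snd p)"
      "prob (E' p) = path_prob (cell N (fst p) (snd p)) * f (fst p) (snd p)"
      unfolding E_def E'_def t f[OF \<open>fst p \<in> {3..N - 3}\<close>] by (rule refl)+
  qed
  have ED: "x \<in> space W" "\<exists>t. follows (\<lambda>t. path x t / u) (cell N (fst p) (snd p)) t" "\<exists>t. follows (\<lambda>t. path x (- t) / u) (exit_left N (fst p)) t"
    if "x \<in> E p" for x p using that rs(2) ls(2) unfolding E_def traced_iff[OF u] by blast+
  have ED': "x \<in> space W" "\<exists>t. follows (\<lambda>t. path x (- t) / u) (cell N (fst p) (snd p)) t" "\<exists>t. follows (\<lambda>t. path x t / u) (exit_left N (fst p)) t"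
    if "x \<in> E' p" for x p using that rs(2) ls(2) unfolding E'_def traced_iff[OF u] by blast+
  have d: "disjoint_family_on E ?I"
    unfolding disjoint_family_on_def
  proof (intro ballI impI equals0I)
    fix p q x assume p: "p \<in> ?I" and q: "q \<in> ?I" and ne: "p \<noteq> q" and x: "x \<in> E p \<inter> E q"
    have "fst p = fst q \<and> snd p = snd q"
      using cell_unique[of "\<lambda>t. path x t / u"] ED(2)[of x p] ED(2)[of x q] x j[of "fst p"] j[of "fst q"] p q scaled_path(2)[of x u] ED(1)[of x p]
      by (metis IntD1 IntD2 SigmaE fst_conv)
    with ne show False by (simp add: prod_eq_iff)
  qed
  have d': "disjoint_family_on E' ?I"
    unfolding disjoint_family_on_def
  proof (intro ballI impI equals0I)
    fix p q x assume p: "p \<in> ?I" and q: "q \<in> ?I" and ne: "p \<noteq> q" and x: "x \<in> E' p \<inter> E' q"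
    have "fst p = fst q \<and> snd p = snd q"
      using cell_unique[of "\<lambda>t. path x (- t) / u"] ED'(2)[of x p] ED'(2)[of x q] x j[of "fst p"] j[of "fst q"] p q scaled_path(4)[of x u] ED'(1)[of x p]
      by (metis IntD1 IntD2 SigmaE fst_conv)
    with ne show False by (simp add: prod_eq_iff)
  qed
  have dd: "(\<Union>p\<in>?I. E p) \<inter> (\<Union>p\<in>?I. E' p) = {}"
  proof (rule equals0I)
    fix x assume "x \<in> (\<Union>p\<in>?I. E p) \<inter> (\<Union>p\<in>?I. E' p)"
    then obtain p q where p: "p \<in> ?I" "x \<in> E p" and q: "q \<in> ?I" "x \<in> E' q" by blast
    obtain t1 t2 where "follows (\<lambda>t. path x t / u) (cell N (fst p) (snd p)) t1" "follows (\<lambda>t. path x (- t) / u) (exit_left N (fst p)) t2"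
      using ED(2,3)[OF p(2)] by blast
    moreover obtain t3 t4 where "follows (\<lambda>t. path x (- t) / u) (cell N (fst q) (snd q)) t3" "follows (\<lambda>t. path x t / u) (exit_left N (fst q)) t4"
      using ED'(2,3)[OF q(2)] by blast
    moreover have "3 \<le> fst p" "fst p + 3 \<le> N" "3 \<le> fst q" "fst q + 3 \<le> N" using j[of "fst p"] j[of "fst q"] p(1) q(1) by auto
    ultimately show False by (rule cells_sides_False[of "\<lambda>t. path x t / u"])
  qed
  have G: "G = (\<Union>p\<in>?I. E p) \<union> (\<Union>p\<in>?I. E' p)" unfolding G_def E_def E'_def
    by (simp only: set_eq_iff UN_iff Un_iff Bex_def split_paired_Ex mem_Sigma_iff fst_conv snd_conv) blast
  have fin: "finite ?I" by simp
  have ee: "(\<Union>p\<in>?I. E p) \<in> events" "(\<Union>p\<in>?I. E' p) \<in> events" using ev(1,2) fin by (intro sets.finite_UN; blast)+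
  then show "G \<in> events" unfolding G by (rule sets.Un)
  have cs: "cell_sum N f = (\<Sum>p\<in>?I. path_prob (cell N (fst p) (snd p)) * f (fst p) (snd p))"
    unfolding cell_sum_def by (simp add: sum.cartesian_product case_prod_beta)
  have "prob (\<Union>p\<in>?I. E p) = cell_sum N f" unfolding cs
    by (subst finite_measure_finite_Union[OF fin _ d]) (use ev in \<open>auto intro!: sum.cong\<close>)
  moreover have "prob (\<Union>p\<in>?I. E' p) = cell_sum N f" unfolding cs
    by (subst finite_measure_finite_Union[OF fin _ d']) (use ev in \<open>auto intro!: sum.cong\<close>)
  ultimately show "prob G = 2 * cell_sum N f" unfolding G using finite_measure_Union[OF ee dd] by simp
qed

text \<open>The cells for a given \<open>N\<close> miss paths whose probability tends to 0 as
  \<open>N\<close> grows, so the union over all \<open>N\<close> has full measure.\<close>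

lemma AE_valley:
  assumes H: "0 < H"
  shows "AE x in W. \<exists>b. valley H (path x) b \<or> valley H (\<lambda>t. path x (- t)) b"
proof -
  define G where "G N = (\<Union>j\<in>{3..N - 3}. \<Union>k\<in>{..N\<^sup>2}. traced (H / real N) (cell N j k) (exit_left N j) \<union> traced_mirror (H / real N) (cell N j k) (exit_left N j))" for N
  have u: "0 < H / real N" if "6 \<le> N" for N using that H by simp
  have *: "G N \<in> events \<and> prob (G N) = 2 * cell_sum N (\<lambda>j k. (real N - real j - 2) / (real N - 1))" if N: "6 \<le> N" for N
  proof -
    have a: "admissible (cell N j k)" "admissible (exit_left N j)" "path_prob (exit_left N j) = (real N - real j - 2) / (real N - 1)"
      if "j \<in> {3..N - 3}" for j k
    proof -
      have j: "3 \<le> j" "j + 3 \<le> N" using that N by auto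
      show "admissible (cell N j k)" using j by (rule admissible_cell)
      show "admissible (exit_left N j)" using j by (simp add: exit_left_def)
      show "path_prob (exit_left N j) = (real N - real j - 2) / (real N - 1)" using j by (simp add: exit_left_def)
    qed
    show ?thesis
      unfolding G_def
      by (intro conjI traced_cells[where rs = "cell N" and ls = "\<lambda>j k. exit_left N j" and f = "\<lambda>j k. (real N - real j - 2) / (real N - 1)", OF u[OF N] N])
        (simp_all add: a exI)
  qed
  have val: "\<exists>b. valley H (path x) b \<or> valley H (\<lambda>t. path x (- t)) b" if N: "6 \<le> N" and x: "x \<in> G N" for N x
  proof -
    obtain j k where j: "j \<in> {3..N - 3}" and xx: "x \<in> traced (H / real N) (cell N j k) (exit_left N j) \<or> x \<in> traced_mirror (H / real N) (cell N j k) (exit_left N j)"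
      using x unfolding G_def by blast
    have j: "3 \<le> j" "j + 3 \<le> N" using j N by auto
    have HN: "H / real N * real N = H" using N by simp
    have xW: "x \<in> space W" using xx unfolding traced_iff[OF u[OF N]] by blast
    note sp = scaled_path[OF xW, of "H / real N"]
    from xx show ?thesis
    proof
      assume "x \<in> traced (H / real N) (cell N j k) (exit_left N j)"
      then obtain t s where "follows (\<lambda>t. path x t / (H / real N)) (cell N j k) t" "follows (\<lambda>t. path x (- t) / (H / real N)) (exit_left N j) s"
        unfolding traced_iff[OF u[OF N]] by blast
      from single_valley[OF this sp(1,2) j] show ?thesis unfolding valley_scale[OF u[OF N], of _ "path x"] HN by blast
    next
      assume "x \<in> traced_mirror (H / real N) (cell N j k) (exit_left N j)"
      then obtain t s where "follows (\<lambda>t. path x (- t) / (H / real N)) (cell N j k) t" "follows (\<lambda>t. path x t / (H / real N)) (exit_left N j) s"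
        unfolding traced_iff[OF u[OF N]] by blast
      then have "follows (\<lambda>t. path x (- t) / (H / real N)) (cell N j k) t" "follows (\<lambda>t. path x (- (- t)) / (H / real N)) (exit_left N j) s" by simp_all
      from single_valley[OF this sp(3,4) j] show ?thesis unfolding valley_scale[OF u[OF N], of _ "\<lambda>t. path x (- t)"] HN by blast
    qed
  qed
  have lim: "(\<lambda>N. 2 * cell_sum N (\<lambda>j k. (real N - real j - 2) / (real N - 1))) \<longlonglongrightarrow> 1"
    using tendsto_mult[OF tendsto_const[of 2] cell_sum_single] by simp
  have ev: "(\<Union>N\<in>{6..}. G N) \<in> events" using * by (intro sets.countable_UN') auto
  have "1 \<le> prob (\<Union>N\<in>{6..}. G N)"
  proof (rule tendsto_upperbound[OF lim])
    show "\<forall>\<^sub>F N in sequentially. 2 * cell_sum N (\<lambda>j k. (real N - real j - 2) / (real N - 1)) \<le> prob (\<Union>N\<in>{6..}. G N)"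
      using eventually_ge_at_top[of 6]
    proof eventually_elim
      case (elim N)
      then have "prob (G N) \<le> prob (\<Union>N\<in>{6..}. G N)" by (intro finite_measure_mono ev) auto
      with * elim show ?case by simp
    qed
  qed simp
  then have "prob (\<Union>N\<in>{6..}. G N) = 1" using prob_le_1[of "\<Union>N\<in>{6..}. G N"] by linarith
  then have "AE x in W. x \<in> (\<Union>N\<in>{6..}. G N)" by (subst prob_eq_1[OF ev, symmetric])
  then show ?thesis by eventually_elim (use val in blast)
qed

end

section \<open>The probability of coinciding bottoms\<close>

definition shared_valley :: "real \<Rightarrow> (real \<Rightarrow> real) \<Rightarrow> bool" where
  "shared_valley h w \<longleftrightarrow> (\<exists>b. valley 1 w b \<and> valley h w b)"

lemma shared_valley_scale:
  assumes "0 < N" shows "shared_valley h w \<longleftrightarrow> (\<exists>b. valley (real N) (\<lambda>t. w t / (1 / real N)) b \<and> valley (h * real N) (\<lambda>t. w t / (1 / real N)) b)"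
proof -
  have "0 < 1 / real N" using assms by simp
  note v = valley_scale[OF this, of _ w]
  have "1 / real N * real N = 1" "1 / real N * (h * real N) = h" using assms by simp_all
  then show ?thesis unfolding shared_valley_def v by simp
qed

context brownian
begin

lemma shared_valley_lower:
  assumes h: "1 < h" and e: "0 < e"
  obtains G where "G \<in> events" "aging_prob h - e \<le> prob G"
    "\<And>x. x \<in> G \<Longrightarrow> x \<in> space W \<and> (shared_valley h (path x) \<or> shared_valley h (\<lambda>t. path x (- t)))"
proof -
  define f where "f N j k = (real N - real j - 2) / (real N - 1) * ((real N + 1) / (h * real N + 1) * ((h * real N - 1 - excess N (h * real N) k) / (h * real N)))"
    for N j k :: nat
  have "(\<lambda>N. 2 * cell_sum N (f N)) \<longlonglongrightarrow> aging_prob h"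
    using tendsto_mult[OF tendsto_const[of 2] cell_sum_common(1)[OF h]] by (simp add: f_def[abs_def])
  then have "\<forall>\<^sub>F N in sequentially. aging_prob h - e < 2 * cell_sum N (f N)"
    using e by (intro order_tendstoD(1)) auto
  then obtain N where N: "6 \<le> N" "aging_prob h - e < 2 * cell_sum N (f N)"
    using eventually_ge_at_top[of 6] by (metis (mono_tags, lifting) eventually_conj eventually_happens' sequentially_bot)
  define K where "K = h * real N"
  have K: "real N < K" using h N by (simp add: K_def)
  define rs where "rs j k = (level N j k + K + 1, level N j k) # cell N j k" for j k
  define ls where "ls j k = (real j + 2 + excess N K k, real j + 2 + excess N K k - K) # exit_left N j" for j k
  have exc: "0 \<le> excess N K k" "excess N K k \<le> K - real N" for k using K by (auto simp: excess_def)
  have u: "0 < 1 / real N" using N by simp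
  define G where "G = (\<Union>j\<in>{3..N - 3}. \<Union>k\<in>{..N\<^sup>2}. traced (1 / real N) (rs j k) (ls j k) \<union> traced_mirror (1 / real N) (rs j k) (ls j k))"
  have adm: "admissible (rs j k)" "admissible (ls j k)" "path_prob (rs j k) * path_prob (ls j k) = path_prob (cell N j k) * f N j k"
    if "j \<in> {3..N - 3}" for j k
  proof -
    have j: "3 \<le> j" "j + 3 \<le> N" using that N by auto
    show "admissible (rs j k)" using admissible_cell[OF j] K by (simp add: rs_def endpoint_cell)
    show "admissible (ls j k)" using j exc[of k] N(1) by (simp add: ls_def exit_left_def)
    have "path_prob (rs j k) = path_prob (cell N j k) * ((real N + 1) / (K + 1))"
      by (simp add: rs_def endpoint_cell)
    moreover have "path_prob (ls j k) = (real N - real j - 2) / (real N - 1) * ((K - 1 - excess N K k) / K)"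
      by (simp add: ls_def exit_left_def) (simp add: algebra_simps)
    ultimately show "path_prob (rs j k) * path_prob (ls j k) = path_prob (cell N j k) * f N j k"
      by (simp only: f_def K_def[symmetric] mult_ac)
  qed
  have tl: "follows w (rs j k) t \<Longrightarrow> \<exists>s. follows w (cell N j k) s" "follows w (ls j k) t \<Longrightarrow> \<exists>s. follows w (exit_left N j) s"
    for j k w t
    unfolding rs_def ls_def by (rule follows_tl; assumption)+
  have GG: "G \<in> events \<and> prob G = 2 * cell_sum N (f N)"
    unfolding G_def by (intro conjI; rule traced_cells[where rs = rs and ls = ls and f = "f N", OF u N(1) adm(1) tl(1) adm(2) tl(2) adm(3)])
  show ?thesis
  proof (rule that)
    show "G \<in> events" using GG by (rule conjunct1)
    show "aging_prob h - e \<le> prob G" using GG N(2) by linarith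
    fix x assume "x \<in> G"
    then obtain j k where j: "j \<in> {3..N - 3}" and xx: "x \<in> traced (1 / real N) (rs j k) (ls j k) \<or> x \<in> traced_mirror (1 / real N) (rs j k) (ls j k)"
      unfolding G_def by blast
    have j: "3 \<le> j" "j + 3 \<le> N" using j N by auto
    have xW: "x \<in> space W" using xx unfolding traced_iff[OF u] by blast
    note sp = scaled_path[OF xW, of "1 / real N"]
    have N0: "0 < N" using N by simp
    note sc = shared_valley_scale[OF N0, folded K_def]
    from xx have "shared_valley h (path x) \<or> shared_valley h (\<lambda>t. path x (- t))"
    proof
      assume "x \<in> traced (1 / real N) (rs j k) (ls j k)"
      then obtain t s where "follows (\<lambda>t. path x t / (1 / real N)) (rs j k) t" "follows (\<lambda>t. path x (- t) / (1 / real N)) (ls j k) s"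
        unfolding traced_iff[OF u] by blast
      from common_valley[OF this[unfolded rs_def ls_def] sp(1,2) j K] have "shared_valley h (path x)"
        unfolding shared_valley_scale[OF N0] K_def .
      then show ?thesis by (rule disjI1)
    next
      assume "x \<in> traced_mirror (1 / real N) (rs j k) (ls j k)"
      then obtain t s where t: "follows (\<lambda>t. path x (- t) / (1 / real N)) (rs j k) t" and s: "follows (\<lambda>t. path x t / (1 / real N)) (ls j k) s"
        unfolding traced_iff[OF u] by blast
      have "follows (\<lambda>t. path x (- (- t)) / (1 / real N)) (ls j k) s" using s by simp
      from common_valley[OF t[unfolded rs_def] this[unfolded ls_def] sp(3,4) j K] have "shared_valley h (\<lambda>t. path x (- t))"
        unfolding shared_valley_scale[OF N0] K_def .
      then show ?thesis by (rule disjI2)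
    qed
    with xW show "x \<in> space W \<and> (shared_valley h (path x) \<or> shared_valley h (\<lambda>t. path x (- t)))" by blast
  qed
qed

lemma followed_ConsD: "x \<in> followed (p # ps) \<Longrightarrow> x \<in> followed ps"
  unfolding followed_def by auto

text \<open>The two orders of hitting exclude each other, and their probabilities add up to that of
  the tail.\<close>

lemma followed_exit:
  assumes adm: "admissible ((c, d) # ps)"
  shows "AE x in W. x \<in> followed ps \<longrightarrow> x \<in> followed ((c, d) # ps) \<union> followed ((d, c) # ps)"
proof -
  have adm': "admissible ((d, c) # ps)" "admissible ps" using adm by auto
  have ne: "c \<noteq> d" using adm by auto
  let ?A = "followed ((c, d) # ps)" and ?B = "followed ((d, c) # ps)"
  note ev = followed_event[OF adm] followed_event[OF adm'(1)] followed_event[OF adm'(2)]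
  have dj: "?A \<inter> ?B = {}"
  proof (rule equals0I)
    fix x assume "x \<in> ?A \<inter> ?B"
    then obtain t t' s s' where "follows (path x) ps s" "hits (path x) s c d t" "follows (path x) ps s'" "hits (path x) s' d c t'"
      unfolding followed_def by auto
    then show False using follows_unique hits_exclusive by metis
  qed
  have top: "space W \<in> sets (incr {..0})" using sets.top[of "incr {..0}"] by simp
  have pr: "prob (followed qs) = path_prob qs" if "admissible qs" for qs
    using prob_followed[OF top that] followed_event[OF that] sets.sets_into_space[of "followed qs" W] by (simp add: prob_space Int_absorb1)
  have "prob (?A \<union> ?B) = path_prob ps * ((endpoint ps - d) / (c - d)) + path_prob ps * ((endpoint ps - c) / (d - c))"
    using finite_measure_Union[OF ev(1,2) dj] pr[OF adm] pr[OF adm'(1)] by simp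
  also have "\<dots> = path_prob ps * (((endpoint ps - d) + (c - endpoint ps)) / (c - d))"
    unfolding add_divide_distrib distrib_left using minus_divide_divide[of "c - endpoint ps" "c - d"] by simp
  also have "\<dots> = prob (followed ps)" using ne by (simp add: pr[OF adm'(2)])
  finally have eq: "prob (?A \<union> ?B) = prob (followed ps)" .
  have sub: "?A \<union> ?B \<subseteq> followed ps" using followed_ConsD by blast
  have "prob (followed ps - (?A \<union> ?B)) = 0"
    using finite_measure_Diff[OF ev(3) sets.Un[OF ev(1,2)] sub] eq by simp
  then have "followed ps - (?A \<union> ?B) \<in> null_sets W" using ev by (auto simp: null_sets_def emeasure_eq_measure)
  from AE_not_in[OF this] show ?thesis by eventually_elim blast
qed

end

lemma (in brownian) brownian_reflected: "brownian W (\<lambda>t. B (- t))"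
  by (rule brownian.intro) (rule brownian_reflect)

context brownian
begin

lemma followed_left_reflected: "followed_left ps = brownian.followed W (\<lambda>t. B (- t)) ps"
  unfolding followed_left_def brownian.followed_def[OF brownian_reflected] ..

lemma followed_left_exit:
  assumes "admissible ((c, d) # ps)"
  shows "AE x in W. x \<in> followed_left ps \<longrightarrow> x \<in> followed_left ((c, d) # ps) \<union> followed_left ((d, c) # ps)"
  unfolding followed_left_reflected using brownian.followed_exit[OF brownian_reflected assms] .

text \<open>Paths in no cell are put into \<open>G\<close>, as they have small probability. Inside a
  cell, \<open>common_valley_necessary\<close> forbids one order of hitting for each of three pairs
  of levels; almost surely the opposite order then occurs, which is the pattern counted by the
  second sum of \<open>cell_sum_common\<close>.\<close>

lemma shared_valley_upper_right:
  assumes h: "1 < h" and e: "0 < e"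
  obtains G where "G \<in> events" "prob G \<le> aging_prob h / 2 + e" "AE x in W. shared_valley h (path x) \<longrightarrow> x \<in> G"
proof -
  define f where "f N j k = (real N - real j + 2) / real N * ((real N + 2) / (h * real N) * ((h * real N - 1 - excess N (h * real N) k) / (h * real N)))"
    for N j k :: nat
  have "(\<lambda>N. 1 - cell_sum N (\<lambda>j k. 1) + cell_sum N (f N)) \<longlonglongrightarrow> 1 - 1 + aging_prob h / 2"
    unfolding f_def by (intro tendsto_intros cell_sum_total cell_sum_common(2) h)
  then have "\<forall>\<^sub>F N in sequentially. 1 - cell_sum N (\<lambda>j k. 1) + cell_sum N (f N) < aging_prob h / 2 + e"
    using e by (intro order_tendstoD(2)) auto
  moreover have "\<forall>\<^sub>F N in sequentially. real N + 2 < h * real N" using h by real_asymp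
  ultimately obtain N where N: "6 \<le> N" "1 - cell_sum N (\<lambda>j k. 1) + cell_sum N (f N) < aging_prob h / 2 + e" "real N + 2 < h * real N"
    using eventually_ge_at_top[of 6] by (metis (mono_tags, lifting) eventually_conj eventually_happens' sequentially_bot)
  define K where "K = h * real N"
  have K: "real N + 2 < K" using N by (simp add: K_def)
  have u: "0 < 1 / real N" and N0: "0 < N" using N by simp_all
  define rs where "rs j k = (level N j k - 1 + K, level N j k - 1) # cell N j k" for j k
  define ls0 where "ls0 j = [(real j - 2, real j - 2 - real N)]" for j
  define ls where "ls j k = (real j - 1 + excess N K k, real j - 1 + excess N K k - K) # ls0 j" for j k
  have exc: "0 \<le> excess N K k" "excess N K k \<le> K - real N" for k using K by (auto simp: excess_def)
  let ?I = "{3..N - 3} \<times> {..N\<^sup>2}"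
  have j: "3 \<le> j" "j + 3 \<le> N" if "j \<in> {3..N - 3}" for j using that N(1) by auto
  have adm: "admissible (cell N j k)" "admissible (rs j k)" "admissible (ls0 j)" "admissible (ls j k)" if "j \<in> {3..N - 3}" for j k
  proof -
    show c: "admissible (cell N j k)" using j[OF that] by (rule admissible_cell)
    show "admissible (rs j k)" using c K by (simp add: rs_def endpoint_cell)
    show l: "admissible (ls0 j)" using j[OF that] by (simp add: ls0_def)
    show "admissible (ls j k)" using l exc[of k] N(1) by (simp add: ls_def) (simp add: ls0_def)
  qed
  define sc where "sc = scale_levels (1 / real N)"
  have adm_sc: "admissible (sc ps) \<longleftrightarrow> admissible ps" and prob_sc: "path_prob (sc ps) = path_prob ps" for ps
    unfolding sc_def by (rule admissible_scale[OF u] path_prob_scale[OF u])+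
  define C where "C p = followed (sc (cell N (fst p) (snd p)))" for p
  define U where "U p = traced (1 / real N) (rs (fst p) (snd p)) (ls (fst p) (snd p))" for p
  have evC: "C p \<in> events" "prob (C p) = path_prob (cell N (fst p) (snd p))"
    and evU: "U p \<in> events" "prob (U p) = path_prob (cell N (fst p) (snd p)) * f N (fst p) (snd p)" if "p \<in> ?I" for p
  proof -
    have p: "fst p \<in> {3..N - 3}" using that by auto
    have a: "admissible (sc (cell N (fst p) (snd p)))" unfolding adm_sc using p by (rule adm)
    show "C p \<in> events" unfolding C_def using a by (rule followed_event)
    have top: "space W \<in> sets (incr {..0})" using sets.top[of "incr {..0}"] by simp
    show "prob (C p) = path_prob (cell N (fst p) (snd p))"
      using prob_followed[OF top a] followed_event[OF a] sets.sets_into_space[of "C p" W]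
      by (simp add: prob_space Int_absorb1 C_def prob_sc)
    note t = traced_events[OF u adm(2)[OF p] adm(4)[OF p], of "snd p" "snd p"]
    show "U p \<in> events" unfolding U_def by (rule t)
    let ?j = "fst p" and ?k = "snd p"
    have "path_prob (rs ?j ?k) = path_prob (cell N ?j ?k) * ((real N + 2) / K)"
      by (simp add: rs_def endpoint_cell)
    moreover have "path_prob (ls ?j ?k) = (real N - real ?j + 2) / real N * ((K - 1 - excess N K ?k) / K)"
      by (simp add: ls_def ls0_def) (simp add: algebra_simps)
    ultimately show "prob (U p) = path_prob (cell N (fst p) (snd p)) * f N (fst p) (snd p)"
      unfolding U_def t by (simp only: f_def K_def[symmetric] mult_ac)
  qed
  have fin: "finite ?I" by simp
  have followed_sc: "x \<in> followed (sc ps) \<longleftrightarrow> x \<in> space W \<and> (\<exists>t. follows (\<lambda>t. path x t / (1 / real N)) ps t)"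
    "x \<in> followed_left (sc ps) \<longleftrightarrow> x \<in> space W \<and> (\<exists>t. follows (\<lambda>t. path x (- t) / (1 / real N)) ps t)" for x ps
    unfolding followed_def followed_left_def sc_def follows_scale[OF u, of "path x"] follows_scale[OF u, of "\<lambda>t. path x (- t)"] by auto
  have d: "disjoint_family_on C ?I"
    unfolding disjoint_family_on_def
  proof (intro ballI impI equals0I)
    fix p q x assume p: "p \<in> ?I" and q: "q \<in> ?I" and ne: "p \<noteq> q" and x: "x \<in> C p \<inter> C q"
    obtain t s where "follows (\<lambda>t. path x t / (1 / real N)) (cell N (fst p) (snd p)) t" "follows (\<lambda>t. path x t / (1 / real N)) (cell N (fst q) (snd q)) s"
      and xW: "x \<in> space W"
      using x unfolding C_def Int_iff followed_sc by blast
    from cell_unique[OF this(1,2) scaled_path(2)[OF xW] j[of "fst p"] j[of "fst q"]] have "fst p = fst q \<and> snd p = snd q"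
      using p q by auto
    with ne show False by (simp add: prod_eq_iff)
  qed
  define G where "G = (space W - (\<Union>p\<in>?I. C p)) \<union> (\<Union>p\<in>?I. U p)"
  have eC: "(\<Union>p\<in>?I. C p) \<in> events" and eU: "(\<Union>p\<in>?I. U p) \<in> events"
    using evC(1) evU(1) fin by (intro sets.finite_UN; blast)+
  have cs: "cell_sum N g = (\<Sum>p\<in>?I. path_prob (cell N (fst p) (snd p)) * g (fst p) (snd p))" for g
    unfolding cell_sum_def by (simp add: sum.cartesian_product case_prod_beta)
  have "prob (\<Union>p\<in>?I. C p) = cell_sum N (\<lambda>j k. 1)" unfolding cs
    by (subst finite_measure_finite_Union[OF fin _ d]) (use evC in \<open>auto intro!: sum.cong\<close>)
  moreover have "prob (\<Union>p\<in>?I. U p) \<le> (\<Sum>p\<in>?I. prob (U p))"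
    using evU(1) by (intro finite_measure_subadditive_finite fin) blast
  moreover have "(\<Sum>p\<in>?I. prob (U p)) = cell_sum N (f N)"
    unfolding cs by (intro sum.cong refl evU(2))
  moreover have "prob G \<le> prob (space W - (\<Union>p\<in>?I. C p)) + prob (\<Union>p\<in>?I. U p)"
    unfolding G_def using eC eU by (intro measure_Un_le) auto
  ultimately have pG: "prob G \<le> aging_prob h / 2 + e" using N(2) prob_compl[OF eC] by linarith
  have "AE x in W. x \<in> C p \<longrightarrow> shared_valley h (path x) \<longrightarrow> x \<in> U p" if p: "p \<in> ?I" for p
  proof -
    obtain j k where jk: "p = (j, k)" "j \<in> {3..N - 3}" using p by auto
    note a = adm[OF jk(2)]
    have sc_Cons: "sc ((c, d) # ps) = (1 / real N * c, 1 / real N * d) # sc ps" for c d ps by (simp add: sc_def scale_levels_def)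
    have swap: "admissible ((c, d) # ps) \<Longrightarrow> AE x in W. x \<in> followed (sc ps) \<longrightarrow> x \<in> followed (sc ((c, d) # ps)) \<union> followed (sc ((d, c) # ps))"
      "admissible ((c, d) # ps) \<Longrightarrow> AE x in W. x \<in> followed_left (sc ps) \<longrightarrow> x \<in> followed_left (sc ((c, d) # ps)) \<union> followed_left (sc ((d, c) # ps))" for c d ps
      unfolding adm_sc[symmetric, of "(c, d) # ps"] unfolding sc_Cons by (rule followed_exit followed_left_exit; assumption)+
    note r = swap(1)[OF a(2)[of k, unfolded rs_def]]
    note l0 = swap(2)[OF a(3)[unfolded ls0_def]]
    note l = swap(2)[OF a(4)[of k, unfolded ls_def]]
    show ?thesis
      using r l0 l AE_space
    proof eventually_elim
      case (elim x)
      show ?case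
      proof (intro impI)
        assume x: "x \<in> C p" and sh: "shared_valley h (path x)"
        let ?w = "\<lambda>t. path x t / (1 / real N)"
        obtain b where b: "valley (real N) ?w b" "valley K ?w b" using sh unfolding shared_valley_scale[OF N0] K_def by blast
        note xW = \<open>x \<in> space W\<close>
        have xc: "x \<in> followed (sc (cell N j k))" using x by (simp add: C_def jk)
        note nec = common_valley_necessary[OF _ scaled_path(2)[OF xW, of "1 / real N"] j[OF jk(2)] K b]
        have "x \<notin> followed (sc ((level N j k - 1, level N j k - 1 + K) # cell N j k))"
          using nec(1) unfolding followed_sc by auto
        with elim(1) xc have 1: "x \<in> followed (sc (rs j k))" unfolding rs_def by blast
        obtain e where e: "follows ?w (cell N j k) e" using xc unfolding followed_sc by blast
        have "x \<notin> followed_left (sc [(real j - 2 - real N, real j - 2)])"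
          using nec(2)[OF e] unfolding followed_sc by auto
        moreover have "x \<in> followed_left (sc [])" unfolding followed_sc follows.simps(1) using xW by blast
        ultimately have l0: "x \<in> followed_left (sc (ls0 j))" using elim(2) unfolding ls0_def by blast
        have "x \<notin> followed_left (sc ((real j - 1 + excess N K k - K, real j - 1 + excess N K k) # ls0 j))"
          using nec(3)[OF e] unfolding followed_sc by (auto simp: ls0_def)
        with elim(3) l0 have 2: "x \<in> followed_left (sc (ls j k))" unfolding ls_def by blast
        show "x \<in> U p" using 1 2 unfolding U_def traced_def jk sc_def by simp
      qed
    qed
  qed
  then have "AE x in W. \<forall>p\<in>?I. x \<in> C p \<longrightarrow> shared_valley h (path x) \<longrightarrow> x \<in> U p"
    unfolding AE_finite_all[OF fin] by blast
  then have "AE x in W. shared_valley h (path x) \<longrightarrow> x \<in> G"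
    using AE_space by eventually_elim (unfold G_def, blast)
  moreover have "G \<in> events" unfolding G_def using eC eU by auto
  ultimately show ?thesis using that pG by blast
qed


lemma shared_valley_upper:
  assumes h: "1 < h" and e: "0 < e"
  obtains G where "G \<in> events" "prob G \<le> aging_prob h + e"
    "AE x in W. shared_valley h (path x) \<or> shared_valley h (\<lambda>t. path x (- t)) \<longrightarrow> x \<in> G"
proof -
  have e2: "0 < e / 2" using e by simp
  obtain G where G: "G \<in> events" "prob G \<le> aging_prob h / 2 + e / 2" "AE x in W. shared_valley h (path x) \<longrightarrow> x \<in> G"
    by (rule shared_valley_upper_right[OF h e2])
  obtain G' where G': "G' \<in> events" "prob G' \<le> aging_prob h / 2 + e / 2" "AE x in W. shared_valley h (\<lambda>t. path x (- t)) \<longrightarrow> x \<in> G'"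
    by (rule brownian.shared_valley_upper_right[OF brownian_reflected h e2])
  show ?thesis
  proof (rule that[of "G \<union> G'"])
    show "G \<union> G' \<in> events" using G G' by blast
    show "prob (G \<union> G') \<le> aging_prob h + e" using measure_Un_le[OF G(1) G'(1)] G(2) G'(2) by simp
    show "AE x in W. shared_valley h (path x) \<or> shared_valley h (\<lambda>t. path x (- t)) \<longrightarrow> x \<in> G \<union> G'"
      using G(3) G'(3) by eventually_elim blast
  qed
qed

end

section \<open>Bottoms of valleys\<close>

definition bottom :: "real \<Rightarrow> (real \<Rightarrow> real) \<Rightarrow> real \<Rightarrow> bool" where
  "bottom H w z \<longleftrightarrow> valley H w z \<or> valley H (\<lambda>t. w (- t)) (- z)"

definition margin_bottom :: "real \<Rightarrow> real \<Rightarrow> real \<Rightarrow> real \<Rightarrow> (real \<Rightarrow> real) \<Rightarrow> real \<Rightarrow> bool" where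
  "margin_bottom H \<delta> T r w z \<longleftrightarrow> margin_valley H \<delta> T r w z \<or> margin_valley H \<delta> T r (\<lambda>t. w (- t)) (- z)"

text \<open>What remains of a bottom when depth and side are forgotten; uniqueness and distances are
  settled at this level.\<close>

definition interval_min :: "(real \<Rightarrow> real) \<Rightarrow> real \<Rightarrow> real \<Rightarrow> real \<Rightarrow> bool" where
  "interval_min w p q z \<longleftrightarrow> p < z \<and> z < q \<and> (\<forall>s\<in>{p..q}. w z \<le> w s)"

text \<open>Rational end points leave countably many conditions, so almost every Brownian path
  satisfies all of them.\<close>

definition distinct_minima :: "(real \<Rightarrow> real) \<Rightarrow> bool" where
  "distinct_minima w \<longleftrightarrow> (\<forall>p q r s :: rat. p \<le> q \<longrightarrow> q < r \<longrightarrow> r \<le> s \<longrightarrow>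
     path_min w (of_rat p) (of_rat q) \<noteq> path_min w (of_rat r) (of_rat s))"

lemma bottom_interval_min:
  assumes "bottom H w z" "0 < H"
  shows "\<exists>p q. interval_min w p q z"
  using assms(1) unfolding bottom_def
proof
  assume "valley H w z"
  then obtain a c where "0 \<le> z" "a \<le> 0" "z < c" and low: "\<forall>t\<in>{a..c}. w z \<le> w t" and "w z + H < w a"
    unfolding valley_def by blast
  moreover from this assms(2) have "a \<noteq> z" by auto
  ultimately have "interval_min w a c z" unfolding interval_min_def by auto
  then show ?thesis by blast
next
  assume "valley H (\<lambda>t. w (- t)) (- z)"
  then obtain a c where "0 \<le> - z" "a \<le> 0" "- z < c" and low: "\<forall>t\<in>{a..c}. w (- (- z)) \<le> w (- t)" and "w (- (- z)) + H < w (- a)"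
    unfolding valley_def by blast
  moreover from this assms(2) have "a \<noteq> - z" by auto
  moreover have "w z \<le> w s" if "s \<in> {- c..- a}" for s using bspec[OF low, of "- s"] that by simp
  ultimately have "interval_min w (- c) (- a) z" unfolding interval_min_def by auto
  then show ?thesis by blast
qed

lemma interval_min_rat:
  assumes "interval_min w p q z" "p \<le> u" "u < z" "z < v" "v \<le> q" and w: "continuous_on UNIV w"
  obtains a b :: rat where "u < of_rat a" "of_rat a < z" "z < of_rat b" "of_rat b < v" "a < b"
    "path_min w (of_rat a) (of_rat b) = w z"
proof -
  obtain a where a: "u < of_rat a" "of_rat a < z" using of_rat_dense[OF \<open>u < z\<close>] by blast
  obtain b where b: "z < of_rat b" "of_rat b < v" using of_rat_dense[OF \<open>z < v\<close>] by blast
  have ab: "(of_rat a :: real) < of_rat b" using a b by linarith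
  note m = path_min[OF w less_imp_le[OF ab]]
  have "path_min w (of_rat a) (of_rat b) \<le> w z" using a b by (intro m(1)) auto
  moreover have "w z \<le> path_min w (of_rat a) (of_rat b)"
  proof -
    obtain t where t: "t \<in> {of_rat a..of_rat b}" "w t = path_min w (of_rat a) (of_rat b)" using m(2) by blast
    then have "t \<in> {p..q}" using assms(2,5) a b by simp
    then show ?thesis using assms(1) t(2) unfolding interval_min_def by metis
  qed
  ultimately show ?thesis using that a b ab by (auto simp: of_rat_less)
qed

text \<open>Two minimisers could be separated by disjoint rational intervals with equal
  minima.\<close>

lemma interval_min_unique:
  assumes d: "distinct_minima w" and w: "continuous_on UNIV w" and z: "interval_min w p q z"
    and t: "p < t" "t < q" "t \<noteq> z"
  shows "w z < w t"
proof (rule ccontr)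
  assume "\<not> w z < w t"
  moreover have "w z \<le> w t" using z t by (auto simp: interval_min_def)
  ultimately have eq: "w t = w z" by simp
  have zt: "interval_min w p q t" using z t eq by (auto simp: interval_min_def)
  have False if x: "interval_min w p q x" and y: "interval_min w p q y" and xy: "x < y" "w x = w y" for x y
  proof -
    have b: "p < x" "y < q" using x y by (auto simp: interval_min_def)
    define c where "c = (x + y) / 2"
    have c: "x < c" "c < y" using xy by (simp_all add: c_def)
    obtain a1 b1 :: rat where 1: "p < of_rat a1" "of_rat b1 < c" "a1 < b1" "path_min w (of_rat a1) (of_rat b1) = w x"
    proof (rule interval_min_rat[OF x order_refl b(1) c(1) _ w])
      show "c \<le> q" using b(2) c(2) by linarith
    qed blast
    obtain a2 b2 :: rat where 2: "c < of_rat a2" "a2 < b2" "path_min w (of_rat a2) (of_rat b2) = w y"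
    proof (rule interval_min_rat[OF y _ c(2) b(2) order_refl w])
      show "p \<le> c" using b(1) c(1) by linarith
    qed blast
    have "(of_rat b1 :: real) < of_rat a2" using 1 2 by linarith
    then have "b1 < a2" by (simp add: of_rat_less)
    with d 1(3) 2(2) have "path_min w (of_rat a1) (of_rat b1) \<noteq> path_min w (of_rat a2) (of_rat b2)"
      unfolding distinct_minima_def by (simp add: less_imp_le)
    with 1(4) 2(3) xy(2) show False by simp
  qed
  from this[OF zt z] this[OF z zt] eq t(3) show False by (cases "t < z") auto
qed

lemma interval_min_argmin:
  assumes d: "distinct_minima w" and w: "continuous_on UNIV w" and z: "interval_min w p q z"
    and ab: "p < a" "a < z" "z < b" "b < q"
  shows "path_argmin w a b = z"
proof (rule ccontr)
  assume ne: "path_argmin w a b \<noteq> z"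
  have ab': "a \<le> b" using ab by linarith
  note m = path_argmin[OF w ab']
  have "w z < w (path_argmin w a b)"
    by (rule interval_min_unique[OF d w z _ _ ne]) (use m ab in linarith)+
  moreover have "path_min w a b \<le> w z" using path_min(1)[OF w ab'] ab by simp
  ultimately show False using m(3) by simp
qed

lemma distinct_minima_reflect:
  assumes "distinct_minima w" "continuous_on UNIV w" shows "distinct_minima (\<lambda>t. w (- t))"
proof -
  have m: "path_min (\<lambda>t. w (- t)) p q = path_min w (- q) (- p)" for p q
  proof -
    have "(\<lambda>t. w (- t)) ` {p..q} = w ` uminus ` {p..q}" by (simp only: image_image)
    then show ?thesis by (simp add: path_min_def)
  qed
  show ?thesis
    unfolding distinct_minima_def m
  proof (intro allI impI)
    fix p q r s :: rat assume "p \<le> q" "q < r" "r \<le> s"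
    then have "path_min w (of_rat (- s)) (of_rat (- r)) \<noteq> path_min w (of_rat (- q)) (of_rat (- p))"
      using assms(1)[unfolded distinct_minima_def, rule_format, of "- s" "- r" "- q" "- p"] by simp
    then show "path_min w (- of_rat q) (- of_rat p) \<noteq> path_min w (- of_rat s) (- of_rat r)"
      by (simp add: of_rat_minus)
  qed
qed

lemma bottom_margin:
  assumes w: "continuous_on UNIV w" and d: "distinct_minima w" and b: "bottom H w z" and r: "0 < r" and H: "0 < H"
  obtains \<delta> T where "0 < \<delta>" "margin_bottom H \<delta> T r w z"
  using b unfolding bottom_def
proof
  have "\<exists>\<delta> T. 0 < \<delta> \<and> margin_valley H \<delta> T r v y"
    if v: "continuous_on UNIV v" "distinct_minima v" "valley H v y" for v y
  proof -
    obtain \<delta> T where "0 < \<delta>" "margin_valley H \<delta> T r v y"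
    proof (rule valley_margin[OF v(1,3) r _ H])
      fix p q t assume "p < y" "y < q" "\<And>s. s \<in> {p..q} \<Longrightarrow> v y \<le> v s" "p < t" "t < q" "t \<noteq> y"
      then show "v y < v t" using interval_min_unique[OF v(2,1), of p q y t] by (simp add: interval_min_def)
    qed
    then show ?thesis by blast
  qed
  note * = this
  {
    assume "valley H w z"
    from *[OF w d this] show ?thesis using that unfolding margin_bottom_def by blast
  next
    assume v: "valley H (\<lambda>t. w (- t)) (- z)"
    have "continuous_on UNIV (\<lambda>t. w (- t))" by (intro continuous_on_compose2[OF w] continuous_intros) auto
    from *[OF this distinct_minima_reflect[OF d w] v] show ?thesis using that unfolding margin_bottom_def by blast
  }
qed

context brownian
begin

section \<open>Almost sure properties of Brownian bottoms\<close>

lemma AE_distinct_minima: "AE x in W. distinct_minima (path x)"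
proof -
  have "AE x in W. \<forall>p q r s :: rat. p \<le> q \<longrightarrow> q < r \<longrightarrow> r \<le> s \<longrightarrow>
     path_min (path x) (of_rat p) (of_rat q) \<noteq> path_min (path x) (of_rat r) (of_rat s)"
    unfolding AE_all_countable
  proof (intro allI)
    fix p q r s :: rat
    show "AE x in W. p \<le> q \<longrightarrow> q < r \<longrightarrow> r \<le> s \<longrightarrow>
      path_min (path x) (of_rat p) (of_rat q) \<noteq> path_min (path x) (of_rat r) (of_rat s)"
    proof (cases "p \<le> q \<and> q < r \<and> r \<le> s")
      case True
      then show ?thesis using path_min_ne[of "of_rat p" "of_rat q" "of_rat r" "of_rat s"] by (simp add: of_rat_less of_rat_less_eq)
    qed auto
  qed
  then show ?thesis unfolding distinct_minima_def .
qed

text \<open>Two different bottoms are the minimisers over disjoint rational intervals. Minimisers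
  over disjoint intervals are independent and atomless, so their distance has no atoms. The value 0
  must be left out because bottoms of different depths coincide with positive probability.\<close>

lemma AE_bottom_distance:
  assumes H: "0 < H" "0 < H'" and c: "c \<noteq> 0"
  shows "AE x in W. \<forall>z z'. bottom H (path x) z \<longrightarrow> bottom H' (path x) z' \<longrightarrow> \<bar>z - z'\<bar> \<noteq> c"
proof -
  have "AE x in W. \<forall>p q r s :: rat. p < q \<longrightarrow> q \<le> r \<longrightarrow> r < s \<longrightarrow>
     path_argmin (path x) (of_rat r) (of_rat s) - path_argmin (path x) (of_rat p) (of_rat q) \<noteq> c"
    unfolding AE_all_countable
  proof (intro allI)
    fix p q r s :: rat
    show "AE x in W. p < q \<longrightarrow> q \<le> r \<longrightarrow> r < s \<longrightarrow>
     path_argmin (path x) (of_rat r) (of_rat s) - path_argmin (path x) (of_rat p) (of_rat q) \<noteq> c"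
    proof (cases "p < q \<and> q \<le> r \<and> r < s")
      case True
      then show ?thesis using path_argmin_gap[of "of_rat p" "of_rat q" "of_rat r" "of_rat s" c] by (simp add: of_rat_less of_rat_less_eq)
    qed auto
  qed
  with AE_distinct_minima AE_space show ?thesis
  proof eventually_elim
    case (elim x)
    note w = B_continuous[OF elim(2)]
    have *: "y - z \<noteq> c" if z: "interval_min (path x) p q z" and y: "interval_min (path x) p' q' y" and zy: "z < y" for p q z p' q' y
    proof -
      define m where "m = (z + y) / 2"
      have m: "z < m" "m < y" using zy by (simp_all add: m_def)
      have bz: "p < z" "z < q" "p' < y" "y < q'" using z y by (auto simp: interval_min_def)
      obtain a1 b1 :: rat where 1: "p < of_rat a1" "of_rat a1 < z" "z < of_rat b1" "of_rat b1 < min m q" "a1 < b1"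
        by (rule interval_min_rat[OF z order_refl bz(1), of "min m q"]) (use m(1) bz(2) w in \<open>simp_all\<close>)
      obtain a2 b2 :: rat where 2: "max m p' < of_rat a2" "of_rat a2 < y" "y < of_rat b2" "of_rat b2 < q'" "a2 < b2"
        by (rule interval_min_rat[OF y, of "max m p'" q']) (use m(2) bz(3,4) w in \<open>simp_all\<close>)
      have "(of_rat b1 :: real) < of_rat a2" using 1 2 by linarith
      then have "b1 \<le> a2" by (simp add: of_rat_less)
      moreover have "path_argmin (path x) (of_rat a1) (of_rat b1) = z"
        by (rule interval_min_argmin[OF elim(1) w z]) (use 1 in auto)
      moreover have "path_argmin (path x) (of_rat a2) (of_rat b2) = y"
        by (rule interval_min_argmin[OF elim(1) w y]) (use 2 in auto)
      ultimately show ?thesis using elim(3) 1(5) 2(5) by metis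
    qed
    show ?case
    proof (intro allI impI)
      fix z z' assume "bottom H (path x) z" "bottom H' (path x) z'"
      then obtain p q p' q' where "interval_min (path x) p q z" "interval_min (path x) p' q' z'"
        using bottom_interval_min H by meson
      then show "\<bar>z - z'\<bar> \<noteq> c" using *[of p q z p' q' z'] *[of p' q' z' p q z] c by (cases z z' rule: linorder_cases) auto
    qed
  qed
qed

lemma AE_not_bottom_0:
  assumes H: "0 < H" shows "AE x in W. \<not> bottom H (path x) 0"
proof -
  have "AE x in W. \<forall>q :: rat. 0 < q \<longrightarrow> path_min (path x) 0 (of_rat q) < B 0 x"
    unfolding AE_all_countable
  proof (intro allI)
    fix q :: rat
    show "AE x in W. 0 < q \<longrightarrow> path_min (path x) 0 (of_rat q) < B 0 x"
      using path_min_at_left_end_null[of 0 "of_rat q"] by (cases "0 < q") auto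
  qed
  with AE_space show ?thesis
  proof eventually_elim
    case (elim x)
    show ?case
    proof
      assume "bottom H (path x) 0"
      then obtain p q where z: "interval_min (path x) p q 0" using bottom_interval_min H by blast
      then have "0 < q" by (simp add: interval_min_def)
      then obtain b where b: "(0::real) < of_rat b" "of_rat b < q" using of_rat_dense by blast
      obtain t where "t \<in> {0..of_rat b}" "path x t = path_min (path x) 0 (of_rat b)"
        using path_min(2)[OF B_continuous[OF elim(1)], of 0 "of_rat b"] b by auto
      moreover have "path x 0 \<le> path x t" using z calculation(1) b unfolding interval_min_def by auto
      moreover have "path_min (path x) 0 (of_rat b) < path x 0" using elim(2) b(1) by simp
      ultimately show False by linarith
    qed
  qed
qed

lemma AE_bottom: "0 < H \<Longrightarrow> AE x in W. \<exists>z. bottom H (path x) z"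
proof -
  assume "0 < H"
  from AE_valley[OF this] show ?thesis
    by eventually_elim (auto simp: bottom_def intro: exI[of _ "- _"])
qed

text \<open>A bottom at 0 would belong to both sides and could join a valley on the right with one
  on the left. It is excluded almost surely, as the path goes below 0 at once.\<close>

lemma AE_common_bottom:
  assumes h: "1 < h"
  shows "AE x in W. (\<exists>z. bottom 1 (path x) z \<and> bottom h (path x) z) \<longleftrightarrow> shared_valley h (path x) \<or> shared_valley h (\<lambda>t. path x (- t))"
  using AE_not_bottom_0[OF zero_less_one]
proof eventually_elim
  case (elim x)
  show ?case
  proof
    assume "\<exists>z. bottom 1 (path x) z \<and> bottom h (path x) z"
    then obtain z where z: "bottom 1 (path x) z" "bottom h (path x) z" by blast
    have "\<not> (valley H (path x) z \<and> valley H' (\<lambda>t. path x (- t)) (- z))" for H H'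
    proof
      assume "valley H (path x) z \<and> valley H' (\<lambda>t. path x (- t)) (- z)"
      then have "z = 0" unfolding valley_def by auto
      with z elim show False by simp
    qed
    with z show "shared_valley h (path x) \<or> shared_valley h (\<lambda>t. path x (- t))"
      unfolding bottom_def shared_valley_def by blast
  next
    assume "shared_valley h (path x) \<or> shared_valley h (\<lambda>t. path x (- t))"
    then show "\<exists>z. bottom 1 (path x) z \<and> bottom h (path x) z"
      unfolding bottom_def shared_valley_def by (metis minus_minus)
  qed
qed

end

text \<open>A whole basic neighbourhood lies in \<open>S\<close>. By \<open>stable_gap\<close> this
  is positivity of a continuous functional, so it is measurable for Brownian paths and
  \<open>portmanteau\<close> applies to it.\<close>

definition stable :: "(real \<Rightarrow> real) set \<Rightarrow> (real \<Rightarrow> real) \<Rightarrow> bool" where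
  "stable S w \<longleftrightarrow> (\<exists>e>0. skorokhod_nbhd w e \<subseteq> S)"

lemma stable_gap: "stable S w \<longleftrightarrow> 0 < skorokhod_gap (- S) w"
  unfolding stable_def skorokhod_gap_pos_iff disjoint_eq_subset_Compl by simp

lemma stable_mono: "stable S w \<Longrightarrow> S \<subseteq> S' \<Longrightarrow> stable S' w"
  unfolding stable_def by blast

text \<open>At a continuous path a small displacement of time changes the values little on compacts,
  so closeness up to a time change is uniform closeness. Surjectivity of the time change allows
  every \<open>t\<close> to be written as \<open>l s\<close>.\<close>

lemma skorokhod_nbhd_uniform:
  fixes w :: "real \<Rightarrow> real"
  assumes w: "continuous_on UNIV w" and e: "0 < e" and T: "0 \<le> T"
  obtains a where "0 < a" "\<And>y t. y \<in> skorokhod_nbhd w a \<Longrightarrow> \<bar>t\<bar> \<le> T \<Longrightarrow> \<bar>y t - w t\<bar> \<le> e"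
proof -
  have "uniformly_continuous_on {- T - 1..T + 1} w"
    by (intro compact_uniformly_continuous continuous_on_subset[OF w]) auto
  then obtain d where d: "0 < d" "\<And>s t. s \<in> {- T - 1..T + 1} \<Longrightarrow> t \<in> {- T - 1..T + 1} \<Longrightarrow> dist s t < d \<Longrightarrow> dist (w s) (w t) < e / 2"
    using e unfolding uniformly_continuous_on_def by (meson half_gt_zero)
  define a where "a = min (min (d / 2) (e / 2)) (1 / (T + 1))"
  have a0: "0 < a" using d(1) e T by (simp add: a_def)
  have a: "a < d" "a \<le> e / 2" "a \<le> 1 / (T + 1)" using d(1) unfolding a_def by linarith+
  have "1 / (T + 1) \<le> 1" using T by simp
  with a have a1: "a \<le> 1" by linarith
  have Ta: "T + 1 \<le> 1 / a" using a(3) a0 T by (simp add: field_simps)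
  show ?thesis
  proof (rule that[OF a0])
    fix y t assume "y \<in> skorokhod_nbhd w a" and t: "\<bar>t\<bar> \<le> T"
    then obtain l where l: "surj l" "\<And>t. \<bar>l t - t\<bar> \<le> a" "\<And>t. \<bar>t\<bar> \<le> 1 / a \<Longrightarrow> \<bar>y (l t) - w t\<bar> \<le> a"
      unfolding skorokhod_nbhd_def by blast
    obtain s where s: "t = l s" using l(1) by (meson surjD)
    have st: "\<bar>t - s\<bar> \<le> a" using l(2)[of s] s by simp
    have "\<bar>s\<bar> \<le> T + 1" using st t a1 by linarith
    then have "\<bar>y t - w s\<bar> \<le> a" using l(3)[of s] s Ta by simp
    moreover have "dist (w s) (w t) < e / 2"
      by (rule d(2)) (use \<open>\<bar>s\<bar> \<le> T + 1\<close> t st a(1) in \<open>auto simp: dist_real_def abs_le_iff\<close>)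
    ultimately show "\<bar>y t - w t\<bar> \<le> e" using a(2) unfolding dist_real_def by linarith
  qed
qed

lemma margin_bottom_mono:
  "margin_bottom H \<delta> T r w z \<Longrightarrow> \<delta>' \<le> \<delta> \<Longrightarrow> T \<le> T' \<Longrightarrow> margin_bottom H \<delta>' T' r w z"
  unfolding margin_bottom_def using margin_valley_mono by blast

lemma margin_bottom_perturb:
  assumes "margin_bottom H \<delta> T r w z" "\<And>t. \<bar>t\<bar> \<le> T \<Longrightarrow> \<bar>y t - w t\<bar> \<le> \<delta> / 4"
  shows "margin_bottom H (\<delta> / 2) T r y z"
  using assms(1) unfolding margin_bottom_def
proof
  assume "margin_valley H \<delta> T r w z"
  from margin_valley_perturb[OF this assms(2)]
  show "margin_valley H (\<delta> / 2) T r y z \<or> margin_valley H (\<delta> / 2) T r (\<lambda>t. y (- t)) (- z)" by blast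
next
  assume "margin_valley H \<delta> T r (\<lambda>t. w (- t)) (- z)"
  then have "margin_valley H (\<delta> / 2) T r (\<lambda>t. y (- t)) (- z)"
    by (rule margin_valley_perturb) (use assms(2) in simp)
  then show "margin_valley H (\<delta> / 2) T r y z \<or> margin_valley H (\<delta> / 2) T r (\<lambda>t. y (- t)) (- z)" by blast
qed

text \<open>The slack \<open>2 * r\<close> is for the walk, which stays within about
  \<open>r\<close> of each bottom at the two times; the slack \<open>1 / m\<close> is for rounding
  and for replacing the index \<open>k\<close> by the squared logarithm.\<close>

definition bottoms_at :: "real \<Rightarrow> real \<Rightarrow> real set \<Rightarrow> (real \<Rightarrow> real) set" where
  "bottoms_at h m I = {y. \<exists>r>0. \<exists>z z'. margin_bottom 1 (1 / m) m r y z \<and> margin_bottom h (1 / m) m r y z' \<and>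
     (\<forall>d. \<bar>d - \<bar>z - z'\<bar>\<bar> \<le> 2 * r + 1 / m \<longrightarrow> d \<in> I)}"

lemma bottoms_at_mono:
  assumes "0 < m" "m \<le> m'" "I \<subseteq> I'"
  shows "bottoms_at h m I \<subseteq> bottoms_at h m' I'"
proof
  fix y assume "y \<in> bottoms_at h m I"
  then obtain r z z' where r: "0 < r" and mb: "margin_bottom 1 (1 / m) m r y z" "margin_bottom h (1 / m) m r y z'"
    and d: "\<And>d. \<bar>d - \<bar>z - z'\<bar>\<bar> \<le> 2 * r + 1 / m \<Longrightarrow> d \<in> I"
    unfolding bottoms_at_def by blast
  have le: "1 / m' \<le> 1 / m" using assms by (simp add: frac_le)
  have "margin_bottom 1 (1 / m') m' r y z" "margin_bottom h (1 / m') m' r y z'"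
    using mb le assms(2) by (blast intro: margin_bottom_mono)+
  moreover have "\<forall>d. \<bar>d - \<bar>z - z'\<bar>\<bar> \<le> 2 * r + 1 / m' \<longrightarrow> d \<in> I'" using d le assms(3) by fastforce
  ultimately show "y \<in> bottoms_at h m' I'" unfolding bottoms_at_def using r by blast
qed

text \<open>The valleys of \<open>w\<close> have positive margins, half of which survive in a
  neighbourhood. One large index then serves as margin, window and slack at once.\<close>

lemma bottoms_stable:
  assumes w: "continuous_on UNIV w" "distinct_minima w" and b: "bottom 1 w z" "bottom h w z'" and h: "0 < h"
    and I: "open I" "\<bar>z - z'\<bar> \<in> I"
  shows "\<exists>m::nat. stable (bottoms_at h (real (Suc m)) I) w"
proof -
  obtain \<rho> where \<rho>: "0 < \<rho>" "\<And>d. \<bar>d - \<bar>z - z'\<bar>\<bar> < \<rho> \<Longrightarrow> d \<in> I"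
    using I unfolding open_dist by (metis dist_real_def)
  \<comment> \<open>Then \<open>2 * r + 1 / n < \<rho>\<close> as soon as
    \<open>1 / n \<le> \<rho> / 4\<close>.\<close>
  define r where "r = \<rho> / 4"
  have r: "0 < r" using \<rho> by (simp add: r_def)
  obtain \<delta>1 T1 where 1: "0 < \<delta>1" "margin_bottom 1 \<delta>1 T1 r w z" by (rule bottom_margin[OF w b(1) r zero_less_one])
  obtain \<delta>2 T2 where 2: "0 < \<delta>2" "margin_bottom h \<delta>2 T2 r w z'" by (rule bottom_margin[OF w b(2) r h])
  define \<delta> T where "\<delta> = min \<delta>1 \<delta>2" and "T = max 0 (max T1 T2)"
  have \<delta>: "0 < \<delta>" "\<delta> \<le> \<delta>1" "\<delta> \<le> \<delta>2" and T: "0 \<le> T" "T1 \<le> T" "T2 \<le> T" using 1 2 by (auto simp: \<delta>_def T_def)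
  have mb: "margin_bottom 1 \<delta> T r w z" "margin_bottom h \<delta> T r w z'" using 1(2) 2(2) \<delta> T by (blast intro: margin_bottom_mono)+
  have "0 < \<delta> / 4" using \<delta> by simp
  from skorokhod_nbhd_uniform[OF w(1) this T(1)]
  obtain a where a: "0 < a" "\<And>y t. y \<in> skorokhod_nbhd w a \<Longrightarrow> \<bar>t\<bar> \<le> T \<Longrightarrow> \<bar>y t - w t\<bar> \<le> \<delta> / 4" by metis
  obtain m :: nat where m: "max T (max (2 / \<delta>) (4 / \<rho>)) < real m" using reals_Archimedean2 by blast
  define n where "n = real (Suc m)"
  have n: "T \<le> n" "2 / \<delta> \<le> n" "4 / \<rho> \<le> n" "0 < n" using m by (auto simp: n_def)
  have inv: "1 / n \<le> \<delta> / 2" "1 / n \<le> \<rho> / 4" using n \<delta> \<rho> by (auto simp: field_simps)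
  have "skorokhod_nbhd w a \<subseteq> bottoms_at h n I"
  proof
    fix y assume y: "y \<in> skorokhod_nbhd w a"
    have "margin_bottom 1 (\<delta> / 2) T r y z" "margin_bottom h (\<delta> / 2) T r y z'"
      by (rule margin_bottom_perturb[OF mb(1) a(2)[OF y]] margin_bottom_perturb[OF mb(2) a(2)[OF y]]; assumption)+
    then have "margin_bottom 1 (1 / n) n r y z" "margin_bottom h (1 / n) n r y z'"
      using inv(1) n(1) by (blast intro: margin_bottom_mono)+
    moreover have "\<forall>d. \<bar>d - \<bar>z - z'\<bar>\<bar> \<le> 2 * r + 1 / n \<longrightarrow> d \<in> I"
      using inv(2) \<rho> by (auto simp: r_def)
    ultimately show "y \<in> bottoms_at h n I" unfolding bottoms_at_def using r by blast
  qed
  then show ?thesis unfolding stable_def n_def using a(1) by blast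
qed

section \<open>The walk near the bottom of a valley\<close>

text \<open>For \<open>\<mu> \<le> L \<le> \<mu> + \<sigma>\<close> the time
  \<open>exp (H * L)\<close> exceeds the scale \<open>exp (\<mu> * (H - 1 / m))\<close> of the
  barriers and falls short of the scale \<open>exp (\<mu> * (H + 1 / m))\<close> of the walls, each
  time by a factor \<open>exp (\<mu> / m)\<close> up to constants. The factor one half allows for
  integer parts.\<close>

lemma sinai_error:
  fixes R \<mu> L H m \<sigma> \<epsilon> :: real
  assumes R: "1 \<le> R" and \<mu>: "\<mu> \<le> L" "L \<le> \<mu> + \<sigma>" and H: "0 < H" and m: "0 < m" and \<epsilon>: "0 < \<epsilon>" and \<mu>0: "0 \<le> \<mu>"
  shows "n \<le> R \<Longrightarrow> s \<le> exp (H * L) \<Longrightarrow> 0 \<le> s \<Longrightarrow>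
      n * (exp (- (\<mu> * (1 / m))) / \<epsilon>) + 2 * (s + 1) * (exp (- (\<mu> * (H + 1 / m))) / \<epsilon>) \<le> (R + 4 * exp (H * \<sigma>)) * exp (- (\<mu> * (1 / m))) / \<epsilon>"
    and "0 \<le> d \<Longrightarrow> d \<le> R \<Longrightarrow> exp (H * L) / 2 \<le> t \<Longrightarrow>
      (R + 4 * exp (H * \<sigma>)) * exp (- (\<mu> * (1 / m))) / \<epsilon> + d * exp (- (\<mu> * (1 / m))) / \<epsilon> + d\<^sup>2 * exp (\<mu> * (H - 1 / m)) / (\<epsilon> * t)
      \<le> 4 * (R\<^sup>2 + exp (H * \<sigma>)) * exp (- (\<mu> * (1 / m))) / \<epsilon>"
proof -
  define q where "q = exp (- (\<mu> * (1 / m)))"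
  have q: "0 < q" by (simp add: q_def)
  {
    assume n: "n \<le> R" and s: "s \<le> exp (H * L)" "0 \<le> s"
    define E where "E = exp (H * L)"
    have "1 \<le> E" using H \<mu> \<mu>0 by (simp add: E_def)
    then have "2 * (s + 1) \<le> 4 * E" using s(1) unfolding E_def[symmetric] by simp
    then have "2 * (s + 1) * exp (- (\<mu> * (H + 1 / m))) \<le> 4 * exp (H * L) * exp (- (\<mu> * (H + 1 / m)))"
      unfolding E_def by (rule mult_right_mono) simp
    also have "\<dots> = 4 * (exp (H * (L - \<mu>)) * q)"
      unfolding q_def by (simp add: exp_add[symmetric] algebra_simps)
    also have "\<dots> \<le> 4 * (exp (H * \<sigma>) * q)"
      using q H \<mu> by (intro mult_left_mono mult_right_mono) auto
    finally have "n * q + 2 * (s + 1) * exp (- (\<mu> * (H + 1 / m))) \<le> R * q + 4 * (exp (H * \<sigma>) * q)"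
      using mult_right_mono[OF n, of q] q by linarith
    then have "(n * q + 2 * (s + 1) * exp (- (\<mu> * (H + 1 / m)))) / \<epsilon> \<le> (R * q + 4 * (exp (H * \<sigma>) * q)) / \<epsilon>"
      using \<epsilon> by (intro divide_right_mono) auto
    then show "n * (exp (- (\<mu> * (1 / m))) / \<epsilon>) + 2 * (s + 1) * (exp (- (\<mu> * (H + 1 / m))) / \<epsilon>) \<le> (R + 4 * exp (H * \<sigma>)) * exp (- (\<mu> * (1 / m))) / \<epsilon>"
      unfolding q_def[symmetric] by (simp add: add_divide_distrib distrib_right)
  }
  {
    assume d: "0 \<le> d" "d \<le> R" and t: "exp (H * L) / 2 \<le> t"
    have t0: "0 < t" using t exp_gt_zero[of "H * L"] by linarith
    have "exp (\<mu> * (H - 1 / m)) \<le> q * exp (H * L)"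
      unfolding q_def exp_add[symmetric] using \<mu> H by (simp add: right_diff_distrib mult.commute)
    also have "\<dots> \<le> q * (2 * t)" using q t by (intro mult_left_mono) auto
    finally have "exp (\<mu> * (H - 1 / m)) / t \<le> 2 * q" using t0 by (simp add: pos_divide_le_eq mult_ac)
    then have "d\<^sup>2 * (exp (\<mu> * (H - 1 / m)) / t) \<le> R\<^sup>2 * (2 * q)"
      using d q t0 by (intro mult_mono power_mono) auto
    moreover have "R \<le> R\<^sup>2" using R by (simp add: self_le_power)
    then have "R * q \<le> R\<^sup>2 * q" "d * q \<le> R\<^sup>2 * q" using d q by (auto intro: mult_right_mono)
    ultimately have "(R + 4 * exp (H * \<sigma>)) * q + d * q + d\<^sup>2 * (exp (\<mu> * (H - 1 / m)) / t) \<le> 4 * (R\<^sup>2 + exp (H * \<sigma>)) * q"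
      by (simp add: algebra_simps)
    then have "((R + 4 * exp (H * \<sigma>)) * q + d * q + d\<^sup>2 * (exp (\<mu> * (H - 1 / m)) / t)) / \<epsilon> \<le> 4 * (R\<^sup>2 + exp (H * \<sigma>)) * q / \<epsilon>"
      using \<epsilon> by (intro divide_right_mono) auto
    then show "(R + 4 * exp (H * \<sigma>)) * exp (- (\<mu> * (1 / m))) / \<epsilon> + d * exp (- (\<mu> * (1 / m))) / \<epsilon> + d\<^sup>2 * exp (\<mu> * (H - 1 / m)) / (\<epsilon> * t)
      \<le> 4 * (R\<^sup>2 + exp (H * \<sigma>)) * exp (- (\<mu> * (1 / m))) / \<epsilon>"
      unfolding q_def[symmetric] by (simp add: add_divide_distrib mult.commute)
  }
qed

text \<open>Lifts the site \<open>x\<close> to a time in \<open>[p, q]\<close>. The obvious choice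
  \<open>x / k\<close> may lie below \<open>p\<close> when \<open>x\<close> is the floor of
  \<open>k * p\<close>.\<close>

lemma floor_point:
  fixes k p q :: real and x :: int
  assumes k: "0 < k" and p: "p \<le> q" and x: "\<lfloor>k * p\<rfloor> \<le> x" "x \<le> \<lfloor>k * q\<rfloor>"
  shows "max p (x / k) \<le> q" "\<lfloor>k * max p (x / k)\<rfloor> = x"
proof -
  have "x \<le> k * q" using x(2) by (simp add: le_floor_iff)
  then have "x / k \<le> q" using k by (simp add: pos_divide_le_eq mult.commute)
  then show "max p (x / k) \<le> q" using p by simp
  have "k * max p (x / k) = max (k * p) x" using k by (simp add: max_mult_distrib_left)
  then show "\<lfloor>k * max p (x / k)\<rfloor> = x"
    using x(1) by (simp add: max_def floor_eq_iff) linarith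
qed

text \<open>The margin \<open>1 / m\<close> of the rescaled path is a margin
  \<open>\<mu> / m\<close> of the potential. It localises the walk from the bottom at all times up
  to \<open>t\<close> and lets the walk from 0 reach the bottom in time.\<close>

lemma walk_near_right_bottom:
  fixes k t :: nat and H m r L \<sigma> z :: real
  assumes el: "elliptic \<epsilon> \<omega>" "0 < \<epsilon>" and k: "0 < k" and \<sigma>: "0 < \<sigma>" and m: "0 < m" and H: "0 < H"
    and mv: "margin_valley H (1 / m) m r (scaled_potential \<sigma> k \<omega>) z"
    and L: "sqrt k * \<sigma> \<le> L" "L \<le> sqrt k * \<sigma> + \<sigma>" and t: "exp (H * L) / 2 \<le> t" "t \<le> exp (H * L)"
  shows "(walk_op \<omega> ^^ t) (indicator {x. r * k + 2 \<le> \<bar>x - k * z\<bar>}) 0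
    \<le> 4 * (((2 * m + 2) * k)\<^sup>2 + exp (H * \<sigma>)) * exp (- (sqrt k * \<sigma> * (1 / m))) / \<epsilon>"
proof -
  define \<mu> where "\<mu> = sqrt k * \<sigma>"
  have \<mu>: "0 < \<mu>" using k \<sigma> by (simp add: \<mu>_def)
  define y where "y = scaled_potential \<sigma> k \<omega>"
  have V: "potential \<omega> \<lfloor>k * s\<rfloor> = \<mu> * y s" for s :: real
    using k \<sigma> by (simp add: y_def scaled_potential_def \<mu>_def)
  obtain a c where z: "0 \<le> z" and ac: "- m \<le> a" "a \<le> 0" "z \<le> c" "c \<le> m"
    and bot: "\<And>s. a \<le> s \<Longrightarrow> s \<le> c \<Longrightarrow> r \<le> \<bar>s - z\<bar> \<Longrightarrow> y z + 1 / m \<le> y s"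
    and edge: "y z + H + 1 / m \<le> y a" "y z + H + 1 / m \<le> y c"
    and draw: "\<And>u v. a \<le> u \<Longrightarrow> u \<le> v \<Longrightarrow> v \<le> z \<Longrightarrow> y v - y u \<le> H - 1 / m"
    and wall: "\<And>s. 0 \<le> s \<Longrightarrow> s \<le> z \<Longrightarrow> y s + 1 / m \<le> y a"
    using mv unfolding margin_valley_def y_def by auto
  define a' b' c' where "a' = \<lfloor>k * a\<rfloor>" and "b' = \<lfloor>k * z\<rfloor>" and "c' = \<lfloor>k * c\<rfloor>"
  have k0: "(0::real) < k" using k by simp
  have az: "a \<le> z" and ac': "a \<le> c" using ac z by auto
  have ord: "a' \<le> 0" "0 \<le> b'" "a' \<le> b'" "b' \<le> c'"
  proof -
    have "k * a \<le> 0" "0 \<le> k * z" "k * a \<le> k * z" "k * z \<le> k * c"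
      using ac z k0 az by (auto simp: mult_nonneg_nonpos)
    then show "a' \<le> 0" "0 \<le> b'" "a' \<le> b'" "b' \<le> c'"
      unfolding a'_def b'_def c'_def by (simp_all only: floor_mono zero_le_floor) linarith
  qed
  define q where "q x = max a (real_of_int x / k)" for x
  have q: "a \<le> q x" "q x \<le> c" "\<lfloor>k * q x\<rfloor> = x" if "a' \<le> x" "x \<le> c'" for x
    using floor_point[OF k0 ac' that[unfolded a'_def c'_def]] by (auto simp: q_def)
  have qz: "q x \<le> z" if "a' \<le> x" "x \<le> b'" for x
    using floor_point[OF k0 az that[unfolded a'_def b'_def]] by (auto simp: q_def)
  have Vq: "potential \<omega> x = \<mu> * y (q x)" if "a' \<le> x" "x \<le> c'" for x
    using V[of "q x"] q(3)[OF that] by simp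
  have Vb: "potential \<omega> b' = \<mu> * y z" "potential \<omega> a' = \<mu> * y a" "potential \<omega> c' = \<mu> * y c"
    unfolding a'_def b'_def c'_def by (rule V)+
  \<comment> \<open>The 2 covers the rounding of times to sites.\<close>
  define A where "A = {x :: int. r * k + 2 \<le> \<bar>x - k * z\<bar>}"
  \<comment> \<open>Bounds the number of sites between the walls, including the rounding at both
    ends.\<close>
  define R where "R = (2 * m + 2) * k"
  have "2 * 1 \<le> (2 * m + 2) * real k" using k m by (intro mult_mono) auto
  then have R: "1 \<le> R" by (simp add: R_def)
  have "real_of_int c' \<le> k * c" "k * a < real_of_int a' + 1" unfolding a'_def c'_def by linarith+
  moreover have "real k * c \<le> k * m" "real k * (- m) \<le> k * a" using ac k0 by (intro mult_left_mono; simp)+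
  moreover have "1 \<le> real k" using k by simp
  moreover have "R = 2 * (real k * m) + 2 * real k" "k * (- m) = - (real k * m)" unfolding R_def by (simp_all add: algebra_simps)
  ultimately have w: "real_of_int (c' - a' + 1) \<le> R" by (simp only: of_int_add of_int_diff of_int_1)
  have w': "real_of_int (b' - a') \<le> R" using w ord by linarith
  define \<gamma> where "\<gamma> = (R + 4 * exp (H * \<sigma>)) * exp (- (\<mu> * (1 / m))) / \<epsilon>"
  note err = sinai_error[OF R L[folded \<mu>_def] H m el(2) less_imp_le[OF \<mu>]]
  have loc: "(walk_op \<omega> ^^ s) (indicator A) b' \<le> \<gamma>" if "s \<le> t" for s
  proof -
    have "(walk_op \<omega> ^^ s) (indicator A) b' \<le> (c' - a' + 1) * (exp (- (\<mu> * (1 / m))) / \<epsilon>) + 2 * (real s + 1) * (exp (- (\<mu> * (H + 1 / m))) / \<epsilon>)"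
    proof (rule walk_localized[OF el ord(3,4)])
      fix x assume x: "a' \<le> x" "x \<le> c'" "x \<in> A"
      have "\<bar>k * q x - x\<bar> \<le> 1" using q(3)[OF x(1,2)] by linarith
      moreover have "k * (q x - z) = (k * q x - x) + (x - k * z)" by (simp add: right_diff_distrib)
      ultimately have "r * k \<le> \<bar>k * (q x - z)\<bar>" using x(3) unfolding A_def by simp
      then have "k * r \<le> k * \<bar>q x - z\<bar>" using k0 by (simp add: abs_mult mult.commute)
      then have "r \<le> \<bar>q x - z\<bar>" using k0 by simp
      from bot[OF q(1,2)[OF x(1,2)] this] have "\<mu> * (y z + 1 / m) \<le> \<mu> * y (q x)" using \<mu> by (intro mult_left_mono) auto
      then show "potential \<omega> b' + \<mu> * (1 / m) \<le> potential \<omega> x"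
        unfolding Vb Vq[OF x(1,2)] by (simp only: distrib_left)
    next
      have "\<mu> * (y z + (H + 1 / m)) \<le> \<mu> * y a" "\<mu> * (y z + (H + 1 / m)) \<le> \<mu> * y c"
        using \<mu> edge by (auto intro!: mult_left_mono simp: add.assoc)
      then show "potential \<omega> b' + \<mu> * (H + 1 / m) \<le> potential \<omega> a'" "potential \<omega> b' + \<mu> * (H + 1 / m) \<le> potential \<omega> c'"
        unfolding Vb by (simp_all only: distrib_left)
    qed
    also have "\<dots> \<le> \<gamma>"
      unfolding \<gamma>_def using err(1)[OF w, of "real s"] that t(2) by simp
    finally show ?thesis .
  qed
  have t0: "0 < t" using t(1) exp_gt_zero[of "H * L"] by (intro gr0I) simp
  have "(walk_op \<omega> ^^ t) (indicator A) 0 \<le> \<gamma> + (b' - a') * exp (- (\<mu> * (1 / m))) / \<epsilon> + (b' - a')\<^sup>2 * exp (\<mu> * (H - 1 / m)) / (\<epsilon> * t)"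
  proof (rule walk_reach_from_left[OF el ord(1,2) _ _ loc t0])
    fix u v assume uv: "a' \<le> u" "u \<le> v" "v \<le> b'"
    have "q u \<le> q v" unfolding q_def using uv k0 by (intro max.mono divide_right_mono) auto
    then have "y (q v) - y (q u) \<le> H - 1 / m" using q(1)[of u] uv qz[of v] ord by (intro draw) auto
    then have "\<mu> * (y (q v) - y (q u)) \<le> \<mu> * (H - 1 / m)" using \<mu> by (intro mult_left_mono) auto
    then show "potential \<omega> v - potential \<omega> u \<le> \<mu> * (H - 1 / m)"
      using Vq[of u] Vq[of v] uv ord by (simp add: right_diff_distrib)
  next
    fix x :: int assume x: "0 \<le> x" "x \<le> b'"
    have "0 \<le> q x" unfolding q_def using x(1) k0 by (simp add: le_max_iff_disj)
    then have "y (q x) + 1 / m \<le> y a" using qz[of x] x ord by (intro wall) auto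
    then have "\<mu> * (y (q x) + 1 / m) \<le> \<mu> * y a" using \<mu> by (intro mult_left_mono) auto
    then show "potential \<omega> x + \<mu> * (1 / m) \<le> potential \<omega> a'"
      using Vq[of x] Vb(2) x ord by (simp add: distrib_left)
  next
    show "0 \<le> \<gamma>" unfolding \<gamma>_def using R el(2) by simp
  qed
  also have "\<dots> \<le> 4 * (R\<^sup>2 + exp (H * \<sigma>)) * exp (- (\<mu> * (1 / m))) / \<epsilon>"
    unfolding \<gamma>_def using err(2)[OF _ w' t(1)] ord(3) by simp
  finally show ?thesis unfolding A_def R_def \<mu>_def .
qed

lemma walk_near_left_bottom:
  fixes k t :: nat and H m r L \<sigma> z :: real
  assumes el: "elliptic \<epsilon> \<omega>" "0 < \<epsilon>" and k: "0 < k" and \<sigma>: "0 < \<sigma>" and m: "0 < m" and H: "0 < H"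
    and mv: "margin_valley H (1 / m) m r (\<lambda>s. scaled_potential \<sigma> k \<omega> (- s)) (- z)"
    and L: "sqrt k * \<sigma> \<le> L" "L \<le> sqrt k * \<sigma> + \<sigma>" and t: "exp (H * L) / 2 \<le> t" "t \<le> exp (H * L)"
  shows "(walk_op \<omega> ^^ t) (indicator {x. r * k + 2 \<le> \<bar>x - k * z\<bar>}) 0
    \<le> 4 * (((2 * m + 2) * k)\<^sup>2 + exp (H * \<sigma>)) * exp (- (sqrt k * \<sigma> * (1 / m))) / \<epsilon>"
proof -
  define \<mu> where "\<mu> = sqrt k * \<sigma>"
  have \<mu>: "0 < \<mu>" using k \<sigma> by (simp add: \<mu>_def)
  define y where "y = scaled_potential \<sigma> k \<omega>"
  have V: "potential \<omega> \<lfloor>k * s\<rfloor> = \<mu> * y s" for s :: real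
    using k \<sigma> by (simp add: y_def scaled_potential_def \<mu>_def)
  obtain a c where z: "z \<le> 0" and ac: "- m \<le> a" "a \<le> z" "0 \<le> c" "c \<le> m"
    and bot: "\<And>s. a \<le> s \<Longrightarrow> s \<le> c \<Longrightarrow> r \<le> \<bar>s - z\<bar> \<Longrightarrow> y z + 1 / m \<le> y s"
    and edge: "y z + H + 1 / m \<le> y a" "y z + H + 1 / m \<le> y c"
    and draw: "\<And>u v. z \<le> u \<Longrightarrow> u \<le> v \<Longrightarrow> v \<le> c \<Longrightarrow> y u - y v \<le> H - 1 / m"
    and wall: "\<And>s. z \<le> s \<Longrightarrow> s \<le> 0 \<Longrightarrow> y s + 1 / m \<le> y c"
  proof -
    from mv obtain a c where 1: "0 \<le> - z" "- m \<le> a" "a \<le> 0" "- z \<le> c" "c \<le> m"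
      and bot: "\<And>s. a \<le> s \<Longrightarrow> s \<le> c \<Longrightarrow> r \<le> \<bar>s + z\<bar> \<Longrightarrow> y z + 1 / m \<le> y (- s)"
      and edge: "y z + H + 1 / m \<le> y (- a)" "y z + H + 1 / m \<le> y (- c)"
      and draw: "\<And>u v. a \<le> u \<Longrightarrow> u \<le> v \<Longrightarrow> v \<le> - z \<Longrightarrow> y (- v) - y (- u) \<le> H - 1 / m"
      and wall: "\<And>s. 0 \<le> s \<Longrightarrow> s \<le> - z \<Longrightarrow> y (- s) + 1 / m \<le> y (- a)"
      unfolding margin_valley_def y_def by auto
    show ?thesis
    proof (rule that[of "- c" "- a"])
      show "y z + 1 / m \<le> y s" if "- c \<le> s" "s \<le> - a" "r \<le> \<bar>s - z\<bar>" for s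
        using bot[of "- s"] that by (simp add: abs_minus_commute)
      show "y u - y v \<le> H - 1 / m" if "z \<le> u" "u \<le> v" "v \<le> - a" for u v
        using draw[of "- v" "- u"] that by simp
      show "y s + 1 / m \<le> y (- a)" if "z \<le> s" "s \<le> 0" for s
        using wall[of "- s"] that by simp
    qed (use 1 edge in auto)
  qed
  define a' b' c' where "a' = \<lfloor>k * a\<rfloor>" and "b' = \<lfloor>k * z\<rfloor>" and "c' = \<lfloor>k * c\<rfloor>"
  have k0: "(0::real) < k" using k by simp
  have zc: "z \<le> c" and ac': "a \<le> c" using ac z by auto
  have ord: "b' \<le> 0" "0 \<le> c'" "a' \<le> b'" "b' \<le> c'"
  proof -
    have "k * z \<le> 0" "0 \<le> k * c" "k * a \<le> k * z" "k * z \<le> k * c"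
      using ac z k0 zc by (auto simp: mult_nonneg_nonpos)
    then show "b' \<le> 0" "0 \<le> c'" "a' \<le> b'" "b' \<le> c'"
      unfolding a'_def b'_def c'_def by (simp_all only: floor_mono zero_le_floor) linarith
  qed
  define q where "q x = max a (real_of_int x / k)" for x
  have q: "a \<le> q x" "q x \<le> c" "\<lfloor>k * q x\<rfloor> = x" if "a' \<le> x" "x \<le> c'" for x
    using floor_point[OF k0 ac' that[unfolded a'_def c'_def]] by (auto simp: q_def)
  \<comment> \<open>Sites are lifted from the bottom \<open>z\<close>, not from the wall
    \<open>a\<close>, so that the times stay in \<open>[z, c]\<close>, where the barriers are
    bounded.\<close>
  define q' where "q' x = max z (real_of_int x / k)" for x
  have q': "z \<le> q' x" "q' x \<le> c" "\<lfloor>k * q' x\<rfloor> = x" if "b' \<le> x" "x \<le> c'" for x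
    using floor_point[OF k0 zc that[unfolded b'_def c'_def]] by (auto simp: q'_def)
  have Vq: "potential \<omega> x = \<mu> * y (q x)" if "a' \<le> x" "x \<le> c'" for x
    using V[of "q x"] q(3)[OF that] by simp
  have Vq': "potential \<omega> x = \<mu> * y (q' x)" if "b' \<le> x" "x \<le> c'" for x
    using V[of "q' x"] q'(3)[OF that] by simp
  have Vb: "potential \<omega> b' = \<mu> * y z" "potential \<omega> a' = \<mu> * y a" "potential \<omega> c' = \<mu> * y c"
    unfolding a'_def b'_def c'_def by (rule V)+
  define A where "A = {x :: int. r * k + 2 \<le> \<bar>x - k * z\<bar>}"
  define R where "R = (2 * m + 2) * k"
  have "2 * 1 \<le> (2 * m + 2) * real k" using k m by (intro mult_mono) auto
  then have R: "1 \<le> R" by (simp add: R_def)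
  have "real_of_int c' \<le> k * c" "k * a < real_of_int a' + 1" unfolding a'_def c'_def by linarith+
  moreover have "real k * c \<le> k * m" "real k * (- m) \<le> k * a" using ac k0 by (intro mult_left_mono; simp)+
  moreover have "1 \<le> real k" using k by simp
  moreover have "R = 2 * (real k * m) + 2 * real k" "k * (- m) = - (real k * m)" unfolding R_def by (simp_all add: algebra_simps)
  ultimately have w: "real_of_int (c' - a' + 1) \<le> R" by (simp only: of_int_add of_int_diff of_int_1)
  have w': "real_of_int (c' - b') \<le> R" using w ord by linarith
  define \<gamma> where "\<gamma> = (R + 4 * exp (H * \<sigma>)) * exp (- (\<mu> * (1 / m))) / \<epsilon>"
  note err = sinai_error[OF R L[folded \<mu>_def] H m el(2) less_imp_le[OF \<mu>]]
  have loc: "(walk_op \<omega> ^^ s) (indicator A) b' \<le> \<gamma>" if "s \<le> t" for s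
  proof -
    have "(walk_op \<omega> ^^ s) (indicator A) b' \<le> (c' - a' + 1) * (exp (- (\<mu> * (1 / m))) / \<epsilon>) + 2 * (real s + 1) * (exp (- (\<mu> * (H + 1 / m))) / \<epsilon>)"
    proof (rule walk_localized[OF el ord(3,4)])
      fix x assume x: "a' \<le> x" "x \<le> c'" "x \<in> A"
      have "\<bar>k * q x - x\<bar> \<le> 1" using q(3)[OF x(1,2)] by linarith
      moreover have "k * (q x - z) = (k * q x - x) + (x - k * z)" by (simp add: right_diff_distrib)
      ultimately have "r * k \<le> \<bar>k * (q x - z)\<bar>" using x(3) unfolding A_def by simp
      then have "k * r \<le> k * \<bar>q x - z\<bar>" using k0 by (simp add: abs_mult mult.commute)
      then have "r \<le> \<bar>q x - z\<bar>" using k0 by simp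
      from bot[OF q(1,2)[OF x(1,2)] this] have "\<mu> * (y z + 1 / m) \<le> \<mu> * y (q x)" using \<mu> by (intro mult_left_mono) auto
      then show "potential \<omega> b' + \<mu> * (1 / m) \<le> potential \<omega> x"
        unfolding Vb Vq[OF x(1,2)] by (simp only: distrib_left)
    next
      have "\<mu> * (y z + (H + 1 / m)) \<le> \<mu> * y a" "\<mu> * (y z + (H + 1 / m)) \<le> \<mu> * y c"
        using \<mu> edge by (auto intro!: mult_left_mono simp: add.assoc)
      then show "potential \<omega> b' + \<mu> * (H + 1 / m) \<le> potential \<omega> a'" "potential \<omega> b' + \<mu> * (H + 1 / m) \<le> potential \<omega> c'"
        unfolding Vb by (simp_all only: distrib_left)
    qed
    also have "\<dots> \<le> \<gamma>"
      unfolding \<gamma>_def using err(1)[OF w, of "real s"] that t(2) by simp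
    finally show ?thesis .
  qed
  have t0: "0 < t" using t(1) exp_gt_zero[of "H * L"] by (intro gr0I) simp
  have "(walk_op \<omega> ^^ t) (indicator A) 0 \<le> \<gamma> + (c' - b') * exp (- (\<mu> * (1 / m))) / \<epsilon> + (c' - b')\<^sup>2 * exp (\<mu> * (H - 1 / m)) / (\<epsilon> * t)"
  proof (rule walk_reach_from_right[OF el ord(1,2) _ _ loc t0])
    fix u v assume uv: "b' \<le> u" "u \<le> v" "v \<le> c'"
    have "q' u \<le> q' v" unfolding q'_def using uv k0 by (intro max.mono divide_right_mono) auto
    then have "y (q' u) - y (q' v) \<le> H - 1 / m" using q'(1)[of u] uv q'(2)[of v] ord by (intro draw) auto
    then have "\<mu> * (y (q' u) - y (q' v)) \<le> \<mu> * (H - 1 / m)" using \<mu> by (intro mult_left_mono) auto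
    then show "potential \<omega> u - potential \<omega> v \<le> \<mu> * (H - 1 / m)"
      using Vq'[of u] Vq'[of v] uv ord by (simp add: right_diff_distrib)
  next
    fix x :: int assume x: "b' \<le> x" "x \<le> 0"
    have "q' x \<le> 0" unfolding q'_def using x(2) k0 z by (simp add: divide_nonpos_pos)
    then have "y (q' x) + 1 / m \<le> y c" using q'(1)[of x] x ord by (intro wall) auto
    then have "\<mu> * (y (q' x) + 1 / m) \<le> \<mu> * y c" using \<mu> by (intro mult_left_mono) auto
    then show "potential \<omega> x + \<mu> * (1 / m) \<le> potential \<omega> c'"
      using Vq'[of x] Vb(3) x ord by (simp add: distrib_left)
  next
    show "0 \<le> \<gamma>" unfolding \<gamma>_def using R el(2) by simp
  qed
  also have "\<dots> \<le> 4 * (R\<^sup>2 + exp (H * \<sigma>)) * exp (- (\<mu> * (1 / m))) / \<epsilon>"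
    unfolding \<gamma>_def using err(2)[OF _ w' t(1)] ord(4) by simp
  finally show ?thesis unfolding A_def R_def \<mu>_def .
qed

lemma walk_near_bottom:
  fixes k t :: nat and H m r L \<sigma> z :: real
  assumes el: "elliptic \<epsilon> \<omega>" "0 < \<epsilon>" and k: "0 < k" and \<sigma>: "0 < \<sigma>" and m: "0 < m" and H: "0 < H"
    and mb: "margin_bottom H (1 / m) m r (scaled_potential \<sigma> k \<omega>) z"
    and L: "sqrt k * \<sigma> \<le> L" "L \<le> sqrt k * \<sigma> + \<sigma>" and t: "exp (H * L) / 2 \<le> t" "t \<le> exp (H * L)"
  shows "(walk_op \<omega> ^^ t) (indicator {x. r * k + 2 \<le> \<bar>x - k * z\<bar>}) 0
    \<le> 4 * (((2 * m + 2) * k)\<^sup>2 + exp (H * \<sigma>)) * exp (- (sqrt k * \<sigma> * (1 / m))) / \<epsilon>"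
  using mb unfolding margin_bottom_def
  by (elim disjE) (rule walk_near_right_bottom[OF el k \<sigma> m H _ L t] walk_near_left_bottom[OF el k \<sigma> m H _ L t]; assumption)+

lemma quenched_pair_set:
  "{X. R (X n) (X m)} \<in> sets (quenched_law \<omega> v)"
proof -
  have "(\<lambda>X. R i (X m)) \<in> measurable (quenched_law \<omega> v) (count_space UNIV)" for i
    by (rule measurable_compose[OF quenched_law_component_measurable]) simp
  then have "(\<lambda>X. R (X n) (X m)) \<in> measurable (quenched_law \<omega> v) (count_space UNIV)"
    by (rule measurable_compose_countable[OF _ quenched_law_component_measurable])
  then show ?thesis unfolding pred_def by simp
qed

definition aging_error :: "real \<Rightarrow> real \<Rightarrow> real \<Rightarrow> real \<Rightarrow> nat \<Rightarrow> real" where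
  "aging_error h \<sigma> m \<epsilon> k = 4 * (((2 * m + 2) * k)\<^sup>2 + exp (h * \<sigma>)) * exp (- (sqrt k * \<sigma> * (1 / m))) / \<epsilon>"

lemma aging_error_tendsto:
  assumes "0 < \<sigma>" "0 < m"
  shows "aging_error h \<sigma> m \<epsilon> \<longlonglongrightarrow> 0"
proof -
  define B where "B = \<sigma> * (1 / m)"
  have B: "0 < B" using assms by (simp add: B_def)
  have 1: "(\<lambda>k. (real k)\<^sup>2 * exp (- (sqrt k * B))) \<longlonglongrightarrow> 0" using B by real_asymp
  have 2: "(\<lambda>k. exp (- (sqrt k * B))) \<longlonglongrightarrow> 0" using B by real_asymp
  have "(\<lambda>k. 4 / \<epsilon> * ((2 * m + 2)\<^sup>2 * ((real k)\<^sup>2 * exp (- (sqrt k * B))) + exp (h * \<sigma>) * exp (- (sqrt k * B))))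
     \<longlonglongrightarrow> 4 / \<epsilon> * ((2 * m + 2)\<^sup>2 * 0 + exp (h * \<sigma>) * 0)"
    by (intro tendsto_intros 1 2)
  moreover have "4 / \<epsilon> * ((2 * m + 2)\<^sup>2 * ((real k)\<^sup>2 * exp (- (sqrt k * B))) + exp (h * \<sigma>) * exp (- (sqrt k * B))) = aging_error h \<sigma> m \<epsilon> k" for k
    unfolding aging_error_def B_def power_mult_distrib by (simp add: distrib_right mult.assoc)
  ultimately show ?thesis by simp
qed

text \<open>Off two unlikely events both positions, divided by \<open>k\<close>, are within
  \<open>r + 2 / k\<close> of their bottoms. As \<open>8 * m \<le> k\<close>, rounding uses half of
  the slack \<open>1 / m\<close>; the other half is handed on to the hypothesis about
  \<open>R\<close>.\<close>

lemma quenched_pair_bottoms: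
  fixes n n' k :: nat and m h L \<sigma> \<epsilon> :: real
  assumes el: "elliptic \<epsilon> \<omega>" "0 < \<epsilon>" and k: "0 < k" "8 * m \<le> k" and \<sigma>: "0 < \<sigma>" and m: "0 < m" and h: "1 \<le> h"
    and y: "scaled_potential \<sigma> k \<omega> \<in> bottoms_at h m I"
    and L: "sqrt k * \<sigma> \<le> L" "L \<le> sqrt k * \<sigma> + \<sigma>"
    and n: "exp L / 2 \<le> n" "n \<le> exp L" and n': "exp (h * L) / 2 \<le> n'" "n' \<le> exp (h * L)"
    and R: "\<And>a b. (\<And>d. \<bar>d - \<bar>real_of_int (b - a)\<bar> / k\<bar> \<le> 1 / (2 * m) \<Longrightarrow> d \<in> I) \<Longrightarrow> R a b"
  shows "1 - 2 * aging_error h \<sigma> m \<epsilon> k \<le> measure (quenched_law \<omega> 0) {X. R (X n) (X n')}"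
proof -
  interpret Q: prob_space "quenched_law \<omega> 0" by (rule prob_space_quenched_law)
  obtain r z z' where r: "0 < r" and mb: "margin_bottom 1 (1 / m) m r (scaled_potential \<sigma> k \<omega>) z"
      "margin_bottom h (1 / m) m r (scaled_potential \<sigma> k \<omega>) z'"
    and d: "\<And>d. \<bar>d - \<bar>z - z'\<bar>\<bar> \<le> 2 * r + 1 / m \<Longrightarrow> d \<in> I"
    using y unfolding bottoms_at_def by blast
  note \<omega> = elliptic_Omega[OF el]
  define A where "A = {X :: nat \<Rightarrow> int. X n \<in> {x. r * k + 2 \<le> \<bar>x - k * z\<bar>}}"
  define A' where "A' = {X :: nat \<Rightarrow> int. X n' \<in> {x. r * k + 2 \<le> \<bar>x - k * z'\<bar>}}"
  have sets: "A \<in> Q.events" "A' \<in> Q.events" "{X. R (X n) (X n')} \<in> Q.events"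
    unfolding A_def A'_def by (rule quenched_pair_set)+
  have n1: "exp (1 * L) / 2 \<le> n" "n \<le> exp (1 * L)" using n by simp_all
  have h0: "0 < h" using h by simp
  have "Q.prob A \<le> 4 * (((2 * m + 2) * k)\<^sup>2 + exp (1 * \<sigma>)) * exp (- (sqrt k * \<sigma> * (1 / m))) / \<epsilon>"
    unfolding A_def quenched_law_marginal[OF \<omega>]
    by (rule walk_near_bottom[OF el k(1) \<sigma> m zero_less_one mb(1) L n1])
  also have "\<dots> \<le> aging_error h \<sigma> m \<epsilon> k"
  proof -
    have "exp (1 * \<sigma>) \<le> exp (h * \<sigma>)" using h \<sigma> by simp
    then show ?thesis
      unfolding aging_error_def using el(2) by (intro divide_right_mono mult_right_mono mult_left_mono add_left_mono) simp_all
  qed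
  finally have pA: "Q.prob A \<le> aging_error h \<sigma> m \<epsilon> k" .
  have pA': "Q.prob A' \<le> aging_error h \<sigma> m \<epsilon> k"
    unfolding A'_def quenched_law_marginal[OF \<omega>] aging_error_def
    by (rule walk_near_bottom[OF el k(1) \<sigma> m h0 mb(2) L n'])
  have "UNIV - (A \<union> A') \<subseteq> {X. R (X n) (X n')}"
  proof (intro subsetI CollectI R)
    fix X d assume X: "X \<in> UNIV - (A \<union> A')" and dd: "\<bar>d - \<bar>real_of_int (X n' - X n)\<bar> / k\<bar> \<le> 1 / (2 * m)"
    define u u' where "u = real_of_int (X n) / k - z" and "u' = real_of_int (X n') / k - z'"
    have k0: "0 < real k" using k by simp
    have "\<bar>X n - k * z\<bar> < r * k + 2" "\<bar>X n' - k * z'\<bar> < r * k + 2" using X unfolding A_def A'_def by auto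
    moreover have "X n - k * z = k * u" "X n' - k * z' = k * u'" unfolding u_def u'_def using k0 by (simp_all add: right_diff_distrib)
    ultimately have "k * \<bar>u\<bar> < k * (r + 2 / k)" "k * \<bar>u'\<bar> < k * (r + 2 / k)"
      using k0 by (simp_all add: abs_mult distrib_left mult.commute)
    then have u: "\<bar>u\<bar> < r + 2 / k" "\<bar>u'\<bar> < r + 2 / k" using k0 by simp_all
    have "4 / real k \<le> 4 / (8 * m)" using k m by (intro divide_left_mono) auto
    then have "2 / real k + 2 / real k \<le> 1 / (2 * m)" by simp
    then have near: "2 / real k + 2 / real k \<le> 1 / (2 * m)" .
    define D where "D = \<bar>real_of_int (X n' - X n)\<bar> / k"
    have "D = \<bar>(z' - z) + (u' - u)\<bar>"
    proof -
      have "(z' - z) + (u' - u) = real_of_int (X n' - X n) / k" unfolding u_def u'_def by (simp add: diff_divide_distrib)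
      then show ?thesis using k0 by (simp add: D_def abs_divide)
    qed
    then have "\<bar>D - \<bar>z' - z\<bar>\<bar> \<le> \<bar>u' - u\<bar>"
      using abs_triangle_ineq3[of "(z' - z) + (u' - u)" "z' - z"] by simp
    also have "\<dots> \<le> \<bar>u'\<bar> + \<bar>u\<bar>" by (rule abs_triangle_ineq4)
    also have "\<dots> \<le> 2 * r + 1 / (2 * m)" using u near by linarith
    finally have "\<bar>D - \<bar>z' - z\<bar>\<bar> \<le> 2 * r + 1 / (2 * m)" .
    moreover have "\<bar>d - \<bar>z' - z\<bar>\<bar> \<le> \<bar>d - D\<bar> + \<bar>D - \<bar>z' - z\<bar>\<bar>" by linarith
    moreover have "1 / m = 1 / (2 * m) + 1 / (2 * m)" by simp
    ultimately have "\<bar>d - \<bar>z' - z\<bar>\<bar> \<le> 2 * r + 1 / m" using dd[folded D_def] by linarith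
    then show "d \<in> I" by (intro d) (simp only: abs_minus_commute[of z z'])
  qed
  then have "Q.prob (UNIV - (A \<union> A')) \<le> Q.prob {X. R (X n) (X n')}" by (rule Q.finite_measure_mono) (rule sets)
  moreover have "Q.prob (UNIV - (A \<union> A')) = 1 - Q.prob (A \<union> A')"
    using Q.prob_compl[of "A \<union> A'"] sets by simp
  moreover have "Q.prob (A \<union> A') \<le> Q.prob A + Q.prob A'" by (rule measure_Un_le) (rule sets)+
  ultimately show ?thesis using pA pA' by linarith
qed

text \<open>The index \<open>k\<close> with \<open>\<sigma> * sqrt k\<close> close to \<open>log n\<close>, at which potential differences of order \<open>log n\<close> become of order \<open>1\<close>.\<close>

definition scale_index :: "real \<Rightarrow> nat \<Rightarrow> nat" where
  "scale_index \<sigma> n = nat \<lfloor>(ln (real n))\<^sup>2 / \<sigma>\<^sup>2\<rfloor>"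

lemma scale_index_bounds:
  assumes "1 \<le> n" "0 < \<sigma>"
  shows "sqrt (scale_index \<sigma> n) * \<sigma> \<le> ln (real n)" "ln (real n) \<le> sqrt (scale_index \<sigma> n) * \<sigma> + \<sigma>"
    "real (scale_index \<sigma> n) * \<sigma>\<^sup>2 \<le> (ln (real n))\<^sup>2" "(ln (real n))\<^sup>2 \<le> real (scale_index \<sigma> n) * \<sigma>\<^sup>2 + \<sigma>\<^sup>2"
proof -
  define L where "L = ln (real n)"
  have L: "0 \<le> L" using assms by (simp add: L_def)
  define k where "k = real (scale_index \<sigma> n)"
  have "k = of_int \<lfloor>L\<^sup>2 / \<sigma>\<^sup>2\<rfloor>" unfolding k_def scale_index_def L_def by simp
  then have "k \<le> L\<^sup>2 / \<sigma>\<^sup>2" "L\<^sup>2 / \<sigma>\<^sup>2 < k + 1" by linarith+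
  then have *: "k * \<sigma>\<^sup>2 \<le> L\<^sup>2" "L\<^sup>2 < (k + 1) * \<sigma>\<^sup>2" using assms(2) by (simp_all add: field_simps)
  have k: "0 \<le> k" by (simp add: k_def)
  show "real (scale_index \<sigma> n) * \<sigma>\<^sup>2 \<le> (ln (real n))\<^sup>2" "(ln (real n))\<^sup>2 \<le> real (scale_index \<sigma> n) * \<sigma>\<^sup>2 + \<sigma>\<^sup>2"
    using * unfolding k_def[symmetric] L_def[symmetric] by (simp_all add: distrib_right)
  have "(sqrt k * \<sigma>)\<^sup>2 \<le> L\<^sup>2" using * k by (simp add: power_mult_distrib)
  then have "sqrt k * \<sigma> \<le> L" using L by (rule power2_le_imp_le)
  moreover have "L\<^sup>2 \<le> (sqrt k * \<sigma> + \<sigma>)\<^sup>2"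
  proof -
    have "(sqrt k * \<sigma> + \<sigma>)\<^sup>2 = (k + 1) * \<sigma>\<^sup>2 + 2 * sqrt k * \<sigma>\<^sup>2"
      using k by (simp add: power2_sum power_mult_distrib distrib_right) (simp add: power2_eq_square)
    moreover have "0 \<le> 2 * sqrt k * \<sigma>\<^sup>2" using k by simp
    ultimately show ?thesis using *(2) by linarith
  qed
  then have "L \<le> sqrt k * \<sigma> + \<sigma>" 
  proof (rule power2_le_imp_le)
    show "0 \<le> sqrt k * \<sigma> + \<sigma>" using assms(2) k by simp
  qed
  ultimately show "sqrt (scale_index \<sigma> n) * \<sigma> \<le> ln (real n)" "ln (real n) \<le> sqrt (scale_index \<sigma> n) * \<sigma> + \<sigma>"
    unfolding k_def L_def by blast+
qed

lemma scale_index_at_top: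
  assumes "0 < \<sigma>" shows "filterlim (scale_index \<sigma>) at_top sequentially"
proof -
  have "filterlim (\<lambda>n. (ln (real n))\<^sup>2 / \<sigma>\<^sup>2) at_top sequentially" using assms by real_asymp
  then show ?thesis
    unfolding scale_index_def
    by (intro filterlim_compose[OF filterlim_nat_sequentially] filterlim_compose[OF filterlim_floor_sequentially])
qed

text \<open>\<open>F\<close> vanishes off \<open>bottoms_at\<close> and is at most 1 on it, where
  the quenched probability is at least 1 minus an error. So \<open>F\<close> minus the error is a
  pointwise lower bound whose mean is eventually above \<open>c - e\<close>.\<close>

lemma annealed_lower:
  fixes R :: "nat \<Rightarrow> int \<Rightarrow> int \<Rightarrow> bool" and m h \<sigma> \<epsilon> c e :: real
  assumes P: "env_law P" and B: "two_sided_brownian W B"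
    and conv: "converges_weakly skorokhod P (scaled_potential \<sigma>) W (\<lambda>x t. B t x)"
    and el: "AE \<omega> in P. elliptic \<epsilon> \<omega>" "0 < \<epsilon>" and \<sigma>: "0 < \<sigma>" and m: "0 < m" and h: "1 < h"
    and c: "c < measure W {x \<in> space W. stable (bottoms_at h m I) (\<lambda>t. B t x)}"
    and R: "\<forall>\<^sub>F n in sequentially. \<forall>a b. (\<forall>d. \<bar>d - \<bar>real_of_int (b - a)\<bar> / scale_index \<sigma> n\<bar> \<le> 1 / (2 * m) \<longrightarrow> d \<in> I) \<longrightarrow> R n a b"
    and e: "0 < e"
  shows "\<forall>\<^sub>F n in sequentially. c - e < annealed_prob P 0 {X. R n (X n) (X (nat \<lfloor>real n powr h\<rfloor>))}"
proof -
  interpret P: prob_space P using P by (simp add: env_law_def)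
  obtain F where F: "\<And>y. 0 \<le> F y" "\<And>y. F y \<le> 1" "\<And>y. y \<in> cadlag \<Longrightarrow> y \<in> - bottoms_at h m I \<Longrightarrow> F y = 0"
    and Fm: "\<And>k. 0 < k \<Longrightarrow> (\<lambda>\<omega>. F (scaled_potential \<sigma> k \<omega>)) \<in> borel_measurable P"
    and Fc: "eventually (\<lambda>k. c < (\<integral>\<omega>. F (scaled_potential \<sigma> k \<omega>) \<partial>P)) sequentially"
    using portmanteau[OF P B conv c[unfolded stable_gap]] by blast
  let ?k = "scale_index \<sigma>"
  note top = scale_index_at_top[OF \<sigma>]
  have "(\<lambda>n. 2 * aging_error h \<sigma> m \<epsilon> (?k n)) \<longlonglongrightarrow> 2 * 0"
    by (intro tendsto_mult tendsto_const filterlim_compose[OF aging_error_tendsto[OF \<sigma> m] top])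
  then have "\<forall>\<^sub>F n in sequentially. 2 * aging_error h \<sigma> m \<epsilon> (?k n) < e" using e by (intro order_tendstoD(2)) auto
  moreover have "\<forall>\<^sub>F n in sequentially. c < (\<integral>\<omega>. F (scaled_potential \<sigma> (?k n) \<omega>) \<partial>P)"
    by (rule eventually_compose_filterlim[OF Fc top])
  moreover obtain k0 :: nat where k0: "8 * m \<le> real k0" using real_arch_simple by blast
  have "\<forall>\<^sub>F n in sequentially. max 1 k0 \<le> ?k n" using top unfolding filterlim_at_top by blast
  ultimately show ?thesis
    using R eventually_ge_at_top[of 2]
  proof eventually_elim
    case (elim n)
    define k where "k = ?k n"
    have k: "0 < k" "8 * m \<le> k" using elim(3) k0 unfolding k_def by auto
    define n' where "n' = nat \<lfloor>real n powr h\<rfloor>"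
    define L where "L = ln (real n)"
    have n1: "1 \<le> real n" using elim(5) by simp
    have exL: "exp L = real n" using elim(5) by (simp add: L_def)
    have exhL: "exp (h * L) = real n powr h" using elim(5) by (simp add: L_def powr_def mult.commute)
    have ge: "real n \<le> real n powr h" using powr_mono[of 1 h "real n"] h n1 by simp
    have n'r: "real n' = of_int \<lfloor>real n powr h\<rfloor>" unfolding n'_def using ge n1 by simp
    \<comment> \<open>As \<open>n \<ge> 2\<close>, the integer part is at least half of
      \<open>n powr h\<close>.\<close>
    have n': "exp (h * L) / 2 \<le> n'" "n' \<le> exp (h * L)" unfolding exhL n'r using ge n1 elim(5) by linarith+
    have "real n - 1 < real n'" unfolding n'r using ge by linarith
    then have nn': "n \<le> n'" by linarith
    then obtain j where j: "n' = n + j" using le_Suc_ex by blast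
    have n: "exp L / 2 \<le> n" "n \<le> exp L" unfolding exL by simp_all
    note Lk = scale_index_bounds[of n \<sigma>, folded k_def L_def]
    have L: "sqrt k * \<sigma> \<le> L" "L \<le> sqrt k * \<sigma> + \<sigma>" using Lk(1,2) elim(5) \<sigma> by auto
    define f where "f \<omega> = measure (quenched_law \<omega> 0) {X. R n (X n) (X n')}" for \<omega>
    have fm: "f \<in> borel_measurable P" unfolding f_def j by (rule quenched_law_pair_measurable[OF P])
    have f01: "0 \<le> f \<omega>" "f \<omega> \<le> 1" for \<omega>
      unfolding f_def using prob_space.prob_le_1[OF prob_space_quenched_law] by auto
    have fi: "integrable P f" by (rule P.integrable_const_bound[of _ 1]) (use f01 fm in auto)
    have Fi: "integrable P (\<lambda>\<omega>. F (scaled_potential \<sigma> k \<omega>))"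
      by (rule P.integrable_const_bound[of _ 1]) (use F Fm[OF k(1)] in auto)
    let ?E = "2 * aging_error h \<sigma> m \<epsilon> k"
    have E0: "0 \<le> ?E" unfolding aging_error_def using el(2) by simp
    have "(\<integral>\<omega>. F (scaled_potential \<sigma> k \<omega>) - ?E \<partial>P) \<le> (\<integral>\<omega>. f \<omega> \<partial>P)"
    proof (rule integral_mono_AE)
      show "AE \<omega> in P. F (scaled_potential \<sigma> k \<omega>) - ?E \<le> f \<omega>"
        using el(1)
      proof eventually_elim
        case (elim \<omega>)
        show ?case
        proof (cases "scaled_potential \<sigma> k \<omega> \<in> bottoms_at h m I")
          case True
          have "1 - ?E \<le> f \<omega>" unfolding f_def
          proof (rule quenched_pair_bottoms[OF elim el(2) k \<sigma> m _ True L n n'])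
            show "1 \<le> h" using h by simp
            fix a b assume "\<And>d. \<bar>d - \<bar>real_of_int (b - a)\<bar> / real k\<bar> \<le> 1 / (2 * m) \<Longrightarrow> d \<in> I"
            then show "R n a b" using \<open>\<forall>a b. (\<forall>d. \<bar>d - \<bar>real_of_int (b - a)\<bar> / real (?k n)\<bar> \<le> 1 / (2 * m) \<longrightarrow> d \<in> I) \<longrightarrow> R n a b\<close>
              unfolding k_def by blast
          qed
          then show ?thesis using F(2)[of "scaled_potential \<sigma> k \<omega>"] by linarith
        next
          case False
          then have "F (scaled_potential \<sigma> k \<omega>) = 0" by (intro F(3) cadlag_scaled_potential k) simp
          then show ?thesis using f01(1)[of \<omega>] E0 by linarith
        qed
      qed
    qed (use Fi fi in auto)
    then have "(\<integral>\<omega>. F (scaled_potential \<sigma> k \<omega>) \<partial>P) - ?E \<le> (\<integral>\<omega>. f \<omega> \<partial>P)"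
      using Fi by (simp add: P.prob_space)
    then show ?case using elim(1,2) unfolding annealed_prob_def f_def n'_def k_def by linarith
  qed
qed

section \<open>The limit\<close>

context brownian
begin

text \<open>The sets grow with \<open>m\<close>, so a single margin already carries almost all of
  the probability of the union.\<close>

definition stable_bottoms :: "real \<Rightarrow> real set \<Rightarrow> 'w set" where
  "stable_bottoms h I = (\<Union>m::nat. {x \<in> space W. stable (bottoms_at h (real (Suc m)) I) (path x)})"

lemma stable_event: "{x \<in> space W. stable S (path x)} \<in> events"
  unfolding stable_gap
  by (intro borel_measurable_less borel_measurable_const skorokhod_gap_brownian_measurable[OF brownian])

lemma stable_bottoms_event: "stable_bottoms h I \<in> events"
  unfolding stable_bottoms_def by (intro sets.countable_nat_UN image_subsetI stable_event)

lemma stable_bottoms_approx: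
  assumes "a < prob (stable_bottoms h I)"
  obtains m :: real where "0 < m" "a < prob {x \<in> space W. stable (bottoms_at h m I) (path x)}"
proof -
  let ?A = "\<lambda>m::nat. {x \<in> space W. stable (bottoms_at h (real (Suc m)) I) (path x)}"
  have "(\<lambda>m. prob (?A m)) \<longlonglongrightarrow> prob (\<Union>m. ?A m)"
  proof (rule finite_Lim_measure_incseq)
    show "range ?A \<subseteq> events" using stable_event by blast
    show "incseq ?A"
    proof (rule incseq_SucI, rule Collect_mono, rule impI)
      fix m x assume "x \<in> space W \<and> stable (bottoms_at h (real (Suc m)) I) (path x)"
      moreover have "bottoms_at h (real (Suc m)) I \<subseteq> bottoms_at h (real (Suc (Suc m))) I" by (rule bottoms_at_mono) auto
      ultimately show "x \<in> space W \<and> stable (bottoms_at h (real (Suc (Suc m))) I) (path x)" using stable_mono by blast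
    qed
  qed
  then have "\<forall>\<^sub>F m in sequentially. a < prob (?A m)"
    using assms unfolding stable_bottoms_def by (rule order_tendstoD(1))
  then obtain m where "a < prob (?A m)" by (meson eventually_happens' sequentially_bot)
  then show ?thesis by (intro that[of "real (Suc m)"]) auto
qed

lemma stable_bottoms_mono:
  assumes "I \<subseteq> J" shows "stable_bottoms h I \<subseteq> stable_bottoms h J"
proof -
  have sub: "bottoms_at h (real (Suc m)) I \<subseteq> bottoms_at h (real (Suc m)) J" for m by (rule bottoms_at_mono) (use assms in auto)
  have "{x \<in> space W. stable (bottoms_at h (real (Suc m)) I) (path x)} \<subseteq> {x \<in> space W. stable (bottoms_at h (real (Suc m)) J) (path x)}" for m
    using stable_mono[OF _ sub[of m]] by blast
  then show ?thesis unfolding stable_bottoms_def by (intro UN_mono order_refl)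
qed

lemma AE_stable_bottoms:
  assumes h: "1 < h"
  shows "AE x in W. \<forall>I z z'. open I \<longrightarrow> bottom 1 (path x) z \<longrightarrow> bottom h (path x) z' \<longrightarrow> \<bar>z - z'\<bar> \<in> I \<longrightarrow> x \<in> stable_bottoms h I"
  using AE_distinct_minima AE_space
proof eventually_elim
  case (elim x)
  have h0: "0 < h" using h by simp
  show ?case
  proof (intro allI impI)
    fix I z z' assume "open I" "bottom 1 (path x) z" "bottom h (path x) z'" "\<bar>z - z'\<bar> \<in> I"
    from bottoms_stable[OF B_continuous[OF elim(2)] elim(1) this(2,3) h0 this(1,4)]
    show "x \<in> stable_bottoms h I" unfolding stable_bottoms_def using elim(2) by blast
  qed
qed

text \<open>Bottoms exist and their distance is almost surely not \<open>c\<close>, so it satisfies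
  one of two open conditions; open conditions on the distance are stable.\<close>

lemma prob_near_or_far:
  assumes h: "1 < h" and c: "0 < c"
  shows "1 \<le> prob (stable_bottoms h {..<c}) + prob (stable_bottoms h {c<..})"
proof -
  have h0: "0 < h" using h by simp
  have "AE x in W. x \<in> stable_bottoms h {..<c} \<union> stable_bottoms h {c<..}"
    using AE_stable_bottoms[OF h] AE_bottom[OF zero_less_one] AE_bottom[OF h0] AE_bottom_distance[OF zero_less_one h0 less_imp_neq[OF c, symmetric]]
  proof eventually_elim
    case (elim x)
    obtain z z' where z: "bottom 1 (path x) z" "bottom h (path x) z'" using elim(2,3) by blast
    then have "\<bar>z - z'\<bar> \<noteq> c" using elim(4) by blast
    then have "\<bar>z - z'\<bar> \<in> {..<c} \<or> \<bar>z - z'\<bar> \<in> {c<..}" by auto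
    then show ?case using elim(1)[rule_format, OF _ z] open_lessThan open_greaterThan by blast
  qed
  then have "prob (stable_bottoms h {..<c} \<union> stable_bottoms h {c<..}) = 1"
    by (subst prob_eq_1) (use stable_bottoms_event in auto)
  then show ?thesis using measure_Un_le[OF stable_bottoms_event stable_bottoms_event, of h "{..<c}" h "{c<..}"] by simp
qed

lemma prob_near_lower:
  assumes h: "1 < h" and c: "0 < c"
  shows "aging_prob h \<le> prob (stable_bottoms h {..<c})"
proof (rule field_le_epsilon)
  fix e :: real assume "0 < e"
  then obtain G where G: "G \<in> events" "aging_prob h - e \<le> prob G"
    "\<And>x. x \<in> G \<Longrightarrow> x \<in> space W \<and> (shared_valley h (path x) \<or> shared_valley h (\<lambda>t. path x (- t)))"
    using shared_valley_lower[OF h] by metis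
  have "AE x in W. x \<in> G \<longrightarrow> x \<in> stable_bottoms h {..<c}"
    using AE_stable_bottoms[OF h] AE_common_bottom[OF h]
  proof eventually_elim
    case (elim x)
    show ?case
    proof
      assume "x \<in> G"
      then obtain z where "bottom 1 (path x) z" "bottom h (path x) z" using G(3) elim(2) by blast
      from elim(1)[rule_format, OF open_lessThan this, of c] show "x \<in> stable_bottoms h {..<c}" using c by simp
    qed
  qed
  then have "prob G \<le> prob (stable_bottoms h {..<c})" by (rule finite_measure_mono_AE) (rule stable_bottoms_event)
  with G(2) show "aging_prob h \<le> prob (stable_bottoms h {..<c}) + e" by linarith
qed

text \<open>Different bottoms are at distance more than some \<open>1 / (i + 1)\<close>. All other
  paths have coinciding bottoms and so lie in a set of probability at most
  \<open>aging_prob h + e / 2\<close>.\<close>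

lemma prob_far_lower:
  assumes h: "1 < h" and e: "0 < e"
  obtains c where "0 < c" "1 - aging_prob h - e < prob (stable_bottoms h {c<..})"
proof -
  have h0: "0 < h" and e2: "0 < e / 2" using h e by simp_all
  obtain G where G: "G \<in> events" "prob G \<le> aging_prob h + e / 2"
    "AE x in W. shared_valley h (path x) \<or> shared_valley h (\<lambda>t. path x (- t)) \<longrightarrow> x \<in> G"
    by (rule shared_valley_upper[OF h e2])
  define U where "U i = stable_bottoms h {1 / real (Suc i)<..}" for i
  have U: "U i \<in> events" for i unfolding U_def by (rule stable_bottoms_event)
  have UU: "(\<Union>i. U i) \<in> events" using U by (intro sets.countable_UN) auto
  have "AE x in W. x \<in> G \<union> (\<Union>i. U i)"
    using G(3) AE_stable_bottoms[OF h] AE_common_bottom[OF h] AE_bottom[OF zero_less_one] AE_bottom[OF h0]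
  proof eventually_elim
    case (elim x)
    obtain z z' where z: "bottom 1 (path x) z" "bottom h (path x) z'" using elim(4,5) by blast
    show ?case
    proof (cases "z = z'")
      case True
      then have "x \<in> G" using z elim(1,3) by blast
      then show ?thesis by blast
    next
      case False
      then have "0 < \<bar>z - z'\<bar>" by simp
      then obtain i where "1 / real (Suc i) < \<bar>z - z'\<bar>" using nat_approx_posE by blast
      then have "x \<in> U i" using elim(2)[rule_format, OF open_greaterThan z] unfolding U_def by simp
      then show ?thesis by blast
    qed
  qed
  then have "prob (G \<union> (\<Union>i. U i)) = 1" by (subst prob_eq_1) (use G(1) UU in auto)
  then have far: "1 - aging_prob h - e < prob (\<Union>i. U i)"
    using measure_Un_le[OF G(1) UU] G(2) e by linarith
  have "(\<lambda>i. prob (U i)) \<longlonglongrightarrow> prob (\<Union>i. U i)"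
  proof (rule finite_Lim_measure_incseq)
    show "range U \<subseteq> events" using U by blast
    show "incseq U"
    proof (rule incseq_SucI)
      fix i
      have "1 / real (Suc (Suc i)) \<le> 1 / real (Suc i)" by (intro divide_left_mono) auto
      then show "U i \<le> U (Suc i)" unfolding U_def by (intro stable_bottoms_mono) (auto simp only: greaterThan_subset_iff)
    qed
  qed
  then have "\<forall>\<^sub>F i in sequentially. 1 - aging_prob h - e < prob (U i)" using far by (rule order_tendstoD(1))
  then obtain i where "1 - aging_prob h - e < prob (U i)" by (meson eventually_happens' sequentially_bot)
  then show ?thesis unfolding U_def by (intro that[of "1 / real (Suc i)"]) auto
qed

end

section \<open>Uniform ellipticity and complements\<close>

lemma shift_measurable:
  assumes "env_law P" shows "shift \<in> measurable P P"
proof -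
  have "continuous_on UNIV shift"
  proof (rule continuous_on_coordinatewise_then_product)
    fix z :: int
    show "continuous_on UNIV (\<lambda>\<omega>. shift \<omega> z)"
      using continuous_on_product_coordinates[of "z + 1"] by (simp add: shift_def)
  qed
  then have "shift \<in> borel \<rightarrow>\<^sub>M borel" by (rule borel_measurable_continuous_onI)
  then have "shift \<in> restrict_space borel Omega \<rightarrow>\<^sub>M restrict_space borel Omega"
    by (rule measurable_restrict_space3) (auto simp: Omega_def shift_def)
  then show ?thesis
    using assms measurable_cong_sets[of P "restrict_space borel Omega" P "restrict_space borel Omega"] unfolding env_law_def by blast
qed

text \<open>The bound at site 0 is carried to all sites by stationarity, one shift at a time in
  either direction.\<close>

lemma AE_elliptic:
  assumes P: "env_law P" and st: "stationary P"
    and min: "measure P {\<omega> \<in> space P. min (w_minus \<omega> 0) (w_plus \<omega> 0) < \<epsilon>} = 0"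
  shows "AE \<omega> in P. elliptic \<epsilon> \<omega>"
proof -
  interpret prob_space P using P by (simp add: env_law_def)
  note [measurable] = w_plus_measurable[OF P] w_minus_measurable[OF P] shift_measurable[OF P]
  let ?Q = "\<lambda>z. AE \<omega> in P. \<epsilon> \<le> w_minus \<omega> z \<and> \<epsilon> \<le> w_plus \<omega> z"
  have "{\<omega> \<in> space P. min (w_minus \<omega> 0) (w_plus \<omega> 0) < \<epsilon>} \<in> null_sets P"
    using min by (intro null_setsI) (auto simp: emeasure_eq_measure)
  from AE_not_in[OF this] AE_space have 0: "?Q 0" by eventually_elim auto
  have step: "?Q z \<longleftrightarrow> ?Q (z + 1)" for z
  proof -
    have "?Q z \<longleftrightarrow> (AE \<omega> in distr P P shift. \<epsilon> \<le> w_minus \<omega> z \<and> \<epsilon> \<le> w_plus \<omega> z)"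
      unfolding st[unfolded stationary_def] by (rule refl)
    also have "\<dots> \<longleftrightarrow> (AE \<omega> in P. \<epsilon> \<le> w_minus (shift \<omega>) z \<and> \<epsilon> \<le> w_plus (shift \<omega>) z)"
      by (rule AE_distr_iff) measurable
    also have "\<dots> \<longleftrightarrow> ?Q (z + 1)" by (simp add: shift_def w_minus_def w_plus_def)
    finally show ?thesis .
  qed
  have "?Q z" for z
  proof (induction z rule: int_induct[where k = 0])
    case (step2 i)
    then show ?case using step[of "i - 1"] by simp
  qed (use 0 step in auto)
  then have "AE \<omega> in P. \<forall>z. \<epsilon> \<le> w_minus \<omega> z \<and> \<epsilon> \<le> w_plus \<omega> z" unfolding AE_all_countable by blast
  with AE_space show ?thesis by eventually_elim (simp add: elliptic_def space_env_law[OF P])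
qed

lemma annealed_prob_compl:
  assumes P: "env_law P" and n: "n \<le> n'"
  shows "annealed_prob P v {X. \<not> R (X n) (X n')} = 1 - annealed_prob P v {X. R (X n) (X n')}"
proof -
  interpret P: prob_space P using P by (simp add: env_law_def)
  obtain j where j: "n' = n + j" using n le_Suc_ex by blast
  define f where "f \<omega> = measure (quenched_law \<omega> v) {X. R (X n) (X n')}" for \<omega>
  have fm: "f \<in> borel_measurable P" unfolding f_def j by (rule quenched_law_pair_measurable[OF P])
  have c: "measure (quenched_law \<omega> v) {X. \<not> R (X n) (X n')} = 1 - f \<omega>" and f01: "0 \<le> f \<omega>" "f \<omega> \<le> 1" for \<omega>
  proof -
    interpret Q: prob_space "quenched_law \<omega> v" by (rule prob_space_quenched_law)
    show "0 \<le> f \<omega>" "f \<omega> \<le> 1" unfolding f_def by simp_all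
    have "{X. \<not> R (X n) (X n')} = space (quenched_law \<omega> v) - {X. R (X n) (X n')}" by auto
    then show "measure (quenched_law \<omega> v) {X. \<not> R (X n) (X n')} = 1 - f \<omega>"
      unfolding f_def by (simp only: Q.prob_compl[OF quenched_pair_set])
  qed
  have "integrable P f" by (rule P.integrable_const_bound[of _ 1]) (use f01 fm in auto)
  then show ?thesis unfolding annealed_prob_def c f_def[symmetric] by (simp add: P.prob_space)
qed

lemma floor_powr_ge: "1 \<le> n \<Longrightarrow> 1 \<le> h \<Longrightarrow> n \<le> nat \<lfloor>real n powr h\<rfloor>"
proof -
  assume "1 \<le> n" "1 \<le> h"
  then have "real n \<le> real n powr h" using powr_mono[of 1 h "real n"] by simp
  then have "int n \<le> \<lfloor>real n powr h\<rfloor>" by (simp add: le_floor_iff)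
  then show ?thesis by (simp add: le_nat_iff)
qed

theorem theorem2p15:
  fixes P :: "env measure" and h :: real
  assumes "standing_assumption P"
    and "\<exists>\<epsilon>>0. measure P {\<omega>\<in>space P. min (w_minus \<omega> 0) (w_plus \<omega> 0) < \<epsilon>} = 0"
    and "h > 1"
  shows "\<exists>L :: real \<Rightarrow> real.
    (\<forall>\<eta>>0. (\<lambda>n::nat. annealed_prob P 0
        {X. \<bar>real_of_int (X (nat \<lfloor>real n powr h\<rfloor>) - X n)\<bar> / (ln (real n))\<^sup>2 < \<eta>}) \<longlonglongrightarrow> L \<eta>) \<and>
    (L \<longlongrightarrow> 1 / h\<^sup>2 * (5 / 3 - 2 / 3 * exp (- (h - 1)))) (at_right 0)"
proof -
  have h: "1 < h" using assms(3) by simp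
  have P: "env_law P" "stationary P" using assms(1) by (simp_all add: standing_assumption_def)
  obtain \<sigma> and W :: "(real \<Rightarrow> real) measure" and B where \<sigma>: "0 < \<sigma>" and B: "two_sided_brownian W B"
    and conv: "converges_weakly skorokhod P (scaled_potential \<sigma>) W (\<lambda>x t. B t x)"
    using assms(1) unfolding standing_assumption_def by blast
  obtain \<epsilon> where \<epsilon>: "0 < \<epsilon>" "measure P {\<omega>\<in>space P. min (w_minus \<omega> 0) (w_plus \<omega> 0) < \<epsilon>} = 0"
    using assms(2) by blast
  note el = AE_elliptic[OF P \<epsilon>(2)] \<epsilon>(1)
  interpret brownian W B by (rule brownian.intro) (rule B)
  define near where "near \<eta> n a b \<longleftrightarrow> \<bar>real_of_int (b - a)\<bar> / (ln (real n))\<^sup>2 < \<eta>" for \<eta> n a b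
  define p where "p \<eta> n = annealed_prob P 0 {X. near \<eta> n (X n) (X (nat \<lfloor>real n powr h\<rfloor>))}" for \<eta> n
  \<comment> \<open>Positions are divided by \<open>k\<close> in the Brownian picture, while the
    squared logarithm of \<open>n\<close> is about \<open>k * \<sigma>^2\<close>; hence the factor
    \<open>\<sigma>^2\<close>.\<close>
  define L where "L \<eta> = prob (stable_bottoms h {..<\<eta> * \<sigma>\<^sup>2})" for \<eta>
  define U where "U \<eta> = prob (stable_bottoms h {\<eta> * \<sigma>\<^sup>2<..})" for \<eta>
  have lower: "\<forall>\<^sub>F n in sequentially. a < p \<eta> n" if \<eta>: "0 < \<eta>" and a: "a < L \<eta>" for a \<eta>
  proof -
    obtain m where m: "0 < m" "a < prob {x \<in> space W. stable (bottoms_at h m {..<\<eta> * \<sigma>\<^sup>2}) (path x)}"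
      using stable_bottoms_approx a unfolding L_def by blast
    then obtain c where c: "a < c" "c < prob {x \<in> space W. stable (bottoms_at h m {..<\<eta> * \<sigma>\<^sup>2}) (path x)}" using dense by blast
    have "0 < c - a" using c by simp
    have "\<forall>\<^sub>F n in sequentially. \<forall>a b. (\<forall>d. \<bar>d - \<bar>real_of_int (b - a)\<bar> / scale_index \<sigma> n\<bar> \<le> 1 / (2 * m) \<longrightarrow> d \<in> {..<\<eta> * \<sigma>\<^sup>2}) \<longrightarrow> near \<eta> n a b"
      using eventually_ge_at_top[of 2] filterlim_at_top[THEN iffD1, OF scale_index_at_top[OF \<sigma>], rule_format, of 1]
    proof eventually_elim
      case (elim n)
      have l: "0 < (ln (real n))\<^sup>2" using elim(1) by simp
      have k: "0 < real (scale_index \<sigma> n)" using elim(2) by simp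
      have kl: "real (scale_index \<sigma> n) * \<sigma>\<^sup>2 \<le> (ln (real n))\<^sup>2" using scale_index_bounds(3)[of n \<sigma>] elim(1) \<sigma> by simp
      show ?case
      proof (intro allI impI)
        fix a b assume d: "\<forall>d. \<bar>d - \<bar>real_of_int (b - a)\<bar> / scale_index \<sigma> n\<bar> \<le> 1 / (2 * m) \<longrightarrow> d \<in> {..<\<eta> * \<sigma>\<^sup>2}"
        have "\<bar>real_of_int (b - a)\<bar> / scale_index \<sigma> n < \<eta> * \<sigma>\<^sup>2"
          using d[rule_format, of "\<bar>real_of_int (b - a)\<bar> / scale_index \<sigma> n"] m(1) by simp
        then have "\<bar>real_of_int (b - a)\<bar> < \<eta> * (scale_index \<sigma> n * \<sigma>\<^sup>2)" using k by (simp add: pos_divide_less_eq mult_ac)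
        also have "\<dots> \<le> \<eta> * (ln (real n))\<^sup>2" using kl \<eta> by (intro mult_left_mono) auto
        finally show "near \<eta> n a b" unfolding near_def using l by (simp add: pos_divide_less_eq)
      qed
    qed
    from annealed_lower[OF P(1) B conv el \<sigma> m(1) h c(2) this \<open>0 < c - a\<close>] show ?thesis unfolding p_def by simp
  qed
  \<comment> \<open>Being far is the complement of being near, so the lower bound for
    \<open>U\<close> turns into an upper bound for \<open>p\<close>.\<close>
  have upper: "\<forall>\<^sub>F n in sequentially. p \<eta> n < a" if \<eta>: "0 < \<eta>" and a: "1 - U \<eta> < a" for a \<eta>
  proof -
    have "1 - a < U \<eta>" using a by simp
    then obtain m where m: "0 < m" "1 - a < prob {x \<in> space W. stable (bottoms_at h m {\<eta> * \<sigma>\<^sup>2<..}) (path x)}"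
      using stable_bottoms_approx unfolding U_def by blast
    then obtain c where c: "1 - a < c" "c < prob {x \<in> space W. stable (bottoms_at h m {\<eta> * \<sigma>\<^sup>2<..}) (path x)}" using dense by blast
    have "0 < c - (1 - a)" using c by simp
    \<comment> \<open>For \<open>k \<ge> K\<close> the slack \<open>k / (2 * m)\<close> is at least
      \<open>\<eta> * \<sigma>^2\<close>, which covers the replacement of \<open>(ln n)^2\<close> by
      \<open>k * \<sigma>^2\<close>.\<close>
    obtain K :: nat where K: "2 * m * (\<eta> * \<sigma>\<^sup>2) \<le> real K" using real_arch_simple by blast
    have "\<forall>\<^sub>F n in sequentially. \<forall>a b. (\<forall>d. \<bar>d - \<bar>real_of_int (b - a)\<bar> / scale_index \<sigma> n\<bar> \<le> 1 / (2 * m) \<longrightarrow> d \<in> {\<eta> * \<sigma>\<^sup>2<..}) \<longrightarrow> \<not> near \<eta> n a b"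
      using eventually_ge_at_top[of 2] filterlim_at_top[THEN iffD1, OF scale_index_at_top[OF \<sigma>], rule_format, of "max 1 K"]
    proof eventually_elim
      case (elim n)
      define k where "k = real (scale_index \<sigma> n)"
      have l: "0 < (ln (real n))\<^sup>2" using elim(1) by simp
      have k: "0 < k" "2 * m * (\<eta> * \<sigma>\<^sup>2) \<le> k" using elim(2) K unfolding k_def by auto
      have kl: "(ln (real n))\<^sup>2 \<le> k * \<sigma>\<^sup>2 + \<sigma>\<^sup>2" using scale_index_bounds(4)[of n \<sigma>] elim(1) \<sigma> unfolding k_def by simp
      show ?case
      proof (intro allI impI)
        fix a b assume d: "\<forall>d. \<bar>d - \<bar>real_of_int (b - a)\<bar> / scale_index \<sigma> n\<bar> \<le> 1 / (2 * m) \<longrightarrow> d \<in> {\<eta> * \<sigma>\<^sup>2<..}"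
        have "\<eta> * \<sigma>\<^sup>2 < \<bar>real_of_int (b - a)\<bar> / k - 1 / (2 * m)"
          using d[folded k_def, rule_format, of "\<bar>real_of_int (b - a)\<bar> / k - 1 / (2 * m)"] m(1) by simp
        then have "\<eta> * \<sigma>\<^sup>2 + 1 / (2 * m) < \<bar>real_of_int (b - a)\<bar> / k" by linarith
        then have "(\<eta> * \<sigma>\<^sup>2 + 1 / (2 * m)) * k < \<bar>real_of_int (b - a)\<bar>" using k(1) by (simp only: pos_less_divide_eq)
        moreover have "\<eta> * \<sigma>\<^sup>2 \<le> 1 / (2 * m) * k" using k(2) m(1) by (simp add: pos_le_divide_eq mult_ac)
        moreover have "\<eta> * (ln (real n))\<^sup>2 \<le> \<eta> * (k * \<sigma>\<^sup>2 + \<sigma>\<^sup>2)" using kl \<eta> by (intro mult_left_mono) auto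
        moreover have "\<eta> * (k * \<sigma>\<^sup>2 + \<sigma>\<^sup>2) = \<eta> * \<sigma>\<^sup>2 * k + \<eta> * \<sigma>\<^sup>2" by (simp add: algebra_simps)
        ultimately have "\<eta> * (ln (real n))\<^sup>2 \<le> \<bar>real_of_int (b - a)\<bar>" unfolding distrib_right by linarith
        then show "\<not> near \<eta> n a b" unfolding near_def using l by (simp add: pos_divide_less_eq not_less)
      qed
    qed
    from annealed_lower[OF P(1) B conv el \<sigma> m(1) h c(2) this \<open>0 < c - (1 - a)\<close>]
    have "\<forall>\<^sub>F n in sequentially. 1 - a < annealed_prob P 0 {X. \<not> near \<eta> n (X n) (X (nat \<lfloor>real n powr h\<rfloor>))}" by simp
    then show ?thesis using eventually_ge_at_top[of 1]
    proof eventually_elim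
      case (elim n)
      have "n \<le> nat \<lfloor>real n powr h\<rfloor>" using floor_powr_ge[of n h] elim(2) h by simp
      from annealed_prob_compl[OF P(1) this, of 0 "near \<eta> n"] elim(1) show ?case unfolding p_def by linarith
    qed
  qed
  have LU: "1 \<le> L \<eta> + U \<eta>" if "0 < \<eta>" for \<eta>
    unfolding L_def U_def by (rule prob_near_or_far[OF h]) (use that \<sigma> in simp)
  have lim: "p \<eta> \<longlonglongrightarrow> L \<eta>" if \<eta>: "0 < \<eta>" for \<eta>
  proof (rule order_tendstoI)
    fix a assume "L \<eta> < a"
    then have "1 - U \<eta> < a" using LU[OF \<eta>] by linarith
    then show "\<forall>\<^sub>F n in sequentially. p \<eta> n < a" by (rule upper[OF \<eta>])
  qed (rule lower[OF \<eta>])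
  \<comment> \<open>A statement about Brownian motion obtained from the walk: \<open>p\<close> tends
    to \<open>L\<close> and is eventually below every number above \<open>1 - U\<close>.\<close>
  have LU': "L \<eta> \<le> 1 - U \<eta>" if \<eta>: "0 < \<eta>" for \<eta>
  proof (rule dense_ge)
    fix a assume "1 - U \<eta> < a"
    from upper[OF \<eta> this] have "\<forall>\<^sub>F n in sequentially. p \<eta> n \<le> a" by eventually_elim simp
    then show "L \<eta> \<le> a" using tendsto_upperbound[OF lim[OF \<eta>]] by simp
  qed
  have "(L \<longlongrightarrow> aging_prob h) (at_right 0)"
  proof (rule order_tendstoI)
    fix a assume a: "a < aging_prob h"
    show "\<forall>\<^sub>F \<eta> in at_right 0. a < L \<eta>"
      using eventually_at_right_less[of "0::real"]
    proof eventually_elim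
      case (elim \<eta>)
      have "aging_prob h \<le> L \<eta>" unfolding L_def by (rule prob_near_lower[OF h]) (use elim \<sigma> in simp)
      with a show ?case by linarith
    qed
  next
    fix a assume "aging_prob h < a"
    then have "0 < a - aging_prob h" by simp
    from prob_far_lower[OF h this] obtain c where c: "0 < c" "1 - a < prob (stable_bottoms h {c<..})" by auto
    have "0 < c / \<sigma>\<^sup>2" using c \<sigma> by simp
    then have "\<forall>\<^sub>F \<eta> in at_right 0. \<eta> \<in> {0<..<c / \<sigma>\<^sup>2}" by (rule eventually_at_right_real)
    then show "\<forall>\<^sub>F \<eta> in at_right 0. L \<eta> < a"
    proof eventually_elim
      case (elim \<eta>)
      have "\<eta> * \<sigma>\<^sup>2 \<le> c" using elim \<sigma> by (simp add: pos_less_divide_eq)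
      then have "prob (stable_bottoms h {c<..}) \<le> U \<eta>" unfolding U_def
        by (intro finite_measure_mono stable_bottoms_mono stable_bottoms_event) auto
      with c(2) LU'[of \<eta>] elim show ?case by simp
    qed
  qed
  moreover have "\<forall>\<eta>>0. p \<eta> \<longlonglongrightarrow> L \<eta>" using lim by blast
  ultimately show ?thesis unfolding p_def near_def aging_prob_def by blast
qed

end
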